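(* Let $p\ge q\ge 0$ be integers, let $v\in S_\infty$ be a $p$-inverse Grassmannian permutation and $u\in S_\infty$ a $q$-inverse Grassmannian permutation, and define $c_{v,u}^w(t)$ by $$\mathfrak S_v(x;t)\cdot\mathfrak S_u(x;t)=\sum_{w\in S_\infty}c_{v,u}^w(t)\,\mathfrak S_w(x;t).$$ Let $w\in S_\infty$, and choose $m\ge 0$ large enough that, with $n=p+m+q$, one has $v,u,w\in S_n$ and the $(p,m,q)$-preclan $\gamma_{v,u}$ is defined. Put $\gamma:=w*\gamma_{v,u}$. Then $$c_{v,u}^w(t)=\begin{cases}\mathfrak S_{\eta_\gamma}(-t_q,\ldots,-t_1;\,-t_{p+1},-t_{p+2},\ldots,-t_n), & \text{if }\gamma\text{ is permutational and }\ell(\gamma)=\ell(w)+\ell(\gamma_{v,u}),\\ 0,&\text{otherwise.}\end{cases}$$ (Here $\eta_\gamma\in S_{q+m}$ and $\mathfrak S_{\eta_\gamma}(x;t)$ involves only $x_1,\dots,x_q$ and $t_1,\dots,t_{q+m}$; one substitutes $x_i\mapsto -t_{q+1-i}$ for $1\le i\le q$ and $t_j\mapsto -t_{p+j}$ for $1\le j\le q+m$.)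
   Context: **Permutations.** $S_\infty=\bigcup_n S_n$, with simple reflections $s_k=(k,k+1)$ and length $\ell$. A permutation $v$ is $p$-inverse Grassmannian if $v^{-1}(1)<\dots<v^{-1}(p)$ and $v^{-1}(p+1)<v^{-1}(p+2)<\cdots$ (i.e. $v^{-1}$ has no descent except possibly at $p$). $[k]=\{1,\dots,k\}$. **Double Schubert polynomials.** For $w_0=n\cdots 21\in S_n$, $\mathfrak S_{w_0}(x;t)=\prod_{i+j\le n}(x_i-t_j)$, and $\mathfrak S_w(x;t)=\partial_k\mathfrak S_{ws_k}(x;t)$ if $\ell(ws_k)=\ell(w)+1$, where $\partial_kf=(f-f|_{x_k\leftrightarrow x_{k+1}})/(x_k-x_{k+1})$. They are stable under $S_n\subset S_{n+1}$, hence defined for $w\in S_\infty$. **Preclans.** Let $p,m,q\ge0$, $n=p+m+q$. A $(p,m,q)$-preclan is a partial matching on nodes $1,\dots,n$ (pairwise disjoint pairs $(i,j)$, $i<j$; $i$ is the left-end, $j$ the right-end), where each unmatched node is colored $+$, colored $-$, or left uncolored, such that (number of $+$'s)+(number of matchings)$=p$, (number of $-$'s)+(number of matchings)$=q$, and there are $m$ uncolored (unmatched) nodes. **Length.** If $m=0$, $\ell(\gamma)=\sum_{(i,j)\text{ matching}}(j-i)-\#\{\text{crossings}\}$, where a crossing is a pair of matchings $(a,b),(c,d)$ with $a<c<b<d$. In general $\ell(\gamma)=\ell(\bar\gamma)+\sum_{i=1}^m(a_i-i)$, where $a_1<\dots<a_m$ are the positions of the uncolored nodes and $\bar\gamma$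 is obtained from $\gamma$ by deleting the uncolored nodes (and renumbering). **Action.** For $1\le k\le n-1$, $s_k*\gamma$ is obtained from $\gamma$ by applying the following move to nodes $k,k+1$ if one applies, and $s_k*\gamma=\gamma$ otherwise: (1) nodes $(k,k+1)$ are $(+,-)$ or $(-,+)$: replace by a matching $(k,k+1)$; (2) $k$ is colored $\pm$ and $k+1$ is the left-end of $(k+1,j)$: replace by matching $(k,j)$, with $k+1$ colored by the same sign; (3) $k$ is the right-end of $(i,k)$ and $k+1$ is colored $\pm$: replace by matching $(i,k+1)$, with $k$ colored by the same sign; (4) matchings $(i,k)$, $(k+1,j)$: replace by $(i,k+1)$, $(k,j)$; (5) matchings $(k,a),(k+1,b)$ with $a<b$: replace by $(k,b),(k+1,a)$; (6) matchings $(a,k),(b,k+1)$ with $a<b$: replace by $(a,k+1),(b,k)$; (7) $k$ uncolored and $k+1$ colored $\pm$: exchange the two nodes; (8) $k$ uncolored and $k+1$ left-end of $(k+1,j)$: replace by matching $(k,j)$, $k+1$ uncolored; (9) $k$ uncolored and $k+1$ right-end of $(i,k+1)$: replace by matching $(i,k)$, $k+1$ uncolored. For $w\in S_n$ with reduced word $w=s_{i_1}\cdots s_{i_\ell}$, $w*\gamma=s_{i_1}*(\cdots*(s_{i_\ell}*\gamma))$ (independent of the reduced word). **The preclan $\gamma_{v,u}$.** For $1\le i\le n$ the $i$-th step is: down if $i\in v^{-1}([p])\cap u^{-1}([q])$; a horizontal step colored $+$ if $i\in v^{-1}([p])\setminus u^{-1}([q])$; a horizontal step colored $-$ if $i\in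 u^{-1}([q])\setminus v^{-1}([p])$; up otherwise. Each down step $i$ is matched with the minimal $j>i$ such that step $j$ is up and at the same height as step $i$ (i.e. steps $i,\dots,j$ contain equally many ups and downs). Unmatched up steps become uncolored nodes, horizontal steps become nodes colored $+$ or $-$ accordingly. It is defined when $v,u\in S_n$ and every down step gets matched within $[n]$, which holds for all $m\gg0$. **Permutational preclans ($p\ge q$).** $\gamma$ is permutational if nodes $1,\dots,q$ are left-ends and nodes $q+1,\dots,p$ are colored $+$. Then there is no $-$ node, and $\eta_\gamma\in S_{q+m}$ is defined by: for $1\le i\le q$, $\eta_\gamma(i)=j-p$ where $j$ is the node matched with node $q+1-i$; for $1\le i\le m$, $\eta_\gamma(q+i)=a_i-p$ where $a_i$ is the position of the $i$-th uncolored node. *)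

theory Defs
  imports "HOL-Library.Poly_Mapping" "HOL-Combinatorics.Permutations"
begin

section \<open>Permutations\<close>

text \<open>Permutations of the positive integers are functions on \<^typ>\<open>nat\<close> fixing 0; the product
  of permutations is composition of functions.\<close>

definition Sn :: "nat \<Rightarrow> (nat \<Rightarrow> nat) set" where
  "Sn n = {w. w permutes {1..n}}"

definition S_infty :: "(nat \<Rightarrow> nat) set" where
  "S_infty = (\<Union>n. Sn n)"

definition simple_refl :: "nat \<Rightarrow> nat \<Rightarrow> nat" where
  "simple_refl k = transpose k (k + 1)"

definition word_perm :: "nat list \<Rightarrow> nat \<Rightarrow> nat" where
  "word_perm ks = foldr (\<lambda>k w. simple_refl k \<circ> w) ks id"

definition perm_length :: "(nat \<Rightarrow> nat) \<Rightarrow> nat" where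
  "perm_length w = (LEAST l. \<exists>ks. 0 \<notin> set ks \<and> word_perm ks = w \<and> length ks = l)"

definition reduced_word :: "nat \<Rightarrow> (nat \<Rightarrow> nat) \<Rightarrow> nat list \<Rightarrow> bool" where
  "reduced_word n w ks \<longleftrightarrow>
     set ks \<subseteq> {1..<n} \<and> word_perm ks = w \<and> length ks = perm_length w"

definition inverse_grassmannian :: "nat \<Rightarrow> (nat \<Rightarrow> nat) \<Rightarrow> bool" where
  "inverse_grassmannian p v \<longleftrightarrow>
     strict_mono_on {1..p} (inv v) \<and> strict_mono_on {p<..} (inv v)"


section \<open>Polynomials\<close>

type_synonym 'a mpoly = "(nat \<Rightarrow>\<^sub>0 nat) \<Rightarrow>\<^sub>0 'a"

text \<open>Only variables with a positive index are used. The ring of polynomials in \<open>x\<close> and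
  \<open>t\<close> is \<^typ>\<open>int mpoly mpoly\<close>: the variables \<open>x\<close> are adjoined to the ring
  \<^typ>\<open>int mpoly\<close> of polynomials in \<open>t\<close>.\<close>

definition Var :: "nat \<Rightarrow> 'a::comm_ring_1 mpoly" where
  "Var i = Poly_Mapping.single (Poly_Mapping.single i 1) 1"

definition Const :: "'a::comm_ring_1 \<Rightarrow> 'a mpoly" where
  "Const c = Poly_Mapping.single 0 c"

definition mpoly_subst ::
  "('a::comm_ring_1 \<Rightarrow> 'b::comm_ring_1) \<Rightarrow> (nat \<Rightarrow> 'b) \<Rightarrow> 'a mpoly \<Rightarrow> 'b" where
  "mpoly_subst h a f =
     (\<Sum>e\<in>Poly_Mapping.keys f. h (Poly_Mapping.lookup f e) *
        (\<Prod>i\<in>Poly_Mapping.keys e. a i ^ Poly_Mapping.lookup e i))"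

definition swap_vars :: "nat \<Rightarrow> 'a::comm_ring_1 mpoly \<Rightarrow> 'a mpoly" where
  "swap_vars k f = mpoly_subst Const (\<lambda>i. Var (simple_refl k i)) f"

definition divided_difference :: "nat \<Rightarrow> 'a::idom mpoly \<Rightarrow> 'a mpoly" where
  "divided_difference k f = (THE g. (Var k - Var (k + 1)) * g = f - swap_vars k f)"


section \<open>Double Schubert polynomials\<close>

abbreviation x_var :: "nat \<Rightarrow> int mpoly mpoly" where
  "x_var i \<equiv> Var i"

abbreviation t_var :: "nat \<Rightarrow> int mpoly" where
  "t_var j \<equiv> Var j"

definition longest_perm :: "nat \<Rightarrow> nat \<Rightarrow> nat" where
  "longest_perm n i = (if i \<in> {1..n} then n + 1 - i else i)"

inductive schubert_rel :: "nat \<Rightarrow> (nat \<Rightarrow> nat) \<Rightarrow> int mpoly mpoly \<Rightarrow> bool" for n where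
  longest:
    "schubert_rel n (longest_perm n)
       (\<Prod>(i, j) \<in> {(i, j). 1 \<le> i \<and> 1 \<le> j \<and> i + j \<le> n}. x_var i - Const (t_var j))"
| descend:
    "\<lbrakk>w \<in> Sn n; 1 \<le> k; k < n; perm_length (w \<circ> simple_refl k) = perm_length w + 1;
      schubert_rel n (w \<circ> simple_refl k) f\<rbrakk>
     \<Longrightarrow> schubert_rel n w (divided_difference k f)"

text \<open>The relation determines the polynomial independently of the chain of divided
  differences and, by stability, of \<open>n\<close>.\<close>

definition double_schubert :: "(nat \<Rightarrow> nat) \<Rightarrow> int mpoly mpoly" where
  "double_schubert w = (THE f. \<exists>n. schubert_rel n w f)"

definition structure_const ::
  "(nat \<Rightarrow> nat) \<Rightarrow> (nat \<Rightarrow> nat) \<Rightarrow> (nat \<Rightarrow> nat) \<Rightarrow> int mpoly" where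
  "structure_const v u =
     (THE c. finite {w. c w \<noteq> 0} \<and> {w. c w \<noteq> 0} \<subseteq> S_infty \<and>
        double_schubert v * double_schubert u =
          (\<Sum>w\<in>{w. c w \<noteq> 0}. Const (c w) * double_schubert w))"

definition schubert_subst ::
  "(nat \<Rightarrow> int mpoly) \<Rightarrow> (nat \<Rightarrow> int mpoly) \<Rightarrow> int mpoly mpoly \<Rightarrow> int mpoly" where
  "schubert_subst a b f = mpoly_subst (mpoly_subst Const b) a f"


section \<open>Preclans\<close>

text \<open>A preclan assigns to each of the nodes \<open>1, \<dots>, n\<close> its color, its partner in the
  matching (\<open>Mate\<close>), or \<open>Blank\<close> if it is uncolored; all other indices carry \<open>Blank\<close>.\<close>

datatype node = Plus | Minus | Blank | Mate nat

definition matchings :: "nat \<Rightarrow> (nat \<Rightarrow> node) \<Rightarrow> (nat \<times> nat) set" where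
  "matchings n \<gamma> = {(i, j). 1 \<le> i \<and> i < j \<and> j \<le> n \<and> \<gamma> i = Mate j}"

definition preclan :: "nat \<Rightarrow> nat \<Rightarrow> nat \<Rightarrow> (nat \<Rightarrow> node) \<Rightarrow> bool" where
  "preclan p m q \<gamma> \<longleftrightarrow> (let n = p + m + q in
     (\<forall>i. i \<notin> {1..n} \<longrightarrow> \<gamma> i = Blank) \<and>
     (\<forall>i j. \<gamma> i = Mate j \<longrightarrow> j \<noteq> i \<and> \<gamma> j = Mate i) \<and>
     card {i \<in> {1..n}. \<gamma> i = Plus} + card (matchings n \<gamma>) = p \<and>
     card {i \<in> {1..n}. \<gamma> i = Minus} + card (matchings n \<gamma>) = q \<and>
     card {i \<in> {1..n}. \<gamma> i = Blank} = m)"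

text \<open>The \<open>k\<close>-th element, counted from 1, of a finite set in increasing order.\<close>

definition nth_smallest :: "nat set \<Rightarrow> nat \<Rightarrow> nat" where
  "nth_smallest A k = sorted_list_of_set A ! (k - 1)"

definition blanks :: "nat \<Rightarrow> (nat \<Rightarrow> node) \<Rightarrow> nat set" where
  "blanks n \<gamma> = {i \<in> {1..n}. \<gamma> i = Blank}"

definition delete_blanks :: "nat \<Rightarrow> (nat \<Rightarrow> node) \<Rightarrow> nat \<Rightarrow> node" where
  "delete_blanks n \<gamma> k =
     (let A = {1..n} - blanks n \<gamma> in
      if k \<in> {1..card A} then
        (case \<gamma> (nth_smallest A k) of
           Mate j \<Rightarrow> Mate (card (A \<inter> {..j}))
         | c \<Rightarrow> c)
      else Blank)"

definition crossings :: "nat \<Rightarrow> (nat \<Rightarrow> node) \<Rightarrow> ((nat \<times> nat) \<times> (nat \<times> nat)) set" where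
  "crossings n \<gamma> =
     {((a, b), (c, d)). (a, b) \<in> matchings n \<gamma> \<and> (c, d) \<in> matchings n \<gamma> \<and>
        a < c \<and> c < b \<and> b < d}"

definition clan_length :: "nat \<Rightarrow> (nat \<Rightarrow> node) \<Rightarrow> int" where
  "clan_length n \<gamma> = (\<Sum>(i, j)\<in>matchings n \<gamma>. int j - int i) - int (card (crossings n \<gamma>))"

definition preclan_length :: "nat \<Rightarrow> (nat \<Rightarrow> node) \<Rightarrow> int" where
  "preclan_length n \<gamma> =
     (let m = card (blanks n \<gamma>) in
      clan_length (n - m) (delete_blanks n \<gamma>) +
      (\<Sum>i = 1..m. int (nth_smallest (blanks n \<gamma>) i) - int i))"

text \<open>In the branch for two matched nodes, the three disjuncts are the cases of a right-end
  followed by a left-end, of two left-ends, and of two right-ends; in each of them \<open>k\<close> and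
  \<open>k + 1\<close> exchange their partners.\<close>

definition simple_act :: "nat \<Rightarrow> (nat \<Rightarrow> node) \<Rightarrow> nat \<Rightarrow> node" where
  "simple_act k \<gamma> = (case (\<gamma> k, \<gamma> (k + 1)) of
       (Plus, Minus) \<Rightarrow> \<gamma>(k := Mate (k + 1), k + 1 := Mate k)
     | (Minus, Plus) \<Rightarrow> \<gamma>(k := Mate (k + 1), k + 1 := Mate k)
     | (Plus, Mate j) \<Rightarrow>
         if k + 1 < j then \<gamma>(k := Mate j, j := Mate k, k + 1 := Plus) else \<gamma>
     | (Minus, Mate j) \<Rightarrow>
         if k + 1 < j then \<gamma>(k := Mate j, j := Mate k, k + 1 := Minus) else \<gamma>
     | (Mate i, Plus) \<Rightarrow>
         if i < k then \<gamma>(i := Mate (k + 1), k + 1 := Mate i, k := Plus) else \<gamma>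
     | (Mate i, Minus) \<Rightarrow>
         if i < k then \<gamma>(i := Mate (k + 1), k + 1 := Mate i, k := Minus) else \<gamma>
     | (Mate a, Mate b) \<Rightarrow>
         if (a < k \<and> k + 1 < b) \<or> (k < a \<and> k + 1 < b \<and> a < b) \<or> (a < k \<and> b < k + 1 \<and> a < b)
         then \<gamma>(k := Mate b, b := Mate k, k + 1 := Mate a, a := Mate (k + 1)) else \<gamma>
     | (Blank, Plus) \<Rightarrow> \<gamma>(k := Plus, k + 1 := Blank)
     | (Blank, Minus) \<Rightarrow> \<gamma>(k := Minus, k + 1 := Blank)
     | (Blank, Mate j) \<Rightarrow> \<gamma>(k := Mate j, j := Mate k, k + 1 := Blank)
     | _ \<Rightarrow> \<gamma>)"

text \<open>The choice of the reduced word is immaterial.\<close>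

definition perm_act :: "nat \<Rightarrow> (nat \<Rightarrow> nat) \<Rightarrow> (nat \<Rightarrow> node) \<Rightarrow> nat \<Rightarrow> node" where
  "perm_act n w \<gamma> = foldr simple_act (SOME ks. reduced_word n w ks) \<gamma>"


section \<open>The preclan of a pair of permutations\<close>

definition down_steps :: "nat \<Rightarrow> nat \<Rightarrow> (nat \<Rightarrow> nat) \<Rightarrow> (nat \<Rightarrow> nat) \<Rightarrow> nat set" where
  "down_steps p q v u = v -` {1..p} \<inter> u -` {1..q}"

definition plus_steps :: "nat \<Rightarrow> nat \<Rightarrow> (nat \<Rightarrow> nat) \<Rightarrow> (nat \<Rightarrow> nat) \<Rightarrow> nat set" where
  "plus_steps p q v u = v -` {1..p} - u -` {1..q}"

definition minus_steps :: "nat \<Rightarrow> nat \<Rightarrow> (nat \<Rightarrow> nat) \<Rightarrow> (nat \<Rightarrow> nat) \<Rightarrow> nat set" where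
  "minus_steps p q v u = u -` {1..q} - v -` {1..p}"

definition up_steps :: "nat \<Rightarrow> nat \<Rightarrow> (nat \<Rightarrow> nat) \<Rightarrow> (nat \<Rightarrow> nat) \<Rightarrow> nat set" where
  "up_steps p q v u = {1..} - (v -` {1..p} \<union> u -` {1..q})"

definition returns_at ::
  "nat \<Rightarrow> nat \<Rightarrow> (nat \<Rightarrow> nat) \<Rightarrow> (nat \<Rightarrow> nat) \<Rightarrow> nat \<Rightarrow> nat \<Rightarrow> bool" where
  "returns_at p q v u i j \<longleftrightarrow>
     i \<in> down_steps p q v u \<and> i < j \<and> j \<in> up_steps p q v u \<and>
     card (up_steps p q v u \<inter> {i..j}) = card (down_steps p q v u \<inter> {i..j})"

definition step_match ::
  "nat \<Rightarrow> nat \<Rightarrow> (nat \<Rightarrow> nat) \<Rightarrow> (nat \<Rightarrow> nat) \<Rightarrow> nat \<Rightarrow> nat \<Rightarrow> bool" where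
  "step_match p q v u i j \<longleftrightarrow>
     returns_at p q v u i j \<and> (\<forall>j'. returns_at p q v u i j' \<longrightarrow> j \<le> j')"

definition pair_preclan ::
  "nat \<Rightarrow> nat \<Rightarrow> nat \<Rightarrow> (nat \<Rightarrow> nat) \<Rightarrow> (nat \<Rightarrow> nat) \<Rightarrow> nat \<Rightarrow> node" where
  "pair_preclan p q n v u i =
     (if i \<notin> {1..n} then Blank
      else if i \<in> plus_steps p q v u then Plus
      else if i \<in> minus_steps p q v u then Minus
      else if i \<in> down_steps p q v u then Mate (THE j. step_match p q v u i j)
      else if \<exists>l. step_match p q v u l i then Mate (THE l. step_match p q v u l i)
      else Blank)"

definition pair_preclan_defined ::
  "nat \<Rightarrow> nat \<Rightarrow> nat \<Rightarrow> (nat \<Rightarrow> nat) \<Rightarrow> (nat \<Rightarrow> nat) \<Rightarrow> bool" where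
  "pair_preclan_defined p q n v u \<longleftrightarrow>
     v \<in> Sn n \<and> u \<in> Sn n \<and>
     (\<forall>i\<in>down_steps p q v u. \<exists>j\<le>n. step_match p q v u i j)"


lemma preclan_pair_preclan:
  assumes "pair_preclan_defined p q n v u" "n = p + m + q"
  shows "preclan p m q (pair_preclan p q n v u)"
proof -
  let ?D = "down_steps p q v u" and ?U = "up_steps p q v u"
  let ?P = "plus_steps p q v u" and ?M = "minus_steps p q v u"
  let ?R = "returns_at p q v u" and ?S = "step_match p q v u" and ?g = "pair_preclan p q n v u"
  have v: "v permutes {1..n}" and u: "u permutes {1..n}"
    and ex: "\<And>i. i \<in> ?D \<Longrightarrow> \<exists>j\<le>n. ?S i j"
    using assms(1) by (auto simp: pair_preclan_defined_def Sn_def)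
  have vs: "v -` {1..p} \<subseteq> {1..n}" and us: "u -` {1..q} \<subseteq> {1..n}"
    using permutes_not_in[OF v] permutes_not_in[OF u] assms(2) by fastforce+
  have cv: "card (v -` {1..p}) = p" and cu: "card (u -` {1..q}) = q"
    using permutes_bij[OF v] permutes_bij[OF u]
    by (simp_all add: card_vimage_inj bij_is_inj bij_is_surj)
  have D: "?D \<subseteq> {1..n}" and P: "?P \<subseteq> {1..n}" and M: "?M \<subseteq> {1..n}"
    using vs us by (auto simp: down_steps_def plus_steps_def minus_steps_def)
  note defs = down_steps_def plus_steps_def minus_steps_def up_steps_def
  have fin: "finite ?D" "finite ?P" "finite ?M"
    using D P M by (auto intro: finite_subset)
  have UD: "?U \<inter> ?D = {}" by (auto simp: defs)
  have uniq1: "j = j'" if "?S i j" "?S i j'" for i j j'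
    using that unfolding step_match_def by (meson dual_order.antisym)
  define H where "H i = int (card (?U \<inter> {1..i})) - int (card (?D \<inter> {1..i}))" for i
  have HSuc: "H (Suc k) = H k + (if Suc k \<in> ?U then 1 else 0) - (if Suc k \<in> ?D then 1 else 0)" for k
    by (simp add: H_def atLeastAtMostSuc_conv Int_insert_right)
  have Hdiff: "H j - H i = int (card (?U \<inter> {Suc i..j})) - int (card (?D \<inter> {Suc i..j}))"
    if "i \<le> j" for i j
  proof -
    have "{1..j} = {1..i} \<union> {Suc i..j}" using that by auto
    then have "card (X \<inter> {1..j}) = card (X \<inter> {1..i}) + card (X \<inter> {Suc i..j})" for X
      by (subst card_Un_disjoint[symmetric]) (auto simp: Int_Un_distrib)
    then show ?thesis by (simp add: H_def)
  qed
  have ret: "?R i j \<longleftrightarrow> i \<in> ?D \<and> i < j \<and> j \<in> ?U \<and> H j = H (i - 1)" for i j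
    using Hdiff[of "i - 1" j] D by (fastforce simp: returns_at_def)
  have no: False if s1: "?S a j" and s2: "?S b j" and ab: "a < b" for a b j :: nat
  proof -
    have r: "a \<in> ?D" "b \<in> ?D" "b < j" "H (b - 1) = H (a - 1)"
      using s1 s2 by (auto simp: step_match_def ret)
    have "H a < H (a - 1)"
      using r(1) D HSuc[of "a - 1"] UD by (cases a) auto
    define l where "l = (LEAST l. a \<le> l \<and> H l \<ge> H (a - 1))"
    have ex: "a \<le> b - 1 \<and> H (b - 1) \<ge> H (a - 1)" using ab r by auto
    have l: "a \<le> l" "H l \<ge> H (a - 1)" "l \<le> b - 1"
      using LeastI[of "\<lambda>l. a \<le> l \<and> H l \<ge> H (a - 1)", OF ex]
        Least_le[of "\<lambda>l. a \<le> l \<and> H l \<ge> H (a - 1)", OF ex] by (auto simp: l_def)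
    have "a \<noteq> l" using l \<open>H a < H (a - 1)\<close> by auto
    then obtain k where k: "l = Suc k" "a \<le> k" using l by (cases l) auto
    have "H k < H (a - 1)"
      using not_less_Least[of k "\<lambda>l. a \<le> l \<and> H l \<ge> H (a - 1)"] k unfolding l_def[symmetric] by auto
    then have "l \<in> ?U" "H l = H (a - 1)"
      using l k HSuc[of k] by (auto split: if_splits)
    then have "?R a l" using r k by (auto simp: ret)
    then have "j \<le> l" using s1 by (auto simp: step_match_def)
    then show False using l r by auto
  qed
  have uniq2: "a = b" if "?S a j" "?S b j" for a b j :: nat
    using no[of a j b] no[of b j a] that by (cases a b rule: linorder_cases) auto
  have S: "i \<in> ?D \<and> i \<in> {1..n} \<and> i < j \<and> j \<in> ?U \<and> j \<in> {1..n}" if "?S i j" for i j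
  proof -
    have i: "i \<in> ?D" "i < j" "j \<in> ?U" using that by (auto simp: step_match_def ret)
    moreover have "j \<le> n" using ex[OF i(1)] uniq1[OF that] by blast
    ultimately show ?thesis using D by (auto simp: subset_iff)
  qed
  have gD: "?g i = Mate j" if "?S i j" for i j
  proof -
    have "(THE j. ?S i j) = j" by (rule the_equality) (use that uniq1 in blast)+
    then show ?thesis using S[OF that] by (auto simp: pair_preclan_def defs)
  qed
  have gU: "?g j = Mate i" if "?S i j" for i j
  proof -
    have "(THE i. ?S i j) = i" by (rule the_equality) (use that uniq2 in blast)+
    then show ?thesis using S[OF that] that by (auto simp: pair_preclan_def defs)
  qed
  have gMate: "?S i j \<or> ?S j i" if g: "?g i = Mate j" for i j
  proof (cases "i \<in> ?D")
    case True
    then obtain j' where "?S i j'" using ex by blast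
    then show ?thesis using gD[of i j'] g by simp
  next
    case False
    then obtain l where "?S l i"
      using g by (auto simp: pair_preclan_def split: if_splits)
    then show ?thesis using gU[of l i] g by simp
  qed
  have match: "matchings n ?g = {(i, j). ?S i j}"
  proof -
    have "i < j \<and> 1 \<le> i \<and> j \<le> n \<and> ?g i = Mate j \<longleftrightarrow> ?S i j" for i j
      using gMate[of i j] gD[of i j] S[of i j] S[of j i] by auto
    then show ?thesis unfolding matchings_def by blast
  qed
  have PM: "?P \<inter> ?M = {}" by (auto simp: defs)
  have plus: "{i \<in> {1..n}. ?g i = Plus} = ?P"
  proof -
    have "?g i = Plus \<longleftrightarrow> i \<in> ?P" if "i \<in> {1..n}" for i
      using that by (simp add: pair_preclan_def)
    then show ?thesis using P by blast
  qed
  have minus: "{i \<in> {1..n}. ?g i = Minus} = ?M"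
  proof -
    have "?g i = Minus \<longleftrightarrow> i \<in> ?M" if "i \<in> {1..n}" for i
      using that PM by (auto simp add: pair_preclan_def)
    then show ?thesis using M by blast
  qed
  have bij1: "bij_betw fst {(i, j). ?S i j} ?D"
  proof (rule bij_betw_imageI)
    show "inj_on fst {(i, j). ?S i j}" using uniq1 by (auto intro!: inj_onI)
    show "fst ` {(i, j). ?S i j} = ?D"
    proof (intro equalityI subsetI)
      fix i assume "i \<in> ?D"
      then obtain j where "?S i j" using ex by blast
      then have "(i, j) \<in> {(i, j). ?S i j}" by simp
      then show "i \<in> fst ` {(i, j). ?S i j}" by (metis fst_conv image_eqI)
    qed (use S in auto)
  qed
  then have cm: "card (matchings n ?g) = card ?D"
    by (simp add: match bij_betw_same_card)
  have bij2: "bij_betw snd {(i, j). ?S i j} {j. \<exists>i. ?S i j}"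
  proof (rule bij_betw_imageI)
    show "inj_on snd {(i, j). ?S i j}" using uniq2 by (auto intro!: inj_onI)
    show "snd ` {(i, j). ?S i j} = {j. \<exists>i. ?S i j}" by (auto simp: image_iff)
  qed
  let ?E = "{j. \<exists>i. ?S i j}"
  have E: "?E \<subseteq> {1..n}" "card ?E = card ?D" "?E \<subseteq> ?U"
    using S bij2 cm by (auto simp: match dest: bij_betw_same_card)
  have blank: "{i \<in> {1..n}. ?g i = Blank} = {1..n} - (?P \<union> ?M \<union> ?D \<union> ?E)"
  proof -
    have "?g i = Blank \<longleftrightarrow> i \<notin> ?P \<union> ?M \<union> ?D \<union> ?E" if "i \<in> {1..n}" for i
      using that by (simp add: pair_preclan_def)
    then show ?thesis by blast
  qed
  have PD: "card ?P + card ?D = p"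
  proof -
    have "v -` {1..p} = ?P \<union> ?D" "?P \<inter> ?D = {}" by (auto simp: defs)
    then show ?thesis using cv fin by (simp add: card_Un_disjoint)
  qed
  have MD: "card ?M + card ?D = q"
  proof -
    have "u -` {1..q} = ?M \<union> ?D" "?M \<inter> ?D = {}" by (auto simp: defs)
    then show ?thesis using cu fin by (simp add: card_Un_disjoint)
  qed
  have finE: "finite ?E" using E(1) finite_subset by blast
  have "card (?P \<union> ?M \<union> ?D \<union> ?E) = card (?P \<union> ?M \<union> ?D) + card ?E"
    using E(3) by (intro card_Un_disjoint fin finE finite_UnI) (auto simp: defs)
  also have "card (?P \<union> ?M \<union> ?D) = card (?P \<union> ?M) + card ?D"
    by (intro card_Un_disjoint fin finite_UnI) (auto simp: defs)
  also have "card (?P \<union> ?M) = card ?P + card ?M"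
    by (intro card_Un_disjoint fin) (auto simp: defs)
  finally have "card (?P \<union> ?M \<union> ?D \<union> ?E) = p + q"
    using E(2) PD MD by simp
  moreover have "card ({1..n} - (?P \<union> ?M \<union> ?D \<union> ?E)) = n - card (?P \<union> ?M \<union> ?D \<union> ?E)"
    using P M D E(1) fin finE by (subst card_Diff_subset) auto
  ultimately have "card {i \<in> {1..n}. ?g i = Blank} = m"
    unfolding blank using assms(2) by simp
  moreover have "j \<noteq> i \<and> ?g j = Mate i" if "?g i = Mate j" for i j
    using gMate[OF that] gD[of j i] gU[of i j] S[of i j] S[of j i] by auto
  moreover have "?g i = Blank" if "i \<notin> {1..n}" for i
    using that by (simp add: pair_preclan_def)
  ultimately show ?thesis
    using PD MD unfolding preclan_def Let_def plus minus assms(2)[symmetric] cm by blast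
qed

section \<open>Permutational preclans\<close>

definition permutational :: "nat \<Rightarrow> nat \<Rightarrow> (nat \<Rightarrow> node) \<Rightarrow> bool" where
  "permutational p q \<gamma> \<longleftrightarrow>
     (\<forall>i\<in>{1..q}. \<exists>j>i. \<gamma> i = Mate j) \<and> (\<forall>i\<in>{q+1..p}. \<gamma> i = Plus)"

definition eta_perm :: "nat \<Rightarrow> nat \<Rightarrow> nat \<Rightarrow> (nat \<Rightarrow> node) \<Rightarrow> nat \<Rightarrow> nat" where
  "eta_perm p m q \<gamma> i =
     (if i \<in> {1..q} then (THE j. \<gamma> (q + 1 - i) = Mate j) - p
      else if i \<in> {q+1..q+m} then nth_smallest (blanks (p + m + q) \<gamma>) (i - q) - p
      else i)"

end

theory Submission
  imports Defs
begin

text \<open>The structure constant is the localization at \<open>x = t\<close> of \<open>\<partial>\<^sub>w (\<SS>\<^sub>v \<cdot> \<SS>\<^sub>u)\<close>, because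
  double Schubert polynomials are dual to divided differences followed by \<open>x = t\<close>
  (\<open>structure_const_eq\<close>). So one has to follow the product \<open>\<SS>\<^sub>v \<cdot> \<SS>\<^sub>u\<close> under divided
  differences, and the preclans record what happens.

  To every preclan \<open>\<gamma>\<close> there is a polynomial \<open>P \<gamma>\<close> such that \<open>\<partial>\<^sub>k (P \<gamma>)\<close> is \<open>P (s\<^sub>k * \<gamma>)\<close>
  if \<open>s\<^sub>k\<close> moves \<open>\<gamma>\<close>, and zero otherwise (\<open>dd_family.P_simple_act\<close>). A preclan consisting of
  blanks followed by signs gets the product of the two Grassmannian double Schubert polynomials
  given by the positions of its pluses and of its minuses, and the other preclans get divided
  differences of these. That the result does not depend on the chosen chain is a diamond argument:
  two descents of a preclan are compared by a commutation or a braid relation, directly or through a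
  third descent, and the pairs for which this is impossible lie just above preclans without descents,
  where the comparison is a property of products of Grassmannian polynomials. If no arcs of \<open>\<gamma>\<close>
  cross and no blank lies below an arc, then \<open>P \<gamma>\<close> is still a product of two Grassmannian
  polynomials, for the positions that are left ends or carry the sign
  (\<open>noncrossing_clan_poly\<close>); for \<open>\<gamma>\<^sub>v\<^sub>u\<close> these are \<open>\<SS>\<^sub>v\<close> and \<open>\<SS>\<^sub>u\<close>.
  Since each effective move increases the length by one, \<open>\<partial>\<^sub>w (\<SS>\<^sub>v \<cdot> \<SS>\<^sub>u)\<close> is \<open>P \<gamma>\<close> with
  \<open>\<gamma> = w * \<gamma>\<^sub>v\<^sub>u\<close> if the lengths add up, and zero otherwise.

  It remains to localize \<open>P \<gamma>\<close> at \<open>x = t\<close>. The localizations of a Grassmannian polynomial vanish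
  outside an order ideal, and this vanishing is inherited along divided differences with the set of
  positions moved to the left (\<open>vanishing_clan_poly\<close>); hence the localization at the identity is
  zero unless the two sets of positions are \<open>{1..p}\<close> and \<open>{1..q}\<close>, that is, unless \<open>\<gamma>\<close> is
  permutational. For permutational \<open>\<gamma>\<close> one uses that \<open>P \<gamma>\<close> is symmetric in all parameters
  \<open>t\<^sub>k\<close>, \<open>t\<^sub>k\<^sub>+\<^sub>1\<close> with \<open>k \<noteq> p, q\<close> (\<open>tswap_clan_poly\<close>). So a divided difference in the
  variables \<open>x\<close> at a place after the first \<open>p\<close> becomes, after localization, one in the parameters, and
  the specialized polynomial of \<open>\<eta>\<^sub>\<gamma>\<close> satisfies the same recursion (\<open>loc_perm_preclan\<close>).
  The recursion ends at the preclan with arcs from \<open>i\<close> to \<open>p + m + i\<close>, where \<open>\<eta>\<^sub>\<gamma>\<close> is dominant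
  and its polynomial is a product of linear forms; the localization is found by moving the nodes to
  a position without crossings (\<open>loc_clan_poly_grass\<close>, \<open>loc_base\<close>).\<close>

section \<open>Substitution in polynomials\<close>

locale comm_ring_hom' =
  fixes h :: "'a::comm_ring_1 \<Rightarrow> 'b::comm_ring_1"
  assumes hom_add: "h (a + b) = h a + h b"
    and hom_mult: "h (a * b) = h a * h b"
    and hom_one: "h 1 = 1"
begin

lemma hom_zero: "h 0 = 0"
  using hom_add[of 0 0] by simp

lemma hom_uminus: "h (- a) = - h a"
  using hom_add[of a "- a"] by (simp add: hom_zero eq_neg_iff_add_eq_0 add.commute)

lemma hom_diff: "h (a - b) = h a - h b"
  using hom_add[of a "- b"] by (simp add: hom_uminus)

lemma hom_sum: "h (sum f A) = (\<Sum>a\<in>A. h (f a))"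
  by (induction A rule: infinite_finite_induct) (auto simp: hom_zero hom_add)

lemma hom_prod: "h (prod f A) = (\<Prod>a\<in>A. h (f a))"
  by (induction A rule: infinite_finite_induct) (auto simp: hom_one hom_mult)

lemmas hom_simps = hom_zero hom_one hom_add hom_mult hom_uminus hom_diff hom_sum hom_prod

end

definition mono_eval :: "(nat \<Rightarrow> 'b::comm_ring_1) \<Rightarrow> (nat \<Rightarrow>\<^sub>0 nat) \<Rightarrow> 'b" where
  "mono_eval a e = (\<Prod>i\<in>Poly_Mapping.keys e. a i ^ Poly_Mapping.lookup e i)"

lemma mono_eval_superset:
  "finite A \<Longrightarrow> Poly_Mapping.keys e \<subseteq> A \<Longrightarrow> mono_eval a e = (\<Prod>i\<in>A. a i ^ Poly_Mapping.lookup e i)"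
  unfolding mono_eval_def by (rule prod.mono_neutral_left) (auto simp: in_keys_iff)

lemma mono_eval_add: "mono_eval a (e + f) = mono_eval a e * mono_eval a f"
proof -
  let ?A = "Poly_Mapping.keys e \<union> Poly_Mapping.keys f"
  have "Poly_Mapping.keys (e + f) \<subseteq> ?A" by (rule Poly_Mapping.keys_add)
  then show ?thesis
    by (simp add: mono_eval_superset[of ?A] lookup_add power_add prod.distrib)
qed

lemma mono_eval_0: "mono_eval a 0 = 1"
  by (simp add: mono_eval_def)

lemma mono_eval_single: "mono_eval a (Poly_Mapping.single i 1) = a i"
  by (simp add: mono_eval_def)

context comm_ring_hom'
begin

lemma mpoly_subst_superset:
  "finite A \<Longrightarrow> Poly_Mapping.keys f \<subseteq> A \<Longrightarrow>
    mpoly_subst h a f = (\<Sum>e\<in>A. h (Poly_Mapping.lookup f e) * mono_eval a e)"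
  unfolding mpoly_subst_def mono_eval_def
  by (rule sum.mono_neutral_left) (auto simp: in_keys_iff hom_zero)

lemma mpoly_subst_add: "mpoly_subst h a (f + g) = mpoly_subst h a f + mpoly_subst h a g"
proof -
  let ?A = "Poly_Mapping.keys f \<union> Poly_Mapping.keys g"
  have "Poly_Mapping.keys (f + g) \<subseteq> ?A" by (rule Poly_Mapping.keys_add)
  then show ?thesis
    by (simp add: mpoly_subst_superset[of ?A] lookup_add hom_add ring_distribs sum.distrib)
qed

lemma mpoly_subst_single: "mpoly_subst h a (Poly_Mapping.single e c) = h c * mono_eval a e"
  by (subst mpoly_subst_superset[of "{e}"]) auto

lemma mpoly_subst_zero: "mpoly_subst h a 0 = 0"
  by (simp add: mpoly_subst_def)

end

lemma mpoly_monomial_induct [case_names zero add]: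
  fixes f :: "'a::comm_ring_1 mpoly"
  assumes "P 0" "\<And>e c f. P f \<Longrightarrow> P (Poly_Mapping.single e c + f)"
  shows "P f"
proof (induction f rule: update_induct)
  case const
  then show ?case by (rule assms(1))
next
  case (update f a b)
  have "Poly_Mapping.update a b f = Poly_Mapping.single a b + f"
    using update(1)
    by (intro poly_mapping_eqI) (auto simp: lookup_update lookup_add lookup_single when_def in_keys_iff)
  then show ?case using assms(2)[OF update(3)] by simp
qed

context comm_ring_hom'
begin

lemma mpoly_subst_mult: "mpoly_subst h a (f * g) = mpoly_subst h a f * mpoly_subst h a g"
proof (induction f rule: mpoly_monomial_induct)
  case zero
  then show ?case by (simp add: mpoly_subst_zero)
next
  case (add e c f)
  have "mpoly_subst h a (Poly_Mapping.single e c * g)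
      = mpoly_subst h a (Poly_Mapping.single e c) * mpoly_subst h a g"
  proof (induction g rule: mpoly_monomial_induct)
    case zero
    then show ?case by (simp add: mpoly_subst_zero)
  next
    case (add e' c' g)
    then show ?case
      by (simp add: ring_distribs mpoly_subst_add mult_single mpoly_subst_single mono_eval_add
          hom_mult mult_ac)
  qed
  with add show ?case by (simp add: ring_distribs mpoly_subst_add)
qed

lemma mpoly_subst_hom: "comm_ring_hom' (mpoly_subst h a)"
proof
  show "mpoly_subst h a 1 = 1"
    using mpoly_subst_single[of a 0 1] by (simp add: mono_eval_0 hom_one)
qed (auto simp: mpoly_subst_add mpoly_subst_mult)

lemma mpoly_subst_Var: "mpoly_subst h a (Var i) = a i"
  unfolding Var_def mpoly_subst_single mono_eval_single by (simp add: hom_one)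

lemma mpoly_subst_Const: "mpoly_subst h a (Const c) = h c"
  unfolding Const_def by (simp add: mpoly_subst_single mono_eval_0)

end

lemma Const_hom: "comm_ring_hom' (Const :: 'a::comm_ring_1 \<Rightarrow> 'a mpoly)"
  by standard (auto simp: Const_def single_add mult_single)

lemma id_hom: "comm_ring_hom' (\<lambda>x. x)"
  by standard auto

interpretation Const: comm_ring_hom' "Const :: 'a::comm_ring_1 \<Rightarrow> 'a mpoly"
  by (rule Const_hom)

lemma Var_pow: "Var i ^ k = Poly_Mapping.single (Poly_Mapping.single i k) (1::'a::comm_ring_1)"
  by (induction k) (auto simp: Var_def mult_single single_add[symmetric])

text \<open>Equalities between ring homomorphisms, and properties of divided differences, are checked on
  generators; this is the induction behind both.\<close>

lemma mpoly_induct [case_names Const Var add mult]: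
  fixes f :: "'a::comm_ring_1 mpoly"
  assumes "\<And>c. P (Const c)" "\<And>i. P (Var i)"
    "\<And>f g. P f \<Longrightarrow> P g \<Longrightarrow> P (f + g)" "\<And>f g. P f \<Longrightarrow> P g \<Longrightarrow> P (f * g)"
  shows "P f"
proof (induction f rule: mpoly_monomial_induct)
  case zero
  then show ?case using assms(1)[of 0] by (simp add: Const_def)
next
  case (add e c f)
  have "P (Poly_Mapping.single e 1 :: 'a mpoly)"
  proof (induction e rule: update_induct)
    case const
    then show ?case using assms(1)[of 1] by (simp add: Const_def)
  next
    case (update e i k)
    have "Poly_Mapping.update i k e = Poly_Mapping.single i k + e"
      using update(1)
      by (intro poly_mapping_eqI) (auto simp: lookup_update lookup_add lookup_single when_def in_keys_iff)
    then have "Poly_Mapping.single (Poly_Mapping.update i k e) (1::'a) = Var i ^ k * Poly_Mapping.single e 1"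
      by (simp add: Var_pow mult_single)
    moreover have "P (Var i ^ k :: 'a mpoly)"
    proof (induction k)
      case 0
      then show ?case using assms(1)[of 1] by (simp add: Const_def)
    qed (auto intro: assms)
    ultimately show ?case using assms(4) update(3) by simp
  qed
  moreover have "Poly_Mapping.single e c = Const c * Poly_Mapping.single e 1"
    by (simp add: Const_def mult_single)
  ultimately show ?case using assms add by metis
qed

lemma hom_eqI:
  fixes f :: "'a::comm_ring_1 mpoly"
  assumes "comm_ring_hom' \<phi>" "comm_ring_hom' \<psi>"
    "\<And>c. \<phi> (Const c) = \<psi> (Const c)" "\<And>i. \<phi> (Var i) = \<psi> (Var i)"
  shows "\<phi> f = \<psi> f"
proof -
  interpret a: comm_ring_hom' \<phi> by fact
  interpret b: comm_ring_hom' \<psi> by fact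
  show ?thesis
    by (induction f rule: mpoly_induct) (auto simp: assms a.hom_simps b.hom_simps)
qed

lemma hom_comp: "comm_ring_hom' \<phi> \<Longrightarrow> comm_ring_hom' \<psi> \<Longrightarrow> comm_ring_hom' (\<lambda>x. \<phi> (\<psi> x))"
  by (simp add: comm_ring_hom'_def)


section \<open>Divided differences\<close>

lemma swap_vars_hom: "comm_ring_hom' (swap_vars k)"
  unfolding swap_vars_def[abs_def] by (rule Const.mpoly_subst_hom)

interpretation sv: comm_ring_hom' "swap_vars k :: 'a::comm_ring_1 mpoly \<Rightarrow> 'a mpoly" for k
  by (rule swap_vars_hom)

lemma swap_vars_Var [simp]: "swap_vars k (Var i) = Var (simple_refl k i)"
  by (simp add: swap_vars_def Const.mpoly_subst_Var)

lemma swap_vars_Const [simp]: "swap_vars k (Const c) = Const c"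
  by (simp add: swap_vars_def Const.mpoly_subst_Const)

lemma simple_refl_simps [simp]:
  "simple_refl k k = Suc k" "simple_refl k (Suc k) = k"
  "i \<noteq> k \<Longrightarrow> i \<noteq> Suc k \<Longrightarrow> simple_refl k i = i"
  by (auto simp: simple_refl_def)

lemma simple_refl_def': "simple_refl k i = (if i = k then Suc k else if i = Suc k then k else i)"
  by auto

lemma simple_refl_invol [simp]: "simple_refl k (simple_refl k i) = i"
  by (simp add: simple_refl_def)

lemma simple_refl_eq_iff [simp]: "simple_refl k i = simple_refl k j \<longleftrightarrow> i = j"
  by (metis simple_refl_invol)

lemma swap_vars_invol [simp]: "swap_vars k (swap_vars k f) = f"
  by (rule hom_eqI[OF hom_comp[OF swap_vars_hom swap_vars_hom] id_hom]) auto

lemma swap_vars_comm: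
  assumes "Suc k < l"
  shows "swap_vars k (swap_vars l f) = swap_vars l (swap_vars k f)"
  by (rule hom_eqI[OF hom_comp[OF swap_vars_hom swap_vars_hom] hom_comp[OF swap_vars_hom swap_vars_hom]])
    (use assms in \<open>auto simp: simple_refl_def'\<close>)

lemma swap_vars_braid:
  "swap_vars k (swap_vars (Suc k) (swap_vars k f)) = swap_vars (Suc k) (swap_vars k (swap_vars (Suc k) f))"
  by (rule hom_eqI[OF hom_comp[OF swap_vars_hom hom_comp[OF swap_vars_hom swap_vars_hom]]
        hom_comp[OF swap_vars_hom hom_comp[OF swap_vars_hom swap_vars_hom]]])
    (auto simp: simple_refl_def')

lemma Var_eq_iff [simp]: "(Var i :: 'a::comm_ring_1 mpoly) = Var j \<longleftrightarrow> i = j"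
proof
  assume "(Var i :: 'a mpoly) = Var j"
  then have "Poly_Mapping.keys (Var i :: 'a mpoly) = Poly_Mapping.keys (Var j :: 'a mpoly)" by simp
  then have "Poly_Mapping.single i (1::nat) = Poly_Mapping.single j 1" by (simp add: Var_def)
  then have "Poly_Mapping.keys (Poly_Mapping.single i (1::nat)) = Poly_Mapping.keys (Poly_Mapping.single j (1::nat))"
    by simp
  then show "i = j" by simp
qed simp

abbreviation (input) DD :: "nat \<Rightarrow> 'a::idom mpoly \<Rightarrow> 'a mpoly" where
  "DD \<equiv> divided_difference"

text \<open>Divisibility by \<open>x\<^sub>k - x\<^sub>k\<^sub>+\<^sub>1\<close> is closed under products by the twisted Leibniz rule.\<close>

lemma dd_exists: "\<exists>g. (Var k - Var (Suc k)) * g = f - swap_vars k (f :: 'a::idom mpoly)"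
proof (induction f rule: mpoly_induct)
  case (Const c)
  show ?case by (rule exI[of _ 0]) simp
next
  case (Var i)
  consider "i = k" | "i = Suc k" | "i \<noteq> k" "i \<noteq> Suc k" by blast
  then show ?case
  proof cases
    case 1
    then show ?thesis by (intro exI[of _ 1]) simp
  next
    case 2
    then show ?thesis by (intro exI[of _ "-1"]) simp
  next
    case 3
    then show ?thesis by (intro exI[of _ 0]) simp
  qed
next
  case (add f g)
  then obtain a b where "(Var k - Var (Suc k)) * a = f - swap_vars k f"
    "(Var k - Var (Suc k)) * b = g - swap_vars k g" by blast
  then show ?case by (intro exI[of _ "a + b"]) (simp add: sv.hom_simps algebra_simps)
next
  case (mult f g)
  then obtain a b where ab: "(Var k - Var (Suc k)) * a = f - swap_vars k f"
    "(Var k - Var (Suc k)) * b = g - swap_vars k g" by blast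
  have "(Var k - Var (Suc k)) * (a * g + swap_vars k f * b)
      = ((Var k - Var (Suc k)) * a) * g + swap_vars k f * ((Var k - Var (Suc k)) * b)"
    by (simp add: algebra_simps)
  then have "(Var k - Var (Suc k)) * (a * g + swap_vars k f * b) = f * g - swap_vars k (f * g)"
    unfolding ab by (simp add: sv.hom_mult algebra_simps)
  then show ?case by blast
qed

lemma Var_diff_ne [simp]: "(Var k - Var (Suc k) :: 'a::idom mpoly) \<noteq> 0"
  by simp

lemma dd_eq: "(Var k - Var (Suc k)) * DD k f = f - swap_vars k (f :: 'a::idom mpoly)"
proof -
  obtain g where g: "(Var k - Var (Suc k)) * g = f - swap_vars k f" using dd_exists by blast
  have "(THE g. (Var k - Var (k + 1)) * g = f - swap_vars k f) = g"
  proof (rule the_equality)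
    show "(Var k - Var (k + 1)) * g = f - swap_vars k f" using g by simp
  next
    fix g' assume "(Var k - Var (k + 1)) * g' = f - swap_vars k f"
    with g have "(Var k - Var (Suc k)) * g' = (Var k - Var (Suc k)) * g" by simp
    then show "g' = g" by (metis Var_diff_ne mult_cancel_left)
  qed
  then show ?thesis using g by (simp add: divided_difference_def)
qed

lemma dd_eqI: "(Var k - Var (Suc k)) * g = f - swap_vars k (f :: 'a::idom mpoly) \<Longrightarrow> DD k f = g"
  by (metis dd_eq Var_diff_ne mult_cancel_left)

lemma dd_sym: "swap_vars k f = f \<Longrightarrow> DD k f = 0"
  by (rule dd_eqI) simp

lemma dd_eq_0_iff: "DD k f = 0 \<longleftrightarrow> swap_vars k f = f"
  using dd_eq[of k f] dd_sym by auto

lemma dd_zero [simp]: "DD k 0 = 0"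
  by (rule dd_sym) (simp add: sv.hom_simps)

lemma dd_add: "DD k (f + g) = DD k f + DD k g"
  by (rule dd_eqI) (simp add: sv.hom_add distrib_left dd_eq)

lemma dd_uminus: "DD k (- f) = - DD k f"
  by (rule dd_eqI) (simp only: sv.hom_uminus mult_minus_right dd_eq, simp)

lemma dd_diff: "DD k (f - g) = DD k f - DD k g"
  using dd_add[of k f "- g"] by (simp add: dd_uminus)

lemma dd_mult: "DD k (f * g) = DD k f * g + swap_vars k f * DD k g"
proof (rule dd_eqI)
  have "(Var k - Var (Suc k)) * (DD k f * g + swap_vars k f * DD k g)
    = ((Var k - Var (Suc k)) * DD k f) * g + swap_vars k f * ((Var k - Var (Suc k)) * DD k g)"
    by (simp add: algebra_simps)
  then show "(Var k - Var (Suc k)) * (DD k f * g + swap_vars k f * DD k g) = f * g - swap_vars k (f * g)"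
    unfolding dd_eq by (simp add: sv.hom_mult algebra_simps)
qed

lemma dd_mult_sym: "swap_vars k f = f \<Longrightarrow> DD k (f * g) = f * DD k g"
  by (simp add: dd_mult dd_sym)

lemma dd_Const_mult: "DD k (Const c * g) = Const c * DD k g"
  by (simp add: dd_mult_sym)

lemma swap_dd [simp]: "swap_vars k (DD k f) = DD k f"
proof -
  have "swap_vars k ((Var k - Var (Suc k)) * DD k f) = swap_vars k (f - swap_vars k f)"
    by (simp add: dd_eq)
  then have "(Var (Suc k) - Var k) * swap_vars k (DD k f) = swap_vars k f - f"
    by (simp add: sv.hom_mult sv.hom_diff)
  then have "(Var k - Var (Suc k)) * swap_vars k (DD k f) = f - swap_vars k f"
    by (metis minus_diff_eq mult_minus_left)
  then have "(Var k - Var (Suc k)) * swap_vars k (DD k f) = (Var k - Var (Suc k)) * DD k f"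
    by (simp only: dd_eq)
  then show ?thesis by (metis Var_diff_ne mult_cancel_left)
qed

lemma dd_dd: "DD k (DD k f) = 0"
  by (simp add: dd_sym)

lemma dd_comm:
  assumes "Suc k < l"
  shows "DD k (DD l f) = DD l (DD k (f :: 'a::idom mpoly))"
proof -
  let ?a = "Var k - Var (Suc k) :: 'a mpoly" and ?b = "Var l - Var (Suc l) :: 'a mpoly"
  have sa: "swap_vars l ?a = ?a" and sb: "swap_vars k ?b = ?b"
    using assms by (auto simp: sv.hom_simps)
  have "swap_vars k (?b * DD l f) = swap_vars k f - swap_vars k (swap_vars l f)"
    unfolding dd_eq sv.hom_diff ..
  then have 1: "?b * swap_vars k (DD l f) = swap_vars k f - swap_vars k (swap_vars l f)"
    unfolding sv.hom_mult sb .
  have "swap_vars l (?a * DD k f) = swap_vars l f - swap_vars l (swap_vars k f)"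
    unfolding dd_eq sv.hom_diff ..
  then have 2: "?a * swap_vars l (DD k f) = swap_vars l f - swap_vars l (swap_vars k f)"
    unfolding sv.hom_mult sa .
  have "?a * ?b * DD k (DD l f) = ?b * (?a * DD k (DD l f))" by (simp only: mult_ac)
  also have "\<dots> = ?b * DD l f - ?b * swap_vars k (DD l f)"
    unfolding dd_eq[of k] by (rule right_diff_distrib)
  also have "\<dots> = (f - swap_vars k f) - (swap_vars l f - swap_vars l (swap_vars k f))"
    unfolding 1 dd_eq[of l] swap_vars_comm[OF assms] by simp
  also have "\<dots> = ?a * (DD k f - swap_vars l (DD k f))"
    unfolding right_diff_distrib[of ?a] 2 dd_eq[of k] ..
  also have "\<dots> = ?a * (?b * DD l (DD k f))"
    unfolding dd_eq[of l] ..
  finally have "(?a * ?b) * DD k (DD l f) = (?a * ?b) * DD l (DD k f)" by (simp only: mult.assoc)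
  moreover have "?a * ?b \<noteq> 0" by simp
  ultimately show ?thesis by (metis mult_cancel_left)
qed

lemma dd_comm': "Suc k < l \<or> Suc l < k \<Longrightarrow> DD k (DD l f) = DD l (DD k f)"
  using dd_comm by metis

lemma dd_braid: "DD k (DD (Suc k) (DD k f)) = DD (Suc k) (DD k (DD (Suc k) (f :: 'a::idom mpoly)))"
proof -
  let ?x = "Var k :: 'a mpoly" and ?y = "Var (Suc k) :: 'a mpoly" and ?z = "Var (Suc (Suc k)) :: 'a mpoly"
  let ?s = "swap_vars k :: 'a mpoly \<Rightarrow> 'a mpoly" and ?t = "swap_vars (Suc k) :: 'a mpoly \<Rightarrow> 'a mpoly"
  have sx: "?s ?x = ?y" "?s ?y = ?x" "?s ?z = ?z" "?t ?x = ?x" "?t ?y = ?z" "?t ?z = ?y"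
    by (auto simp: simple_refl_def')
  define f1 where "f1 = DD k f"
  define g where "g = DD (Suc k) f1"
  define f2 where "f2 = DD (Suc k) f"
  define h where "h = DD k f2"
  have 1: "(?x - ?y) * f1 = f - ?s f" using dd_eq[of k f] by (simp add: f1_def)
  have 2: "(?y - ?z) * g = f1 - ?t f1" using dd_eq[of "Suc k" f1] by (simp add: g_def)
  have s1: "?s f1 = f1" by (simp add: f1_def)
  have 3: "(?x - ?z) * ?s g = f1 - ?s (?t f1)"
    using arg_cong[OF 2, of ?s] by (simp add: sv.hom_mult sv.hom_diff sx s1 del: swap_vars_Var)
  have 4: "(?x - ?z) * ?t f1 = ?t f - ?t (?s f)"
    using arg_cong[OF 1, of ?t] by (simp add: sv.hom_mult sv.hom_diff sx del: swap_vars_Var)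
  have 5: "(?y - ?z) * ?s (?t f1) = ?s (?t f) - ?s (?t (?s f))"
    using arg_cong[OF 4, of ?s] by (simp add: sv.hom_mult sv.hom_diff sx del: swap_vars_Var)
  have 6: "(?x - ?y) * DD k g = g - ?s g" using dd_eq[of k g] by simp
  have "(?x - ?y) * (?y - ?z) * (?x - ?z) * DD k g = (?y - ?z) * (?x - ?z) * ((?x - ?y) * DD k g)"
    by (simp only: mult_ac)
  also have "\<dots> = (?x - ?z) * ((?y - ?z) * g) - (?y - ?z) * ((?x - ?z) * ?s g)"
    unfolding 6 by (simp add: algebra_simps)
  also have "\<dots> = (?x - ?z) * (f1 - ?t f1) - (?y - ?z) * (f1 - ?s (?t f1))"
    unfolding 2 3 ..
  also have "\<dots> = (?x - ?y) * f1 - (?x - ?z) * ?t f1 + (?y - ?z) * ?s (?t f1)"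
    by (simp add: algebra_simps)
  also have "\<dots> = f - ?s f - (?t f - ?t (?s f)) + (?s (?t f) - ?s (?t (?s f)))"
    unfolding 1 4 5 ..
  finally have L: "(?x - ?y) * (?y - ?z) * (?x - ?z) * DD k g
      = f - ?s f - ?t f + ?t (?s f) + ?s (?t f) - ?s (?t (?s f))"
    by simp
  have 1: "(?y - ?z) * f2 = f - ?t f" using dd_eq[of "Suc k" f] by (simp add: f2_def)
  have 2: "(?x - ?y) * h = f2 - ?s f2" using dd_eq[of k f2] by (simp add: h_def)
  have s1: "?t f2 = f2" by (simp add: f2_def)
  have 3: "(?x - ?z) * ?t h = f2 - ?t (?s f2)"
    using arg_cong[OF 2, of ?t] by (simp add: sv.hom_mult sv.hom_diff sx s1 del: swap_vars_Var)
  have 4: "(?x - ?z) * ?s f2 = ?s f - ?s (?t f)"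
    using arg_cong[OF 1, of ?s] by (simp add: sv.hom_mult sv.hom_diff sx del: swap_vars_Var)
  have 5: "(?x - ?y) * ?t (?s f2) = ?t (?s f) - ?t (?s (?t f))"
    using arg_cong[OF 4, of ?t] by (simp add: sv.hom_mult sv.hom_diff sx del: swap_vars_Var)
  have 6: "(?y - ?z) * DD (Suc k) h = h - ?t h" using dd_eq[of "Suc k" h] by simp
  have "(?x - ?y) * (?y - ?z) * (?x - ?z) * DD (Suc k) h = (?x - ?y) * (?x - ?z) * ((?y - ?z) * DD (Suc k) h)"
    by (simp only: mult_ac)
  also have "\<dots> = (?x - ?z) * ((?x - ?y) * h) - (?x - ?y) * ((?x - ?z) * ?t h)"
    unfolding 6 by (simp add: algebra_simps)
  also have "\<dots> = (?x - ?z) * (f2 - ?s f2) - (?x - ?y) * (f2 - ?t (?s f2))"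
    unfolding 2 3 ..
  also have "\<dots> = (?y - ?z) * f2 - (?x - ?z) * ?s f2 + (?x - ?y) * ?t (?s f2)"
    by (simp add: algebra_simps)
  also have "\<dots> = f - ?t f - (?s f - ?s (?t f)) + (?t (?s f) - ?t (?s (?t f)))"
    unfolding 1 4 5 ..
  finally have R: "(?x - ?y) * (?y - ?z) * (?x - ?z) * DD (Suc k) h
      = f - ?s f - ?t f + ?t (?s f) + ?s (?t f) - ?t (?s (?t f))"
    by simp
  have "(?x - ?y) * (?y - ?z) * (?x - ?z) * DD k g = (?x - ?y) * (?y - ?z) * (?x - ?z) * DD (Suc k) h"
    unfolding L R swap_vars_braid[of k f] by simp
  moreover have "(?x - ?y) * (?y - ?z) * (?x - ?z) \<noteq> 0" by simp
  ultimately have "DD k g = DD (Suc k) h" by (metis mult_cancel_left)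
  then show ?thesis by (simp add: g_def f1_def h_def f2_def)
qed


lemma dd_Var: "DD k (Var i) = (if i = k then 1 else if i = Suc k then - 1 else 0)"
  by (rule dd_eqI) auto

text \<open>A bound on the total degree that is compatible with sums, products and the swap of variables; what
  matters is that divided differences lower it.\<close>

inductive deg_le :: "nat \<Rightarrow> 'a::idom mpoly \<Rightarrow> bool" where
  deg_Const: "deg_le d (Const c)"
| deg_Var: "deg_le (Suc d) (Var i)"
| deg_add: "deg_le d f \<Longrightarrow> deg_le d g \<Longrightarrow> deg_le d (f + g)"
| deg_mult: "deg_le a f \<Longrightarrow> deg_le b g \<Longrightarrow> a + b \<le> d \<Longrightarrow> deg_le d (f * g)"

lemma deg_le_mono: "deg_le d f \<Longrightarrow> d \<le> e \<Longrightarrow> deg_le e f"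
proof (induction arbitrary: e rule: deg_le.induct)
  case (deg_Var d i)
  then show ?case by (cases e) (auto intro: deg_le.intros)
qed (auto intro: deg_le.intros dest: order_trans)

lemma deg_le_0: "deg_le d 0"
  using deg_Const[of d 0] by (simp add: Const.hom_zero)

lemma deg_le_ex: "\<exists>d. deg_le d f"
proof (induction f rule: mpoly_induct)
  case (mult f g)
  then obtain a b where "deg_le a f" "deg_le b g" by blast
  then show ?case using deg_mult[of a f b g "a + b"] by blast
next
  case (add f g)
  then obtain a b where "deg_le a f" "deg_le b g" by blast
  then have "deg_le (max a b) (f + g)" by (intro deg_add) (erule deg_le_mono, simp)+
  then show ?case by blast
qed (auto intro: deg_le.intros)

lemma deg_le_swap: "deg_le d f \<Longrightarrow> deg_le d (swap_vars k f)"
  by (induction rule: deg_le.induct) (auto simp: sv.hom_simps intro: deg_le.intros)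

lemma deg_le_dd:
  "deg_le d f \<Longrightarrow> deg_le (d - 1) (DD k f) \<and> (d = 0 \<longrightarrow> DD k f = 0)"
proof (induction rule: deg_le.induct)
  case (deg_Const d c)
  then show ?case by (simp add: dd_sym deg_le_0)
next
  case (deg_Var d i)
  have "deg_le d (1 :: 'a mpoly)" "deg_le d (- 1 :: 'a mpoly)"
    using deg_le.deg_Const[of d 1] deg_le.deg_Const[of d "-1"] by (simp_all add: Const.hom_simps)
  then show ?case by (auto simp: dd_Var deg_le_0)
next
  case (deg_add d f g)
  then show ?case by (auto simp: dd_add intro: deg_le.intros)
next
  case (deg_mult a f b g d)
  have 1: "deg_le (d - 1) (DD k f * g)"
  proof (cases a)
    case 0
    then show ?thesis using deg_mult by (simp add: deg_le_0)
  next
    case (Suc a')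
    then show ?thesis using deg_mult by (intro deg_le.deg_mult[of a' _ b]) auto
  qed
  have 2: "deg_le (d - 1) (swap_vars k f * DD k g)"
  proof (cases b)
    case 0
    then show ?thesis using deg_mult by (simp add: deg_le_0)
  next
    case (Suc b')
    then show ?thesis using deg_mult by (intro deg_le.deg_mult[of a _ b']) (auto intro: deg_le_swap)
  qed
  show ?case using 1 2 deg_mult by (auto simp: dd_mult intro: deg_add)
qed

text \<open>A polynomial fixed by all swaps is constant: a swap at the largest variable occurring in it would
  introduce a new one.\<close>

definition mvars :: "'a::comm_ring_1 mpoly \<Rightarrow> nat set" where
  "mvars f = (\<Union>e\<in>Poly_Mapping.keys f. Poly_Mapping.keys e)"

lemma finite_mvars: "finite (mvars f)"
  by (simp add: mvars_def)

lemma mvars_sum: "mvars (sum g A) \<subseteq> (\<Union>a\<in>A. mvars (g a))"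
proof (induction A rule: infinite_finite_induct)
  case (insert x F)
  have "mvars (g x + sum g F) \<subseteq> mvars (g x) \<union> mvars (sum g F)"
    using Poly_Mapping.keys_add unfolding mvars_def by fastforce
  with insert show ?case by auto
qed (auto simp: mvars_def)

lemma mvars_mult: "mvars (f * g) \<subseteq> mvars f \<union> mvars g"
proof
  fix i assume "i \<in> mvars (f * g)"
  then obtain e where e: "e \<in> Poly_Mapping.keys (f * g)" "i \<in> Poly_Mapping.keys e"
    by (auto simp: mvars_def)
  from keys_mult[of f g] e(1) obtain a b where
    "a \<in> Poly_Mapping.keys f" "b \<in> Poly_Mapping.keys g" "e = a + b" by blast
  moreover have "Poly_Mapping.keys (a + b) \<subseteq> Poly_Mapping.keys a \<union> Poly_Mapping.keys b"
    by (rule Poly_Mapping.keys_add)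
  ultimately show "i \<in> mvars f \<union> mvars g" using e(2) by (auto simp: mvars_def)
qed

lemma mvars_Const: "mvars (Const c) = {}"
  by (simp add: mvars_def Const_def)

lemma mvars_prod: "mvars (prod g A) \<subseteq> (\<Union>a\<in>A. mvars (g a))"
proof (induction A rule: infinite_finite_induct)
  case (insert x F)
  have "mvars (g x * prod g F) \<subseteq> mvars (g x) \<union> mvars (prod g F)" by (rule mvars_mult)
  with insert show ?case by auto
qed (auto simp: mvars_Const[of 1, unfolded Const.hom_one])

lemma mvars_power: "mvars (g ^ k) \<subseteq> mvars g"
  by (induction k) (use mvars_mult in \<open>auto simp: mvars_Const[of 1, unfolded Const.hom_one]\<close>)

lemma mvars_Var: "mvars (Var i :: 'a::comm_ring_1 mpoly) \<subseteq> {i}"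
  by (simp add: mvars_def Var_def)

lemma mvars_swap: "mvars (swap_vars k f) \<subseteq> simple_refl k ` mvars f"
proof -
  let ?g = "\<lambda>e. Const (Poly_Mapping.lookup f e) *
     (\<Prod>i\<in>Poly_Mapping.keys e. Var (simple_refl k i) ^ Poly_Mapping.lookup e i)"
  have "mvars (?g e) \<subseteq> simple_refl k ` mvars f" if "e \<in> Poly_Mapping.keys f" for e
  proof -
    have "mvars (?g e) \<subseteq> mvars (Const (Poly_Mapping.lookup f e)) \<union>
      mvars (\<Prod>i\<in>Poly_Mapping.keys e. Var (simple_refl k i) ^ Poly_Mapping.lookup e i :: 'a mpoly)"
      by (rule mvars_mult)
    also have "\<dots> \<subseteq> (\<Union>i\<in>Poly_Mapping.keys e. mvars (Var (simple_refl k i) ^ Poly_Mapping.lookup e i :: 'a mpoly))"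
      using mvars_prod by (auto simp: mvars_Const)
    also have "\<dots> \<subseteq> (\<Union>i\<in>Poly_Mapping.keys e. {simple_refl k i})"
      using mvars_power mvars_Var by fast
    also have "\<dots> \<subseteq> simple_refl k ` mvars f" using that by (auto simp: mvars_def)
    finally show ?thesis .
  qed
  then show ?thesis
    unfolding swap_vars_def mpoly_subst_def using mvars_sum[of ?g "Poly_Mapping.keys f"] by blast
qed

lemma mvars_empty: "mvars f = {} \<Longrightarrow> \<exists>c. f = Const c"
proof -
  assume "mvars f = {}"
  then have "Poly_Mapping.keys f \<subseteq> {0}" by (auto simp: mvars_def)
  then have "f = Const (Poly_Mapping.lookup f 0)"
    unfolding Const_def by (intro poly_mapping_eqI) (auto simp: lookup_single when_def in_keys_iff)
  then show ?thesis by blast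
qed

lemma symmetric_const:
  assumes "\<And>k. 1 \<le> k \<Longrightarrow> swap_vars k f = f" "0 \<notin> mvars f"
  shows "\<exists>c. f = Const c"
proof (rule mvars_empty, rule ccontr)
  assume ne: "mvars f \<noteq> {}"
  define i where "i = Max (mvars f)"
  have i: "i \<in> mvars f" "\<And>j. j \<in> mvars f \<Longrightarrow> j \<le> i"
    unfolding i_def using Max_in[OF finite_mvars ne] Max_ge[OF finite_mvars] by auto
  then have "1 \<le> i" using assms(2) by (cases i) auto
  then have "i \<in> simple_refl i ` mvars f" using mvars_swap[of i f] assms(1)[of i] i(1) by auto
  then obtain j where "j \<in> mvars f" "i = simple_refl i j" by auto
  then have "j = Suc i" by (metis simple_refl_invol simple_refl_simps(1))
  then show False using i(2) \<open>j \<in> mvars f\<close> by fastforce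
qed

text \<open>The swaps \<open>s\<^sub>k\<close> with \<open>k \<ge> 1\<close> do not move the variable of index 0, which has to be excluded
  separately: \<open>kill0 f = f\<close> says that it does not occur in \<open>f\<close>.\<close>

definition kill0 :: "'a::comm_ring_1 mpoly \<Rightarrow> 'a mpoly" where
  "kill0 = mpoly_subst Const (\<lambda>i. if i = 0 then 0 else Var i)"

lemma kill0_hom: "comm_ring_hom' kill0"
  unfolding kill0_def by (rule Const.mpoly_subst_hom)

interpretation k0: comm_ring_hom' "kill0 :: 'a::comm_ring_1 mpoly \<Rightarrow> 'a mpoly"
  by (rule kill0_hom)

lemma kill0_Var: "kill0 (Var i) = (if i = 0 then 0 else Var i)"
  by (simp add: kill0_def Const.mpoly_subst_Var)

lemma kill0_Const: "kill0 (Const c) = Const c"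
  by (simp add: kill0_def Const.mpoly_subst_Const)

lemma kill0_swap: "1 \<le> k \<Longrightarrow> kill0 (swap_vars k f) = swap_vars k (kill0 f)"
  by (rule hom_eqI[OF hom_comp[OF kill0_hom swap_vars_hom] hom_comp[OF swap_vars_hom kill0_hom]])
    (auto simp: kill0_Var kill0_Const simple_refl_def' sv.hom_zero)

lemma kill0_dd:
  assumes "1 \<le> k"
  shows "kill0 (DD k f) = DD k (kill0 (f :: 'a::idom mpoly))"
proof (rule dd_eqI[symmetric])
  have "kill0 ((Var k - Var (Suc k)) * DD k f) = kill0 f - swap_vars k (kill0 f)"
    unfolding dd_eq k0.hom_diff kill0_swap[OF assms] ..
  then show "(Var k - Var (Suc k)) * kill0 (DD k f) = kill0 f - swap_vars k (kill0 f)"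
    unfolding k0.hom_mult k0.hom_diff kill0_Var using assms by simp
qed

lemma kill0_mvars: "kill0 f = f \<Longrightarrow> 0 \<notin> mvars f"
proof -
  let ?a = "\<lambda>i. if i = 0 then 0 else Var i :: 'a mpoly"
  let ?g = "\<lambda>e. Const (Poly_Mapping.lookup f e) * (\<Prod>i\<in>Poly_Mapping.keys e. ?a i ^ Poly_Mapping.lookup e i)"
  have "mvars (?g e) \<subseteq> - {0}" for e
  proof -
    have "mvars (?a i) \<subseteq> - {0}" for i
      using mvars_Var[of i, where 'a='a] by (cases "i = 0") (auto simp: mvars_def[of 0])
    then have "(\<Union>i\<in>Poly_Mapping.keys e. mvars (?a i ^ Poly_Mapping.lookup e i)) \<subseteq> - {0}"
      using mvars_power by fast
    moreover have "mvars (?g e) \<subseteq> mvars (Const (Poly_Mapping.lookup f e)) \<union>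
      mvars (\<Prod>i\<in>Poly_Mapping.keys e. ?a i ^ Poly_Mapping.lookup e i)"
      by (rule mvars_mult)
    moreover have "mvars (\<Prod>i\<in>Poly_Mapping.keys e. ?a i ^ Poly_Mapping.lookup e i)
        \<subseteq> (\<Union>i\<in>Poly_Mapping.keys e. mvars (?a i ^ Poly_Mapping.lookup e i))" by (rule mvars_prod)
    ultimately show ?thesis by (auto simp: mvars_Const)
  qed
  then have "mvars (kill0 f) \<subseteq> - {0}"
    unfolding kill0_def mpoly_subst_def using mvars_sum[of ?g "Poly_Mapping.keys f"] by blast
  then show "kill0 f = f \<Longrightarrow> 0 \<notin> mvars f" by auto
qed


section \<open>Localization and equivariant parameters\<close>

text \<open>The localization at the fixed point \<open>\<sigma>\<close> of the flag variety: substitute \<open>t\<^bsub>\<sigma> i\<^esub>\<close> for \<open>x\<^sub>i\<close>.\<close>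

definition loc :: "(nat \<Rightarrow> nat) \<Rightarrow> int mpoly mpoly \<Rightarrow> int mpoly" where
  "loc \<sigma> = mpoly_subst (\<lambda>c. c) (\<lambda>i. t_var (\<sigma> i))"

lemma loc_hom: "comm_ring_hom' (loc \<sigma>)"
  unfolding loc_def by (rule comm_ring_hom'.mpoly_subst_hom[OF id_hom])

interpretation loc: comm_ring_hom' "loc \<sigma>" for \<sigma>
  by (rule loc_hom)

lemma loc_Var [simp]: "loc \<sigma> (Var i) = t_var (\<sigma> i)"
  by (simp add: loc_def comm_ring_hom'.mpoly_subst_Var[OF id_hom])

lemma loc_Const [simp]: "loc \<sigma> (Const c) = c"
  by (simp add: loc_def comm_ring_hom'.mpoly_subst_Const[OF id_hom])

lemma loc_swap: "loc \<sigma> (swap_vars k f) = loc (\<sigma> \<circ> simple_refl k) f"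
  by (rule hom_eqI[OF hom_comp[OF loc_hom swap_vars_hom] loc_hom]) auto

lemma loc_dd: "(t_var (\<sigma> k) - t_var (\<sigma> (Suc k))) * loc \<sigma> (DD k f) = loc \<sigma> f - loc (\<sigma> \<circ> simple_refl k) f"
  using arg_cong[OF dd_eq[of k f], of "loc \<sigma>"] by (simp add: loc.hom_simps loc_swap)

definition tswap :: "nat \<Rightarrow> int mpoly mpoly \<Rightarrow> int mpoly mpoly" where
  "tswap k = mpoly_subst (\<lambda>c. Const (swap_vars k c)) Var"

lemma Const_swap_hom: "comm_ring_hom' (\<lambda>c. Const (swap_vars k c))"
  by (rule hom_comp[OF Const_hom swap_vars_hom])

lemma tswap_hom: "comm_ring_hom' (tswap k)"
  unfolding tswap_def by (rule comm_ring_hom'.mpoly_subst_hom[OF Const_swap_hom])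

interpretation ts: comm_ring_hom' "tswap k" for k
  by (rule tswap_hom)

lemma tswap_Var [simp]: "tswap k (Var i) = Var i"
  by (simp add: tswap_def comm_ring_hom'.mpoly_subst_Var[OF Const_swap_hom])

lemma tswap_Const [simp]: "tswap k (Const c) = Const (swap_vars k c)"
  by (simp add: tswap_def comm_ring_hom'.mpoly_subst_Const[OF Const_swap_hom])

lemma tswap_swap: "tswap k (swap_vars l f) = swap_vars l (tswap k f)"
  by (rule hom_eqI[OF hom_comp[OF tswap_hom swap_vars_hom] hom_comp[OF swap_vars_hom tswap_hom]]) auto

lemma tswap_dd: "tswap k (DD l f) = DD l (tswap k f)"
proof (rule dd_eqI[symmetric])
  have "tswap k ((Var l - Var (Suc l)) * DD l f) = tswap k f - swap_vars l (tswap k f)"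
    unfolding dd_eq ts.hom_diff tswap_swap ..
  then show "(Var l - Var (Suc l)) * tswap k (DD l f) = tswap k f - swap_vars l (tswap k f)"
    unfolding ts.hom_mult ts.hom_diff by simp
qed

lemma swap_loc: "swap_vars k (loc \<sigma> f) = loc (simple_refl k \<circ> \<sigma>) (tswap k f)"
  by (rule hom_eqI[OF hom_comp[OF swap_vars_hom loc_hom] hom_comp[OF loc_hom tswap_hom]]) auto


section \<open>Permutations and inversions\<close>

lemma Sn_0: "w \<in> Sn n \<Longrightarrow> w 0 = 0"
  by (auto simp: Sn_def permutes_def)

lemma Sn_mono: "n \<le> m \<Longrightarrow> Sn n \<subseteq> Sn m"
  by (auto simp: Sn_def intro: permutes_subset)

lemma Sn_id: "id \<in> Sn n"
  by (simp add: Sn_def permutes_id)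

lemma Sn_comp: "v \<in> Sn n \<Longrightarrow> w \<in> Sn n \<Longrightarrow> v \<circ> w \<in> Sn n"
  by (simp add: Sn_def permutes_compose)

lemma Sn_inv: "w \<in> Sn n \<Longrightarrow> inv w \<in> Sn n"
  by (simp add: Sn_def permutes_inv)

lemma simple_refl_Sn: "1 \<le> k \<Longrightarrow> k < n \<Longrightarrow> simple_refl k \<in> Sn n"
  by (auto simp: Sn_def simple_refl_def intro: permutes_swap_id)

lemma Sinf_id: "id \<in> S_infty"
  using Sn_id by (auto simp: S_infty_def)

lemma Sinf_comp: "v \<in> S_infty \<Longrightarrow> w \<in> S_infty \<Longrightarrow> v \<circ> w \<in> S_infty"
proof -
  assume "v \<in> S_infty" "w \<in> S_infty"
  then obtain a b where "v \<in> Sn a" "w \<in> Sn b" by (auto simp: S_infty_def)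
  then have "v \<in> Sn (max a b)" "w \<in> Sn (max a b)"
    using Sn_mono[of a "max a b"] Sn_mono[of b "max a b"] by auto
  then have "v \<circ> w \<in> Sn (max a b)" by (rule Sn_comp)
  then show ?thesis unfolding S_infty_def by blast
qed

lemma Sinf_inv: "w \<in> S_infty \<Longrightarrow> inv w \<in> S_infty"
  using Sn_inv by (auto simp: S_infty_def)

lemma Sinf_simple: "1 \<le> k \<Longrightarrow> simple_refl k \<in> S_infty"
  using simple_refl_Sn[of k "Suc k"] by (auto simp: S_infty_def)

lemma Sinf_bij: "w \<in> S_infty \<Longrightarrow> bij w"
  by (auto simp: S_infty_def Sn_def dest: permutes_bij)

lemma Sinf_inj: "w \<in> S_infty \<Longrightarrow> inj w"
  using Sinf_bij bij_is_inj by blast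

lemma Sinf_0: "w \<in> S_infty \<Longrightarrow> w 0 = 0"
  using Sn_0 by (auto simp: S_infty_def)

lemma Sinf_pos: "w \<in> S_infty \<Longrightarrow> 1 \<le> i \<Longrightarrow> 1 \<le> w i"
  using Sinf_0[of w] Sinf_inj[of w] by (metis inj_eq less_one not_less)

lemma Sinf_eq_iff: "w \<in> S_infty \<Longrightarrow> w i = w j \<longleftrightarrow> i = j"
  using Sinf_inj[of w] by (simp add: inj_eq)

lemma Sinf_inv_simps:
  assumes "w \<in> S_infty"
  shows "inv w (w i) = i" "w (inv w i) = i" "inv w \<circ> w = id" "w \<circ> inv w = id" "inv (inv w) = w"
proof -
  note b = Sinf_bij[OF assms]
  show 1: "inv w (w i) = i" for i by (rule inv_f_f[OF bij_is_inj[OF b]])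
  show 2: "w (inv w i) = i" for i by (rule surj_f_inv_f[OF bij_is_surj[OF b]])
  show "inv w \<circ> w = id" "w \<circ> inv w = id" using 1 2 by (auto simp: fun_eq_iff)
  show "inv (inv w) = w" by (rule inv_inv_eq[OF b])
qed

lemma simple_simple [simp]: "simple_refl k \<circ> simple_refl k = id"
  by auto

lemma inv_simple [simp]: "inv (simple_refl k) = simple_refl k"
  by (rule inv_unique_comp) auto

lemma bij_simple: "bij (simple_refl k)"
  by (rule o_bij[of "simple_refl k"]) auto

lemma inv_comp: "v \<in> S_infty \<Longrightarrow> w \<in> S_infty \<Longrightarrow> inv (v \<circ> w) = inv w \<circ> inv v"
  by (rule o_inv_distrib[OF Sinf_bij Sinf_bij])

lemma inv_comp_simple: "w \<in> S_infty \<Longrightarrow> inv (w \<circ> simple_refl k) = simple_refl k \<circ> inv w"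
  using o_inv_distrib[OF Sinf_bij bij_simple] by simp

lemma inv_simple_comp: "w \<in> S_infty \<Longrightarrow> inv (simple_refl k \<circ> w) = inv w \<circ> simple_refl k"
  using o_inv_distrib[OF bij_simple Sinf_bij] by simp

definition invs :: "(nat \<Rightarrow> nat) \<Rightarrow> (nat \<times> nat) set" where
  "invs w = {(i, j). 1 \<le> i \<and> i < j \<and> w j < w i}"

definition ninv :: "(nat \<Rightarrow> nat) \<Rightarrow> nat" where
  "ninv w = card (invs w)"

lemma invs_Sn: assumes "w \<in> Sn n" shows "invs w \<subseteq> {1..n} \<times> {1..n}"
proof clarify
  fix i j assume "(i, j) \<in> invs w"
  then have ij: "1 \<le> i" "i < j" "w j < w i" by (auto simp: invs_def)
  have w: "w permutes {1..n}" using assms by (simp add: Sn_def)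
  have "j \<le> n"
  proof (rule ccontr)
    assume "\<not> j \<le> n"
    then have wj: "w j = j" using w by (auto simp: permutes_def)
    then show False using ij w permutes_in_image[OF w, of i] \<open>\<not> j \<le> n\<close>
      by (cases "i \<le> n") (auto simp: permutes_def)
  qed
  then show "i \<in> {1..n} \<and> j \<in> {1..n}" using ij by auto
qed

lemma finite_invs: "w \<in> S_infty \<Longrightarrow> finite (invs w)"
  unfolding S_infty_def using finite_subset[OF invs_Sn] by blast

lemma ninv_id: "ninv id = 0"
proof -
  have "invs id = {}" by (auto simp: invs_def)
  then show ?thesis by (simp add: ninv_def)
qed

text \<open>The bijection of inversion sets sends \<open>(i, j)\<close> to \<open>(s\<^sub>k i, s\<^sub>k j)\<close>; only the pair \<open>(k, k + 1)\<close> is new.\<close>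

lemma ninv_asc:
  assumes w: "w \<in> S_infty" and k: "1 \<le> k" and asc: "w k < w (Suc k)"
  shows "ninv (w \<circ> simple_refl k) = Suc (ninv w)"
proof -
  let ?s = "simple_refl k" and ?f = "map_prod (simple_refl k) (simple_refl k)"
  have s: "?s i = (if i = k then Suc k else if i = Suc k then k else i)" for i by auto
  have "invs (w \<circ> ?s) = insert (k, Suc k) (?f ` invs w)"
  proof (intro equalityI subsetI)
    fix x assume x: "x \<in> invs (w \<circ> ?s)"
    obtain i j where ij: "x = (i, j)" by force
    show "x \<in> insert (k, Suc k) (?f ` invs w)"
    proof (cases "x = (k, Suc k)")
      case False
      then have "(?s i, ?s j) \<in> invs w" using x ij k by (auto simp: invs_def simple_refl_def')
      moreover have "x = ?f (?s i, ?s j)" by (simp add: ij)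
      ultimately show ?thesis by blast
    qed simp
  next
    fix x assume "x \<in> insert (k, Suc k) (?f ` invs w)"
    then consider "x = (k, Suc k)" | i j where "(i, j) \<in> invs w" "x = (?s i, ?s j)" by auto
    then show "x \<in> invs (w \<circ> ?s)"
    proof cases
      case 1
      then show ?thesis using k asc by (simp add: invs_def)
    next
      case 2
      have "(i, j) \<noteq> (k, Suc k)" using 2(1) asc by (auto simp: invs_def)
      then have "?s i < ?s j" using 2(1) by (auto simp: invs_def simple_refl_def')
      moreover have "1 \<le> ?s i" using 2(1) k by (auto simp: invs_def simple_refl_def')
      ultimately show ?thesis using 2 by (auto simp: invs_def)
    qed
  qed
  moreover have "(k, Suc k) \<notin> ?f ` invs w"
  proof
    assume "(k, Suc k) \<in> ?f ` invs w"
    then obtain x where x: "(k, Suc k) = ?f x" "x \<in> invs w" by (rule imageE)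
    have "?f (?f x) = x" by (cases x) simp
    then have "x = ?f (k, Suc k)" using x(1) by metis
    then show False using x(2) by (simp add: invs_def)
  qed
  moreover have "inj_on ?f (invs w)"
  proof (rule inj_on_inverseI)
    show "?f (?f x) = x" for x by (cases x) simp
  qed
  ultimately show ?thesis using finite_invs[OF w] by (simp add: ninv_def card_image)
qed

lemma ninv_desc:
  assumes w: "w \<in> S_infty" and k: "1 \<le> k" and desc: "w (Suc k) < w k"
  shows "Suc (ninv (w \<circ> simple_refl k)) = ninv w"
proof -
  have "ninv (w \<circ> simple_refl k \<circ> simple_refl k) = Suc (ninv (w \<circ> simple_refl k))"
    by (rule ninv_asc) (use assms in \<open>auto intro!: Sinf_comp Sinf_simple simp del: One_nat_def\<close>)
  then show ?thesis by (simp add: comp_assoc)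
qed

lemma ninv_inv: assumes "w \<in> S_infty" shows "ninv (inv w) = ninv w"
proof -
  note [simp] = Sinf_inv_simps[OF assms]
  have p: "0 < w i \<longleftrightarrow> 0 < i" for i
    using Sinf_pos[OF assms, of i] Sinf_0[OF assms] by (cases "i = 0") auto
  have ip: "0 < inv w i \<longleftrightarrow> 0 < i" for i
    using p[of "inv w i"] by simp
  have "bij_betw (\<lambda>(i, j). (w j, w i)) (invs w) (invs (inv w))"
    by (rule bij_betwI[where g = "\<lambda>(i, j). (inv w j, inv w i)"])
      (auto simp: invs_def Suc_le_eq p ip intro: p[THEN iffD2] ip[THEN iffD2] dest: order.strict_trans)
  then have "card (invs w) = card (invs (inv w))" by (rule bij_betw_same_card)
  then show ?thesis by (simp add: ninv_def)
qed

lemma asc_or_desc: "w \<in> S_infty \<Longrightarrow> w k < w (Suc k) \<or> w (Suc k) < w k"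
  using Sinf_eq_iff[of w k "Suc k"] by linarith

lemma ninv_left_asc:
  assumes w: "w \<in> S_infty" and k: "1 \<le> k" and asc: "inv w k < inv w (Suc k)"
  shows "ninv (simple_refl k \<circ> w) = Suc (ninv w)"
proof -
  have "ninv (simple_refl k \<circ> w) = ninv (inv (simple_refl k \<circ> w))"
    by (rule ninv_inv[symmetric]) (intro Sinf_comp Sinf_simple k w)
  also have "\<dots> = ninv (inv w \<circ> simple_refl k)" by (simp add: inv_simple_comp w)
  also have "\<dots> = Suc (ninv (inv w))" by (rule ninv_asc) (use assms Sinf_inv in auto)
  finally show ?thesis by (simp add: ninv_inv w)
qed

lemma ninv_left_desc:
  assumes w: "w \<in> S_infty" and k: "1 \<le> k" and desc: "inv w (Suc k) < inv w k"
  shows "Suc (ninv (simple_refl k \<circ> w)) = ninv w"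
proof -
  have "ninv (simple_refl k \<circ> w) = ninv (inv (simple_refl k \<circ> w))"
    by (rule ninv_inv[symmetric]) (intro Sinf_comp Sinf_simple k w)
  also have "\<dots> = ninv (inv w \<circ> simple_refl k)" by (simp add: inv_simple_comp w)
  also have "Suc \<dots> = ninv (inv w)" by (rule ninv_desc) (use assms Sinf_inv in auto)
  finally show ?thesis by (simp add: ninv_inv w)
qed

text \<open>An increasing permutation of \<open>{1..n}\<close> dominates the identity pointwise and has the same sum.\<close>

lemma no_desc_id:
  assumes w: "w \<in> Sn n" and asc: "\<And>k. 1 \<le> k \<Longrightarrow> k < n \<Longrightarrow> w k < w (Suc k)"
  shows "w = id"
proof -
  have p: "w permutes {1..n}" using w by (simp add: Sn_def)
  have im: "w ` {1..n} = {1..n}" using p by (simp add: permutes_image)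
  have eq: "w i = i" if "i \<in> {1..n}" for i
  proof -
    have ge: "i \<le> w i" if "i \<le> n" for i
      using that
    proof (induction i)
      case (Suc i)
      then show ?case
      proof (cases i)
        case 0
        then show ?thesis using permutes_in_image[OF p, of 1] Suc.prems by auto
      next
        case (Suc j)
        then have "i \<le> w i" "w i < w (Suc i)" using Suc.IH asc[of i] \<open>Suc i \<le> n\<close> by auto
        then show ?thesis by linarith
      qed
    qed simp
    have "w i \<le> i" if "i \<in> {1..n}" for i
    proof (rule ccontr)
      assume "\<not> w i \<le> i"
      then have lt: "i < w i" by simp
      have "sum w {1..n} = sum id {1..n}"
        using sum.reindex[of w "{1..n}" id] permutes_inj_on[OF p] im by simp
      moreover have "sum id {1..n} < sum w {1..n}"
        by (rule sum_strict_mono_ex1) (use ge lt that in auto)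
      ultimately show False by simp
    qed
    then show ?thesis using ge[of i] that by force
  qed
  then show ?thesis using p by (auto simp: fun_eq_iff permutes_def)
qed

lemma ex_desc:
  assumes "w \<in> Sn n" "w \<noteq> id"
  obtains k where "1 \<le> k" "k < n" "w (Suc k) < w k"
proof -
  have "w \<in> S_infty" using assms by (auto simp: S_infty_def)
  then show ?thesis using no_desc_id[OF assms(1)] assms(2) asc_or_desc that by blast
qed

lemma Sinf_no_desc_id:
  assumes "w \<in> S_infty" "\<And>k. 1 \<le> k \<Longrightarrow> w k < w (Suc k)"
  shows "w = id"
proof -
  obtain n where "w \<in> Sn n" using assms(1) unfolding S_infty_def by blast
  then show ?thesis using no_desc_id assms(2) by blast
qed


section \<open>Reduced words\<close>

lemma word_perm_Nil [simp]: "word_perm [] = id"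
  by (simp add: word_perm_def)

lemma word_perm_Cons [simp]: "word_perm (k # ks) = simple_refl k \<circ> word_perm ks"
  by (simp add: word_perm_def)

lemma word_perm_append: "word_perm (ks @ ls) = word_perm ks \<circ> word_perm ls"
  by (induction ks) (auto simp: comp_assoc)

lemma word_perm_Sinf: "0 \<notin> set ks \<Longrightarrow> word_perm ks \<in> S_infty"
proof (induction ks)
  case (Cons k ks)
  then have "simple_refl k \<in> S_infty" using Sinf_simple[of k] by (cases k) auto
  moreover have "word_perm ks \<in> S_infty" using Cons by simp
  ultimately show ?case unfolding word_perm_Cons by (rule Sinf_comp)
qed (simp add: Sinf_id)

lemma ninv_simple_le:
  assumes "w \<in> S_infty" "1 \<le> k"
  shows "ninv (simple_refl k \<circ> w) \<le> Suc (ninv w)"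
proof (cases "inv w k < inv w (Suc k)")
  case True
  then show ?thesis using ninv_left_asc[OF assms] by simp
next
  case False
  then have "inv w (Suc k) < inv w k" using asc_or_desc[OF Sinf_inv[OF assms(1)]] by blast
  then show ?thesis using ninv_left_desc[OF assms] by linarith
qed

lemma ninv_word_le: "0 \<notin> set ks \<Longrightarrow> ninv (word_perm ks) \<le> length ks"
proof (induction ks)
  case (Cons k ks)
  then have "ninv (simple_refl k \<circ> word_perm ks) \<le> Suc (ninv (word_perm ks))"
    by (intro ninv_simple_le word_perm_Sinf) (auto simp: Suc_le_eq intro: Nat.gr0I)
  moreover have "ninv (word_perm ks) \<le> length ks" using Cons by simp
  ultimately show ?case unfolding word_perm_Cons length_Cons by linarith
qed (simp add: ninv_id)

definition redw :: "nat list \<Rightarrow> bool" where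
  "redw ks \<longleftrightarrow> 0 \<notin> set ks \<and> length ks = ninv (word_perm ks)"

lemma ex_word: "w \<in> Sn n \<Longrightarrow> \<exists>ks. set ks \<subseteq> {1..<n} \<and> word_perm ks = w \<and> length ks = ninv w"
proof (induction "ninv w" arbitrary: w rule: less_induct)
  case less
  show ?case
  proof (cases "w = id")
    case True
    then show ?thesis by (intro exI[of _ "[]"]) (auto simp: ninv_id)
  next
    case False
    then obtain k where k: "1 \<le> k" "k < n" "w (Suc k) < w k" using ex_desc less.prems by blast
    have w: "w \<in> S_infty" using less.prems by (auto simp: S_infty_def)
    have n: "Suc (ninv (w \<circ> simple_refl k)) = ninv w" using ninv_desc[OF w k(1,3)] .
    have "w \<circ> simple_refl k \<in> Sn n" using less.prems k by (intro Sn_comp simple_refl_Sn)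
    then obtain ks where ks: "set ks \<subseteq> {1..<n}" "word_perm ks = w \<circ> simple_refl k"
      "length ks = ninv (w \<circ> simple_refl k)" using less.hyps n by (metis lessI)
    then show ?thesis using k n
      by (intro exI[of _ "ks @ [k]"]) (auto simp: word_perm_append comp_assoc)
  qed
qed

lemma ex_redw: "w \<in> S_infty \<Longrightarrow> \<exists>ks. redw ks \<and> word_perm ks = w"
  using ex_word by (fastforce simp: S_infty_def redw_def)

lemma perm_length_eq: assumes "w \<in> S_infty" shows "perm_length w = ninv w"
  unfolding perm_length_def
proof (rule Least_equality)
  show "\<exists>ks. 0 \<notin> set ks \<and> word_perm ks = w \<and> length ks = ninv w"
    using ex_redw[OF assms] by (auto simp: redw_def)
qed (use ninv_word_le in auto)

lemma redw_Sinf: "redw ks \<Longrightarrow> word_perm ks \<in> S_infty"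
  by (simp add: redw_def word_perm_Sinf)

lemma redw_Nil: "redw []"
  by (simp add: redw_def ninv_id)

lemma redw_ConsD:
  assumes "redw (k # ks)"
  shows "redw ks" "1 \<le> k" "inv (word_perm ks) k < inv (word_perm ks) (Suc k)"
proof -
  have k: "0 \<notin> set ks" "1 \<le> k" using assms by (auto simp: redw_def Suc_le_eq intro: Nat.gr0I)
  then have w: "word_perm ks \<in> S_infty" by (simp add: word_perm_Sinf)
  have l: "ninv (simple_refl k \<circ> word_perm ks) = Suc (length ks)" using assms by (simp add: redw_def)
  show "inv (word_perm ks) k < inv (word_perm ks) (Suc k)"
    using asc_or_desc[OF Sinf_inv[OF w], of k] ninv_left_desc[OF w k(2)] ninv_word_le[OF k(1)] l by force
  then show "redw ks" using ninv_left_asc[OF w k(2)] l k by (simp add: redw_def)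
  show "1 \<le> k" by fact
qed

lemma redw_Cons:
  assumes "redw ks" "1 \<le> k" "inv (word_perm ks) k < inv (word_perm ks) (Suc k)"
  shows "redw (k # ks)"
  using assms ninv_left_asc[OF redw_Sinf[OF assms(1)] assms(2,3)]
  unfolding redw_def word_perm_Cons by simp

lemma redw_snoc:
  assumes "redw ks" "1 \<le> k" "word_perm ks k < word_perm ks (Suc k)"
  shows "redw (ks @ [k])"
  using assms ninv_asc[OF redw_Sinf[OF assms(1)] assms(2,3)]
  unfolding redw_def word_perm_append word_perm_Cons word_perm_Nil by simp

abbreviation dds :: "nat list \<Rightarrow> 'a::idom mpoly \<Rightarrow> 'a mpoly" where
  "dds ks f \<equiv> foldr divided_difference ks f"


lemma simple_comm: "Suc k < l \<or> Suc l < k \<Longrightarrow> simple_refl k \<circ> simple_refl l = simple_refl l \<circ> simple_refl k"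
  by (auto simp: fun_eq_iff simple_refl_def')

lemma simple_braid: "simple_refl k \<circ> simple_refl (Suc k) \<circ> simple_refl k
    = simple_refl (Suc k) \<circ> simple_refl k \<circ> simple_refl (Suc k)"
proof
  fix x
  consider "x = k" | "x = Suc k" | "x = Suc (Suc k)" | "x \<noteq> k" "x \<noteq> Suc k" "x \<noteq> Suc (Suc k)" by blast
  then show "(simple_refl k \<circ> simple_refl (Suc k) \<circ> simple_refl k) x
    = (simple_refl (Suc k) \<circ> simple_refl k \<circ> simple_refl (Suc k)) x"
    by cases simp_all
qed

text \<open>The first of two configurations of distinct left descents \<open>a\<close>, \<open>b\<close> of \<open>w\<close>: the common element below \<open>w\<close>
  is \<open>s\<^sub>a s\<^sub>b w\<close>.\<close>

lemma comm_words:
  assumes w: "w \<in> S_infty" and a: "1 \<le> a" "inv w (Suc a) < inv w a" and b: "1 \<le> b" "inv w (Suc b) < inv w b"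
    and ab: "Suc a < b \<or> Suc b < a"
  shows "\<exists>r. redw (b # r) \<and> word_perm (b # r) = simple_refl a \<circ> w \<and>
    redw (a # r) \<and> word_perm (a # r) = simple_refl b \<circ> w"
proof -
  let ?a = "simple_refl a" and ?b = "simple_refl b"
  have S: "?a \<in> S_infty" "?b \<in> S_infty" using a b by (auto intro: Sinf_simple)
  define g where "g = ?b \<circ> (?a \<circ> w)"
  have g: "g \<in> S_infty" using S w by (auto simp: g_def intro!: Sinf_comp)
  have ig: "inv g = inv w \<circ> ?a \<circ> ?b"
    by (simp add: g_def inv_simple_comp Sinf_comp S w)
  obtain r where r: "redw r" "word_perm r = g" using ex_redw[OF g] by blast
  have 1: "redw (b # r)" "redw (a # r)"
    by (rule redw_Cons; use r a b ab in \<open>auto simp: ig simple_refl_def'\<close>)+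
  have "?b \<circ> g = ?a \<circ> w" by (simp add: g_def flip: comp_assoc)
  moreover have "?a \<circ> g = ?b \<circ> w"
    using simple_comm[OF ab] unfolding g_def by (metis comp_assoc simple_simple id_comp)
  ultimately show ?thesis using 1 r by auto
qed

text \<open>The second configuration: the common element below \<open>w\<close> is obtained by removing the longest element of
  the parabolic subgroup generated by the two reflections.\<close>

lemma braid_words:
  assumes w: "w \<in> S_infty" and a: "1 \<le> a" "inv w (Suc a) < inv w a" "inv w (Suc (Suc a)) < inv w (Suc a)"
  shows "\<exists>r. redw (Suc a # a # r) \<and> word_perm (Suc a # a # r) = simple_refl a \<circ> w \<and>
    redw (a # Suc a # r) \<and> word_perm (a # Suc a # r) = simple_refl (Suc a) \<circ> w"
proof -
  let ?a = "simple_refl a" and ?b = "simple_refl (Suc a)"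
  have S: "?a \<in> S_infty" "?b \<in> S_infty" using a by (auto intro: Sinf_simple)
  define g where "g = ?a \<circ> (?b \<circ> (?a \<circ> w))"
  have g: "g \<in> S_infty" using S w by (auto simp: g_def intro!: Sinf_comp)
  have ig: "inv g = inv w \<circ> ?a \<circ> ?b \<circ> ?a"
    by (simp add: g_def inv_simple_comp Sinf_comp S w)
  obtain r where r: "redw r" "word_perm r = g" using ex_redw[OF g] by blast
  have ag: "?a \<circ> g = ?b \<circ> ?a \<circ> w" by (simp add: g_def flip: comp_assoc)
  have "g = (?a \<circ> ?b \<circ> ?a) \<circ> w" by (simp add: g_def comp_assoc)
  then have bg: "?b \<circ> g = ?a \<circ> ?b \<circ> w" unfolding simple_braid by (simp flip: comp_assoc)
  have 1: "redw (a # r)" by (rule redw_Cons) (use r a in \<open>auto simp: ig simple_refl_def'\<close>)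
  have i1: "inv (word_perm (a # r)) = inv w \<circ> ?a \<circ> ?b"
    by (simp add: r ag inv_simple_comp Sinf_comp S w comp_assoc)
  have 2: "redw (Suc a # a # r)" by (rule redw_Cons[OF 1]) (use a in \<open>auto simp only: i1, auto simp: simple_refl_def'\<close>)
  have 3: "redw (Suc a # r)" by (rule redw_Cons) (use r a in \<open>auto simp: ig simple_refl_def'\<close>)
  have i3: "inv (word_perm (Suc a # r)) = inv w \<circ> ?b \<circ> ?a"
    by (simp add: r bg inv_simple_comp Sinf_comp S w comp_assoc)
  have 4: "redw (a # Suc a # r)" by (rule redw_Cons[OF 3]) (use a in \<open>auto simp only: i3, auto simp: simple_refl_def'\<close>)
  have "word_perm (Suc a # a # r) = ?a \<circ> w" by (simp add: r ag) (simp flip: comp_assoc)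
  moreover have "word_perm (a # Suc a # r) = ?b \<circ> w" by (simp add: r bg) (simp flip: comp_assoc)
  ultimately show ?thesis using 2 4 by blast
qed

text \<open>Matsumoto's exchange argument: two reduced words of a permutation can be rewritten so
  that they differ only in a braid relation between their first letters.\<close>

lemma dds_unique:
  "redw ks \<Longrightarrow> redw ls \<Longrightarrow> word_perm ks = word_perm ls \<Longrightarrow> dds ks f = dds ls f"
proof (induction "length ks" arbitrary: ks ls rule: less_induct)
  case less
  have len: "length ks = length ls" using less.prems by (simp add: redw_def)
  have IH: "dds xs f = dds ys f" if "redw xs" "redw ys" "word_perm xs = word_perm ys" "length xs < length ks"
    for xs ys
    using less.hyps that by blast
  show ?case
  proof (cases ks)
    case Nil
    then show ?thesis using len by simp
  next
    case (Cons a ks')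
    then obtain b ls' where ls: "ls = b # ls'" using len by (cases ls) auto
    let ?w = "word_perm ks"
    have w: "?w \<in> S_infty" using less.prems redw_Sinf by auto
    have a: "redw ks'" "1 \<le> a" "inv (word_perm ks') a < inv (word_perm ks') (Suc a)"
      using redw_ConsD less.prems(1) Cons by auto
    have b: "redw ls'" "1 \<le> b" "inv (word_perm ls') b < inv (word_perm ls') (Suc b)"
      using redw_ConsD less.prems(2) ls by auto
    have wa: "word_perm ks' = simple_refl a \<circ> ?w" by (simp add: Cons flip: comp_assoc)
    have wb: "word_perm ls' = simple_refl b \<circ> ?w" by (simp add: less.prems(3) ls flip: comp_assoc)
    have da: "inv ?w (Suc a) < inv ?w a" using a(3) unfolding wa by (simp add: inv_simple_comp w)
    have db: "inv ?w (Suc b) < inv ?w b" using b(3) unfolding wb by (simp add: inv_simple_comp w)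
    have la: "length ks' < length ks" "length ls' < length ks" using Cons ls len by auto
    consider "a = b" | "Suc a < b \<or> Suc b < a" | "b = Suc a" | "a = Suc b" by linarith
    then show ?thesis
    proof cases
      case 1
      then have "dds ks' f = dds ls' f" using IH[OF a(1) b(1)] wa wb la by simp
      then show ?thesis using Cons ls 1 by simp
    next
      case 2
      obtain r where r: "redw (b # r)" "word_perm (b # r) = simple_refl a \<circ> ?w"
        "redw (a # r)" "word_perm (a # r) = simple_refl b \<circ> ?w"
        using comm_words[OF w a(2) da b(2) db 2] by blast
      have "dds ks' f = dds (b # r) f" using IH[OF a(1) r(1)] wa r la by simp
      moreover have "dds ls' f = dds (a # r) f" using IH[OF b(1) r(3)] wb r la by simp
      ultimately show ?thesis using Cons ls 2 dd_comm' by simp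
    next
      case 3
      obtain r where r: "redw (b # a # r)" "word_perm (b # a # r) = simple_refl a \<circ> ?w"
        "redw (a # b # r)" "word_perm (a # b # r) = simple_refl b \<circ> ?w"
        using braid_words[OF w a(2) da] db unfolding 3 by blast
      have "dds ks' f = dds (b # a # r) f" using IH[OF a(1) r(1)] wa r la by simp
      moreover have "dds ls' f = dds (a # b # r) f" using IH[OF b(1) r(3)] wb r la by simp
      ultimately show ?thesis using Cons ls 3 dd_braid[of a "dds r f"] by simp
    next
      case 4
      obtain r where r: "redw (a # b # r)" "word_perm (a # b # r) = simple_refl b \<circ> ?w"
        "redw (b # a # r)" "word_perm (b # a # r) = simple_refl a \<circ> ?w"
        using braid_words[OF w b(2) db] da unfolding 4 by blast
      have "dds ks' f = dds (b # a # r) f" using IH[OF a(1) r(3)] wa r la by simp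
      moreover have "dds ls' f = dds (a # b # r) f" using IH[OF b(1) r(1)] wb r la by simp
      ultimately show ?thesis using Cons ls 4 dd_braid[of b "dds r f"] by simp
    qed
  qed
qed

lemma dds_zero [simp]: "dds ks 0 = 0"
  by (induction ks) auto

lemma dds_add: "dds ks (f + g) = dds ks f + dds ks g"
  by (induction ks) (auto simp: dd_add)

lemma dds_diff: "dds ks (f - g) = dds ks f - dds ks g"
  by (induction ks) (auto simp: dd_diff)

lemma dds_sum: "dds ks (sum g A) = (\<Sum>a\<in>A. dds ks (g a))"
  by (induction A rule: infinite_finite_induct) (auto simp: dds_add)

lemma dds_Const_mult: "dds ks (Const c * g) = Const c * dds ks g"
  by (induction ks) (auto simp: dd_Const_mult)

text \<open>The divided difference of a permutation; \<open>dds_unique\<close> makes the choice of the word immaterial.\<close>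

definition ddw :: "(nat \<Rightarrow> nat) \<Rightarrow> 'a::idom mpoly \<Rightarrow> 'a mpoly" where
  "ddw w = dds (SOME ks. redw ks \<and> word_perm ks = w)"

lemma ddw_word: "redw ks \<Longrightarrow> ddw (word_perm ks) f = dds ks f"
proof -
  assume ks: "redw ks"
  let ?ls = "SOME ls. redw ls \<and> word_perm ls = word_perm ks"
  have "redw ?ls \<and> word_perm ?ls = word_perm ks" 
    by (rule someI[of "\<lambda>ls. redw ls \<and> word_perm ls = word_perm ks" ks]) (simp add: ks)
  then show ?thesis unfolding ddw_def using dds_unique[of ?ls ks f] ks by blast
qed

lemma ddw_id: "ddw id f = f"
  using ddw_word[OF redw_Nil] by simp

lemma ddw_zero: "ddw w 0 = 0"
  by (simp add: ddw_def)

text \<open>The last letter of a reduced word acts first.\<close>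

lemma ddw_desc:
  assumes "w \<in> S_infty" "1 \<le> k" "w (Suc k) < w k"
  shows "ddw w f = ddw (w \<circ> simple_refl k) (divided_difference k f)"
proof -
  have w': "w \<circ> simple_refl k \<in> S_infty" using assms by (intro Sinf_comp Sinf_simple)
  obtain ks where ks: "redw ks" "word_perm ks = w \<circ> simple_refl k" using ex_redw[OF w'] by blast
  have r: "redw (ks @ [k])" by (rule redw_snoc) (use ks assms in auto)
  have "word_perm (ks @ [k]) = w" by (simp add: word_perm_append ks comp_assoc)
  then show ?thesis using ddw_word[OF r, of f] ddw_word[OF ks(1), of "divided_difference k f"] ks by simp
qed

lemma ddw_dd_asc:
  assumes "w \<in> S_infty" "1 \<le> k" "w k < w (Suc k)"
  shows "ddw w (divided_difference k f) = ddw (w \<circ> simple_refl k) f"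
proof -
  have "w \<circ> simple_refl k \<in> S_infty" using assms by (intro Sinf_comp Sinf_simple)
  then show ?thesis using ddw_desc[of "w \<circ> simple_refl k" k f] assms by (simp add: comp_assoc)
qed

lemma ddw_dd_desc:
  assumes "w \<in> S_infty" "1 \<le> k" "w (Suc k) < w k"
  shows "ddw w (divided_difference k f) = 0"
  by (simp add: ddw_desc[OF assms] dd_dd ddw_zero)


section \<open>Double Schubert polynomials\<close>

lemma longest_Sn: "longest_perm n \<in> Sn n"
proof -
  have "bij_betw (longest_perm n) {1..n} {1..n}"
    by (rule bij_betwI[where g = "longest_perm n"]) (auto simp: longest_perm_def)
  then show ?thesis unfolding Sn_def by (auto intro: bij_imp_permutes simp: longest_perm_def)
qed

lemma longest_invol [simp]: "longest_perm n (longest_perm n i) = i"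
  by (auto simp: longest_perm_def)

lemma inv_longest [simp]: "inv (longest_perm n) = longest_perm n"
  by (rule inv_unique_comp) (auto simp: fun_eq_iff)

definition box_prod :: "(nat \<times> nat) set \<Rightarrow> int mpoly mpoly" where
  "box_prod S = (\<Prod>(i, j)\<in>S. x_var i - Const (t_var j))"

definition staircase :: "nat \<Rightarrow> (nat \<times> nat) set" where
  "staircase n = {(i, j). 1 \<le> i \<and> 1 \<le> j \<and> i + j \<le> n}"

lemma finite_staircase: "finite (staircase n)"
  by (rule finite_subset[of _ "{1..n} \<times> {1..n}"]) (auto simp: staircase_def)

abbreviation top_poly :: "nat \<Rightarrow> int mpoly mpoly" where
  "top_poly n \<equiv> box_prod (staircase n)"

lemma top_poly_eq: "top_poly n = (\<Prod>(i, j) \<in> {(i, j). 1 \<le> i \<and> 1 \<le> j \<and> i + j \<le> n}. x_var i - Const (t_var j))"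
  by (simp add: box_prod_def staircase_def)

lemma schubert_Sn: "schubert_rel n w f \<Longrightarrow> w \<in> Sn n"
  by (induction rule: schubert_rel.induct) (auto simp: longest_Sn)

lemma Sn_le: "w \<in> Sn n \<Longrightarrow> 1 \<le> i \<Longrightarrow> i \<le> n \<Longrightarrow> 1 \<le> w i \<and> w i \<le> n"
  using permutes_in_image[of w "{1..n}" i] by (auto simp: Sn_def)

lemma Sn_Sinf: "w \<in> Sn n \<Longrightarrow> w \<in> S_infty"
  by (auto simp: S_infty_def)

lemma perm_length_asc:
  assumes "w \<in> S_infty" "1 \<le> k"
  shows "perm_length (w \<circ> simple_refl k) = perm_length w + 1 \<longleftrightarrow> w k < w (Suc k)"
proof -
  have "perm_length (w \<circ> simple_refl k) = ninv (w \<circ> simple_refl k)" "perm_length w = ninv w"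
    by (rule perm_length_eq, intro Sinf_comp Sinf_simple assms)+
  then show ?thesis
    using asc_or_desc[OF assms(1), of k] ninv_asc[OF assms] ninv_desc[OF assms] by linarith
qed

lemma schubert_descend:
  assumes "w \<in> Sn n" "1 \<le> k" "k < n" "w k < w (Suc k)" "schubert_rel n (w \<circ> simple_refl k) f"
  shows "schubert_rel n w (divided_difference k f)"
  using assms perm_length_asc[OF Sn_Sinf[OF assms(1)] assms(2)] by (intro schubert_rel.descend) auto

lemma schubert_induct [consumes 1, case_names longest descend]:
  assumes "schubert_rel n w f"
    "P (longest_perm n) (top_poly n)"
    "\<And>w k f. \<lbrakk>w \<in> Sn n; 1 \<le> k; k < n; w (Suc k) < w k; schubert_rel n w f; P w f\<rbrakk>
      \<Longrightarrow> P (w \<circ> simple_refl k) (divided_difference k f)"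
  shows "P w f"
  using assms(1)
proof (induction rule: schubert_rel.induct)
  case longest
  then show ?case using assms(2) by (simp add: top_poly_eq)
next
  case (descend w k f)
  let ?w = "w \<circ> simple_refl k"
  have "w k < w (Suc k)" using descend perm_length_asc[OF Sn_Sinf] by auto
  then have "P (?w \<circ> simple_refl k) (divided_difference k f)"
    by (intro assms(3) descend.IH descend.hyps schubert_Sn[OF descend.hyps(5)]) auto
  then show ?case by (simp add: comp_assoc)
qed

text \<open>The chains of divided differences from the top polynomial are the reduced words of a permutation
  determined by \<open>w\<close>, so by \<open>dds_unique\<close> the polynomial does not depend on the chain.\<close>

lemma schubert_word:
  "schubert_rel n w f \<Longrightarrow> \<exists>ks. redw ks \<and> word_perm ks = inv w \<circ> longest_perm n \<and> f = dds ks (top_poly n)"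
proof (induction rule: schubert_induct)
  case longest
  then show ?case by (intro exI[of _ "[]"]) (auto simp: redw_Nil fun_eq_iff)
next
  case (descend w k f)
  then obtain ks where ks: "redw ks" "word_perm ks = inv w \<circ> longest_perm n" "f = dds ks (top_poly n)"
    by blast
  have w: "w \<in> S_infty" using descend Sn_Sinf by auto
  have "inv (word_perm ks) = longest_perm n \<circ> w"
    unfolding ks(2) using inv_comp[OF Sinf_inv[OF w] Sn_Sinf[OF longest_Sn]] Sinf_inv_simps[OF w] by simp
  moreover have "longest_perm n (w k) < longest_perm n (w (Suc k))"
    using descend Sn_le[OF descend(1), of k] Sn_le[OF descend(1), of "Suc k"]
    by (simp add: longest_perm_def)
  ultimately have "redw (k # ks)" using descend ks by (intro redw_Cons) auto
  moreover have "word_perm (k # ks) = inv (w \<circ> simple_refl k) \<circ> longest_perm n"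
    by (simp add: ks(2) inv_comp_simple[OF w] comp_assoc)
  moreover have "divided_difference k f = dds (k # ks) (top_poly n)" by (simp add: ks(3))
  ultimately show ?case by blast
qed

lemma schubert_unique: "schubert_rel n w f \<Longrightarrow> schubert_rel n w g \<Longrightarrow> f = g"
  using schubert_word[of n w f] schubert_word[of n w g] dds_unique by metis

lemma schubert_ex: "w \<in> Sn n \<Longrightarrow> \<exists>f. schubert_rel n w f"
proof (induction "ninv (longest_perm n \<circ> w)" arbitrary: w rule: less_induct)
  case less
  let ?L = "longest_perm n"
  show ?case
  proof (cases "?L \<circ> w = id")
    case True
    then have "w = ?L" by (metis comp_id inv_longest longest_Sn Sn_Sinf Sinf_inv_simps(4) comp_assoc id_comp)
    then show ?thesis using schubert_rel.longest by blast
  next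
    case False
    have Lw: "?L \<circ> w \<in> Sn n" using less.prems longest_Sn by (intro Sn_comp)
    obtain k where k: "1 \<le> k" "k < n" "(?L \<circ> w) (Suc k) < (?L \<circ> w) k"
      using ex_desc[OF Lw False] by blast
    have asc: "w k < w (Suc k)"
      using k Sn_le[OF less.prems, of k] Sn_le[OF less.prems, of "Suc k"]
      by (auto simp: longest_perm_def split: if_splits)
    have "ninv (?L \<circ> w \<circ> simple_refl k) < ninv (?L \<circ> w)"
      using ninv_desc[OF Sn_Sinf[OF Lw] k(1,3)] by linarith
    moreover have "w \<circ> simple_refl k \<in> Sn n" using less.prems k by (intro Sn_comp simple_refl_Sn)
    ultimately obtain f where "schubert_rel n (w \<circ> simple_refl k) f"
      using less.hyps by (metis comp_assoc)
    then show ?thesis using schubert_descend[OF less.prems k(1,2) asc] by blast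
  qed
qed

lemma box_prod_insert:
  "finite S \<Longrightarrow> (i, j) \<notin> S \<Longrightarrow> box_prod (insert (i, j) S) = (x_var i - Const (t_var j)) * box_prod S"
  by (simp add: box_prod_def)

lemma swap_box_prod: "swap_vars k (box_prod S) = box_prod (map_prod (simple_refl k) id ` S)"
proof -
  have "inj_on (map_prod (simple_refl k) id) S" by (auto intro!: inj_onI)
  then show ?thesis
    unfolding box_prod_def
    by (simp add: comm_ring_hom'.hom_simps[OF swap_vars_hom] prod.reindex case_prod_unfold)
qed

text \<open>The box \<open>(k, j)\<close> is removed by the divided difference as the remaining boxes are invariant under
  exchanging the rows \<open>k\<close> and \<open>k + 1\<close>.\<close>

lemma dd_box_prod:
  assumes "finite S" "(k, j) \<notin> S" "\<And>i j. (i, j) \<in> S \<Longrightarrow> (simple_refl k i, j) \<in> S"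
  shows "divided_difference k (box_prod (insert (k, j) S)) = box_prod S"
proof -
  have "map_prod (simple_refl k) id ` S = S"
  proof (intro equalityI subsetI)
    fix x assume "x \<in> S"
    then have "(simple_refl k (fst x), snd x) \<in> S" using assms(3)[of "fst x" "snd x"] by simp
    moreover have "x = map_prod (simple_refl k) id (simple_refl k (fst x), snd x)" by (cases x) simp
    ultimately show "x \<in> map_prod (simple_refl k) id ` S" by blast
  qed (use assms(3) in auto)
  then have "swap_vars k (box_prod S) = box_prod S" by (simp add: swap_box_prod)
  then have "divided_difference k (box_prod S * (x_var k - Const (t_var j))) = box_prod S"
    by (simp add: dd_mult_sym dd_diff dd_Var dd_sym)
  then show ?thesis by (simp add: box_prod_insert assms mult.commute)
qed

text \<open>The permutations \<open>N, \<dots>, m+1, r, \<dots>, 1, r+1, \<dots>, m\<close> with \<open>N = q + m\<close>: their double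
  Schubert polynomials are products. For \<open>q = 0\<close> this is the stability of the top polynomial.\<close>

definition stair_perm :: "nat \<Rightarrow> nat \<Rightarrow> nat \<Rightarrow> nat \<Rightarrow> nat" where
  "stair_perm q m r i = (if i \<in> {1..q} then q + m + 1 - i else if i \<in> {q+1..q+r} then q + r + 1 - i
     else if i \<in> {q+r+1..q+m} then i - q else i)"

definition stair_boxes :: "nat \<Rightarrow> nat \<Rightarrow> nat \<Rightarrow> (nat \<times> nat) set" where
  "stair_boxes q m r = {(i, j). 1 \<le> i \<and> i \<le> q \<and> 1 \<le> j \<and> i + j \<le> q + m} \<union>
     {(i, j). q < i \<and> 1 \<le> j \<and> i + j \<le> q + r}"

text \<open>Passing from \<open>r + 1\<close> to \<open>r\<close> removes one antidiagonal of boxes by one divided difference for each box;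
  \<open>c\<close> measures how many rows of the antidiagonal have been treated.\<close>

lemma stair_perm_step:
  assumes "c \<le> r" "Suc r \<le> m"
    "schubert_rel (q + m) (stair_perm q m (Suc r)) (box_prod (stair_boxes q m (Suc r)))"
  shows "schubert_rel (q + m)
    (\<lambda>i. if i \<in> {q+1..q+c} then q + r + 1 - i else if i = q + c + 1 then r + 1 else stair_perm q m (Suc r) i)
    (box_prod (stair_boxes q m r \<union> {(i, j). q + c < i \<and> 1 \<le> j \<and> i + j = q + r + 1}))"
  using assms(1)
proof (induction c)
  case 0
  have "(\<lambda>i. if i \<in> {q+1..q+0} then q + r + 1 - i else if i = q + 0 + 1 then r + 1
      else stair_perm q m (Suc r) i) = stair_perm q m (Suc r)"
    by (auto simp: fun_eq_iff stair_perm_def)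
  moreover have "stair_boxes q m r \<union> {(i, j). q + 0 < i \<and> 1 \<le> j \<and> i + j = q + r + 1} = stair_boxes q m (Suc r)"
    by (auto simp: stair_boxes_def)
  ultimately show ?case using assms by simp
next
  case (Suc c)
  let ?W = "\<lambda>c i. if i \<in> {q+1..q+c} then q + r + 1 - i else if i = q + c + 1 then r + 1
      else stair_perm q m (Suc r) i"
  let ?B = "\<lambda>c. stair_boxes q m r \<union> {(i, j). q + c < i \<and> 1 \<le> j \<and> i + j = q + r + 1}"
  let ?k = "q + c + 1"
  have IH: "schubert_rel (q + m) (?W c) (box_prod (?B c))" using Suc by simp
  have W: "?W (Suc c) = ?W c \<circ> simple_refl ?k"
  proof
    fix i
    consider "i = ?k" | "i = Suc ?k" | "i \<noteq> ?k" "i \<noteq> Suc ?k" by blast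
    then show "?W (Suc c) i = (?W c \<circ> simple_refl ?k) i"
      by cases (use Suc.prems assms(2) in \<open>auto simp: stair_perm_def\<close>)
  qed
  have B: "?B c = insert (?k, r - c) (?B (Suc c))"
    using Suc.prems by (auto simp: stair_boxes_def)
  have fin: "finite (?B (Suc c))"
    by (rule finite_subset[of _ "{..q + m + q + r + 1} \<times> {..q + m + q + r + 1}"]) (auto simp: stair_boxes_def)
  have "schubert_rel (q + m) (?W c \<circ> simple_refl ?k \<circ> simple_refl ?k) (box_prod (?B c))"
    using IH by (simp add: comp_assoc)
  moreover have "?W c \<circ> simple_refl ?k \<in> Sn (q + m)"
    using schubert_Sn[OF IH] Suc.prems assms(2) by (intro Sn_comp simple_refl_Sn) auto
  moreover have "(?W c \<circ> simple_refl ?k) ?k < (?W c \<circ> simple_refl ?k) (Suc ?k)"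
    using Suc.prems assms(2) by (auto simp: stair_perm_def)
  ultimately have "schubert_rel (q + m) (?W c \<circ> simple_refl ?k) (divided_difference ?k (box_prod (?B c)))"
    using Suc.prems assms(2) by (intro schubert_descend) auto
  moreover have "divided_difference ?k (box_prod (?B c)) = box_prod (?B (Suc c))"
    unfolding B
  proof (rule dd_box_prod[OF fin])
    show "(?k, r - c) \<notin> ?B (Suc c)" using Suc.prems by (auto simp: stair_boxes_def)
  next
    fix i j assume "(i, j) \<in> ?B (Suc c)"
    then show "(simple_refl ?k i, j) \<in> ?B (Suc c)"
      by (auto simp: stair_boxes_def simple_refl_def' split: if_splits)
  qed
  ultimately show ?case using W by simp
qed


lemma stair_perm_schubert:
  "r \<le> m \<Longrightarrow> schubert_rel (q + m) (stair_perm q m r) (box_prod (stair_boxes q m r))"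
proof (induction r rule: inc_induct)
  case base
  have "stair_perm q m m = longest_perm (q + m)"
    by (auto simp: fun_eq_iff stair_perm_def longest_perm_def)
  moreover have "stair_boxes q m m = staircase (q + m)"
    by (auto simp: stair_boxes_def staircase_def)
  ultimately show ?case using schubert_rel.longest[of "q + m"] by (simp add: top_poly_eq)
next
  case (step r)
  have "schubert_rel (q + m)
    (\<lambda>i. if i \<in> {q+1..q+r} then q + r + 1 - i else if i = q + r + 1 then r + 1 else stair_perm q m (Suc r) i)
    (box_prod (stair_boxes q m r \<union> {(i, j). q + r < i \<and> 1 \<le> j \<and> i + j = q + r + 1}))"
    using step by (intro stair_perm_step) auto
  moreover have "(\<lambda>i. if i \<in> {q+1..q+r} then q + r + 1 - i else if i = q + r + 1 then r + 1
      else stair_perm q m (Suc r) i) = stair_perm q m r"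
    using step by (auto simp: fun_eq_iff stair_perm_def)
  moreover have "stair_boxes q m r \<union> {(i, j). q + r < i \<and> 1 \<le> j \<and> i + j = q + r + 1} = stair_boxes q m r"
    by (auto simp: stair_boxes_def)
  ultimately show ?case by simp
qed

text \<open>It suffices to reach the product for \<open>w\<^sub>0\<close> in \<open>S\<^sub>r\<close> from that in \<open>S\<^sub>n\<close>; the rest of the chain is the
  same. This is stability.\<close>

lemma schubert_mono:
  assumes "schubert_rel r w f" "r \<le> n"
  shows "schubert_rel n w f"
  using assms(1)
proof (induction rule: schubert_induct)
  case longest
  have "stair_perm 0 n r = longest_perm r"
    using assms(2) by (auto simp: fun_eq_iff stair_perm_def longest_perm_def)
  moreover have "stair_boxes 0 n r = staircase r"
    by (auto simp: stair_boxes_def staircase_def)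
  ultimately show ?case using stair_perm_schubert[OF assms(2), of 0] by simp
next
  case (descend w k f)
  have ss: "w \<circ> simple_refl k \<circ> simple_refl k = w" by (simp add: comp_assoc)
  have "w \<circ> simple_refl k \<in> Sn n"
    using descend assms(2) Sn_mono[of r n] by (intro Sn_comp simple_refl_Sn) auto
  moreover have "k < n" "(w \<circ> simple_refl k) k < (w \<circ> simple_refl k) (Suc k)"
    using descend assms(2) by auto
  moreover have "schubert_rel n (w \<circ> simple_refl k \<circ> simple_refl k) f" unfolding ss by fact
  ultimately show ?case using descend(2) by (intro schubert_descend)
qed

lemma double_schubert_eq: "schubert_rel n w f \<Longrightarrow> double_schubert w = f"
  unfolding double_schubert_def
proof (rule the_equality)
  fix g assume f: "schubert_rel n w f" and "\<exists>m. schubert_rel m w g"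
  then obtain m where "schubert_rel m w g" by blast
  then have "schubert_rel (max m n) w g" by (rule schubert_mono) simp
  moreover have "schubert_rel (max m n) w f" by (rule schubert_mono[OF f]) simp
  ultimately show "g = f" by (rule schubert_unique)
qed blast

lemma double_schubert_rel: "w \<in> Sn n \<Longrightarrow> schubert_rel n w (double_schubert w)"
  using schubert_ex double_schubert_eq by blast

lemma double_schubert_id: "double_schubert id = 1"
proof -
  have "stair_perm 0 0 0 = id" "stair_boxes 0 0 0 = {}" by (auto simp: stair_perm_def stair_boxes_def fun_eq_iff)
  then have "schubert_rel 0 id 1"
    using stair_perm_schubert[of 0 0 0] by (simp add: box_prod_def)
  then show ?thesis by (rule double_schubert_eq)
qed

lemma double_schubert_dominant:
  "double_schubert (stair_perm q m 0)
     = box_prod {(i, j). 1 \<le> i \<and> i \<le> q \<and> 1 \<le> j \<and> i + j \<le> q + m}"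
proof -
  have "stair_boxes q m 0 = {(i, j). 1 \<le> i \<and> i \<le> q \<and> 1 \<le> j \<and> i + j \<le> q + m}"
    by (auto simp: stair_boxes_def)
  then show ?thesis using double_schubert_eq[OF stair_perm_schubert[of 0 m q]] by simp
qed

lemma dd_double_schubert:
  assumes "w \<in> S_infty" "1 \<le> k"
  shows "divided_difference k (double_schubert w) =
    (if w (Suc k) < w k then double_schubert (w \<circ> simple_refl k) else 0)"
proof -
  obtain r where "w \<in> Sn r" using assms by (auto simp: S_infty_def)
  then have w: "w \<in> Sn (max r (Suc k))" using Sn_mono[of r "max r (Suc k)"] by auto
  let ?n = "max r (Suc k)"
  have k: "1 \<le> k" "k < ?n" using assms by auto
  have ws: "w \<circ> simple_refl k \<in> Sn ?n" by (rule Sn_comp[OF w simple_refl_Sn[OF k]])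
  have ss: "w \<circ> simple_refl k \<circ> simple_refl k = w" by (simp add: comp_assoc)
  show ?thesis
  proof (cases "w (Suc k) < w k")
    case True
    have "schubert_rel ?n (w \<circ> simple_refl k) (divided_difference k (double_schubert w))"
      using True double_schubert_rel[OF w] ss by (intro schubert_descend[OF ws k]) auto
    then show ?thesis using True double_schubert_eq by auto
  next
    case False
    then have asc: "w k < w (Suc k)" using asc_or_desc[OF assms(1), of k] by blast
    have "schubert_rel ?n w (divided_difference k (double_schubert (w \<circ> simple_refl k)))"
      by (rule schubert_descend[OF w k asc double_schubert_rel[OF ws]])
    then have "double_schubert w = divided_difference k (double_schubert (w \<circ> simple_refl k))"
      by (rule double_schubert_eq)
    then show ?thesis using False by (simp add: dd_dd)
  qed
qed

lemma tswap_box_prod: "tswap k (box_prod S) = box_prod (map_prod id (simple_refl k) ` S)"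
proof -
  have "inj_on (map_prod id (simple_refl k)) S" by (auto intro!: inj_onI)
  then show ?thesis
    unfolding box_prod_def
    by (simp add: comm_ring_hom'.hom_simps[OF tswap_hom] prod.reindex case_prod_unfold)
qed

text \<open>In the parameters, a divided difference removes a left factor of the permutation. It commutes
  with the divided differences in \<open>x\<close>, so the statement descends from the top polynomial, where
  the parameters \<open>k\<close>, \<open>k + 1\<close> correspond to the rows \<open>n - k\<close>, \<open>n - k + 1\<close> of the staircase.\<close>

lemma schubert_left:
  assumes "schubert_rel n w f" "1 \<le> k" "k < n"
  shows "f - tswap k f =
    Const (t_var (Suc k) - t_var k) * (if inv w (Suc k) < inv w k then double_schubert (simple_refl k \<circ> w) else 0)"
  using assms(1)
proof (induction rule: schubert_induct)
  case longest
  let ?L = "longest_perm n"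
  define l where "l = n - k"
  have l: "1 \<le> l" "l < n" "l + k = n" using assms by (auto simp: l_def)
  define S where "S = staircase n - {(l, k)}"
  have top: "staircase n = insert (l, k) S" using l assms by (auto simp: S_def staircase_def)
  have S: "finite S" "(l, k) \<notin> S" using finite_staircase by (auto simp: S_def)
  have dd: "divided_difference l (top_poly n) = box_prod S"
    unfolding top
  proof (rule dd_box_prod[OF S])
    fix i j assume "(i, j) \<in> S"
    then show "(simple_refl l i, j) \<in> S"
      using l by (auto simp: S_def staircase_def simple_refl_def' split: if_splits)
  qed
  have "map_prod id (simple_refl k) ` S = S"
  proof -
    have *: "(i, simple_refl k j) \<in> S" if "(i, j) \<in> S" for i j
      using that l assms by (auto simp: S_def staircase_def simple_refl_def' split: if_splits)
    show ?thesis
    proof (intro equalityI subsetI)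
      fix x assume "x \<in> S"
      then have "(fst x, simple_refl k (snd x)) \<in> S" using *[of "fst x" "snd x"] by simp
      moreover have "x = map_prod id (simple_refl k) (fst x, simple_refl k (snd x))" by (cases x) simp
      ultimately show "x \<in> map_prod id (simple_refl k) ` S" by blast
    qed (use * in auto)
  qed
  then have tS: "tswap k (box_prod S) = box_prod S" by (simp add: tswap_box_prod)
  have "simple_refl k \<circ> ?L = ?L \<circ> simple_refl l"
  proof
    fix i
    consider "i = l" | "i = Suc l" | "i \<noteq> l" "i \<noteq> Suc l" "i \<in> {1..n}" | "i \<notin> {1..n}" by blast
    then show "(simple_refl k \<circ> ?L) i = (?L \<circ> simple_refl l) i"
    proof cases
      case 3
      then have "n + 1 - i \<noteq> k" "n + 1 - i \<noteq> Suc k" using l by auto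
      then show ?thesis using 3 by (simp add: longest_perm_def)
    next
      case 4
      then have "i \<noteq> l" "i \<noteq> Suc l" "i \<noteq> k" "i \<noteq> Suc k" using l assms by auto
      moreover have "?L i = i" using 4 by (auto simp: longest_perm_def)
      ultimately show ?thesis by simp
    qed (use l assms in \<open>auto simp: longest_perm_def\<close>)
  qed
  moreover have "double_schubert (?L \<circ> simple_refl l) = box_prod S"
  proof -
    have "double_schubert ?L = top_poly n"
      using double_schubert_eq[OF schubert_rel.longest] by (simp add: top_poly_eq)
    moreover have "?L (Suc l) < ?L l" using l by (simp add: longest_perm_def)
    ultimately show ?thesis
      using dd_double_schubert[OF Sn_Sinf[OF longest_Sn] l(1), of n] dd by simp
  qed
  moreover have "inv ?L (Suc k) < inv ?L k" using assms by (simp add: longest_perm_def)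
  moreover have "top_poly n - tswap k (top_poly n) = Const (t_var (Suc k) - t_var k) * box_prod S"
    unfolding top box_prod_insert[OF S]
    by (simp add: comm_ring_hom'.hom_simps[OF tswap_hom] comm_ring_hom'.hom_simps[OF swap_vars_hom]
        comm_ring_hom'.hom_simps[OF Const_hom] tS algebra_simps)
  ultimately show ?case by simp
next
  case (descend w j f)
  let ?c = "Const (t_var (Suc k) - t_var k)" and ?s = "simple_refl j" and ?t = "simple_refl k"
  have w: "w \<in> S_infty" by (rule Sn_Sinf[OF descend(1)])
  have tw: "?t \<circ> w \<in> S_infty" by (rule Sinf_comp[OF Sinf_simple[OF assms(2)] w])
  define a b where "a = inv w k" and "b = inv w (Suc k)"
  have wab: "w a = k" "w b = Suc k" by (simp_all add: a_def b_def Sinf_inv_simps[OF w])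
  have iw: "inv (w \<circ> ?s) k = ?s a" "inv (w \<circ> ?s) (Suc k) = ?s b"
    by (simp_all add: inv_comp_simple[OF w] a_def b_def)
  have "divided_difference j f - tswap k (divided_difference j f) = divided_difference j (f - tswap k f)"
    by (simp add: tswap_dd dd_diff)
  also have "\<dots> = ?c * (if b < a then divided_difference j (double_schubert (?t \<circ> w)) else 0)"
    unfolding descend.IH a_def b_def by (simp add: dd_Const_mult)
  also have "(if b < a then divided_difference j (double_schubert (?t \<circ> w)) else 0)
    = (if ?s b < ?s a then double_schubert (?t \<circ> (w \<circ> ?s)) else 0)"
  proof (cases "a = Suc j \<and> b = j")
    case True
    then show ?thesis
      using wab dd_double_schubert[OF tw descend(2)] by auto
  next
    case False
    have "\<not> (a = j \<and> b = Suc j)" using wab descend(4) by auto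
    then have "?s b < ?s a \<longleftrightarrow> b < a" using False by (auto simp: simple_refl_def')
    moreover have "(?t \<circ> w) (Suc j) < (?t \<circ> w) j"
    proof -
      have "\<not> (w j = Suc k \<and> w (Suc j) = k)"
        using False wab Sinf_eq_iff[OF w] by metis
      then show ?thesis using descend(4) by (auto simp: simple_refl_def')
    qed
    ultimately show ?thesis using dd_double_schubert[OF tw descend(2)] by (simp add: comp_assoc)
  qed
  finally show ?case unfolding iw .
qed

lemmas double_schubert_left = schubert_left[OF double_schubert_rel]

text \<open>Vanishing: the localization of a double Schubert polynomial at a permutation vanishes
  unless the permutation dominates it in the Bruhat order, given by rank numbers.\<close>

definition rk :: "(nat \<Rightarrow> nat) \<Rightarrow> nat \<Rightarrow> nat \<Rightarrow> nat" where
  "rk w i j = card {a \<in> {1..i}. w a \<le> j}"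

lemma rk_Suc: "rk w (Suc i) j = rk w i j + (if w (Suc i) \<le> j then 1 else 0)"
proof -
  have "{a \<in> {1..Suc i}. w a \<le> j} = {a \<in> {1..i}. w a \<le> j} \<union> (if w (Suc i) \<le> j then {Suc i} else {})"
    by (auto simp: le_Suc_eq)
  then show ?thesis unfolding rk_def by (auto simp: card_insert_if)
qed

lemma rk_swap: "i \<noteq> k \<Longrightarrow> 1 \<le> k \<Longrightarrow> rk (w \<circ> simple_refl k) i j = rk w i j"
proof -
  assume "i \<noteq> k" "1 \<le> k"
  then have "bij_betw (simple_refl k) {a \<in> {1..i}. (w \<circ> simple_refl k) a \<le> j} {a \<in> {1..i}. w a \<le> j}"
    by (intro bij_betwI[where g = "simple_refl k"]) (auto simp: simple_refl_def' split: if_splits)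
  then show ?thesis unfolding rk_def by (rule bij_betw_same_card)
qed

lemma schubert_vanish:
  assumes "schubert_rel n w f" "\<sigma> \<in> S_infty" "i \<le> n" "rk w i j < rk \<sigma> i j"
  shows "loc \<sigma> f = 0"
  using assms
proof (induction arbitrary: \<sigma> i rule: schubert_induct)
  case (longest \<sigma> i)
  show ?case
  proof (rule ccontr)
    assume ne: "loc \<sigma> (top_poly n) \<noteq> 0"
    have nz: "\<sigma> a \<noteq> b" if "1 \<le> a" "1 \<le> b" "a + b \<le> n" for a b
    proof
      assume "\<sigma> a = b"
      then have "(\<Prod>(i, j)\<in>staircase n. t_var (\<sigma> i) - t_var j) = 0"
        using that finite_staircase by (auto simp: prod_zero_iff staircase_def intro!: bexI[of _ "(a, b)"])
      then show False using ne
        by (simp add: box_prod_def comm_ring_hom'.hom_simps[OF loc_hom] case_prod_unfold)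
    qed
    have "{a \<in> {1..i}. \<sigma> a \<le> j} \<subseteq> {a \<in> {1..i}. longest_perm n a \<le> j}"
    proof
      fix a assume "a \<in> {a \<in> {1..i}. \<sigma> a \<le> j}"
      then have a: "a \<in> {1..i}" "\<sigma> a \<le> j" by auto
      have "1 \<le> \<sigma> a" using a Sinf_pos[OF longest(1)] by auto
      then have "n < a + \<sigma> a" using nz[of a "\<sigma> a"] a by force
      then show "a \<in> {a \<in> {1..i}. longest_perm n a \<le> j}"
        using a longest by (auto simp: longest_perm_def)
    qed
    then have "rk \<sigma> i j \<le> rk (longest_perm n) i j" unfolding rk_def by (intro card_mono) auto
    then show False using longest by simp
  qed
next
  case (descend w k f \<sigma> i)
  let ?s = "simple_refl k"
  have w: "w \<in> S_infty" by (rule Sn_Sinf[OF descend(1)])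
  have le: "rk w i' j \<le> rk (w \<circ> ?s) i' j" for i'
  proof (cases "i' = k")
    case True
    obtain k' where k': "k = Suc k'" using descend(2) by (cases k) auto
    have "rk (w \<circ> ?s) k' j = rk w k' j" using descend(2) k' by (intro rk_swap) auto
    then show ?thesis using True k' descend(4) rk_Suc[of w k' j] rk_Suc[of "w \<circ> ?s" k' j] by auto
  qed (use rk_swap[OF _ descend(2)] in simp)
  have 1: "loc \<sigma> f = 0"
    using descend.IH[OF descend.prems(1,2)] descend.prems(3) le[of i] by simp
  have s\<sigma>: "\<sigma> \<circ> ?s \<in> S_infty" using descend by (intro Sinf_comp Sinf_simple)
  have 2: "loc (\<sigma> \<circ> ?s) f = 0"
  proof (rule ccontr)
    assume ne: "loc (\<sigma> \<circ> ?s) f \<noteq> 0"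
    have IH: "rk (\<sigma> \<circ> ?s) i' j \<le> rk w i' j" if "i' \<le> n" for i'
      using descend.IH[OF s\<sigma> that] ne not_le by blast
    obtain k' where k': "k = Suc k'" using descend(2) by (cases k) auto
    have ik: "i = k"
    proof (rule ccontr)
      assume "i \<noteq> k"
      then have "rk (\<sigma> \<circ> ?s) i j = rk \<sigma> i j" "rk (w \<circ> ?s) i j = rk w i j"
        using descend(2) rk_swap by auto
      then show False using IH[of i] descend.prems by simp
    qed
    have a: "rk (w \<circ> ?s) k j < rk \<sigma> k j" using descend.prems(3) unfolding ik .
    have b: "rk \<sigma> k' j \<le> rk w k' j" "rk \<sigma> (Suc k) j \<le> rk w (Suc k) j"
      using IH[of k'] IH[of "Suc k"] descend(2,3) k' rk_swap[of k' k \<sigma> j] rk_swap[of "Suc k" k \<sigma> j] by auto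
    have c: "rk (w \<circ> ?s) k' j = rk w k' j" "rk (w \<circ> ?s) (Suc k) j = rk w (Suc k) j"
      using k' descend(2) by (auto intro!: rk_swap)
    have "rk \<sigma> k j = rk \<sigma> k' j + (if \<sigma> k \<le> j then 1 else 0)"
      "rk (w \<circ> ?s) k j = rk w k' j + (if w (Suc k) \<le> j then 1 else 0)"
      "rk \<sigma> (Suc k) j = rk \<sigma> k j + (if \<sigma> (Suc k) \<le> j then 1 else 0)"
      "rk w (Suc k) j = rk (w \<circ> ?s) k j + (if w k \<le> j then 1 else 0)"
      using rk_Suc[of \<sigma> k' j] rk_Suc[of "w \<circ> ?s" k' j] rk_Suc[of \<sigma> k j] rk_Suc[of "w \<circ> ?s" k j] k' c
      by auto
    then show False using a b descend(4) by (auto split: if_splits)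
  qed
  have "(t_var (\<sigma> k) - t_var (\<sigma> (Suc k))) * loc \<sigma> (divided_difference k f) = 0"
    unfolding loc_dd 1 2 by simp
  moreover have "\<sigma> k \<noteq> \<sigma> (Suc k)" using Sinf_eq_iff[OF descend.prems(1)] by simp
  ultimately show ?case by simp
qed

text \<open>At the smallest \<open>i\<close> moved by \<open>w\<close> the rank numbers of \<open>w\<close> and of the identity differ, so the vanishing
  criterion applies.\<close>

lemma loc_id_double_schubert:
  assumes "w \<in> S_infty"
  shows "loc id (double_schubert w) = (if w = id then 1 else 0)"
proof (cases "w = id")
  case True
  then show ?thesis by (simp add: double_schubert_id comm_ring_hom'.hom_one[OF loc_hom])
next
  case False
  obtain n where w: "w \<in> Sn n" using assms by (auto simp: S_infty_def)
  have "\<exists>i. w i \<noteq> i" using False by (auto simp: fun_eq_iff)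
  define i where "i = (LEAST i. w i \<noteq> i)"
  have i: "w i \<noteq> i" "\<And>a. a < i \<Longrightarrow> w a = a"
    using LeastI_ex[OF \<open>\<exists>i. w i \<noteq> i\<close>] not_less_Least unfolding i_def by blast+
  have i1: "1 \<le> i" "i \<le> n" using i(1) w by (auto simp: Sn_def permutes_def Suc_le_eq intro: Nat.gr0I)
  have "i < w i" using i Sinf_eq_iff[OF assms, of i "w i"] by (metis linorder_neqE_nat)
  then have "{a \<in> {1..i}. w a \<le> i} \<subseteq> {1..i} - {i}" by auto
  then have "rk w i i \<le> card ({1..i} - {i})" unfolding rk_def by (intro card_mono) auto
  moreover have "rk id i i = i"
  proof -
    have "{a \<in> {1..i}. id a \<le> i} = {1..i}" by auto
    then show ?thesis by (simp add: rk_def)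
  qed
  ultimately have "rk w i i < rk id i i" using i1 by simp
  then show ?thesis using False schubert_vanish[OF double_schubert_rel[OF w] Sinf_id i1(2)] by simp
qed


section \<open>Structure constants\<close>

lemma ddw_sum: "ddw w (sum g A) = (\<Sum>a\<in>A. ddw w (g a))"
  by (simp add: ddw_def dds_sum)

lemma ddw_diff: "ddw w (f - g) = ddw w f - ddw w g"
  by (simp add: ddw_def dds_diff)

lemma ddw_Const_mult: "ddw w (Const c * g) = Const c * ddw w g"
  by (simp add: ddw_def dds_Const_mult)

text \<open>Duality of double Schubert polynomials and divided differences.\<close>

lemma loc_ddw_double_schubert:
  assumes "w \<in> S_infty" "w' \<in> S_infty"
  shows "loc id (ddw w (double_schubert w')) = (if w = w' then 1 else 0)"
  using assms
proof (induction "ninv w" arbitrary: w w' rule: less_induct)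
  case less
  show ?case
  proof (cases "w = id")
    case True
    then show ?thesis using loc_id_double_schubert[OF less.prems(2)] by (auto simp: ddw_id)
  next
    case False
    obtain n where "w \<in> Sn n" using less.prems by (auto simp: S_infty_def)
    then obtain k where k: "1 \<le> k" "w (Suc k) < w k" using ex_desc False by metis
    let ?s = "simple_refl k"
    have ws: "w \<circ> ?s \<in> S_infty" "w' \<circ> ?s \<in> S_infty"
      using less.prems k(1) by (auto intro!: Sinf_comp Sinf_simple)
    have lt: "ninv (w \<circ> ?s) < ninv w" using ninv_desc[OF less.prems(1) k] by linarith
    have eq: "loc id (ddw w (double_schubert w'))
        = loc id (ddw (w \<circ> ?s) (if w' (Suc k) < w' k then double_schubert (w' \<circ> ?s) else 0))"
      unfolding ddw_desc[OF less.prems(1) k] dd_double_schubert[OF less.prems(2) k(1)] ..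
    have iff: "w \<circ> ?s = w' \<circ> ?s \<longleftrightarrow> w = w'"
      by (metis comp_assoc comp_id simple_simple)
    show ?thesis
    proof (cases "w' (Suc k) < w' k")
      case True
      then show ?thesis using eq less.hyps[OF lt ws] iff by simp
    next
      case False
      then have "w \<noteq> w'" using k by auto
      then show ?thesis using eq False by (simp add: ddw_zero comm_ring_hom'.hom_zero[OF loc_hom])
    qed
  qed
qed

text \<open>Each divided difference lowers the degree, and only finitely many of them are nonzero at each step.\<close>

lemma finite_ddw:
  fixes f :: "int mpoly mpoly"
  shows "deg_le d f \<Longrightarrow> finite {w \<in> S_infty. ddw w f \<noteq> 0}"
proof (induction d arbitrary: f rule: less_induct)
  case (less d)
  let ?K = "{k. 1 \<le> k \<and> divided_difference k f \<noteq> 0}"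
  have "finite ?K"
  proof (rule finite_subset)
    show "?K \<subseteq> {..Suc (Max (insert 0 (mvars f)))}"
    proof
      fix k assume k: "k \<in> ?K"
      show "k \<in> {..Suc (Max (insert 0 (mvars f)))}"
      proof (rule ccontr)
        assume "k \<notin> {..Suc (Max (insert 0 (mvars f)))}"
        \<comment> \<open>\<open>k\<close> lies beyond all variables of \<open>f\<close>\<close>
        then have big: "i < k" if "i \<in> mvars f" for i
          using that Max_ge[of "insert 0 (mvars f)" i] finite_mvars[of f]
          by (meson atMost_iff finite_insert insertCI le_SucI le_trans linorder_not_less)
        have "swap_vars k f = f"
        proof -
          have "Var (simple_refl k i) = (Var i :: int mpoly mpoly)" if "e \<in> Poly_Mapping.keys f" "i \<in> Poly_Mapping.keys e" for e i
          proof -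
            have "i \<in> mvars f" using that by (auto simp: mvars_def)
            then have "i < k" by (rule big)
            then show ?thesis by simp
          qed
          then have "swap_vars k f = mpoly_subst Const Var f"
            unfolding swap_vars_def mpoly_subst_def by (intro sum.cong refl arg_cong2[of _ _ _ _ "(*)"] prod.cong) auto
          also have "\<dots> = f"
            by (rule hom_eqI[OF comm_ring_hom'.mpoly_subst_hom[OF Const_hom] id_hom])
              (simp_all add: comm_ring_hom'.mpoly_subst_Const[OF Const_hom] comm_ring_hom'.mpoly_subst_Var[OF Const_hom])
          finally show ?thesis .
        qed
        then show False using k dd_sym by auto
      qed
    qed
  qed simp
  moreover have sub: "{w \<in> S_infty. ddw w f \<noteq> 0}
      \<subseteq> insert id (\<Union>k\<in>?K. (\<lambda>w. w \<circ> simple_refl k) ` {w \<in> S_infty. ddw w (divided_difference k f) \<noteq> 0})"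
  proof
    fix w assume w: "w \<in> {w \<in> S_infty. ddw w f \<noteq> 0}"
    show "w \<in> insert id (\<Union>k\<in>?K. (\<lambda>w. w \<circ> simple_refl k) ` {w \<in> S_infty. ddw w (divided_difference k f) \<noteq> 0})"
    proof (cases "w = id")
      case False
      obtain n where "w \<in> Sn n" using w by (auto simp: S_infty_def)
      then obtain k where k: "1 \<le> k" "w (Suc k) < w k" using ex_desc False by metis
      have eq: "ddw w f = ddw (w \<circ> simple_refl k) (divided_difference k f)"
        using w ddw_desc[OF _ k] by blast
      then have "k \<in> ?K" using w k by (auto simp: ddw_zero)
      moreover have "w \<circ> simple_refl k \<in> S_infty" using w k by (intro Sinf_comp Sinf_simple) auto
      ultimately have "k \<in> ?K" "w \<circ> simple_refl k \<in> {w \<in> S_infty. ddw w (divided_difference k f) \<noteq> 0}"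
        using eq w by auto
      moreover have "w = w \<circ> simple_refl k \<circ> simple_refl k" by (simp add: comp_assoc)
      ultimately show ?thesis by (intro insertI2 UN_I image_eqI)
    qed blast
  qed
  moreover have "finite {w \<in> S_infty. ddw w (divided_difference k f) \<noteq> 0}" if "k \<in> ?K" for k
  proof -
    have d: "d \<noteq> 0" "deg_le (d - 1) (divided_difference k f)"
      using deg_le_dd[OF less.prems, of k] that by blast+
    show ?thesis by (rule less.IH[OF _ d(2)]) (use d in simp)
  qed
  ultimately have "finite (insert id (\<Union>k\<in>?K. (\<lambda>w. w \<circ> simple_refl k) ` {w \<in> S_infty. ddw w (divided_difference k f) \<noteq> 0}))"
    by blast
  then show ?case by (rule finite_subset[OF sub])
qed

text \<open>A polynomial all of whose divided differences vanish at \<open>x = t\<close> is zero: by induction on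
  the degree its first divided differences are zero, so it is symmetric, hence constant.\<close>

lemma ddw_eq_0:
  fixes f :: "int mpoly mpoly"
  assumes "deg_le d f" "kill0 f = f" "\<And>w. w \<in> S_infty \<Longrightarrow> loc id (ddw w f) = 0"
  shows "f = 0"
  using assms
proof (induction d arbitrary: f rule: less_induct)
  case (less d)
  have "divided_difference k f = 0" if k: "1 \<le> k" for k
  proof (cases "d = 0")
    case True
    then show ?thesis using deg_le_dd[OF less.prems(1), of k] by simp
  next
    case False
    show ?thesis
    proof (rule less.IH)
      show "d - 1 < d" using False by simp
      show "deg_le (d - 1) (divided_difference k f)" using deg_le_dd[OF less.prems(1)] by blast
      show "kill0 (divided_difference k f) = divided_difference k f"
        by (simp add: kill0_dd[OF k] less.prems(2))
      fix w assume w: "w \<in> S_infty"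
      have ws: "w \<circ> simple_refl k \<in> S_infty" using w k by (intro Sinf_comp Sinf_simple)
      show "loc id (ddw w (divided_difference k f)) = 0"
        using asc_or_desc[OF w, of k] less.prems(3)[OF ws] ddw_dd_asc[OF w k, of f] ddw_dd_desc[OF w k, of f]
          comm_ring_hom'.hom_zero[OF loc_hom] by metis
    qed
  qed
  then have "swap_vars k f = f" if "1 \<le> k" for k using that dd_eq_0_iff by blast
  then obtain c where "f = Const c" using symmetric_const kill0_mvars[OF less.prems(2)] by blast
  moreover have "loc id f = 0" using less.prems(3)[OF Sinf_id] unfolding ddw_id .
  ultimately show ?case by (simp add: comm_ring_hom'.hom_zero[OF Const_hom])
qed

lemma kill0_double_schubert: "w \<in> S_infty \<Longrightarrow> kill0 (double_schubert w) = double_schubert w"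
proof -
  assume "w \<in> S_infty"
  then obtain n where "schubert_rel n w (double_schubert w)"
    using double_schubert_rel by (auto simp: S_infty_def)
  then show ?thesis
  proof (induction rule: schubert_induct)
    case longest
    have "kill0 (x_var i - Const (t_var j)) = x_var i - Const (t_var j)" if "(i, j) \<in> staircase n" for i j
      using that by (auto simp: comm_ring_hom'.hom_diff[OF kill0_hom] kill0_Var kill0_Const staircase_def)
    then show ?case
      unfolding box_prod_def comm_ring_hom'.hom_prod[OF kill0_hom] by (intro prod.cong) auto
  next
    case (descend w k f)
    then show ?case by (simp add: kill0_dd)
  qed
qed

text \<open>The difference of the two sides has vanishing dual coordinates by duality, hence is zero.\<close>

lemma schubert_expansion:
  assumes "kill0 f = f"
  defines "c \<equiv> \<lambda>w. if w \<in> S_infty then loc id (ddw w f) else 0"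
  shows "finite {w. c w \<noteq> 0}" "{w. c w \<noteq> 0} \<subseteq> S_infty"
    "f = (\<Sum>w\<in>{w. c w \<noteq> 0}. Const (c w) * double_schubert w)"
proof -
  obtain d where "deg_le d f" using deg_le_ex by blast
  then have "finite {w \<in> S_infty. ddw w f \<noteq> 0}" by (rule finite_ddw)
  moreover have "{w. c w \<noteq> 0} \<subseteq> {w \<in> S_infty. ddw w f \<noteq> 0}"
    by (auto simp: c_def comm_ring_hom'.hom_zero[OF loc_hom])
  ultimately show fin: "finite {w. c w \<noteq> 0}" by (rule rev_finite_subset)
  show sub: "{w. c w \<noteq> 0} \<subseteq> S_infty" by (auto simp: c_def)
  let ?g = "f - (\<Sum>w\<in>{w. c w \<noteq> 0}. Const (c w) * double_schubert w)"
  obtain e where "deg_le e ?g" using deg_le_ex by blast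
  then have "?g = 0"
  proof (rule ddw_eq_0)
    have "kill0 (Const (c w) * double_schubert w) = Const (c w) * double_schubert w" if "c w \<noteq> 0" for w
      using that sub kill0_double_schubert by (auto simp: comm_ring_hom'.hom_mult[OF kill0_hom] kill0_Const)
    then show "kill0 ?g = ?g" by (simp add: comm_ring_hom'.hom_simps[OF kill0_hom] assms(1))
    fix w assume w: "w \<in> S_infty"
    have "loc id (ddw w (\<Sum>w\<in>{w. c w \<noteq> 0}. Const (c w) * double_schubert w))
      = (\<Sum>w'\<in>{w. c w \<noteq> 0}. c w' * (if w = w' then 1 else 0))"
      using sub loc_ddw_double_schubert[OF w]
      by (auto simp: ddw_sum ddw_Const_mult comm_ring_hom'.hom_simps[OF loc_hom] intro!: sum.cong)
    also have "\<dots> = (\<Sum>w'\<in>{w. c w \<noteq> 0}. if w = w' then c w' else 0)" by (rule sum.cong) auto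
    also have "\<dots> = c w" using fin by (simp add: sum.delta')
    finally show "loc id (ddw w ?g) = 0"
      using w by (simp add: ddw_diff comm_ring_hom'.hom_simps[OF loc_hom] c_def)
  qed
  then show "f = (\<Sum>w\<in>{w. c w \<noteq> 0}. Const (c w) * double_schubert w)" by simp
qed

lemma structure_const_eq:
  assumes "v \<in> S_infty" "u \<in> S_infty" "w \<in> S_infty"
  shows "structure_const v u w = loc id (ddw w (double_schubert v * double_schubert u))"
proof -
  let ?f = "double_schubert v * double_schubert u"
  let ?c = "\<lambda>w. if w \<in> S_infty then loc id (ddw w ?f) else 0"
  have k: "kill0 ?f = ?f"
    by (simp add: comm_ring_hom'.hom_mult[OF kill0_hom] kill0_double_schubert assms)
  have "structure_const v u = ?c"
    unfolding structure_const_def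
  proof (rule the_equality)
    show "finite {w. ?c w \<noteq> 0} \<and> {w. ?c w \<noteq> 0} \<subseteq> S_infty \<and>
      ?f = (\<Sum>w\<in>{w. ?c w \<noteq> 0}. Const (?c w) * double_schubert w)"
      by (intro conjI schubert_expansion[OF k])
  next
    fix c assume c: "finite {w. c w \<noteq> 0} \<and> {w. c w \<noteq> 0} \<subseteq> S_infty \<and>
      ?f = (\<Sum>w\<in>{w. c w \<noteq> 0}. Const (c w) * double_schubert w)"
    show "c = ?c"
    proof
      fix w
      show "c w = ?c w"
      proof (cases "w \<in> S_infty")
        case True
        have "?f = (\<Sum>w\<in>{w. c w \<noteq> 0}. Const (c w) * double_schubert w)" using c by blast
        then have "loc id (ddw w ?f) = loc id (ddw w (\<Sum>w\<in>{w. c w \<noteq> 0}. Const (c w) * double_schubert w))"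
          by (rule arg_cong)
        also have "\<dots> = (\<Sum>w'\<in>{w. c w \<noteq> 0}. c w' * (if w = w' then 1 else 0))"
          using c loc_ddw_double_schubert[OF True]
          by (auto simp: ddw_sum ddw_Const_mult comm_ring_hom'.hom_simps[OF loc_hom] intro!: sum.cong)
        also have "\<dots> = (\<Sum>w'\<in>{w. c w \<noteq> 0}. if w = w' then c w' else 0)" by (rule sum.cong) auto
        also have "\<dots> = c w" using c by (simp add: sum.delta')
        finally show ?thesis using True by simp
      qed (use c in auto)
    qed
  qed
  then show ?thesis using assms(3) by simp
qed


section \<open>Preclans as labelled partial involutions\<close>

text \<open>With this key the nine moves of the action have a uniform description: a move applies at \<open>k\<close> exactly
  if the keys increase from \<open>k\<close> to \<open>k + 1\<close> and the two contents are not equal signs. The key of a matched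
  node is its partner; blanks count as smaller than everything, and decreasing among themselves.\<close>

definition nkey :: "nat \<Rightarrow> node \<Rightarrow> int" where
  "nkey i c = (case c of Mate j \<Rightarrow> int j | Blank \<Rightarrow> - int i | _ \<Rightarrow> int i)"

lemma nkey_simps [simp]:
  "nkey i (Mate j) = int j" "nkey i Blank = - int i" "nkey i Plus = int i" "nkey i Minus = int i"
  by (simp_all add: nkey_def)

abbreviation key :: "(nat \<Rightarrow> node) \<Rightarrow> nat \<Rightarrow> int" where
  "key \<gamma> i \<equiv> nkey i (\<gamma> i)"

fun map_mate :: "(nat \<Rightarrow> nat) \<Rightarrow> node \<Rightarrow> node" where
  "map_mate f (Mate j) = Mate (f j)"
| "map_mate f c = c"

text \<open>Relabelling of the nodes by \<open>s\<^sub>k\<close>, which exchanges the contents of \<open>k\<close> and \<open>k + 1\<close> and corrects their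
  partners.\<close>

definition sconj :: "nat \<Rightarrow> (nat \<Rightarrow> node) \<Rightarrow> nat \<Rightarrow> node" where
  "sconj k \<gamma> i = map_mate (simple_refl k) (\<gamma> (simple_refl k i))"

definition is_sign :: "node \<Rightarrow> bool" where
  "is_sign c \<longleftrightarrow> c = Plus \<or> c = Minus"

lemma is_sign_simps [simp]: "is_sign Plus" "is_sign Minus" "\<not> is_sign Blank" "\<not> is_sign (Mate j)"
  by (auto simp: is_sign_def)

lemma nkey_sign: "is_sign c \<Longrightarrow> nkey i c = int i"
  by (auto simp: is_sign_def)

lemma map_mate_sign [simp]: "is_sign c \<Longrightarrow> map_mate f c = c"
  by (auto simp: is_sign_def)

text \<open>The part of the definition of a preclan that is independent of the numbers of signs and arcs.\<close>

definition valid :: "nat \<Rightarrow> (nat \<Rightarrow> node) \<Rightarrow> bool" where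
  "valid n \<gamma> \<longleftrightarrow> (\<forall>i. i \<notin> {1..n} \<longrightarrow> \<gamma> i = Blank) \<and> (\<forall>i j. \<gamma> i = Mate j \<longrightarrow> j \<noteq> i \<and> \<gamma> j = Mate i)"

lemma valid_mate: "valid n \<gamma> \<Longrightarrow> \<gamma> i = Mate j \<Longrightarrow> \<gamma> j = Mate i"
  unfolding valid_def by blast

lemma validI:
  "(\<And>i. i \<notin> {1..n} \<Longrightarrow> \<gamma> i = Blank) \<Longrightarrow> (\<And>i j. \<gamma> i = Mate j \<Longrightarrow> j \<noteq> i \<and> \<gamma> j = Mate i) \<Longrightarrow> valid n \<gamma>"
  unfolding valid_def by blast

lemma valid_mate_ne: "valid n \<gamma> \<Longrightarrow> \<gamma> i \<noteq> Mate i"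
  unfolding valid_def by blast

lemma valid_mate_range: "valid n \<gamma> \<Longrightarrow> \<gamma> i = Mate j \<Longrightarrow> 1 \<le> i \<and> i \<le> n \<and> 1 \<le> j \<and> j \<le> n"
  unfolding valid_def by (metis atLeastAtMost_iff node.distinct(11))

lemma valid_out: "valid n \<gamma> \<Longrightarrow> i \<notin> {1..n} \<Longrightarrow> \<gamma> i = Blank"
  unfolding valid_def by blast

lemma map_mate_Mate: "map_mate f c = Mate j \<Longrightarrow> \<exists>l. c = Mate l \<and> j = f l"
  by (cases c) auto

lemma map_mate_id: "(\<And>j. c = Mate j \<Longrightarrow> f j = j) \<Longrightarrow> map_mate f c = c"
  by (cases c) auto

lemma sconj_invol [simp]: "sconj k (sconj k \<gamma>) = \<gamma>"
proof
  fix i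
  show "sconj k (sconj k \<gamma>) i = \<gamma> i" by (cases "\<gamma> i") (simp_all add: sconj_def)
qed

lemma sconj_other:
  "i \<noteq> k \<Longrightarrow> i \<noteq> Suc k \<Longrightarrow> \<gamma> i \<noteq> Mate k \<Longrightarrow> \<gamma> i \<noteq> Mate (Suc k) \<Longrightarrow> sconj k \<gamma> i = \<gamma> i"
  by (cases "\<gamma> i") (auto simp: sconj_def simple_refl_def')

lemma sconj_upd: "sconj k (\<gamma>(x := c)) = (sconj k \<gamma>)(simple_refl k x := map_mate (simple_refl k) c)"
proof
  fix i
  have "simple_refl k i = x \<longleftrightarrow> i = simple_refl k x" by (metis simple_refl_invol)
  then show "sconj k (\<gamma>(x := c)) i = ((sconj k \<gamma>)(simple_refl k x := map_mate (simple_refl k) c)) i"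
    by (simp add: sconj_def)
qed

lemma sconj_sconj: "sconj k (sconj l \<gamma>) i = map_mate (simple_refl k \<circ> simple_refl l) (\<gamma> (simple_refl l (simple_refl k i)))"
  by (cases "\<gamma> (simple_refl l (simple_refl k i))") (simp_all add: sconj_def)

lemma sconj_comm:
  assumes "Suc k < l \<or> Suc l < k"
  shows "sconj k (sconj l \<gamma>) = sconj l (sconj k \<gamma>)"
proof
  fix i
  have s: "simple_refl k (simple_refl l x) = simple_refl l (simple_refl k x)" for x
    using assms by (auto simp: simple_refl_def')
  then have "simple_refl k \<circ> simple_refl l = simple_refl l \<circ> simple_refl k" by auto
  with s show "sconj k (sconj l \<gamma>) i = sconj l (sconj k \<gamma>) i" by (simp only: sconj_sconj)
qed

lemma sconj_braid: "sconj k (sconj (Suc k) (sconj k \<gamma>)) = sconj (Suc k) (sconj k (sconj (Suc k) \<gamma>))"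
proof
  fix i
  have s: "simple_refl k (simple_refl (Suc k) (simple_refl k x))
      = simple_refl (Suc k) (simple_refl k (simple_refl (Suc k) x))" for x
  proof -
    consider "x = k" | "x = Suc k" | "x = Suc (Suc k)" | "x \<noteq> k" "x \<noteq> Suc k" "x \<noteq> Suc (Suc k)" by blast
    then show ?thesis by cases simp_all
  qed
  define j where "j = simple_refl k (simple_refl (Suc k) (simple_refl k i))"
  show "sconj k (sconj (Suc k) (sconj k \<gamma>)) i = sconj (Suc k) (sconj k (sconj (Suc k) \<gamma>)) i"
    by (cases "\<gamma> j") (simp_all add: sconj_def s j_def)
qed

lemma valid_sconj: "valid n \<gamma> \<Longrightarrow> 1 \<le> k \<Longrightarrow> k < n \<Longrightarrow> valid n (sconj k \<gamma>)"
proof -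
  assume v: "valid n \<gamma>" and k: "1 \<le> k" "k < n"
  have "sconj k \<gamma> i = Blank" if "i \<notin> {1..n}" for i
    using that v k valid_out[OF v that] by (auto simp: sconj_def simple_refl_def')
  moreover have "j \<noteq> i \<and> sconj k \<gamma> j = Mate i" if ij: "sconj k \<gamma> i = Mate j" for i j
  proof -
    obtain l where l: "\<gamma> (simple_refl k i) = Mate l" "j = simple_refl k l"
      using map_mate_Mate[of "simple_refl k" "\<gamma> (simple_refl k i)" j] ij by (auto simp: sconj_def)
    then have "\<gamma> l = Mate (simple_refl k i)" "l \<noteq> simple_refl k i"
      using valid_mate[OF v l(1)] valid_mate_ne[OF v, of l] by auto
    then show ?thesis using l(2) by (auto simp: sconj_def)
  qed
  ultimately show ?thesis by (rule validI)
qed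

text \<open>All moves except the linking of two opposite signs are relabellings.\<close>

lemma simple_act_eq:
  assumes v: "valid n \<gamma>" and k: "1 \<le> k"
  shows "simple_act k \<gamma> = (if key \<gamma> k < key \<gamma> (Suc k) then
      (if is_sign (\<gamma> k) \<and> is_sign (\<gamma> (Suc k)) then
        (if \<gamma> k \<noteq> \<gamma> (Suc k) then \<gamma>(k := Mate (Suc k), Suc k := Mate k) else \<gamma>)
       else sconj k \<gamma>) else \<gamma>)"
proof -
  have oth: "sconj k \<gamma> i = (if \<gamma> k = Mate i then Mate (Suc k) else if \<gamma> (Suc k) = Mate i then Mate k else \<gamma> i)"
    if "i \<noteq> k" "i \<noteq> Suc k" for i
  proof -
    have "\<gamma> k = Mate i \<longleftrightarrow> \<gamma> i = Mate k" "\<gamma> (Suc k) = Mate i \<longleftrightarrow> \<gamma> i = Mate (Suc k)"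
      using valid_mate[OF v] by blast+
    then show ?thesis using that by (cases "\<gamma> i") (auto simp: sconj_def simple_refl_def')
  qed
  have at: "sconj k \<gamma> k = map_mate (simple_refl k) (\<gamma> (Suc k))" "sconj k \<gamma> (Suc k) = map_mate (simple_refl k) (\<gamma> k)"
    by (simp_all add: sconj_def)
  have ne: "\<gamma> i \<noteq> Mate i" for i using valid_mate_ne[OF v] .
  have m: "\<gamma> k = Mate (Suc k) \<longleftrightarrow> \<gamma> (Suc k) = Mate k" using valid_mate[OF v] by blast
  show ?thesis
  proof (cases "\<gamma> k")
    case (Mate a)
    have a: "a \<noteq> k" using Mate ne by metis
    show ?thesis
    proof (cases "a = Suc k")
      case True
      then show ?thesis using Mate m by (simp add: simple_act_def)
    next
      case False
      then have "\<gamma> (Suc k) \<noteq> Mate k" using Mate m by auto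
      then show ?thesis using Mate a False ne[of "Suc k"]
        by (cases "\<gamma> (Suc k)") (auto simp: simple_act_def fun_eq_iff oth at)
    qed
  next
    case Plus
    then show ?thesis using ne[of "Suc k"] m
      by (cases "\<gamma> (Suc k)") (auto simp: simple_act_def fun_eq_iff oth at)
  next
    case Minus
    then show ?thesis using ne[of "Suc k"] m
      by (cases "\<gamma> (Suc k)") (auto simp: simple_act_def fun_eq_iff oth at)
  next
    case Blank
    then show ?thesis using ne[of "Suc k"] m k
      by (cases "\<gamma> (Suc k)") (auto simp: simple_act_def fun_eq_iff oth at)
  qed
qed

lemma valid_link:
  assumes "valid n \<gamma>" "1 \<le> k" "k < n" "is_sign (\<gamma> k)" "is_sign (\<gamma> (Suc k))"
  shows "valid n (\<gamma>(k := Mate (Suc k), Suc k := Mate k))"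
proof -
  have "\<gamma> i \<noteq> Mate k \<and> \<gamma> i \<noteq> Mate (Suc k)" for i
    using valid_mate[OF assms(1), of i k] valid_mate[OF assms(1), of i "Suc k"] assms(4,5) by auto
  note ne = this
  show ?thesis
  proof (rule validI)
    fix i j assume ij: "(\<gamma>(k := Mate (Suc k), Suc k := Mate k)) i = Mate j"
    show "j \<noteq> i \<and> (\<gamma>(k := Mate (Suc k), Suc k := Mate k)) j = Mate i"
    proof (cases "i = k \<or> i = Suc k")
      case False
      then have "\<gamma> i = Mate j" using ij by auto
      then show ?thesis using ne[of i] valid_mate[OF assms(1), of i j] valid_mate_ne[OF assms(1), of i] by auto
    qed (use ij in auto)
  qed (use assms valid_out[OF assms(1)] in auto)
qed

lemma valid_simple_act: "valid n \<gamma> \<Longrightarrow> 1 \<le> k \<Longrightarrow> k < n \<Longrightarrow> valid n (simple_act k \<gamma>)"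
  by (simp add: simple_act_eq valid_sconj valid_link)

text \<open>The places at which a preclan is the result of a move.\<close>

definition desc :: "nat \<Rightarrow> (nat \<Rightarrow> node) \<Rightarrow> nat \<Rightarrow> bool" where
  "desc n \<gamma> k \<longleftrightarrow> 1 \<le> k \<and> k < n \<and> \<gamma> k \<noteq> Blank \<and> key \<gamma> (Suc k) < key \<gamma> k"

text \<open>The coverings below a preclan in the order generated by the action. A short arc covers two
  preclans at the same place, one for each order of the two signs.\<close>

definition dn :: "nat \<Rightarrow> nat \<Rightarrow> (nat \<Rightarrow> node) \<Rightarrow> (nat \<Rightarrow> node) \<Rightarrow> bool" where
  "dn n k \<gamma> \<delta> \<longleftrightarrow> desc n \<gamma> k \<and>
    (if \<gamma> k = Mate (Suc k) then \<exists>s t. is_sign s \<and> is_sign t \<and> s \<noteq> t \<and> \<delta> = \<gamma>(k := s, Suc k := t)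
     else \<delta> = sconj k \<gamma>)"

lemma dn_link: "desc n \<gamma> k \<Longrightarrow> \<gamma> k = Mate (Suc k) \<Longrightarrow> is_sign s \<Longrightarrow> is_sign t \<Longrightarrow> s \<noteq> t \<Longrightarrow> dn n k \<gamma> (\<gamma>(k := s, Suc k := t))"
  by (auto simp: dn_def)

lemma dn_sconj: "desc n \<gamma> k \<Longrightarrow> \<gamma> k \<noteq> Mate (Suc k) \<Longrightarrow> dn n k \<gamma> (sconj k \<gamma>)"
  by (auto simp: dn_def)

lemma sconj_exchange:
  assumes "valid n \<gamma>" "\<gamma> k \<noteq> Mate (Suc k)" "\<gamma> (Suc k) \<noteq> Mate k"
  shows "sconj k \<gamma> k = \<gamma> (Suc k)" "sconj k \<gamma> (Suc k) = \<gamma> k"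
  using assms(2,3) valid_mate_ne[OF assms(1), of k] valid_mate_ne[OF assms(1), of "Suc k"]
  by (cases "\<gamma> k"; cases "\<gamma> (Suc k)"; auto simp: sconj_def simple_refl_def')+

lemma dn_props:
  assumes v: "valid n \<gamma>" and d: "dn n k \<gamma> \<delta>"
  shows "valid n \<delta>" "1 \<le> k" "k < n" "simple_act k \<delta> = \<gamma>" "\<delta> \<noteq> \<gamma>"
proof -
  have k: "1 \<le> k" "k < n" "\<gamma> k \<noteq> Blank" "key \<gamma> (Suc k) < key \<gamma> k" using d by (auto simp: dn_def desc_def)
  show "1 \<le> k" "k < n" by fact+
  have "valid n \<delta> \<and> simple_act k \<delta> = \<gamma> \<and> \<delta> \<noteq> \<gamma>"
  proof (cases "\<gamma> k = Mate (Suc k)")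
    case True
    then have m: "\<gamma> (Suc k) = Mate k" using valid_mate[OF v] by blast
    obtain s t where st: "is_sign s" "is_sign t" "s \<noteq> t" "\<delta> = \<gamma>(k := s, Suc k := t)"
      using d True by (auto simp: dn_def)
    have "\<gamma> i \<noteq> Mate k \<and> \<gamma> i \<noteq> Mate (Suc k)" if "i \<noteq> k" "i \<noteq> Suc k" for i
      using valid_mate[OF v, of i k] valid_mate[OF v, of i "Suc k"] that True m by auto
    note ne = this
    have vd: "valid n \<delta>"
    proof (rule validI)
      fix i j assume ij: "\<delta> i = Mate j"
      then have i: "i \<noteq> k" "i \<noteq> Suc k" using st by auto
      then have "\<gamma> i = Mate j" using ij st by auto
      then show "j \<noteq> i \<and> \<delta> j = Mate i"
        using st ne[OF i] valid_mate[OF v, of i j] valid_mate_ne[OF v, of i] by auto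
    qed (use st k valid_out[OF v] in auto)
    have "simple_act k \<delta> = \<gamma>"
      unfolding simple_act_eq[OF vd k(1)] using st True m by (auto simp: nkey_sign fun_eq_iff)
    moreover have "\<delta> \<noteq> \<gamma>" using st True by (auto simp: fun_eq_iff is_sign_def dest: spec[of _ k])
    ultimately show ?thesis using vd by blast
  next
    case False
    then have \<delta>: "\<delta> = sconj k \<gamma>" using d by (simp add: dn_def)
    have m: "\<gamma> (Suc k) \<noteq> Mate k" using False valid_mate[OF v] by blast
    note c = sconj_exchange[OF v False m]
    have vd: "valid n \<delta>" unfolding \<delta> by (rule valid_sconj[OF v k(1,2)])
    have asc: "key \<delta> k < key \<delta> (Suc k)"
      using k c unfolding \<delta> by (cases "\<gamma> k"; cases "\<gamma> (Suc k)") auto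
    have "\<not> (is_sign (\<delta> k) \<and> is_sign (\<delta> (Suc k)))"
      using k c unfolding \<delta> by (cases "\<gamma> k"; cases "\<gamma> (Suc k)") auto
    then have "simple_act k \<delta> = sconj k \<delta>"
      unfolding simple_act_eq[OF vd k(1)] using asc by auto
    then have "simple_act k \<delta> = \<gamma>" by (simp add: \<delta>)
    moreover have "\<delta> \<noteq> \<gamma>" using asc k by auto
    ultimately show ?thesis using vd by blast
  qed
  then show "valid n \<delta>" "simple_act k \<delta> = \<gamma>" "\<delta> \<noteq> \<gamma>" by auto
qed

lemma dn_simple_act:
  assumes v: "valid n \<delta>" and k: "1 \<le> k" "k < n" and ne: "simple_act k \<delta> \<noteq> \<delta>"
  shows "dn n k (simple_act k \<delta>) \<delta>"
proof -
  have asc: "key \<delta> k < key \<delta> (Suc k)" using ne unfolding simple_act_eq[OF v k(1)] by auto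
  have nm: "\<delta> k \<noteq> Mate (Suc k)" "\<delta> (Suc k) \<noteq> Mate k"
    using asc valid_mate[OF v, of k "Suc k"] valid_mate[OF v, of "Suc k" k] by auto
  note c = sconj_exchange[OF v nm]
  show ?thesis
  proof (cases "is_sign (\<delta> k) \<and> is_sign (\<delta> (Suc k))")
    case True
    then have e: "simple_act k \<delta> = \<delta>(k := Mate (Suc k), Suc k := Mate k)" "\<delta> k \<noteq> \<delta> (Suc k)"
      using asc ne unfolding simple_act_eq[OF v k(1)] by (auto split: if_splits)
    have "\<delta> = (simple_act k \<delta>)(k := \<delta> k, Suc k := \<delta> (Suc k))" by (auto simp: e)
    moreover have "dn n k (simple_act k \<delta>) ((simple_act k \<delta>)(k := \<delta> k, Suc k := \<delta> (Suc k)))"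
      by (rule dn_link) (use True e k in \<open>auto simp: desc_def\<close>)
    ultimately show ?thesis by simp
  next
    case False
    then have e: "simple_act k \<delta> = sconj k \<delta>"
      using asc unfolding simple_act_eq[OF v k(1)] by (auto split: if_splits)
    have "desc n (sconj k \<delta>) k"
      using asc False k c nm valid_mate_ne[OF v, of k] valid_mate_ne[OF v, of "Suc k"] by (cases "\<delta> k"; cases "\<delta> (Suc k)") (auto simp: desc_def)
    moreover have "sconj k \<delta> k \<noteq> Mate (Suc k)" using c valid_mate_ne[OF v, of "Suc k"] by simp
    ultimately show ?thesis by (simp add: e dn_def)
  qed
qed


section \<open>Counting pairs of nodes\<close>

definition pinv :: "nat \<Rightarrow> (nat \<Rightarrow> node) \<Rightarrow> (nat \<times> nat) set" where
  "pinv n \<gamma> = {(i, j). 1 \<le> i \<and> i < j \<and> j \<le> n \<and> key \<gamma> j < key \<gamma> i}"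

definition pblank :: "nat \<Rightarrow> (nat \<Rightarrow> node) \<Rightarrow> (nat \<times> nat) set" where
  "pblank n \<gamma> = {(i, j). 1 \<le> i \<and> i < j \<and> j \<le> n \<and> \<gamma> i \<noteq> Blank \<and> \<gamma> j = Blank}"

text \<open>This equals \<open>2 \<cdot> preclan_length + (m choose 2)\<close> with \<open>m\<close> the number of blanks
  (\<open>plen_preclan_length\<close>), but it counts pairs of nodes, on which the effect of a move is easy to see.\<close>

definition plen :: "nat \<Rightarrow> (nat \<Rightarrow> node) \<Rightarrow> nat" where
  "plen n \<gamma> = card (pinv n \<gamma>) + card (matchings n \<gamma>) + card (pblank n \<gamma>)"

lemma finite_pairs: "finite (pinv n \<gamma>)" "finite (pblank n \<gamma>)" "finite (matchings n \<gamma>)"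
  by (rule finite_subset[of _ "{1..n} \<times> {1..n}"]; auto simp: pinv_def pblank_def matchings_def)+

text \<open>The counting scheme for the effect of a move: relabelled pairs persist and the pairs in \<open>X\<close> are new.\<close>

lemma pairs_image:
  assumes "finite A" "\<And>i j. (i, j) \<in> B \<longleftrightarrow> (simple_refl k i, simple_refl k j) \<in> A \<or> (i, j) \<in> X"
    "finite X" "\<And>i j. (i, j) \<in> X \<Longrightarrow> (simple_refl k i, simple_refl k j) \<notin> A"
  shows "card B = card A + card X"
proof -
  let ?f = "map_prod (simple_refl k) (simple_refl k)"
  have inv: "?f (?f x) = x" for x by (cases x) simp
  have "B = ?f ` A \<union> X"
  proof (intro equalityI subsetI)
    fix x assume "x \<in> B"
    then have "?f x \<in> A \<or> x \<in> X" using assms(2)[of "fst x" "snd x"] by (cases x) simp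
    then show "x \<in> ?f ` A \<union> X" using inv by (metis UnI1 UnI2 image_eqI)
  next
    fix x assume "x \<in> ?f ` A \<union> X"
    then have "?f x \<in> A \<or> x \<in> X" using inv by (metis UnE imageE)
    then show "x \<in> B" using assms(2)[of "fst x" "snd x"] by (cases x) simp
  qed
  moreover have "?f ` A \<inter> X = {}"
  proof -
    have "y \<notin> X" if y: "y \<in> ?f ` A" for y
    proof -
      obtain a b where "(a, b) \<in> A" "y = (simple_refl k a, simple_refl k b)" using y by auto
      then show ?thesis using assms(4)[of "simple_refl k a" "simple_refl k b"] by auto
    qed
    then show ?thesis by blast
  qed
  moreover have "card (?f ` A) = card A"
    by (rule card_image, rule inj_on_inverseI[where g = ?f]) (rule inv)
  ultimately show ?thesis using assms(1,3) by (simp add: card_Un_disjoint)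
qed


lemma matchings_iff: "(i, j) \<in> matchings n \<gamma> \<longleftrightarrow> 1 \<le> i \<and> i < j \<and> j \<le> n \<and> \<gamma> i = Mate j"
  by (auto simp: matchings_def)

lemma simple_refl_range: "1 \<le> k \<Longrightarrow> k < n \<Longrightarrow> 1 \<le> simple_refl k i \<and> simple_refl k i \<le> n \<longleftrightarrow> 1 \<le> i \<and> i \<le> n"
  by (auto simp: simple_refl_def')

lemma simple_refl_less_iff:
  "\<not> (i = k \<and> j = Suc k) \<Longrightarrow> \<not> (i = Suc k \<and> j = k) \<Longrightarrow> simple_refl k i < simple_refl k j \<longleftrightarrow> i < j"
  by (auto simp: simple_refl_def')

text \<open>The partner of a matched node, and the node itself otherwise; an involution on the nonblank nodes.\<close>

definition pos :: "(nat \<Rightarrow> node) \<Rightarrow> nat \<Rightarrow> nat" where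
  "pos \<gamma> i = (case \<gamma> i of Mate l \<Rightarrow> l | _ \<Rightarrow> i)"

lemma key_pos: "key \<gamma> i = (if \<gamma> i = Blank then - int i else int (pos \<gamma> i))"
  by (cases "\<gamma> i") (auto simp: pos_def)

lemma key_sconj:
  "key (sconj k \<gamma>) (simple_refl k i) = (if \<gamma> i = Blank then - int (simple_refl k i) else int (simple_refl k (pos \<gamma> i)))"
  by (cases "\<gamma> i") (auto simp: pos_def sconj_def)

lemma key_eq_iff:
  assumes v: "valid n \<gamma>" and i: "1 \<le> i" "1 \<le> x"
  shows "key \<gamma> i = int x \<longleftrightarrow> \<gamma> x \<noteq> Blank \<and> i = pos \<gamma> x"
proof
  assume e: "key \<gamma> i = int x"
  show "\<gamma> x \<noteq> Blank \<and> i = pos \<gamma> x"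
  proof (cases "\<gamma> i")
    case (Mate l)
    then show ?thesis using e valid_mate[OF v Mate] by (simp add: pos_def)
  qed (use e i in \<open>auto simp: pos_def\<close>)
next
  assume e: "\<gamma> x \<noteq> Blank \<and> i = pos \<gamma> x"
  show "key \<gamma> i = int x"
  proof (cases "\<gamma> x")
    case (Mate l)
    then show ?thesis using e valid_mate[OF v Mate] by (simp add: pos_def)
  qed (use e in \<open>auto simp: pos_def\<close>)
qed

text \<open>Apart from the order of the nodes \<open>k\<close> and \<open>k + 1\<close> themselves, a relabelling affects inversions only
  where the two keys are \<open>k\<close> and \<open>k + 1\<close>.\<close>

lemma key_sconj_less:
  assumes k: "1 \<le> k" and r: "1 \<le> i" "1 \<le> j"
    and nb: "\<not> (\<gamma> k = Blank \<and> \<gamma> (Suc k) = Blank)"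
    and nk: "{key \<gamma> i, key \<gamma> j} \<noteq> {int k, int (Suc k)}"
  shows "key (sconj k \<gamma>) (simple_refl k j) < key (sconj k \<gamma>) (simple_refl k i) \<longleftrightarrow> key \<gamma> j < key \<gamma> i"
proof -
  let ?s = "simple_refl k"
  have s0: "0 < ?s j" using k r by (auto simp: simple_refl_def')
  show ?thesis
  proof (cases "\<gamma> i = Blank"; cases "\<gamma> j = Blank")
    assume a: "\<gamma> i = Blank" "\<gamma> j = Blank"
    then have "\<not> (i = k \<and> j = Suc k)" "\<not> (i = Suc k \<and> j = k)" using nb by auto
    then show ?thesis using a simple_refl_less_iff[of i k j] by (simp add: key_pos[where \<gamma> = \<gamma>] key_sconj)
  next
    assume a: "\<gamma> i \<noteq> Blank" "\<gamma> j \<noteq> Blank"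
    then have "\<not> (pos \<gamma> j = k \<and> pos \<gamma> i = Suc k)" "\<not> (pos \<gamma> j = Suc k \<and> pos \<gamma> i = k)"
      using nk by (auto simp: key_pos)
    then show ?thesis using a simple_refl_less_iff[of "pos \<gamma> j" k "pos \<gamma> i"] by (simp add: key_pos[where \<gamma> = \<gamma>] key_sconj)
  next
    assume a: "\<gamma> i = Blank" "\<gamma> j \<noteq> Blank"
    then show ?thesis by (simp add: key_pos[where \<gamma> = \<gamma>] key_sconj)
  next
    assume a: "\<gamma> i \<noteq> Blank" "\<gamma> j = Blank"
    then show ?thesis using s0 r by (simp add: key_pos[where \<gamma> = \<gamma>] key_sconj)
  qed
qed


lemma card_matchings_sconj:
  assumes v: "valid n \<gamma>" and k: "1 \<le> k" "k < n" and nm: "\<gamma> k \<noteq> Mate (Suc k)"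
  shows "card (matchings n (sconj k \<gamma>)) = card (matchings n \<gamma>)"
proof -
  have nm': "\<gamma> (Suc k) \<noteq> Mate k" using nm valid_mate[OF v] by blast
  have mate: "sconj k \<gamma> i = Mate j \<longleftrightarrow> \<gamma> (simple_refl k i) = Mate (simple_refl k j)" for i j
    by (cases "\<gamma> (simple_refl k i)") (auto simp: sconj_def)
  have "card (matchings n (sconj k \<gamma>)) = card (matchings n \<gamma>) + card ({} :: (nat \<times> nat) set)"
  proof (rule pairs_image)
    fix i j
    have "\<gamma> (simple_refl k i) = Mate (simple_refl k j) \<Longrightarrow> simple_refl k i < simple_refl k j \<longleftrightarrow> i < j"
      using nm nm' by (intro simple_refl_less_iff) auto
    moreover have "1 \<le> simple_refl k i \<longleftrightarrow> 1 \<le> i" "simple_refl k j \<le> n \<longleftrightarrow> j \<le> n"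
      using k by (auto simp: simple_refl_def')
    ultimately show "(i, j) \<in> matchings n (sconj k \<gamma>) \<longleftrightarrow>
        (simple_refl k i, simple_refl k j) \<in> matchings n \<gamma> \<or> (i, j) \<in> {}"
      by (auto simp: matchings_iff mate)
  qed (auto simp: finite_pairs)
  then show ?thesis by simp
qed

lemma sconj_Blank: "sconj k \<gamma> i = Blank \<longleftrightarrow> \<gamma> (simple_refl k i) = Blank"
  by (cases "\<gamma> (simple_refl k i)") (auto simp: sconj_def)

lemma card_pblank_sconj:
  assumes k: "1 \<le> k" "k < n" and nb: "\<not> (\<gamma> k \<noteq> Blank \<and> \<gamma> (Suc k) = Blank)"
  shows "card (pblank n (sconj k \<gamma>)) = card (pblank n \<gamma>) + (if \<gamma> k = Blank \<and> \<gamma> (Suc k) \<noteq> Blank then 1 else 0)"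
proof -
  let ?s = "simple_refl k"
  define X where "X = (if \<gamma> k = Blank \<and> \<gamma> (Suc k) \<noteq> Blank then {(k, Suc k)} else {})"
  have "card (pblank n (sconj k \<gamma>)) = card (pblank n \<gamma>) + card X"
  proof (rule pairs_image)
    fix i j
    have r: "1 \<le> ?s i \<longleftrightarrow> 1 \<le> i" "?s j \<le> n \<longleftrightarrow> j \<le> n"
      using k by (auto simp: simple_refl_def')
    consider "i = k" "j = Suc k" | "i = Suc k" "j = k" | "?s i < ?s j \<longleftrightarrow> i < j" "(i, j) \<noteq> (k, Suc k)"
      using simple_refl_less_iff[of i k j] by blast
    then show "(i, j) \<in> pblank n (sconj k \<gamma>) \<longleftrightarrow> (?s i, ?s j) \<in> pblank n \<gamma> \<or> (i, j) \<in> X"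
    proof cases
      case 1
      then show ?thesis using k by (auto simp: pblank_def sconj_Blank X_def)
    next
      case 2
      then show ?thesis using k nb by (auto simp: pblank_def sconj_Blank X_def)
    next
      case 3
      then show ?thesis using r by (auto simp: pblank_def sconj_Blank X_def)
    qed
  qed (auto simp: finite_pairs(2) X_def split: if_splits, auto simp: pblank_def)
  then show ?thesis by (simp add: X_def)
qed

text \<open>The new inversions are the pair \<open>(k, k + 1)\<close> and the pair of partners; the latter does not exist if
  there is a blank at \<open>k\<close>.\<close>

lemma card_pinv_sconj:
  assumes v: "valid n \<gamma>" and k: "1 \<le> k" "k < n" and asc: "key \<gamma> k < key \<gamma> (Suc k)"
    and ns: "\<not> (is_sign (\<gamma> k) \<and> is_sign (\<gamma> (Suc k)))"
  shows "card (pinv n (sconj k \<gamma>)) = card (pinv n \<gamma>) + (if \<gamma> k = Blank then 1 else 2)"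
proof -
  let ?s = "simple_refl k"
  have nb: "\<gamma> (Suc k) \<noteq> Blank" using asc by (cases "\<gamma> k") auto
  have nm: "\<gamma> k \<noteq> Mate (Suc k)" "\<gamma> (Suc k) \<noteq> Mate k"
    using asc valid_mate[OF v, of k "Suc k"] valid_mate[OF v, of "Suc k" k] by auto
  define Y where "Y = (if \<gamma> k = Blank then {} else {(?s (pos \<gamma> k), ?s (pos \<gamma> (Suc k)))})"
  have Yk: "pos \<gamma> k < pos \<gamma> (Suc k)" "\<not> (pos \<gamma> k = k \<and> pos \<gamma> (Suc k) = Suc k)" "1 \<le> pos \<gamma> k" "pos \<gamma> (Suc k) \<le> n"
      if "\<gamma> k \<noteq> Blank"
  proof -
    show "pos \<gamma> k < pos \<gamma> (Suc k)" using asc that nb by (simp add: key_pos)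
    show "1 \<le> pos \<gamma> k" using that k valid_mate_range[OF v, of k] by (auto simp: pos_def split: node.splits)
    show "pos \<gamma> (Suc k) \<le> n" using nb k valid_mate_range[OF v, of "Suc k"] by (auto simp: pos_def split: node.splits)
    show "\<not> (pos \<gamma> k = k \<and> pos \<gamma> (Suc k) = Suc k)"
      using ns that nb valid_mate_ne[OF v, of k] valid_mate_ne[OF v, of "Suc k"]
      by (auto simp: pos_def split: node.splits)
  qed
  have "card (pinv n (sconj k \<gamma>)) = card (pinv n \<gamma>) + card (insert (k, Suc k) Y)"
  proof (rule pairs_image)
    fix i j
    have r: "1 \<le> ?s i \<longleftrightarrow> 1 \<le> i" "?s j \<le> n \<longleftrightarrow> j \<le> n"
      using k by (auto simp: simple_refl_def')
    consider (1) "i = k" "j = Suc k" | (2) "i = Suc k" "j = k" | (3) "?s i < ?s j \<longleftrightarrow> i < j" "(i, j) \<noteq> (k, Suc k)"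
      using simple_refl_less_iff[of i k j] by blast
    then show "(i, j) \<in> pinv n (sconj k \<gamma>) \<longleftrightarrow> (?s i, ?s j) \<in> pinv n \<gamma> \<or> (i, j) \<in> insert (k, Suc k) Y"
    proof cases
      case 1
      have "nkey (Suc k) (\<gamma> k) < nkey k (\<gamma> (Suc k))"
        using asc ns nb nm valid_mate_ne[OF v, of k] valid_mate_ne[OF v, of "Suc k"]
        by (cases "\<gamma> k"; cases "\<gamma> (Suc k)") auto
      then show ?thesis using 1 k by (simp add: pinv_def sconj_exchange[OF v nm])
    next
      case 2
      have "(Suc k, k) \<notin> Y"
      proof
        assume "(Suc k, k) \<in> Y"
        then have b: "\<gamma> k \<noteq> Blank" and e: "Suc k = ?s (pos \<gamma> k)" "k = ?s (pos \<gamma> (Suc k))"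
          unfolding Y_def by (metis empty_iff singletonD prod.inject)+
        have "?s (Suc k) = pos \<gamma> k" using e(1) by (metis simple_refl_invol)
        moreover have "?s k = pos \<gamma> (Suc k)" using e(2) by (metis simple_refl_invol)
        ultimately show False using Yk(2)[OF b] by simp
      qed
      then show ?thesis using 2 asc by (auto simp: pinv_def)
    next
      case 3
      show ?thesis
      proof (cases "1 \<le> i \<and> 1 \<le> j")
        case True
        then have ab: "1 \<le> ?s i" "1 \<le> ?s j" using k by (auto simp: simple_refl_def')
        note ki = key_eq_iff[OF v ab(1)] and kj = key_eq_iff[OF v ab(2)]
        show ?thesis
        proof (cases "{key \<gamma> (?s i), key \<gamma> (?s j)} = {int k, int (Suc k)}")
          case False
          then have "key (sconj k \<gamma>) (?s (?s j)) < key (sconj k \<gamma>) (?s (?s i)) \<longleftrightarrow> key \<gamma> (?s j) < key \<gamma> (?s i)"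
            using nb by (intro key_sconj_less k ab) auto
          moreover have "(i, j) \<notin> Y"
          proof
            assume "(i, j) \<in> Y"
            then have "\<gamma> k \<noteq> Blank" "?s i = pos \<gamma> k" "?s j = pos \<gamma> (Suc k)"
              by (auto simp: Y_def split: if_splits)
            then show False using False ki[of k] kj[of "Suc k"] k nb by simp
          qed
          ultimately show ?thesis using 3 r by (auto simp: pinv_def)
        next
          case e: True
          then consider (a) "key \<gamma> (?s i) = int k" "key \<gamma> (?s j) = int (Suc k)"
            | (b) "key \<gamma> (?s i) = int (Suc k)" "key \<gamma> (?s j) = int k" by (auto simp: doubleton_eq_iff)
          then show ?thesis
          proof cases
            case a
            then have p: "\<gamma> k \<noteq> Blank" "?s i = pos \<gamma> k" "?s j = pos \<gamma> (Suc k)"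
              using ki[of k] kj[of "Suc k"] k by auto
            then have "i = ?s (pos \<gamma> k)" "j = ?s (pos \<gamma> (Suc k))" by (metis simple_refl_invol)+
            then have Y: "(i, j) \<in> Y" using p by (simp add: Y_def)
            have lt: "i < j" using Yk(1)[OF p(1)] p 3(1) by simp
            have jn: "j \<le> n" using Yk(4)[OF p(1)] p r by simp
            have nbi: "\<gamma> (?s i) \<noteq> Blank" "\<gamma> (?s j) \<noteq> Blank" using a ab k by auto
            then have "pos \<gamma> (?s i) = k" "pos \<gamma> (?s j) = Suc k" using a by (auto simp: key_pos)
            then have "key (sconj k \<gamma>) (?s (?s i)) = int (Suc k)" "key (sconj k \<gamma>) (?s (?s j)) = int k"
              unfolding key_sconj using nbi by auto
            then show ?thesis using lt jn True Y by (simp add: pinv_def)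
          next
            case b
            then have p: "\<gamma> k \<noteq> Blank" "?s j = pos \<gamma> k" "?s i = pos \<gamma> (Suc k)"
              using kj[of k] ki[of "Suc k"] k by auto
            have ge: "\<not> i < j" using Yk(1)[OF p(1)] p 3(1) by simp
            have "(i, j) \<notin> Y"
            proof
              assume "(i, j) \<in> Y"
              then have "?s i = pos \<gamma> k" by (auto simp: Y_def split: if_splits)
              then show False using p Yk(1)[OF p(1)] by simp
            qed
            then show ?thesis using ge 3 by (auto simp: pinv_def)
          qed
        qed
      next
        case False
        have "\<not> (1 \<le> i \<and> i < j)" using False by auto
        moreover have "(i, j) \<notin> Y"
        proof
          assume "(i, j) \<in> Y"
          then have b: "\<gamma> k \<noteq> Blank" and e: "?s i = pos \<gamma> k" "?s j = pos \<gamma> (Suc k)"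
            by (auto simp: Y_def split: if_splits)
          then have "1 \<le> ?s i" "1 \<le> ?s j" using Yk[OF b] by auto
          then show False using False k by (auto simp: simple_refl_def' split: if_splits)
        qed
        ultimately show ?thesis using 3 r by (auto simp: pinv_def)
      qed
    qed
  next
    fix i j assume "(i, j) \<in> insert (k, Suc k) Y"
    then consider "i = k" "j = Suc k" | "\<gamma> k \<noteq> Blank" "?s i = pos \<gamma> k" "?s j = pos \<gamma> (Suc k)"
      by (auto simp: Y_def split: if_splits)
    then show "(?s i, ?s j) \<notin> pinv n \<gamma>"
    proof cases
      case 1
      then show ?thesis by (simp add: pinv_def)
    next
      case 2
      have "1 \<le> ?s i" "1 \<le> ?s j" using 2 Yk[OF 2(1)] by auto
      then have "key \<gamma> (?s i) = int k" "key \<gamma> (?s j) = int (Suc k)"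
        using 2 nb k key_eq_iff[OF v, of "?s i" k] key_eq_iff[OF v, of "?s j" "Suc k"] by auto
      then show ?thesis by (simp add: pinv_def)
    qed
  qed (auto simp: finite_pairs(1) Y_def)
  moreover have "(k, Suc k) \<notin> Y"
  proof
    assume "(k, Suc k) \<in> Y"
    then have b: "\<gamma> k \<noteq> Blank" and e: "k = ?s (pos \<gamma> k)" "Suc k = ?s (pos \<gamma> (Suc k))"
      unfolding Y_def by (metis empty_iff singletonD prod.inject)+
    have "pos \<gamma> k = Suc k" using e(1) by (metis simple_refl_invol simple_refl_simps(1))
    moreover have "pos \<gamma> (Suc k) = k" using e(2) by (metis simple_refl_invol simple_refl_simps(2))
    ultimately show False using Yk(1)[OF b] by linarith
  qed
  ultimately show ?thesis by (simp add: Y_def)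
qed

lemma plen_simple_act:
  assumes v: "valid n \<gamma>" and k: "1 \<le> k" "k < n" and ne: "simple_act k \<gamma> \<noteq> \<gamma>"
  shows "plen n (simple_act k \<gamma>) = plen n \<gamma> + 2"
proof -
  have asc: "key \<gamma> k < key \<gamma> (Suc k)" using ne unfolding simple_act_eq[OF v k(1)] by auto
  have nb: "\<gamma> (Suc k) \<noteq> Blank" using asc by (cases "\<gamma> k") auto
  have nm: "\<gamma> k \<noteq> Mate (Suc k)" using asc valid_mate[OF v, of k "Suc k"] by auto
  show ?thesis
  proof (cases "is_sign (\<gamma> k) \<and> is_sign (\<gamma> (Suc k))")
    case False
    then have e: "simple_act k \<gamma> = sconj k \<gamma>"
      using asc unfolding simple_act_eq[OF v k(1)] by auto
    show ?thesis
      using card_pinv_sconj[OF v k asc False] card_matchings_sconj[OF v k nm] card_pblank_sconj[of k n \<gamma>] k nb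
      by (simp add: plen_def e)
  next
    case True
    then have e: "simple_act k \<gamma> = \<gamma>(k := Mate (Suc k), Suc k := Mate k)"
      using asc ne unfolding simple_act_eq[OF v k(1)] by (auto split: if_splits)
    have nmi: "\<gamma> i \<noteq> Mate k" "\<gamma> i \<noteq> Mate (Suc k)" for i
      using valid_mate[OF v, of i k] valid_mate[OF v, of i "Suc k"] True by auto
    have nk: "key \<gamma> i \<noteq> int k" "key \<gamma> i \<noteq> int (Suc k)" if "i \<noteq> k" "i \<noteq> Suc k" for i
      using that nmi[of i] k by (cases "\<gamma> i"; auto)+
    have kk: "key \<gamma> k = int k" "key \<gamma> (Suc k) = int (Suc k)" using True by (simp_all add: nkey_sign)
    have "pinv n (simple_act k \<gamma>) = insert (k, Suc k) (pinv n \<gamma>)"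
    proof -
      have "(i, j) \<in> pinv n (simple_act k \<gamma>) \<longleftrightarrow> (i, j) \<in> insert (k, Suc k) (pinv n \<gamma>)" for i j
        using nk[of i] nk[of j] kk k by (auto simp: pinv_def e)
      then show ?thesis by auto
    qed
    moreover have "(k, Suc k) \<notin> pinv n \<gamma>" using asc by (simp add: pinv_def)
    moreover have "matchings n (simple_act k \<gamma>) = insert (k, Suc k) (matchings n \<gamma>)"
    proof -
      have "(i, j) \<in> matchings n (simple_act k \<gamma>) \<longleftrightarrow> (i, j) \<in> insert (k, Suc k) (matchings n \<gamma>)" for i j
        using k True nmi[of i] by (cases "i = k"; cases "i = Suc k") (auto simp: matchings_iff e)
      then show ?thesis by auto
    qed
    moreover have "(k, Suc k) \<notin> matchings n \<gamma>" using nm by (simp add: matchings_def)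
    moreover have "pblank n (simple_act k \<gamma>) = pblank n \<gamma>"
    proof -
      have "simple_act k \<gamma> i = Blank \<longleftrightarrow> \<gamma> i = Blank" for i
        using True by (auto simp: e)
      then show ?thesis by (simp add: pblank_def)
    qed
    ultimately show ?thesis by (simp add: plen_def finite_pairs)
  qed
qed

lemma dn_plen: "valid n \<gamma> \<Longrightarrow> dn n k \<gamma> \<delta> \<Longrightarrow> plen n \<delta> < plen n \<gamma>"
  using dn_props[of n \<gamma> k \<delta>] plen_simple_act[of n \<delta> k] by auto


section \<open>A family of elements indexed by preclans\<close>

lemma sconj_sign: "is_sign c \<Longrightarrow> sconj k (\<gamma>(x := c)) = (sconj k \<gamma>)(simple_refl k x := c)"
  by (simp add: sconj_upd)

lemma descD: "desc n \<gamma> k \<Longrightarrow> 1 \<le> k \<and> k < n \<and> \<gamma> k \<noteq> Blank \<and> key \<gamma> (Suc k) < key \<gamma> k"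
  by (simp add: desc_def)

lemma sconj_at:
  "sconj k \<gamma> k = map_mate (simple_refl k) (\<gamma> (Suc k))"
  "sconj k \<gamma> (Suc k) = map_mate (simple_refl k) (\<gamma> k)"
  "i \<noteq> k \<Longrightarrow> i \<noteq> Suc k \<Longrightarrow> sconj k \<gamma> i = map_mate (simple_refl k) (\<gamma> i)"
  by (simp_all add: sconj_def)

text \<open>The preclans that are not the result of any move. They turn out to have no arcs.\<close>

definition mini :: "nat \<Rightarrow> (nat \<Rightarrow> node) \<Rightarrow> bool" where
  "mini n \<gamma> \<longleftrightarrow> valid n \<gamma> \<and> (\<forall>k. \<not> desc n \<gamma> k)"

text \<open>Partners increase along a chain without descents, so an arc contains a descent.\<close>

lemma arc_desc:
  assumes v: "valid n \<gamma>" and ab: "\<gamma> a = Mate b" "a < b"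
  shows "\<exists>l. a \<le> l \<and> l < b \<and> desc n \<gamma> l"
proof (rule ccontr)
  assume no: "\<not> ?thesis"
  have r: "1 \<le> a" "b \<le> n" using valid_mate_range[OF v ab(1)] by auto
  have "a + d \<le> b \<longrightarrow> int b \<le> key \<gamma> (a + d) \<and> \<gamma> (a + d) \<noteq> Blank" for d
  proof (induction d)
    case 0
    then show ?case using ab by simp
  next
    case (Suc d)
    show ?case
    proof
      assume le: "a + Suc d \<le> b"
      then have IH: "int b \<le> key \<gamma> (a + d)" "\<gamma> (a + d) \<noteq> Blank" using Suc by auto
      have "\<not> desc n \<gamma> (a + d)" using no le by auto
      then have "key \<gamma> (a + d) \<le> key \<gamma> (Suc (a + d))" using IH(2) r le by (auto simp: desc_def)
      then show "int b \<le> key \<gamma> (a + Suc d) \<and> \<gamma> (a + Suc d) \<noteq> Blank" using IH(1) ab r by auto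
    qed
  qed
  from this[of "b - a"] have "int b \<le> key \<gamma> b" using ab by auto
  moreover have "key \<gamma> b = int a" using valid_mate[OF v ab(1)] by simp
  ultimately show False using ab by simp
qed

text \<open>The recursive definition of a family of elements along the moves, for arbitrary operators with
  the relations of divided differences. The assumptions on \<open>base\<close> are the relations between minimal
  preclans that the relations between the operators do not imply: they belong to the short arc, which
  is reached from two signs in either order, to an arc with one sign below it, and to equal
  neighbours.\<close>

locale dd_family =
  fixes D :: "nat \<Rightarrow> 'b::zero \<Rightarrow> 'b" and base :: "(nat \<Rightarrow> node) \<Rightarrow> 'b" and n :: nat
  assumes D_zero: "D k 0 = 0"
    and D_square: "D k (D k f) = 0"
    and D_comm: "Suc k < l \<Longrightarrow> D k (D l f) = D l (D k f)"
    and D_braid: "D k (D (Suc k) (D k f)) = D (Suc k) (D k (D (Suc k) f))"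
    and base_zero: "\<lbrakk>mini n \<gamma>; 1 \<le> k; k < n; \<gamma> k = \<gamma> (Suc k)\<rbrakk> \<Longrightarrow> D k (base \<gamma>) = 0"
    and base_pair: "\<lbrakk>mini n (\<gamma>(k := s, Suc k := t)); mini n (\<gamma>(k := t, Suc k := s)); 1 \<le> k; k < n;
        is_sign s; is_sign t; s \<noteq> t\<rbrakk>
      \<Longrightarrow> D k (base (\<gamma>(k := s, Suc k := t))) = D k (base (\<gamma>(k := t, Suc k := s)))"
    and base_triple: "\<lbrakk>mini n (\<gamma>(k := s, Suc k := s, Suc (Suc k) := t));
        mini n (\<gamma>(k := t, Suc k := s, Suc (Suc k) := s)); 1 \<le> k; Suc k < n;
        is_sign s; is_sign t; s \<noteq> t\<rbrakk>
      \<Longrightarrow> D k (D (Suc k) (base (\<gamma>(k := s, Suc k := s, Suc (Suc k) := t))))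
        = D (Suc k) (D k (base (\<gamma>(k := t, Suc k := s, Suc (Suc k) := s))))"
begin

lemma D_comm': "Suc k < l \<or> Suc l < k \<Longrightarrow> D k (D l f) = D l (D k f)"
  using D_comm by metis

definition down :: "nat \<Rightarrow> (nat \<Rightarrow> node) \<Rightarrow> nat \<Rightarrow> node" where
  "down k \<gamma> = (if \<gamma> k = Mate (Suc k) then \<gamma>(k := Minus, Suc k := Plus) else sconj k \<gamma>)"

lemma dn_down: "desc n \<gamma> k \<Longrightarrow> dn n k \<gamma> (down k \<gamma>)"
  unfolding down_def by (auto intro: dn_link dn_sconj)

function P :: "(nat \<Rightarrow> node) \<Rightarrow> 'b" where
  "P \<gamma> = (if valid n \<gamma> \<and> (\<exists>k. desc n \<gamma> k)
    then D (LEAST k. desc n \<gamma> k) (P (down (LEAST k. desc n \<gamma> k) \<gamma>)) else base \<gamma>)"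
  by auto
termination
proof (relation "measure (plen n)")
  fix \<gamma> assume a: "valid n \<gamma> \<and> (\<exists>k. desc n \<gamma> k)"
  then have "desc n \<gamma> (LEAST k. desc n \<gamma> k)" by (auto intro: LeastI)
  then show "(down (LEAST k. desc n \<gamma> k) \<gamma>, \<gamma>) \<in> measure (plen n)"
    using dn_plen[OF conjunct1[OF a] dn_down] by simp
qed simp

declare P.simps [simp del]

lemma P_mini: "mini n \<gamma> \<Longrightarrow> P \<gamma> = base \<gamma>"
  by (subst P.simps) (auto simp: mini_def)

lemma P_desc:
  assumes "valid n \<gamma>" "desc n \<gamma> k"
  shows "\<exists>l. desc n \<gamma> l \<and> P \<gamma> = D l (P (down l \<gamma>))"
proof -
  have "desc n \<gamma> (LEAST k. desc n \<gamma> k)" using assms(2) by (auto intro: LeastI)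
  then show ?thesis using assms by (subst P.simps) auto
qed

definition good :: "(nat \<Rightarrow> node) \<Rightarrow> bool" where
  "good \<gamma> \<longleftrightarrow> (\<forall>k \<delta>. dn n k \<gamma> \<delta> \<longrightarrow> P \<gamma> = D k (P \<delta>)) \<and>
     (\<forall>k. 1 \<le> k \<longrightarrow> k < n \<longrightarrow> \<gamma> k = \<gamma> (Suc k) \<longrightarrow> D k (P \<gamma>) = 0)"

context
  fixes \<gamma> :: "nat \<Rightarrow> node"
  assumes v: "valid n \<gamma>"
    and IH: "\<And>\<gamma>'. valid n \<gamma>' \<Longrightarrow> plen n \<gamma>' < plen n \<gamma> \<Longrightarrow> good \<gamma>'"
begin

text \<open>The preclans to which the induction hypothesis applies.\<close>

definition below :: "(nat \<Rightarrow> node) \<Rightarrow> bool" where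
  "below \<delta> \<longleftrightarrow> valid n \<delta> \<and> plen n \<delta> < plen n \<gamma>"

lemma below_dn: "dn n k \<gamma> \<delta> \<Longrightarrow> below \<delta>"
  using dn_props(1)[OF v] dn_plen[OF v] by (auto simp: below_def)

lemma below_trans: "below \<delta> \<Longrightarrow> dn n k \<delta> \<epsilon> \<Longrightarrow> below \<epsilon> \<and> P \<delta> = D k (P \<epsilon>)"
  using dn_props(1)[of n \<delta> k \<epsilon>] dn_plen[of n \<delta> k \<epsilon>] IH[of \<delta>] by (auto simp: below_def good_def)

lemma below_zero: "below \<delta> \<Longrightarrow> 1 \<le> k \<Longrightarrow> k < n \<Longrightarrow> \<delta> k = \<delta> (Suc k) \<Longrightarrow> D k (P \<delta>) = 0"
  using IH[of \<delta>] by (auto simp: below_def good_def)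

text \<open>Both descents lead to the same element, for every choice of signs when a short arc is undone.\<close>

definition consistent :: "nat \<Rightarrow> nat \<Rightarrow> bool" where
  "consistent i j \<longleftrightarrow> (\<forall>\<delta> \<epsilon>. dn n i \<gamma> \<delta> \<longrightarrow> dn n j \<gamma> \<epsilon> \<longrightarrow> D i (P \<delta>) = D j (P \<epsilon>))"

lemma consistent_sym: "consistent i j \<Longrightarrow> consistent j i"
  unfolding consistent_def by metis

lemma consistent_trans: "consistent i l \<Longrightarrow> consistent l j \<Longrightarrow> desc n \<gamma> l \<Longrightarrow> consistent i j"
  unfolding consistent_def using dn_down by metis

text \<open>Distant descents commute, unless they exchange the ends of the same two arcs; then undoing one of
  them also removes the other.\<close>

lemma desc_far_sconj:
  assumes i: "desc n \<gamma> i" "\<gamma> i \<noteq> Mate (Suc i)" and j: "desc n \<gamma> j" and ij: "Suc i < j \<or> Suc j < i"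
    and ns: "\<not> (\<gamma> j = Mate (Suc i) \<and> \<gamma> (Suc j) = Mate i)"
  shows "desc n (sconj i \<gamma>) j"
proof -
  have d: "1 \<le> j" "j < n" "\<gamma> j \<noteq> Blank" "key \<gamma> (Suc j) < key \<gamma> j" using j by (auto simp: desc_def)
  have at: "sconj i \<gamma> j = map_mate (simple_refl i) (\<gamma> j)" "sconj i \<gamma> (Suc j) = map_mate (simple_refl i) (\<gamma> (Suc j))"
    using ij by (auto simp: sconj_def)
  show ?thesis
    unfolding desc_def at using d ns ij
    by (cases "\<gamma> j"; cases "\<gamma> (Suc j)") (auto simp: simple_refl_def')
qed

lemma consistent_far:
  assumes i: "desc n \<gamma> i" and j: "desc n \<gamma> j" and ij: "Suc i < j"
    and ns: "\<not> (\<gamma> i = Mate (Suc j) \<and> \<gamma> (Suc i) = Mate j)"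
  shows "consistent i j"
  unfolding consistent_def
proof (intro allI impI)
  fix \<delta> \<epsilon> assume di: "dn n i \<gamma> \<delta>" and dj: "dn n j \<gamma> \<epsilon>"
  have ij': "Suc i < j \<or> Suc j < i" "Suc j < i \<or> Suc i < j" using ij by auto
  have ns': "\<not> (\<gamma> j = Mate (Suc i) \<and> \<gamma> (Suc j) = Mate i)"
  proof
    assume a: "\<gamma> j = Mate (Suc i) \<and> \<gamma> (Suc j) = Mate i"
    then have "\<gamma> (Suc i) = Mate j" "\<gamma> i = Mate (Suc j)" using valid_mate[OF v] by blast+
    then show False using ns by blast
  qed
  have mi: "\<gamma> i = Mate (Suc i) \<Longrightarrow> \<gamma> (Suc i) = Mate i" and mj: "\<gamma> j = Mate (Suc j) \<Longrightarrow> \<gamma> (Suc j) = Mate j"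
    using valid_mate[OF v] by blast+
  have "\<exists>\<eta>. dn n j \<delta> \<eta> \<and> dn n i \<epsilon> \<eta>"
  proof (cases "\<gamma> i = Mate (Suc i)"; cases "\<gamma> j = Mate (Suc j)")
    assume ui: "\<gamma> i \<noteq> Mate (Suc i)" and uj: "\<gamma> j \<noteq> Mate (Suc j)"
    have \<delta>: "\<delta> = sconj i \<gamma>" and \<epsilon>: "\<epsilon> = sconj j \<gamma>" using di dj ui uj by (auto simp: dn_def)
    have "sconj i \<gamma> j \<noteq> Mate (Suc j)" "sconj j \<gamma> i \<noteq> Mate (Suc i)"
      using ui uj ij by (cases "\<gamma> j"; cases "\<gamma> i"; auto simp: sconj_def simple_refl_def')+
    then have "dn n j \<delta> (sconj j \<delta>)" "dn n i \<epsilon> (sconj i \<epsilon>)"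
      unfolding \<delta> \<epsilon> using desc_far_sconj[OF i ui j ij'(1) ns'] desc_far_sconj[OF j uj i ij'(2)] ns
      by (auto intro!: dn_sconj)
    moreover have "sconj j \<delta> = sconj i \<epsilon>" unfolding \<delta> \<epsilon> using sconj_comm[of i j \<gamma>] ij by simp
    ultimately show ?thesis by auto
  next
    assume ui: "\<gamma> i = Mate (Suc i)" and uj: "\<gamma> j \<noteq> Mate (Suc j)"
    obtain s t where st: "is_sign s" "is_sign t" "s \<noteq> t" "\<delta> = \<gamma>(i := s, Suc i := t)"
      using di ui by (auto simp: dn_def)
    have \<epsilon>: "\<epsilon> = sconj j \<gamma>" using dj uj by (auto simp: dn_def)
    have "desc n \<delta> j" "\<delta> j \<noteq> Mate (Suc j)" using j uj ij st by (auto simp: desc_def)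
    then have 1: "dn n j \<delta> (sconj j \<delta>)" by (rule dn_sconj)
    have "desc n (sconj j \<gamma>) i" using desc_far_sconj[OF j uj i ij'(2)] ns by blast
    moreover have "sconj j \<gamma> i = Mate (Suc i)" using ui ij by (simp add: sconj_def)
    ultimately have 2: "dn n i \<epsilon> (\<epsilon>(i := s, Suc i := t))" unfolding \<epsilon> using st by (intro dn_link)
    have "sconj j \<delta> = \<epsilon>(i := s, Suc i := t)"
      unfolding st(4) \<epsilon> using st(1,2) ij by (simp add: sconj_sign)
    then show ?thesis using 1 2 by auto
  next
    assume ui: "\<gamma> i \<noteq> Mate (Suc i)" and uj: "\<gamma> j = Mate (Suc j)"
    obtain s t where st: "is_sign s" "is_sign t" "s \<noteq> t" "\<epsilon> = \<gamma>(j := s, Suc j := t)"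
      using dj uj by (auto simp: dn_def)
    have \<delta>: "\<delta> = sconj i \<gamma>" using di ui by (auto simp: dn_def)
    have "desc n \<epsilon> i" "\<epsilon> i \<noteq> Mate (Suc i)" using i ui ij st by (auto simp: desc_def)
    then have 1: "dn n i \<epsilon> (sconj i \<epsilon>)" by (rule dn_sconj)
    have "desc n (sconj i \<gamma>) j" using desc_far_sconj[OF i ui j ij'(1) ns'] .
    moreover have "sconj i \<gamma> j = Mate (Suc j)" using uj ij by (simp add: sconj_def)
    ultimately have 2: "dn n j \<delta> (\<delta>(j := s, Suc j := t))" unfolding \<delta> using st by (intro dn_link)
    have "sconj i \<epsilon> = \<delta>(j := s, Suc j := t)"
      unfolding st(4) \<delta> using st(1,2) ij by (simp add: sconj_sign)
    then show ?thesis using 1 2 by auto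
  next
    assume ui: "\<gamma> i = Mate (Suc i)" and uj: "\<gamma> j = Mate (Suc j)"
    obtain s t where st: "is_sign s" "is_sign t" "s \<noteq> t" "\<epsilon> = \<gamma>(j := s, Suc j := t)"
      using dj uj by (auto simp: dn_def)
    obtain s' t' where st': "is_sign s'" "is_sign t'" "s' \<noteq> t'" "\<delta> = \<gamma>(i := s', Suc i := t')"
      using di ui by (auto simp: dn_def)
    have "dn n j \<delta> (\<delta>(j := s, Suc j := t))"
      using st j uj ij st'(4) by (intro dn_link) (auto simp: desc_def)
    moreover have "dn n i \<epsilon> (\<epsilon>(i := s', Suc i := t'))"
      using st' i ui ij st(4) by (intro dn_link) (auto simp: desc_def)
    moreover have "\<delta>(j := s, Suc j := t) = \<epsilon>(i := s', Suc i := t')"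
      unfolding st(4) st'(4) using ij by (auto simp: fun_eq_iff)
    ultimately show ?thesis by auto
  qed
  then obtain \<eta> where \<eta>: "dn n j \<delta> \<eta>" "dn n i \<epsilon> \<eta>" by blast
  have "P \<delta> = D j (P \<eta>)" "P \<epsilon> = D i (P \<eta>)"
    using below_trans[OF below_dn[OF di] \<eta>(1)] below_trans[OF below_dn[OF dj] \<eta>(2)] by auto
  then show "D i (P \<delta>) = D j (P \<epsilon>)" using D_comm[OF ij] by simp
qed

text \<open>Shifting contents by at most two places does not change the order of their keys if neither content has
  a partner in the places concerned.\<close>

lemma nkey_shift:
  assumes "nkey y b < nkey x a" "x < y" "x' < y'" "1 \<le> i" "a \<noteq> Blank"
    "{x, y, x', y'} \<subseteq> {i, Suc i, Suc (Suc i)}"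
    "\<And>l. a = Mate l \<Longrightarrow> l \<notin> {i, Suc i, Suc (Suc i)}" "\<And>l. b = Mate l \<Longrightarrow> l \<notin> {i, Suc i, Suc (Suc i)}"
  shows "nkey y' b < nkey x' a"
proof (cases a)
  case (Mate l)
  then have "l < i \<or> Suc (Suc i) < l" using assms(7)[of l] by auto
  then show ?thesis
  proof (cases b)
    case (Mate l')
    then show ?thesis using assms(1) \<open>a = Mate l\<close> by simp
  qed (use assms(1-6) Mate \<open>l < i \<or> Suc (Suc i) < l\<close> in auto)
next
  case Plus
  show ?thesis
  proof (cases b)
    case (Mate l')
    then have "l' < i \<or> Suc (Suc i) < l'" using assms(8)[of l'] by auto
    then show ?thesis using assms(1-6) Mate Plus by auto
  qed (use assms(1-6) Plus in auto)
next
  case Minus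
  show ?thesis
  proof (cases b)
    case (Mate l')
    then have "l' < i \<or> Suc (Suc i) < l'" using assms(8)[of l'] by auto
    then show ?thesis using assms(1-6) Mate Minus by auto
  qed (use assms(1-6) Minus in auto)
qed (use assms in auto)

text \<open>Two neighbouring descents on three distinct contents satisfy the braid relation.\<close>

lemma consistent_adj_generic:
  assumes i: "desc n \<gamma> i" and j: "desc n \<gamma> (Suc i)"
    and u: "\<gamma> i \<noteq> Mate (Suc i)" "\<gamma> (Suc i) \<noteq> Mate (Suc (Suc i))" "\<gamma> i \<noteq> Mate (Suc (Suc i))"
  shows "consistent i (Suc i)"
  unfolding consistent_def
proof (intro allI impI)
  fix \<delta> \<epsilon> assume di: "dn n i \<gamma> \<delta>" and dj: "dn n (Suc i) \<gamma> \<epsilon>"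
  let ?j = "Suc i" and ?k = "Suc (Suc i)"
  have \<delta>: "\<delta> = sconj i \<gamma>" and \<epsilon>: "\<epsilon> = sconj ?j \<gamma>" using di dj u by (auto simp: dn_def)
  have ne: "\<gamma> i \<noteq> Mate i" "\<gamma> ?j \<noteq> Mate ?j" "\<gamma> ?k \<noteq> Mate ?k"
    "\<gamma> ?j \<noteq> Mate i" "\<gamma> ?k \<noteq> Mate i" "\<gamma> ?k \<noteq> Mate ?j"
    using valid_mate_ne[OF v] u valid_mate[OF v, of ?j i] valid_mate[OF v, of ?k i] valid_mate[OF v, of ?k ?j]
    by auto
  have out: "map_mate f c = c" if "c \<in> {\<gamma> i, \<gamma> ?j, \<gamma> ?k}" "\<And>x. x \<notin> {i, ?j, ?k} \<Longrightarrow> f x = x" for f c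
  proof (rule map_mate_id)
    fix x assume "c = Mate x"
    then have "x \<notin> {i, ?j, ?k}" using that(1) ne u by auto
    then show "f x = x" by (rule that(2))
  qed
  have s: "simple_refl i x = x" "simple_refl ?j x = x" if "x \<notin> {i, ?j, ?k}" for x
    using that by (auto simp: simple_refl_def')
  have o: "map_mate (simple_refl i) (\<gamma> i) = \<gamma> i" "map_mate (simple_refl i) (\<gamma> ?j) = \<gamma> ?j"
    "map_mate (simple_refl i) (\<gamma> ?k) = \<gamma> ?k" "map_mate (simple_refl ?j) (\<gamma> i) = \<gamma> i"
    "map_mate (simple_refl ?j) (\<gamma> ?j) = \<gamma> ?j" "map_mate (simple_refl ?j) (\<gamma> ?k) = \<gamma> ?k"
    by (rule out, simp, rule s, assumption)+
  have \<delta>c: "\<delta> i = \<gamma> ?j" "\<delta> ?j = \<gamma> i" "\<delta> ?k = \<gamma> ?k"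
    unfolding \<delta> by (simp_all add: sconj_at o)
  have \<epsilon>c: "\<epsilon> i = \<gamma> i" "\<epsilon> ?j = \<gamma> ?k" "\<epsilon> ?k = \<gamma> ?j"
    unfolding \<epsilon> by (simp_all add: sconj_at o)
  define \<delta>' where "\<delta>' = sconj ?j \<delta>"
  define \<epsilon>' where "\<epsilon>' = sconj i \<epsilon>"
  have \<delta>'c: "\<delta>' i = \<gamma> ?j" "\<delta>' ?j = \<gamma> ?k" "\<delta>' ?k = \<gamma> i"
    unfolding \<delta>'_def by (simp_all add: sconj_at \<delta>c o)
  have \<epsilon>'c: "\<epsilon>' i = \<gamma> ?k" "\<epsilon>' ?j = \<gamma> i" "\<epsilon>' ?k = \<gamma> ?j"
    unfolding \<epsilon>'_def by (simp_all add: sconj_at \<epsilon>c o)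
  note d = descD[OF i] descD[OF j]
  have ds: "desc n \<delta> ?j" "desc n \<delta>' i" "desc n \<epsilon> i" "desc n \<epsilon>' ?j"
  proof -
    have w: "\<gamma> i = Mate l \<Longrightarrow> l \<notin> {i, ?j, ?k}" "\<gamma> ?j = Mate l \<Longrightarrow> l \<notin> {i, ?j, ?k}"
      "\<gamma> ?k = Mate l \<Longrightarrow> l \<notin> {i, ?j, ?k}" for l using ne u by auto
    have ac: "nkey ?k (\<gamma> ?k) < nkey i (\<gamma> i)" using d by simp
    have "nkey ?k (\<gamma> ?k) < nkey ?j (\<gamma> i)" "nkey ?j (\<gamma> ?k) < nkey i (\<gamma> i)"
      by (rule nkey_shift[OF ac, of _ _ i]; use d w in auto)+
    moreover have "nkey ?k (\<gamma> ?j) < nkey ?j (\<gamma> i)"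
      by (rule nkey_shift[of ?j "\<gamma> ?j" i "\<gamma> i" _ _ i]; use d w in auto)
    moreover have "nkey ?j (\<gamma> ?k) < nkey i (\<gamma> ?j)"
      by (rule nkey_shift[of ?k "\<gamma> ?k" ?j "\<gamma> ?j" _ _ i]; use d w in auto)
    ultimately show "desc n \<delta> ?j" "desc n \<delta>' i" "desc n \<epsilon> i" "desc n \<epsilon>' ?j"
      using d by (auto simp: desc_def \<delta>c \<epsilon>c \<delta>'c \<epsilon>'c)
  qed
  have "dn n ?j \<delta> \<delta>'" "dn n i \<delta>' (sconj i \<delta>')" "dn n i \<epsilon> \<epsilon>'" "dn n ?j \<epsilon>' (sconj ?j \<epsilon>')"
    using dn_sconj[OF ds(1)] dn_sconj[OF ds(2)] dn_sconj[OF ds(3)] dn_sconj[OF ds(4)] ne u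
    by (simp_all add: \<delta>c \<epsilon>c \<delta>'c \<epsilon>'c flip: \<delta>'_def \<epsilon>'_def)
  then have "P \<delta> = D ?j (D i (P (sconj i \<delta>')))" "P \<epsilon> = D i (D ?j (P (sconj ?j \<epsilon>')))"
    using below_dn[OF di] below_dn[OF dj] below_trans by metis+
  moreover have "sconj i \<delta>' = sconj ?j \<epsilon>'"
    unfolding \<delta>'_def \<epsilon>'_def \<delta> \<epsilon> by (rule sconj_braid)
  ultimately show "D i (P \<delta>) = D ?j (P \<epsilon>)" by (simp add: D_braid)
qed

text \<open>A short arc followed by a smaller content, and its mirror image. Moving the third content past both
  ends of the arc before or after undoing the arc gives the two sides of the braid relation.\<close>

lemma consistent_adj_left_arc:
  assumes i: "desc n \<gamma> i" and j: "desc n \<gamma> (Suc i)" and m: "\<gamma> i = Mate (Suc i)"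
  shows "consistent i (Suc i)"
  unfolding consistent_def
proof (intro allI impI)
  fix \<delta> \<epsilon> assume di: "dn n i \<gamma> \<delta>" and dj: "dn n (Suc i) \<gamma> \<epsilon>"
  let ?j = "Suc i" and ?k = "Suc (Suc i)"
  have m': "\<gamma> ?j = Mate i" using valid_mate[OF v m] .
  obtain s t where st: "is_sign s" "is_sign t" "s \<noteq> t" "\<delta> = \<gamma>(i := s, ?j := t)"
    using di m by (auto simp: dn_def)
  have \<epsilon>: "\<epsilon> = sconj ?j \<gamma>" using dj m' by (auto simp: dn_def)
  have c: "\<gamma> ?k = Blank \<or> (\<exists>l<i. \<gamma> ?k = Mate l)"
    using descD[OF j] m' by (cases "\<gamma> ?k") auto
  have r: "1 \<le> i" "?j < n" using i j by (auto simp: desc_def)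
  define \<delta>' where "\<delta>' = sconj ?j \<delta>"
  define \<theta> where "\<theta> = sconj i \<epsilon>"
  define \<eta> where "\<eta> = \<theta>(?j := s, ?k := t)"
  have \<delta>c: "\<delta> i = s" "\<delta> ?j = t" "\<delta> ?k = \<gamma> ?k" by (simp_all add: st(4))
  have \<delta>'c: "\<delta>' i = s" "\<delta>' ?j = \<gamma> ?k"
    unfolding \<delta>'_def using c st(1,2) by (auto simp: sconj_at \<delta>c)
  have \<epsilon>c: "\<epsilon> i = Mate ?k" "\<epsilon> ?j = \<gamma> ?k" "\<epsilon> ?k = Mate i"
    unfolding \<epsilon> using c m m' by (auto simp: sconj_at)
  have \<theta>c: "\<theta> ?j = Mate ?k" "\<theta> ?k = Mate ?j"
    unfolding \<theta>_def by (auto simp: sconj_at \<epsilon>c)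
  have "desc n \<delta> ?j" "\<delta> ?j \<noteq> Mate ?k"
    using c st(1,2) r by (auto simp: desc_def \<delta>c nkey_sign)
  then have 1: "dn n ?j \<delta> \<delta>'" unfolding \<delta>'_def by (rule dn_sconj)
  have "desc n \<delta>' i" "\<delta>' i \<noteq> Mate ?j"
    using c st(1,2) r by (auto simp: desc_def \<delta>'c nkey_sign)
  then have 2: "dn n i \<delta>' (sconj i \<delta>')" by (rule dn_sconj)
  have "desc n \<epsilon> i" "\<epsilon> i \<noteq> Mate ?j"
    using c r by (auto simp: desc_def \<epsilon>c)
  then have 3: "dn n i \<epsilon> \<theta>" unfolding \<theta>_def by (rule dn_sconj)
  have "desc n \<theta> ?j" using r by (auto simp: desc_def \<theta>c)
  then have 4: "dn n ?j \<theta> \<eta>" unfolding \<eta>_def using st \<theta>c by (intro dn_link)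
  have "sconj i \<delta>' = \<eta>"
    unfolding \<delta>'_def \<eta>_def \<theta>_def \<epsilon> st(4) using st(1,2)
    by (simp add: sconj_sign simple_refl_def')
  then have "P \<delta> = D ?j (D i (P \<eta>))" "P \<epsilon> = D i (D ?j (P \<eta>))"
    using below_dn[OF di] below_dn[OF dj] below_trans 1 2 3 4 by metis+
  then show "D i (P \<delta>) = D ?j (P \<epsilon>)" by (simp add: D_braid)
qed

lemma consistent_adj_right_arc:
  assumes i: "desc n \<gamma> i" and j: "desc n \<gamma> (Suc i)" and m: "\<gamma> (Suc i) = Mate (Suc (Suc i))"
  shows "consistent i (Suc i)"
  unfolding consistent_def
proof (intro allI impI)
  fix \<delta> \<epsilon> assume di: "dn n i \<gamma> \<delta>" and dj: "dn n (Suc i) \<gamma> \<epsilon>"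
  let ?j = "Suc i" and ?k = "Suc (Suc i)"
  have m': "\<gamma> ?k = Mate ?j" using valid_mate[OF v m] .
  obtain s t where st: "is_sign s" "is_sign t" "s \<noteq> t" "\<epsilon> = \<gamma>(?j := s, ?k := t)"
    using dj m by (auto simp: dn_def)
  have c: "\<exists>l>?k. \<gamma> i = Mate l"
    using descD[OF i] m by (cases "\<gamma> i") auto
  then have \<delta>: "\<delta> = sconj i \<gamma>" using di by (auto simp: dn_def)
  have r: "1 \<le> i" "?j < n" using i j by (auto simp: desc_def)
  define \<epsilon>' where "\<epsilon>' = sconj i \<epsilon>"
  define \<theta> where "\<theta> = sconj ?j \<delta>"
  define \<eta> where "\<eta> = \<theta>(i := s, ?j := t)"
  have \<epsilon>c: "\<epsilon> i = \<gamma> i" "\<epsilon> ?j = s" "\<epsilon> ?k = t" by (simp_all add: st(4))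
  have \<epsilon>'c: "\<epsilon>' ?j = \<gamma> i" "\<epsilon>' ?k = t"
    unfolding \<epsilon>'_def using c st(1,2) by (auto simp: sconj_at \<epsilon>c)
  have \<delta>c: "\<delta> i = Mate ?k" "\<delta> ?j = \<gamma> i" "\<delta> ?k = Mate i"
    unfolding \<delta> using c m m' by (auto simp: sconj_at)
  have \<theta>c: "\<theta> i = Mate ?j" "\<theta> ?j = Mate i"
    unfolding \<theta>_def by (auto simp: sconj_at \<delta>c)
  have "desc n \<epsilon> i" "\<epsilon> i \<noteq> Mate ?j"
    using c st(1,2) r by (auto simp: desc_def \<epsilon>c nkey_sign)
  then have 1: "dn n i \<epsilon> \<epsilon>'" unfolding \<epsilon>'_def by (rule dn_sconj)
  have "desc n \<epsilon>' ?j" "\<epsilon>' ?j \<noteq> Mate ?k"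
    using c st(1,2) r by (auto simp: desc_def \<epsilon>'c nkey_sign)
  then have 2: "dn n ?j \<epsilon>' (sconj ?j \<epsilon>')" by (rule dn_sconj)
  have "desc n \<delta> ?j" "\<delta> ?j \<noteq> Mate ?k"
    using c r by (auto simp: desc_def \<delta>c)
  then have 3: "dn n ?j \<delta> \<theta>" unfolding \<theta>_def by (rule dn_sconj)
  have "desc n \<theta> i" using r by (auto simp: desc_def \<theta>c)
  then have 4: "dn n i \<theta> \<eta>" unfolding \<eta>_def using st \<theta>c by (intro dn_link)
  have "sconj ?j \<epsilon>' = \<eta>"
    unfolding \<epsilon>'_def \<eta>_def \<theta>_def \<delta> st(4) using st(1,2)
    by (simp add: sconj_sign simple_refl_def')
  then have "P \<epsilon> = D i (D ?j (P \<eta>))" "P \<delta> = D ?j (D i (P \<eta>))"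
    using below_dn[OF di] below_dn[OF dj] below_trans 1 2 3 4 by metis+
  then show "D i (P \<delta>) = D ?j (P \<epsilon>)" by (simp add: D_braid)
qed

lemma consistent_adj:
  assumes "desc n \<gamma> i" "desc n \<gamma> (Suc i)" "\<gamma> i \<noteq> Mate (Suc (Suc i))"
  shows "consistent i (Suc i)"
proof (cases "\<gamma> i = Mate (Suc i)")
  case True
  then show ?thesis using consistent_adj_left_arc[OF assms(1,2)] by simp
next
  case False
  then show ?thesis
    using consistent_adj_right_arc[OF assms(1,2)] consistent_adj_generic[OF assms(1,2) False _ assms(3)] by metis
qed

text \<open>If two nested arcs have neighbouring left ends and neighbouring right ends, there is a third
  descent below the inner arc, through which the two descents are compared.\<close>

lemma consistent_shared:
  assumes i: "desc n \<gamma> i" and j: "desc n \<gamma> j" and ij: "Suc i < j"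
    and s: "\<gamma> i = Mate (Suc j)" "\<gamma> (Suc i) = Mate j"
  shows "consistent i j"
proof -
  have s': "\<gamma> (Suc j) = Mate i" "\<gamma> j = Mate (Suc i)" using valid_mate[OF v s(1)] valid_mate[OF v s(2)] .
  obtain l where l: "Suc i \<le> l" "l < j" "desc n \<gamma> l" using arc_desc[OF v s(2) ij] by blast
  have "consistent i l"
  proof (cases "l = Suc i")
    case True
    then show ?thesis using consistent_adj[OF i] l s ij by auto
  next
    case False
    then show ?thesis using l s by (intro consistent_far[OF i l(3)]) auto
  qed
  moreover have "consistent l j"
  proof (cases "j = Suc l")
    case True
    then have "\<gamma> l \<noteq> Mate (Suc j)" using s'(1) l(1) valid_mate[OF v, of l "Suc j"] by auto
    then show ?thesis using consistent_adj[OF l(3)] True j by auto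
  next
    case False
    have "\<gamma> (Suc l) \<noteq> Mate j" using s'(2) l(1) valid_mate[OF v, of "Suc l" j] by auto
    then show ?thesis using l False by (intro consistent_far[OF l(3) j]) auto
  qed
  ultimately show ?thesis using consistent_trans l(3) by blast
qed

lemma mini_below: "below \<delta> \<Longrightarrow> (\<And>k. \<not> desc n \<delta> k) \<Longrightarrow> mini n \<delta>"
  by (auto simp: below_def mini_def)

text \<open>A sign \<open>s\<close> below an arc. Either there is another descent through which the two can be compared, or
  undoing the arc from both sides leads to the minimal preclans with the signs \<open>s s t\<close> and \<open>t s s\<close>.\<close>

lemma consistent_around:
  assumes i: "desc n \<gamma> i" and j: "desc n \<gamma> (Suc i)" and m: "\<gamma> i = Mate (Suc (Suc i))"
  shows "consistent i (Suc i)"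
proof -
  let ?j = "Suc i" and ?k = "Suc (Suc i)"
  have m': "\<gamma> ?k = Mate i" using valid_mate[OF v m] .
  have sg: "is_sign (\<gamma> ?j)"
  proof (cases "\<gamma> ?j")
    case (Mate l)
    then have "i < l" "l < ?k" using descD[OF i] descD[OF j] m m' by auto
    then show ?thesis using Mate valid_mate_ne[OF v, of ?j] by (simp add: less_Suc_eq_le)
  qed (use descD[OF j] in auto)
  have r: "1 \<le> i" "?j < n" using i j by (auto simp: desc_def)
  show ?thesis
  proof (cases "\<exists>l. desc n \<gamma> l \<and> l \<noteq> i \<and> l \<noteq> ?j")
    case True
    then obtain l where l: "desc n \<gamma> l" "l \<noteq> i" "l \<noteq> ?j" by blast
    have nmj: "\<gamma> ?j \<noteq> Mate x" "\<gamma> x \<noteq> Mate ?j" for x using sg valid_mate[OF v, of x ?j] by auto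
    have nmi: "\<gamma> x \<noteq> Mate ?k" if "x \<noteq> i" for x using that valid_mate[OF v, of x ?k] m' by auto
    consider "Suc l = i" | "Suc l < i" | "l = ?k" | "?k < l" using l by linarith
    then have "consistent i l \<and> consistent l ?j"
    proof cases
      case 1
      then have "consistent l i" using consistent_adj[OF l(1)] i nmj by auto
      moreover have "consistent l ?j" using 1 nmi by (intro consistent_far[OF l(1) j]) auto
      ultimately show ?thesis using consistent_sym by blast
    next
      case 2
      then have "consistent l i" using nmj by (intro consistent_far[OF l(1) i]) auto
      moreover have "consistent l ?j" using 2 nmi by (intro consistent_far[OF l(1) j]) auto
      ultimately show ?thesis using consistent_sym by blast
    next
      case 3
      have "consistent i l" using 3 m by (intro consistent_far[OF i l(1)]) auto
      moreover have "consistent ?j l" using consistent_adj[OF j] l(1) 3 nmj by auto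
      ultimately show ?thesis using consistent_sym by blast
    next
      case 4
      have "consistent i l" using 4 m by (intro consistent_far[OF i l(1)]) auto
      moreover have "consistent ?j l" using 4 nmj by (intro consistent_far[OF j l(1)]) auto
      ultimately show ?thesis using consistent_sym by blast
    qed
    then show ?thesis using consistent_trans l(1) by blast
  next
    case False
    show ?thesis
      unfolding consistent_def
    proof (intro allI impI)
      fix \<delta> \<epsilon> assume di: "dn n i \<gamma> \<delta>" and dj: "dn n ?j \<gamma> \<epsilon>"
      define s where "s = \<gamma> ?j"
      define t where "t = (if s = Plus then Minus else Plus)"
      have st: "is_sign s" "is_sign t" "s \<noteq> t" using sg by (auto simp: s_def t_def is_sign_def)
      have "\<gamma> ?j \<noteq> Mate ?k" using sg by auto
      then have \<delta>: "\<delta> = sconj i \<gamma>" and \<epsilon>: "\<epsilon> = sconj ?j \<gamma>" using di dj m by (auto simp: dn_def)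
      have \<delta>c: "\<delta> i = s" "\<delta> ?j = Mate ?k" "\<delta> ?k = Mate ?j"
        unfolding \<delta> using m m' sg by (auto simp: sconj_at s_def)
      have \<epsilon>c: "\<epsilon> i = Mate ?j" "\<epsilon> ?j = Mate i" "\<epsilon> ?k = s"
        unfolding \<epsilon> using m m' sg by (auto simp: sconj_at s_def)
      have oth: "\<delta> x = \<gamma> x" "\<epsilon> x = \<gamma> x" if "x \<notin> {i, ?j, ?k}" for x
      proof -
        have "\<gamma> x \<noteq> Mate i" "\<gamma> x \<noteq> Mate ?j" "\<gamma> x \<noteq> Mate ?k"
          using that valid_mate[OF v, of x i] valid_mate[OF v, of x ?j] valid_mate[OF v, of x ?k] m m' sg by auto
        then show "\<delta> x = \<gamma> x" "\<epsilon> x = \<gamma> x" unfolding \<delta> \<epsilon> using that by (auto intro!: sconj_other)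
      qed
      let ?\<delta> = "\<gamma>(i := s, ?j := s, ?k := t)" and ?\<epsilon> = "\<gamma>(i := t, ?j := s, ?k := s)"
      have e\<delta>: "\<delta>(?j := s, ?k := t) = ?\<delta>"
      proof
        fix x show "(\<delta>(?j := s, ?k := t)) x = ?\<delta> x" using \<delta>c oth(1)[of x] by auto
      qed
      have e\<epsilon>: "\<epsilon>(i := t, ?j := s) = ?\<epsilon>"
      proof
        fix x show "(\<epsilon>(i := t, ?j := s)) x = ?\<epsilon> x" using \<epsilon>c oth(2)[of x] by auto
      qed
      have "dn n ?j \<delta> (\<delta>(?j := s, ?k := t))"
        using st \<delta>c r by (intro dn_link) (auto simp: desc_def)
      then have 1: "below ?\<delta>" "P \<delta> = D ?j (P ?\<delta>)" using below_trans[OF below_dn[OF di]] e\<delta> by auto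
      have "dn n i \<epsilon> (\<epsilon>(i := t, ?j := s))"
        using st \<epsilon>c r by (intro dn_link) (auto simp: desc_def)
      then have 2: "below ?\<epsilon>" "P \<epsilon> = D i (P ?\<epsilon>)" using below_trans[OF below_dn[OF dj]] e\<epsilon> by auto
      have nod: "\<not> desc n \<zeta> x" if \<zeta>: "\<And>y. y \<notin> {i, ?j, ?k} \<Longrightarrow> \<zeta> y = \<gamma> y"
        "is_sign (\<zeta> i)" "is_sign (\<zeta> ?j)" "is_sign (\<zeta> ?k)" for \<zeta> x
      proof
        assume x: "desc n \<zeta> x"
        note dx = descD[OF x]
        consider "x = i" | "x = ?j" | "Suc x = i" | "x = ?k" | "Suc x < i" | "?k < x" by linarith
        then show False
        proof cases
          case 1
          then show ?thesis using dx \<zeta>(2-4) by (simp add: nkey_sign)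
        next
          case 2
          then show ?thesis using dx \<zeta>(2-4) by (simp add: nkey_sign)
        next
          case 3
          then have "\<zeta> x = \<gamma> x" using \<zeta>(1) by auto
          then have "\<gamma> x \<noteq> Blank" "int i < key \<gamma> x" using dx 3 \<zeta>(2) by (auto simp: nkey_sign)
          moreover have "\<gamma> x \<noteq> Mate ?j" "\<gamma> x \<noteq> Mate ?k"
            using 3 valid_mate[OF v, of x ?j] valid_mate[OF v, of x ?k] m' sg by auto
          ultimately have "int ?k < key \<gamma> x" using 3 by (cases "\<gamma> x") auto
          then have "desc n \<gamma> x" using \<open>\<gamma> x \<noteq> Blank\<close> dx m 3 by (auto simp: desc_def)
          then show ?thesis using False 3 by auto
        next
          case 4
          then have z: "\<zeta> (Suc x) = \<gamma> (Suc x)" using \<zeta>(1) by auto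
          then have lt: "key \<gamma> (Suc x) < int ?k" using dx 4 \<zeta>(4) by (auto simp: nkey_sign)
          moreover have "\<gamma> (Suc x) \<noteq> Mate i" "\<gamma> (Suc x) \<noteq> Mate ?j"
            using 4 valid_mate[OF v, of "Suc x" i] valid_mate[OF v, of "Suc x" ?j] m sg by auto
          ultimately have "key \<gamma> (Suc x) < int i" using 4 r by (cases "\<gamma> (Suc x)") auto
          then have "desc n \<gamma> x" using dx m' 4 by (auto simp: desc_def)
          then show ?thesis using False 4 by auto
        next
          case 5
          then have "\<zeta> x = \<gamma> x" "\<zeta> (Suc x) = \<gamma> (Suc x)" using \<zeta>(1) by auto
          then have "desc n \<gamma> x" using x by (simp add: desc_def)
          then show ?thesis using False 5 by auto
        next
          case 6
          then have "\<zeta> x = \<gamma> x" "\<zeta> (Suc x) = \<gamma> (Suc x)" using \<zeta>(1) by auto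
          then have "desc n \<gamma> x" using x by (simp add: desc_def)
          then show ?thesis using False 6 by auto
        qed
      qed
      have 3: "mini n ?\<delta>" "mini n ?\<epsilon>"
        using mini_below[OF 1(1)] mini_below[OF 2(1)] nod st by auto
      show "D i (P \<delta>) = D ?j (P \<epsilon>)"
        unfolding 1(2) 2(2) P_mini[OF 3(1)] P_mini[OF 3(2)] using base_triple[OF 3 r st] .
    qed
  qed
qed

text \<open>Undoing a short arc gives two orders of the signs. They are compared through another descent, or both
  preclans are minimal.\<close>

lemma consistent_self:
  assumes i: "desc n \<gamma> i"
  shows "consistent i i"
proof (cases "\<gamma> i = Mate (Suc i)")
  case False
  then show ?thesis by (simp add: consistent_def dn_def)
next
  case m: True
  have m': "\<gamma> (Suc i) = Mate i" using valid_mate[OF v m] .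
  show ?thesis
  proof (cases "\<exists>l. desc n \<gamma> l \<and> l \<noteq> i")
    case True
    then obtain l where l: "desc n \<gamma> l" "l \<noteq> i" by blast
    consider "Suc l = i" | "Suc l < i" | "l = Suc i" | "Suc i < l" using l by linarith
    then have "consistent i l"
    proof cases
      case 1
      have "\<gamma> l \<noteq> Mate (Suc i)" using 1 valid_mate[OF v, of l "Suc i"] m' by auto
      then show ?thesis using consistent_adj[OF l(1)] i 1 consistent_sym by auto
    next
      case 2
      have "\<gamma> (Suc l) \<noteq> Mate i" using 2 valid_mate[OF v, of "Suc l" i] m by auto
      then show ?thesis using consistent_far[OF l(1) i] 2 consistent_sym by auto
    next
      case 3
      then show ?thesis using consistent_adj[OF i] l m by auto
    next
      case 4
      then show ?thesis using consistent_far[OF i l(1)] m by auto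
    qed
    then show ?thesis using consistent_trans consistent_sym l(1) by blast
  next
    case False
    have r: "1 \<le> i" "i < n" using i by (auto simp: desc_def)
    show ?thesis
      unfolding consistent_def
    proof (intro allI impI)
      fix \<delta> \<epsilon> assume di: "dn n i \<gamma> \<delta>" and dj: "dn n i \<gamma> \<epsilon>"
      have mini: "mini n (\<gamma>(i := s, Suc i := t))" if d: "dn n i \<gamma> (\<gamma>(i := s, Suc i := t))" and st: "is_sign s" "is_sign t" for s t
      proof (rule mini_below[OF below_dn[OF d]], rule notI)
        let ?\<zeta> = "\<gamma>(i := s, Suc i := t)"
        fix x assume x: "desc n ?\<zeta> x"
        note dx = descD[OF x]
        have xr: "1 \<le> x" "x < n" using dx by auto
        consider "x = i" | "Suc x = i" | "x = Suc i" | "Suc x < i" | "Suc i < x" by linarith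
        then show False
        proof cases
          case 1
          then show ?thesis using dx st by (simp add: nkey_sign)
        next
          case 2
          then have "\<gamma> x \<noteq> Blank" "int i < key \<gamma> x" using dx st by (auto simp: nkey_sign)
          moreover have "\<gamma> x \<noteq> Mate (Suc i)" using 2 valid_mate[OF v, of x "Suc i"] m' by auto
          ultimately have "int (Suc i) < key \<gamma> x" using 2 by (cases "\<gamma> x") auto
          moreover have "key \<gamma> (Suc x) = int (Suc i)" using 2 m by simp
          ultimately have "desc n \<gamma> x" using \<open>\<gamma> x \<noteq> Blank\<close> xr by (simp add: desc_def)
          then show ?thesis using False 2 by auto
        next
          case 3
          then have "key \<gamma> (Suc x) < int (Suc i)" using dx st by (auto simp: nkey_sign)
          moreover have "\<gamma> (Suc x) \<noteq> Mate i" using 3 valid_mate[OF v, of "Suc x" i] m by auto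
          ultimately have a: "key \<gamma> (Suc x) < int i" using 3 r by (cases "\<gamma> (Suc x)") auto
          have b: "\<gamma> x = Mate i" using 3 m' by simp
          have "desc n \<gamma> x" unfolding desc_def b using xr a by simp
          then show ?thesis using False 3 by (metis n_not_Suc_n)
        next
          case 4
          then have "?\<zeta> x = \<gamma> x" "?\<zeta> (Suc x) = \<gamma> (Suc x)" by auto
          then have "desc n \<gamma> x" using x unfolding desc_def by metis
          then show ?thesis using False 4 by auto
        next
          case 5
          then have "?\<zeta> x = \<gamma> x" "?\<zeta> (Suc x) = \<gamma> (Suc x)" by auto
          then have "desc n \<gamma> x" using x unfolding desc_def by metis
          then show ?thesis using False 5 by auto
        qed
      qed
      obtain s t where st: "is_sign s" "is_sign t" "s \<noteq> t" "\<delta> = \<gamma>(i := s, Suc i := t)"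
        using di m by (auto simp: dn_def)
      obtain s' t' where st': "is_sign s'" "is_sign t'" "s' \<noteq> t'" "\<epsilon> = \<gamma>(i := s', Suc i := t')"
        using dj m by (auto simp: dn_def)
      have mm: "mini n (\<gamma>(i := s, Suc i := t))" "mini n (\<gamma>(i := s', Suc i := t'))"
        using mini di dj st st' by auto
      have "s' = s \<and> t' = t \<or> s' = t \<and> t' = s" using st st' by (auto simp: is_sign_def)
      then show "D i (P \<delta>) = D i (P \<epsilon>)"
      proof
        assume a: "s' = t \<and> t' = s"
        then have "D i (base (\<gamma>(i := s, Suc i := t))) = D i (base (\<gamma>(i := t, Suc i := s)))"
          using mm r st by (intro base_pair) auto
        then show ?thesis using P_mini[OF mm(1)] P_mini[OF mm(2)] st(4) st'(4) a by simp
      qed (use st(4) st'(4) in simp)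
    qed
  qed
qed

lemma consistent_all:
  assumes i: "desc n \<gamma> i" and j: "desc n \<gamma> j"
  shows "consistent i j"
proof -
  have *: "consistent i j" if i: "desc n \<gamma> i" and j: "desc n \<gamma> j" and ij: "i < j" for i j
  proof (cases "j = Suc i")
    case True
    then show ?thesis using consistent_adj[OF i] consistent_around[OF i] j by blast
  next
    case False
    then show ?thesis using consistent_far[OF i j] consistent_shared[OF i j] ij by (metis Suc_lessI)
  qed
  show ?thesis using *[OF i j] *[OF j i] consistent_self[OF i] consistent_sym by (metis linorder_neqE_nat)
qed

lemma P_dn:
  assumes d: "dn n k \<gamma> \<delta>"
  shows "P \<gamma> = D k (P \<delta>)"
proof -
  have k: "desc n \<gamma> k" using d by (simp add: dn_def)
  obtain l where l: "desc n \<gamma> l" "P \<gamma> = D l (P (down l \<gamma>))" using P_desc[OF v k] by blast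
  have "D l (P (down l \<gamma>)) = D k (P \<delta>)"
    using consistent_all[OF l(1) k] d dn_down[OF l(1)] unfolding consistent_def by blast
  then show ?thesis using l(2) by simp
qed

text \<open>For equal neighbours, a descent next to them moves a third content past one of them; moving it past
  both leaves equal neighbours at the adjacent place, and the braid relation carries the zero back.\<close>

lemma P_equal:
  assumes k: "1 \<le> k" "k < n" and e: "\<gamma> k = \<gamma> (Suc k)"
  shows "D k (P \<gamma>) = 0"
proof (cases "\<exists>l. desc n \<gamma> l")
  case False
  then have "mini n \<gamma>" using v by (auto simp: mini_def)
  then show ?thesis using base_zero[OF _ k e] P_mini by simp
next
  case True
  then obtain l where l: "desc n \<gamma> l" by blast
  have nm: "\<gamma> k \<noteq> Mate x" for x using e valid_mate[OF v, of k x] valid_mate[OF v, of "Suc k" x] by auto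
  have nmk: "\<gamma> x \<noteq> Mate k" "\<gamma> x \<noteq> Mate (Suc k)" for x
    using nm e valid_mate[OF v, of x k] valid_mate[OF v, of x "Suc k"] by auto
  have kc: "is_sign (\<gamma> k) \<or> \<gamma> k = Blank" using nm by (cases "\<gamma> k") auto
  have mk: "map_mate f (\<gamma> k) = \<gamma> k" for f using nm by (cases "\<gamma> k") auto
  let ?d = "down l \<gamma>"
  have dl: "dn n l \<gamma> ?d" using dn_down[OF l] .
  have Pl: "P \<gamma> = D l (P ?d)" by (rule P_dn[OF dl])
  have lk: "l \<noteq> k"
  proof
    assume "l = k"
    then have "\<gamma> k \<noteq> Blank" "nkey (Suc k) (\<gamma> k) < nkey k (\<gamma> k)" using descD[OF l] e by auto
    then show False using nm by (cases "\<gamma> k") auto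
  qed
  consider "Suc l < k \<or> Suc k < l" | "l = Suc k" | "k = Suc l" using lk by linarith
  then show ?thesis
  proof cases
    case 1
    have "?d k = ?d (Suc k)" using 1 e mk by (auto simp: down_def sconj_def)
    then have "D k (P ?d) = 0" using below_zero[OF below_dn[OF dl] k] by blast
    then show ?thesis unfolding Pl using D_comm'[of k l] 1 D_zero by metis
  next
    case 2
    have "\<gamma> l \<noteq> Blank" "key \<gamma> (Suc l) < key \<gamma> l" using descD[OF l] by auto
    then have s: "is_sign (\<gamma> k)" and lt: "key \<gamma> (Suc l) < int (Suc k)"
      using kc e[symmetric] 2 by (auto simp: nkey_sign)
    have c: "\<gamma> (Suc l) = Blank \<or> (\<exists>x<k. \<gamma> (Suc l) = Mate x)"
      using lt 2 nmk[of "Suc l"] by (cases "\<gamma> (Suc l)") (auto simp: less_Suc_eq)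
    have d: "?d = sconj l \<gamma>" using nm[of "Suc l"] e 2 by (simp add: down_def)
    have dc: "?d k = \<gamma> k" "?d l = \<gamma> (Suc l)" "?d (Suc l) = \<gamma> k"
      unfolding d using 2 mk e[symmetric] c by (auto simp: sconj_at)
    have "nkey (Suc k) (\<gamma> (Suc l)) < nkey k (\<gamma> k)" using s c k by (auto simp: nkey_sign)
    then have ds: "desc n ?d k" "?d k \<noteq> Mate (Suc k)" using dc 2 s k nm by (auto simp: desc_def)
    then have dk: "dn n k ?d (sconj k ?d)" by (rule dn_sconj)
    note b = below_trans[OF below_dn[OF dl] dk]
    have "sconj k ?d (Suc k) = \<gamma> k" "sconj k ?d (Suc (Suc k)) = \<gamma> k" using dc 2 mk by (auto simp: sconj_at)
    then have "D (Suc k) (P (sconj k ?d)) = 0" using b l 2 by (intro below_zero) (auto simp: desc_def)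
    then show ?thesis unfolding Pl using b 2 D_braid D_zero by simp
  next
    case 3
    have ln: "\<gamma> l \<noteq> Blank" "1 \<le> l" using l by (auto simp: desc_def)
    have lt: "key \<gamma> k < key \<gamma> l" using descD[OF l] 3 by simp
    have c: "(\<exists>x>Suc k. \<gamma> l = Mate x) \<or> \<gamma> k = Blank \<and> (is_sign (\<gamma> l) \<or> (\<exists>x. x \<notin> {l, k, Suc k} \<and> \<gamma> l = Mate x))"
    proof (cases "\<gamma> l")
      case (Mate x)
      then have "x \<notin> {l, k, Suc k}" using nmk[of l] valid_mate_ne[OF v, of l] by auto
      then show ?thesis using kc lt Mate by (auto simp: nkey_sign)
    qed (use ln kc lt 3 in \<open>auto simp: nkey_sign\<close>)
    have d: "?d = sconj l \<gamma>" using nmk[of l] 3 by (auto simp: down_def)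
    have dc: "?d l = \<gamma> k" "?d k = \<gamma> l" "?d (Suc k) = \<gamma> k"
      unfolding d using 3 mk e[symmetric] c by (auto simp: sconj_def simple_refl_def')
    have "nkey (Suc k) (\<gamma> k) < nkey k (\<gamma> l)"
      using c
    proof
      assume "\<exists>x>Suc k. \<gamma> l = Mate x"
      then show ?thesis using kc by (auto simp: nkey_sign)
    next
      assume "\<gamma> k = Blank \<and> (is_sign (\<gamma> l) \<or> (\<exists>x. x \<notin> {l, k, Suc k} \<and> \<gamma> l = Mate x))"
      then show ?thesis by (auto simp: nkey_sign)
    qed
    then have ds: "desc n ?d k" "?d k \<noteq> Mate (Suc k)"
      using dc c k ln by (auto simp: desc_def)
    then have dk: "dn n k ?d (sconj k ?d)" by (rule dn_sconj)
    note b = below_trans[OF below_dn[OF dl] dk]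
    have "sconj k ?d l = \<gamma> k" "sconj k ?d (Suc l) = \<gamma> k" using dc 3 mk by (auto simp: sconj_at)
    then have "D l (P (sconj k ?d)) = 0" using b l by (intro below_zero) (auto simp: desc_def)
    then show ?thesis unfolding Pl using b 3 D_braid[of l, symmetric] D_zero by simp
  qed
qed

end

lemma all_good: "valid n \<gamma> \<Longrightarrow> good \<gamma>"
proof (induction "plen n \<gamma>" arbitrary: \<gamma> rule: less_induct)
  case less
  have IH: "\<And>\<gamma>'. valid n \<gamma>' \<Longrightarrow> plen n \<gamma>' < plen n \<gamma> \<Longrightarrow> good \<gamma>'" using less.hyps by blast
  show ?case
    unfolding good_def
  proof (intro conjI allI impI)
    fix k \<delta> assume d: "dn n k \<gamma> \<delta>"
    show "P \<gamma> = D k (P \<delta>)" by (rule P_dn[OF less.prems _ d]) (rule IH)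
  next
    fix k assume k: "1 \<le> k" "k < n" "\<gamma> k = \<gamma> (Suc k)"
    show "D k (P \<gamma>) = 0" by (rule P_equal[OF less.prems _ k]) (rule IH)
  qed
qed

text \<open>A move that does not apply is either blocked by a descent, so that the square of an operator
  appears, or by equal neighbours.\<close>

theorem P_simple_act:
  assumes v: "valid n \<gamma>" and k: "1 \<le> k" "k < n"
  shows "D k (P \<gamma>) = (if simple_act k \<gamma> = \<gamma> then 0 else P (simple_act k \<gamma>))"
proof (cases "simple_act k \<gamma> = \<gamma>")
  case False
  then have "dn n k (simple_act k \<gamma>) \<gamma>" by (rule dn_simple_act[OF v k])
  then show ?thesis using all_good[OF valid_simple_act[OF v k]] False by (simp add: good_def)
next
  case True
  show ?thesis
  proof (cases "desc n \<gamma> k")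
    case d: True
    then have "P \<gamma> = D k (P (down k \<gamma>))" using all_good[OF v] dn_down by (simp add: good_def)
    then show ?thesis using True by (simp add: D_square)
  next
    case False
    have "\<gamma> k = \<gamma> (Suc k)"
    proof (cases "key \<gamma> k < key \<gamma> (Suc k)")
      case asc: True
      have nm: "\<gamma> k \<noteq> Mate (Suc k)" "\<gamma> (Suc k) \<noteq> Mate k"
        using asc valid_mate[OF v, of k "Suc k"] valid_mate[OF v, of "Suc k" k] by auto
      show ?thesis
      proof (rule ccontr)
        assume ne: "\<gamma> k \<noteq> \<gamma> (Suc k)"
        then have "sconj k \<gamma> = \<gamma> \<or> \<gamma>(k := Mate (Suc k), Suc k := Mate k) = \<gamma>"
          using True asc unfolding simple_act_eq[OF v k(1)] by (auto split: if_splits)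
        then show False
        proof
          assume "sconj k \<gamma> = \<gamma>"
          then show False using sconj_exchange(1)[OF v nm] ne by simp
        next
          assume "\<gamma>(k := Mate (Suc k), Suc k := Mate k) = \<gamma>"
          then have "\<gamma> k = Mate (Suc k)" by (metis fun_upd_apply n_not_Suc_n)
          then show False using nm by simp
        qed
      qed
    next
      case nasc: False
      then have "\<gamma> k = Blank \<or> key \<gamma> k = key \<gamma> (Suc k)" using False k by (auto simp: desc_def)
      then show ?thesis
      proof
        assume "\<gamma> k = Blank"
        then show ?thesis using nasc k by (cases "\<gamma> (Suc k)") auto
      next
        assume e: "key \<gamma> k = key \<gamma> (Suc k)"
        show ?thesis
        proof (cases "\<gamma> k")
          case (Mate a)
          note a = valid_mate[OF v Mate]
          show ?thesis
          proof (cases "\<gamma> (Suc k)")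
            case (Mate b)
            then show ?thesis using e \<open>\<gamma> k = Mate a\<close> by simp
          next
            case Blank
            then show ?thesis using e Mate by simp
          next
            case Plus
            then have "a = Suc k" using e Mate by simp
            then show ?thesis using a Plus by simp
          next
            case Minus
            then have "a = Suc k" using e Mate by simp
            then show ?thesis using a Minus by simp
          qed
        next
          case Plus
          then have "\<gamma> (Suc k) \<noteq> Mate k" using valid_mate[OF v, of "Suc k" k] by auto
          then show ?thesis using e Plus by (cases "\<gamma> (Suc k)") auto
        next
          case Minus
          then have "\<gamma> (Suc k) \<noteq> Mate k" using valid_mate[OF v, of "Suc k" k] by auto
          then show ?thesis using e Minus by (cases "\<gamma> (Suc k)") auto
        next
          case Blank
          then show ?thesis using e k by (cases "\<gamma> (Suc k)") auto
        qed
      qed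
    qed
    then show ?thesis using all_good[OF v] k True by (simp add: good_def)
  qed
qed

end


section \<open>The length of a preclan\<close>

lemma nth_smallest_rank:
  assumes "finite A" "1 \<le> k" "k \<le> card A"
  shows "nth_smallest A k \<in> A" "card (A \<inter> {..nth_smallest A k}) = k"
proof -
  define xs where "xs = sorted_list_of_set A"
  have xs: "set xs = A" "length xs = card A" "sorted_wrt (<) xs"
    using assms(1) by (auto simp: xs_def)
  have i: "k - 1 < length xs" using assms xs by auto
  have eq: "nth_smallest A k = xs ! (k - 1)" by (simp add: nth_smallest_def xs_def)
  then show "nth_smallest A k \<in> A" using nth_mem[OF i] xs by simp
  have less: "xs ! a < xs ! b \<longleftrightarrow> a < b" if "a < length xs" "b < length xs" for a b
    using sorted_wrt_nth_less[OF xs(3)] that by (metis linorder_neqE_nat order_less_asym)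
  have "A \<inter> {..xs ! (k - 1)} = (!) xs ` {..k - 1}"
  proof (intro equalityI subsetI)
    fix x assume x: "x \<in> A \<inter> {..xs ! (k - 1)}"
    then obtain a where "a < length xs" "x = xs ! a" using xs(1) by (metis IntE in_set_conv_nth)
    then show "x \<in> (!) xs ` {..k - 1}" using x less[OF i, of a] by (auto simp: not_less)
  next
    fix x assume "x \<in> (!) xs ` {..k - 1}"
    then obtain a where a: "a \<le> k - 1" "x = xs ! a" by auto
    then have "a < length xs" using i by simp
    then show "x \<in> A \<inter> {..xs ! (k - 1)}" using a less[OF i, of a] nth_mem[of a xs] xs(1) by (auto simp: not_less)
  qed
  moreover have "inj_on ((!) xs) {..k - 1}"
    using i xs(3) by (auto intro!: inj_onI simp: nth_eq_iff_index_eq strict_sorted_iff)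
  ultimately show "card (A \<inter> {..nth_smallest A k}) = k" using assms by (simp add: eq card_image)
qed

lemma rank_bij:
  assumes "finite (A :: nat set)"
  shows "bij_betw (\<lambda>a. card (A \<inter> {..a})) A {1..card A}"
    "\<And>a. a \<in> A \<Longrightarrow> nth_smallest A (card (A \<inter> {..a})) = a"
    "\<And>a b. a \<in> A \<Longrightarrow> b \<in> A \<Longrightarrow> card (A \<inter> {..a}) < card (A \<inter> {..b}) \<longleftrightarrow> a < b"
proof -
  have lt: "card (A \<inter> {..a}) < card (A \<inter> {..b})" if "b \<in> A" "a < b" for a b
  proof (rule psubset_card_mono)
    have "b \<in> A \<inter> {..b}" "b \<notin> A \<inter> {..a}" using that by auto
    moreover have "A \<inter> {..a} \<subseteq> A \<inter> {..b}" using that by auto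
    ultimately show "A \<inter> {..a} \<subset> A \<inter> {..b}" by blast
  qed (use assms in simp)
  have iff: "card (A \<inter> {..a}) < card (A \<inter> {..b}) \<longleftrightarrow> a < b" if "a \<in> A" "b \<in> A" for a b
    using lt[of b a] lt[of a b] that by (metis linorder_neqE_nat order_less_asym less_irrefl)
  have r: "card (A \<inter> {..a}) \<in> {1..card A}" if "a \<in> A" for a
  proof -
    have "A \<inter> {..a} \<noteq> {}" using that by auto
    then have "0 < card (A \<inter> {..a})" using assms by (simp add: card_gt_0_iff)
    moreover have "card (A \<inter> {..a}) \<le> card A" using assms by (intro card_mono) auto
    ultimately show ?thesis by simp
  qed
  show nr: "nth_smallest A (card (A \<inter> {..a})) = a" if "a \<in> A" for a
  proof -
    let ?b = "nth_smallest A (card (A \<inter> {..a}))"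
    have "?b \<in> A" "card (A \<inter> {..?b}) = card (A \<inter> {..a})"
      using nth_smallest_rank[OF assms, of "card (A \<inter> {..a})"] r[OF that] by auto
    then show ?thesis using iff[of ?b a] iff[of a ?b] that by (metis linorder_neqE_nat less_irrefl)
  qed
  show "bij_betw (\<lambda>a. card (A \<inter> {..a})) A {1..card A}"
    by (rule bij_betwI[where g = "nth_smallest A"]) (use r nr nth_smallest_rank[OF assms] in auto)
  show "\<And>a b. a \<in> A \<Longrightarrow> b \<in> A \<Longrightarrow> card (A \<inter> {..a}) < card (A \<inter> {..b}) \<longleftrightarrow> a < b" by (rule iff)
qed

definition blank_pairs :: "nat \<Rightarrow> (nat \<Rightarrow> node) \<Rightarrow> (nat \<times> nat) set" where
  "blank_pairs n \<gamma> = {(i, j). 1 \<le> i \<and> i < j \<and> j \<le> n \<and> \<gamma> i = Blank \<and> \<gamma> j = Blank}"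

context
  fixes n :: nat and \<gamma> :: "nat \<Rightarrow> node"
  assumes v: "valid n \<gamma>"
begin

definition nbs :: "nat set" where "nbs = {1..n} - blanks n \<gamma>"

lemma nbs_iff: "i \<in> nbs \<longleftrightarrow> \<gamma> i \<noteq> Blank"
  using valid_out[OF v, of i] by (auto simp: nbs_def blanks_def)

lemma finite_nbs: "finite nbs"
  by (simp add: nbs_def)

lemma nbs_range: "i \<in> nbs \<Longrightarrow> 1 \<le> i \<and> i \<le> n"
  by (auto simp: nbs_def)

definition rnk :: "nat \<Rightarrow> nat" where "rnk a = card (nbs \<inter> {..a})"

lemmas rnk_bij = rank_bij[OF finite_nbs, folded rnk_def]

lemma delete_blanks_rnk:
  assumes "a \<in> nbs"
  shows "delete_blanks n \<gamma> (rnk a) = map_mate rnk (\<gamma> a)"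
proof -
  have "rnk a \<in> {1..card nbs}" using rnk_bij(1) assms by (auto simp: bij_betw_def)
  then have "delete_blanks n \<gamma> (rnk a) = (case \<gamma> (nth_smallest nbs (rnk a)) of
      Mate j \<Rightarrow> Mate (card (nbs \<inter> {..j})) | c \<Rightarrow> c)"
    unfolding delete_blanks_def nbs_def[symmetric] Let_def by simp
  then show ?thesis using rnk_bij(2)[OF assms] by (cases "\<gamma> a") (auto simp: rnk_def)
qed

lemma card_nbs: "n - card (blanks n \<gamma>) = card nbs"
  unfolding nbs_def by (subst card_Diff_subset) (auto simp: blanks_def)

lemma matchings_nbs: "(a, b) \<in> matchings n \<gamma> \<Longrightarrow> a \<in> nbs \<and> b \<in> nbs"
  using valid_mate[OF v, of a b] by (auto simp: matchings_iff nbs_iff)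

lemma matchings_delete:
  "matchings (card nbs) (delete_blanks n \<gamma>) = map_prod rnk rnk ` matchings n \<gamma>"
proof (intro equalityI subsetI)
  fix x assume "x \<in> matchings (card nbs) (delete_blanks n \<gamma>)"
  then obtain i j where x: "x = (i, j)" "1 \<le> i" "i < j" "j \<le> card nbs" "delete_blanks n \<gamma> i = Mate j"
    by (auto simp: matchings_def)
  then have "i \<in> rnk ` nbs" using rnk_bij(1) by (auto simp: bij_betw_def)
  then obtain a where a: "a \<in> nbs" "i = rnk a" by blast
  then obtain b where b: "\<gamma> a = Mate b" "j = rnk b"
    using x delete_blanks_rnk[OF a(1)] map_mate_Mate by metis
  have bn: "b \<in> nbs" using valid_mate[OF v b(1)] by (simp add: nbs_iff)
  have "a < b" using x a b rnk_bij(3)[OF a(1) bn] by simp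
  then have "(a, b) \<in> matchings n \<gamma>" using b nbs_range[OF a(1)] nbs_range[OF bn] by (simp add: matchings_iff)
  then show "x \<in> map_prod rnk rnk ` matchings n \<gamma>" using x a b by (intro image_eqI[of _ _ "(a, b)"]) auto
next
  fix x assume "x \<in> map_prod rnk rnk ` matchings n \<gamma>"
  then obtain a b where ab: "(a, b) \<in> matchings n \<gamma>" "x = (rnk a, rnk b)" by auto
  have n: "a \<in> nbs" "b \<in> nbs" using matchings_nbs[OF ab(1)] by auto
  have r: "rnk a \<in> {1..card nbs}" "rnk b \<in> {1..card nbs}" using rnk_bij(1) n by (auto simp: bij_betw_def)
  have m: "a < b" "\<gamma> a = Mate b" using ab(1) by (auto simp: matchings_iff)
  have "rnk a < rnk b" using rnk_bij(3)[OF n] m by simp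
  moreover have "delete_blanks n \<gamma> (rnk a) = Mate (rnk b)" using delete_blanks_rnk[OF n(1)] m by simp
  ultimately show "x \<in> matchings (card nbs) (delete_blanks n \<gamma>)"
    using r ab by (simp add: matchings_iff)
qed

lemma inj_rnk: "inj_on rnk nbs"
  using rnk_bij(1) by (auto simp: bij_betw_def)

lemma inj_rnk2: "inj_on (map_prod rnk rnk) (matchings n \<gamma>)"
proof (rule inj_onI, clarify)
  fix a b c d assume m: "(a, b) \<in> matchings n \<gamma>" "(c, d) \<in> matchings n \<gamma>"
    and e: "map_prod rnk rnk (a, b) = map_prod rnk rnk (c, d)"
  have "a = c" "b = d"
    using inj_onD[OF inj_rnk, of a c] inj_onD[OF inj_rnk, of b d] e matchings_nbs[OF m(1)] matchings_nbs[OF m(2)]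
    by auto
  then show "a = c \<and> b = d" by simp
qed

lemma crossings_delete:
  "card (crossings (card nbs) (delete_blanks n \<gamma>)) = card (crossings n \<gamma>)"
proof -
  let ?f = "map_prod (map_prod rnk rnk) (map_prod rnk rnk)"
  have "crossings (card nbs) (delete_blanks n \<gamma>) = ?f ` crossings n \<gamma>"
  proof (intro equalityI subsetI)
    fix x assume "x \<in> crossings (card nbs) (delete_blanks n \<gamma>)"
    then obtain a b c d where x: "x = ((rnk a, rnk b), (rnk c, rnk d))" "(a, b) \<in> matchings n \<gamma>" "(c, d) \<in> matchings n \<gamma>"
      "rnk a < rnk c" "rnk c < rnk b" "rnk b < rnk d"
      unfolding crossings_def matchings_delete by auto
    have "a < c" "c < b" "b < d"
      using x(4-6) matchings_nbs[OF x(2)] matchings_nbs[OF x(3)] rnk_bij(3) by auto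
    then have "((a, b), (c, d)) \<in> crossings n \<gamma>" using x by (simp add: crossings_def)
    then show "x \<in> ?f ` crossings n \<gamma>" using x(1) by (intro image_eqI) auto
  next
    fix x assume "x \<in> ?f ` crossings n \<gamma>"
    then obtain a b c d where x: "x = ((rnk a, rnk b), (rnk c, rnk d))" "(a, b) \<in> matchings n \<gamma>" "(c, d) \<in> matchings n \<gamma>"
      "a < c" "c < b" "b < d"
      unfolding crossings_def by auto
    have "rnk a < rnk c" "rnk c < rnk b" "rnk b < rnk d"
      using x(4-6) matchings_nbs[OF x(2)] matchings_nbs[OF x(3)] rnk_bij(3) by auto
    moreover have "(rnk a, rnk b) \<in> map_prod rnk rnk ` matchings n \<gamma>" "(rnk c, rnk d) \<in> map_prod rnk rnk ` matchings n \<gamma>"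
      using imageI[OF x(2), of "map_prod rnk rnk"] imageI[OF x(3), of "map_prod rnk rnk"] by simp_all
    ultimately show "x \<in> crossings (card nbs) (delete_blanks n \<gamma>)"
      unfolding crossings_def matchings_delete x(1) by auto
  qed
  moreover have "inj_on ?f (crossings n \<gamma>)"
  proof (rule inj_onI)
    fix x y assume x: "x \<in> crossings n \<gamma>" and y: "y \<in> crossings n \<gamma>" and e: "?f x = ?f y"
    have m: "fst x \<in> matchings n \<gamma>" "snd x \<in> matchings n \<gamma>" "fst y \<in> matchings n \<gamma>" "snd y \<in> matchings n \<gamma>"
      using x y by (auto simp: crossings_def)
    have "map_prod rnk rnk (fst x) = map_prod rnk rnk (fst y)" "map_prod rnk rnk (snd x) = map_prod rnk rnk (snd y)"
      using e by (metis fst_map_prod, metis snd_map_prod)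
    then have "fst x = fst y" "snd x = snd y" using inj_onD[OF inj_rnk2] m by blast+
    then show "x = y" by (rule prod_eqI)
  qed
  ultimately show ?thesis by (simp add: card_image)
qed

lemma clan_length_delete:
  "clan_length (card nbs) (delete_blanks n \<gamma>)
    = (\<Sum>(a, b)\<in>matchings n \<gamma>. int (card (nbs \<inter> {a<..b}))) - int (card (crossings n \<gamma>))"
proof -
  have "(\<Sum>(i, j)\<in>matchings (card nbs) (delete_blanks n \<gamma>). int j - int i)
      = (\<Sum>(a, b)\<in>matchings n \<gamma>. int (rnk b) - int (rnk a))"
    unfolding matchings_delete by (subst sum.reindex[OF inj_rnk2]) (auto intro: sum.cong)
  also have "\<dots> = (\<Sum>(a, b)\<in>matchings n \<gamma>. int (card (nbs \<inter> {a<..b})))"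
  proof (rule sum.cong[OF refl], clarify)
    fix a b assume "(a, b) \<in> matchings n \<gamma>"
    then have "nbs \<inter> {..b} = (nbs \<inter> {..a}) \<union> (nbs \<inter> {a<..b})" by (auto simp: matchings_iff)
    moreover have "card ((nbs \<inter> {..a}) \<union> (nbs \<inter> {a<..b})) = card (nbs \<inter> {..a}) + card (nbs \<inter> {a<..b})"
      using finite_nbs by (intro card_Un_disjoint) auto
    ultimately show "int (rnk b) - int (rnk a) = int (card (nbs \<inter> {a<..b}))"
      unfolding rnk_def by simp
  qed
  finally show ?thesis unfolding clan_length_def crossings_delete by simp
qed

lemma blank_part:
  "(\<Sum>i = 1..card (blanks n \<gamma>). int (nth_smallest (blanks n \<gamma>) i) - int i) = int (card (pblank n \<gamma>))"
proof -
  let ?B = "blanks n \<gamma>"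
  have fin: "finite ?B" by (simp add: blanks_def)
  have "(\<Sum>i = 1..card ?B. int (nth_smallest ?B i) - int i)
      = (\<Sum>b\<in>?B. int (nth_smallest ?B (card (?B \<inter> {..b}))) - int (card (?B \<inter> {..b})))"
    using sum.reindex_bij_betw[OF rank_bij(1)[OF fin], of "\<lambda>i. int (nth_smallest ?B i) - int i"] by simp
  also have "\<dots> = (\<Sum>b\<in>?B. int (card {i. 1 \<le> i \<and> i < b \<and> \<gamma> i \<noteq> Blank}))"
  proof (rule sum.cong[OF refl])
    fix b assume b: "b \<in> ?B"
    then have "{1..b} = (?B \<inter> {..b}) \<union> {i. 1 \<le> i \<and> i < b \<and> \<gamma> i \<noteq> Blank}"
      by (auto simp: blanks_def order_le_less)
    moreover have "card ((?B \<inter> {..b}) \<union> {i. 1 \<le> i \<and> i < b \<and> \<gamma> i \<noteq> Blank})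
        = card (?B \<inter> {..b}) + card {i. 1 \<le> i \<and> i < b \<and> \<gamma> i \<noteq> Blank}"
      by (rule card_Un_disjoint) (use fin in \<open>auto simp: blanks_def\<close>)
    ultimately have "card {1..b} = card (?B \<inter> {..b}) + card {i. 1 \<le> i \<and> i < b \<and> \<gamma> i \<noteq> Blank}"
      by (simp only:)
    then show "int (nth_smallest ?B (card (?B \<inter> {..b}))) - int (card (?B \<inter> {..b}))
        = int (card {i. 1 \<le> i \<and> i < b \<and> \<gamma> i \<noteq> Blank})"
      using rank_bij(2)[OF fin b] by simp
  qed
  also have "\<dots> = int (card (SIGMA b:?B. {i. 1 \<le> i \<and> i < b \<and> \<gamma> i \<noteq> Blank}))"
    using fin by (subst card_SigmaI) auto
  also have "card (SIGMA b:?B. {i. 1 \<le> i \<and> i < b \<and> \<gamma> i \<noteq> Blank}) = card (pblank n \<gamma>)"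
    by (rule bij_betw_same_card[of prod.swap])
      (auto simp: bij_betw_def inj_on_def pblank_def blanks_def image_iff)
  finally show ?thesis .
qed

abbreviation (input) z :: "nat \<Rightarrow> nat" where "z \<equiv> pos \<gamma>"

lemma z_invol: "i \<in> nbs \<Longrightarrow> z i \<in> nbs \<and> z (z i) = i"
proof (cases "\<gamma> i")
  case (Mate j)
  then show ?thesis using valid_mate[OF v Mate] by (simp add: pos_def nbs_iff)
qed (auto simp: pos_def nbs_iff)

text \<open>These pairs are counted by the sum of the spans of the arcs, without blanks.\<close>

definition arc_pairs :: "(nat \<times> nat) set" where
  "arc_pairs = {(a, c). a \<in> nbs \<and> c \<in> nbs \<and> a < c \<and> c \<le> z a}"

text \<open>The pairs of \<open>arc_pairs\<close> that do not come from a crossing.\<close>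

definition inner_pairs :: "(nat \<times> nat) set" where
  "inner_pairs = {(a, c). a \<in> nbs \<and> c \<in> nbs \<and> a < c \<and> c \<le> z a \<and> z c < z a}"

lemma finite_arc_pairs: "finite arc_pairs" "finite inner_pairs"
  by (rule finite_subset[of _ "nbs \<times> nbs"]; use finite_nbs in \<open>auto simp: arc_pairs_def inner_pairs_def\<close>)+

lemma matchings_z: "(a, b) \<in> matchings n \<gamma> \<longleftrightarrow> a \<in> nbs \<and> a < z a \<and> b = z a"
proof
  assume m: "(a, b) \<in> matchings n \<gamma>"
  then show "a \<in> nbs \<and> a < z a \<and> b = z a" using matchings_nbs[OF m] by (auto simp: matchings_iff pos_def)
next
  assume a: "a \<in> nbs \<and> a < z a \<and> b = z a"
  then show "(a, b) \<in> matchings n \<gamma>"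
    using nbs_range[of a] nbs_range[of "z a"] z_invol[of a] by (cases "\<gamma> a") (auto simp: matchings_iff pos_def)
qed

lemma card_arc_pairs: "(\<Sum>(a, b)\<in>matchings n \<gamma>. int (card (nbs \<inter> {a<..b}))) = int (card arc_pairs)"
proof -
  have "(\<Sum>(a, b)\<in>matchings n \<gamma>. int (card (nbs \<inter> {a<..b}))) =
    (\<Sum>x\<in>matchings n \<gamma>. int (card (nbs \<inter> {fst x<..snd x})))" by (simp add: case_prod_unfold)
  also have "\<dots> = int (card (SIGMA x:matchings n \<gamma>. nbs \<inter> {fst x<..snd x}))"
    using finite_nbs by (subst card_SigmaI) (auto simp: finite_pairs)
  also have "card (SIGMA x:matchings n \<gamma>. nbs \<inter> {fst x<..snd x}) = card arc_pairs"
  proof (rule bij_betw_same_card[of "\<lambda>x. (fst (fst x), snd x)"])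
    show "bij_betw (\<lambda>x. (fst (fst x), snd x)) (SIGMA x:matchings n \<gamma>. nbs \<inter> {fst x<..snd x}) arc_pairs"
      by (rule bij_betwI[where g = "\<lambda>(a, c). ((a, z a), c)"])
        (auto simp: matchings_z arc_pairs_def)
  qed
  finally show ?thesis .
qed

lemma card_inner_pairs: "card arc_pairs = card inner_pairs + card (crossings n \<gamma>)"
proof -
  let ?C = "{(a, c). a \<in> nbs \<and> c \<in> nbs \<and> a < c \<and> c < z a \<and> z a < z c}"
  have "arc_pairs = inner_pairs \<union> ?C"
  proof (intro equalityI subsetI)
    fix x assume "x \<in> arc_pairs"
    then obtain a c where x: "x = (a, c)" "a \<in> nbs" "c \<in> nbs" "a < c" "c \<le> z a" by (auto simp: arc_pairs_def)
    have "z a \<noteq> z c" using z_invol[OF x(2)] z_invol[OF x(3)] x(4) by auto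
    moreover have "c = z a \<Longrightarrow> z c < z a" using z_invol[OF x(2)] x(4) by auto
    ultimately show "x \<in> inner_pairs \<union> ?C" using x by (cases "c = z a") (auto simp: inner_pairs_def)
  qed (auto simp: arc_pairs_def inner_pairs_def)
  moreover have "inner_pairs \<inter> ?C = {}" by (auto simp: inner_pairs_def)
  moreover have "finite ?C" by (rule finite_subset[OF _ finite_arc_pairs(1)]) (auto simp: arc_pairs_def)
  ultimately have "card arc_pairs = card inner_pairs + card ?C"
    using finite_arc_pairs by (simp add: card_Un_disjoint)
  moreover have "card (crossings n \<gamma>) = card ?C"
  proof (rule bij_betw_same_card)
    show "bij_betw (\<lambda>x. (fst (fst x), fst (snd x))) (crossings n \<gamma>) ?C"
      by (rule bij_betwI[where g = "\<lambda>(a, c). ((a, z a), (c, z c))"])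
        (auto simp: crossings_def matchings_z)
  qed
  ultimately show ?thesis by simp
qed

definition inv_pairs :: "(nat \<times> nat) set" where
  "inv_pairs = {(a, c). a \<in> nbs \<and> c \<in> nbs \<and> a < c \<and> z c < z a}"

text \<open>The map \<open>(a, c) \<mapsto> (z c, z a)\<close> pairs the inversions with \<open>z a < c\<close> with those with \<open>c < z a\<close>; the inversions
  with \<open>c = z a\<close> are the arcs.\<close>

lemma card_inv_pairs: "card inv_pairs + card (matchings n \<gamma>) = 2 * card inner_pairs"
proof -
  let ?X = "{(a, c). a \<in> nbs \<and> c \<in> nbs \<and> a < c \<and> z a < c \<and> z c < z a}"
  let ?Y = "{(a, c). a \<in> nbs \<and> c \<in> nbs \<and> a < c \<and> c < z a \<and> z c < z a}"
  have fin: "finite ?X" "finite ?Y"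
    by (rule finite_subset[of _ "nbs \<times> nbs"]; use finite_nbs in auto)+
  have "inv_pairs = inner_pairs \<union> ?X" by (auto simp: inv_pairs_def inner_pairs_def)
  moreover have "inner_pairs \<inter> ?X = {}" by (auto simp: inner_pairs_def)
  ultimately have 1: "card inv_pairs = card inner_pairs + card ?X"
    using finite_arc_pairs fin by (simp add: card_Un_disjoint)
  have "inner_pairs = ?Y \<union> matchings n \<gamma>"
  proof (intro equalityI subsetI)
    fix x assume "x \<in> inner_pairs"
    then show "x \<in> ?Y \<union> matchings n \<gamma>" by (auto simp: inner_pairs_def matchings_z order_le_less)
  next
    fix x assume "x \<in> ?Y \<union> matchings n \<gamma>"
    then show "x \<in> inner_pairs" using z_invol by (auto simp: inner_pairs_def matchings_z)
  qed
  moreover have "?Y \<inter> matchings n \<gamma> = {}" by (auto simp: matchings_z)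
  ultimately have 2: "card inner_pairs = card ?Y + card (matchings n \<gamma>)"
    using finite_pairs fin by (simp add: card_Un_disjoint)
  have "bij_betw (\<lambda>(a, c). (z c, z a)) ?X ?Y"
  proof (rule bij_betwI[where g = "\<lambda>(a, c). (z c, z a)"])
    have *: "(z c, z a) \<in> ?Y" if "(a, c) \<in> ?X" for a c
      using that z_invol[of a] z_invol[of c] by simp
    have **: "(z c, z a) \<in> ?X" if "(a, c) \<in> ?Y" for a c
      using that z_invol[of a] z_invol[of c] by simp
    show "(\<lambda>(a, c). (z c, z a)) \<in> ?X \<rightarrow> ?Y"
    proof (rule funcsetI)
      fix x assume x: "x \<in> ?X"
      obtain a c where e: "x = (a, c)" by force
      show "(case x of (a, c) \<Rightarrow> (z c, z a)) \<in> ?Y" using *[OF x[unfolded e]] unfolding e by (simp only: prod.case)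
    qed
    show "(\<lambda>(a, c). (z c, z a)) \<in> ?Y \<rightarrow> ?X"
    proof (rule funcsetI)
      fix x assume x: "x \<in> ?Y"
      obtain a c where e: "x = (a, c)" by force
      show "(case x of (a, c) \<Rightarrow> (z c, z a)) \<in> ?X" using **[OF x[unfolded e]] unfolding e by (simp only: prod.case)
    qed
    show "(case (case x of (a, c) \<Rightarrow> (z c, z a)) of (a, c) \<Rightarrow> (z c, z a)) = x" if "x \<in> ?X" for x
    proof -
      obtain a c where "x = (a, c)" "a \<in> nbs" "c \<in> nbs" using \<open>x \<in> ?X\<close> by (cases x) simp
      then show ?thesis using z_invol[of a] z_invol[of c] by simp
    qed
    show "(case (case y of (a, c) \<Rightarrow> (z c, z a)) of (a, c) \<Rightarrow> (z c, z a)) = y" if "y \<in> ?Y" for y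
    proof -
      obtain a c where "y = (a, c)" "a \<in> nbs" "c \<in> nbs" using \<open>y \<in> ?Y\<close> by (cases y) simp
      then show ?thesis using z_invol[of a] z_invol[of c] by simp
    qed
  qed
  then have "card ?X = card ?Y" by (rule bij_betw_same_card)
  then show ?thesis using 1 2 by simp
qed

lemma card_pinv: "card (pinv n \<gamma>) = card inv_pairs + card (pblank n \<gamma>) + card (blank_pairs n \<gamma>)"
proof -
  have "(i, j) \<in> pinv n \<gamma> \<longleftrightarrow> (i, j) \<in> inv_pairs \<or> (i, j) \<in> pblank n \<gamma> \<or> (i, j) \<in> blank_pairs n \<gamma>" for i j
    using nbs_range[of i] nbs_range[of j]
    by (auto simp: pinv_def inv_pairs_def pblank_def blank_pairs_def key_pos[where \<gamma> = \<gamma>] nbs_iff)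
  then have "pinv n \<gamma> = inv_pairs \<union> pblank n \<gamma> \<union> blank_pairs n \<gamma>" by auto
  moreover have "finite inv_pairs" "finite (blank_pairs n \<gamma>)"
    by (rule finite_subset[of _ "{1..n} \<times> {1..n}"]; use nbs_range in \<open>auto simp: inv_pairs_def blank_pairs_def\<close>)+
  moreover have "inv_pairs \<inter> pblank n \<gamma> = {}" "(inv_pairs \<union> pblank n \<gamma>) \<inter> blank_pairs n \<gamma> = {}"
    by (auto simp: inv_pairs_def pblank_def blank_pairs_def nbs_iff)
  ultimately show ?thesis by (simp add: card_Un_disjoint finite_pairs)
qed

lemma plen_preclan_length: "int (plen n \<gamma>) = 2 * preclan_length n \<gamma> + int (card (blank_pairs n \<gamma>))"
proof -
  have "preclan_length n \<gamma> = int (card inner_pairs) + int (card (pblank n \<gamma>))"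
    unfolding preclan_length_def Let_def card_nbs clan_length_delete blank_part card_arc_pairs card_inner_pairs
    by simp
  then show ?thesis unfolding plen_def card_pinv using card_inv_pairs by linarith
qed

end

text \<open>The number of blanks does not change.\<close>

lemma card_blank_pairs_simple_act:
  assumes v: "valid n \<gamma>" and k: "1 \<le> k" "k < n"
  shows "card (blank_pairs n (simple_act k \<gamma>)) = card (blank_pairs n \<gamma>)"
proof (cases "simple_act k \<gamma> = \<gamma>")
  case False
  let ?s = "simple_refl k"
  have asc: "key \<gamma> k < key \<gamma> (Suc k)" using False unfolding simple_act_eq[OF v k(1)] by auto
  have nb: "\<gamma> (Suc k) \<noteq> Blank" using asc by (cases "\<gamma> k") auto
  show ?thesis
  proof (cases "is_sign (\<gamma> k) \<and> is_sign (\<gamma> (Suc k))")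
    case True
    then have e: "simple_act k \<gamma> = \<gamma>(k := Mate (Suc k), Suc k := Mate k)"
      using asc False unfolding simple_act_eq[OF v k(1)] by (auto split: if_splits)
    have "simple_act k \<gamma> i = Blank \<longleftrightarrow> \<gamma> i = Blank" for i
      using True by (auto simp: e)
    then show ?thesis by (simp add: blank_pairs_def)
  next
    case ns: False
    then have e: "simple_act k \<gamma> = sconj k \<gamma>"
      using asc unfolding simple_act_eq[OF v k(1)] by auto
    have "card (blank_pairs n (sconj k \<gamma>)) = card (blank_pairs n \<gamma>) + card ({} :: (nat \<times> nat) set)"
    proof (rule pairs_image)
      show "finite (blank_pairs n \<gamma>)"
        by (rule finite_subset[of _ "{1..n} \<times> {1..n}"]) (auto simp: blank_pairs_def)
      fix i j
      have r: "1 \<le> ?s i \<longleftrightarrow> 1 \<le> i" "?s j \<le> n \<longleftrightarrow> j \<le> n"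
        using k by (auto simp: simple_refl_def')
      consider "i = k" "j = Suc k" | "i = Suc k" "j = k" | "?s i < ?s j \<longleftrightarrow> i < j"
        using simple_refl_less_iff[of i k j] by blast
      then show "(i, j) \<in> blank_pairs n (sconj k \<gamma>) \<longleftrightarrow> (?s i, ?s j) \<in> blank_pairs n \<gamma> \<or> (i, j) \<in> {}"
        by cases (use r nb in \<open>auto simp: blank_pairs_def sconj_Blank\<close>)
    qed auto
    then show ?thesis by (simp add: e)
  qed
qed simp

lemma preclan_length_simple_act:
  assumes v: "valid n \<gamma>" and k: "1 \<le> k" "k < n" and ne: "simple_act k \<gamma> \<noteq> \<gamma>"
  shows "preclan_length n (simple_act k \<gamma>) = preclan_length n \<gamma> + 1"
  using plen_simple_act[OF v k ne] plen_preclan_length[OF v] plen_preclan_length[OF valid_simple_act[OF v k]]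
    card_blank_pairs_simple_act[OF v k] by simp

context dd_family
begin

lemma foldr_simple_act:
  assumes v: "valid n \<gamma>" and ks: "set ks \<subseteq> {1..<n}"
  defines "\<delta> \<equiv> foldr simple_act ks \<gamma>"
  shows "valid n \<delta> \<and> preclan_length n \<delta> \<le> preclan_length n \<gamma> + int (length ks) \<and>
    foldr D ks (P \<gamma>) = (if preclan_length n \<delta> = preclan_length n \<gamma> + int (length ks) then P \<delta> else 0)"
  unfolding \<delta>_def using ks
proof (induction ks)
  case Nil
  then show ?case using v by simp
next
  case (Cons k ks)
  let ?\<delta> = "foldr simple_act ks \<gamma>"
  have k: "1 \<le> k" "k < n" using Cons.prems by auto
  have IH: "valid n ?\<delta>" "preclan_length n ?\<delta> \<le> preclan_length n \<gamma> + int (length ks)"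
    "foldr D ks (P \<gamma>) = (if preclan_length n ?\<delta> = preclan_length n \<gamma> + int (length ks) then P ?\<delta> else 0)"
    using Cons by auto
  show ?case
  proof (cases "simple_act k ?\<delta> = ?\<delta>")
    case True
    then show ?thesis using IH P_simple_act[OF IH(1) k] by (simp add: D_zero)
  next
    case False
    then show ?thesis
      using IH P_simple_act[OF IH(1) k] preclan_length_simple_act[OF IH(1) k] valid_simple_act[OF IH(1) k]
      by (simp add: D_zero)
  qed
qed

end


section \<open>Inverse Grassmannian permutations\<close>

text \<open>The inverse Grassmannian permutation mapping \<open>A\<close> increasingly to the first values and the complement of
  \<open>A\<close> increasingly to the remaining ones.\<close>

definition grass :: "nat set \<Rightarrow> nat \<Rightarrow> nat" where
  "grass A i = (if i = 0 then 0 else if i \<in> A then card (A \<inter> {..i}) else card A + card ({1..i} - A))"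

lemma mem_swap: "x \<in> simple_refl k ` A \<longleftrightarrow> simple_refl k x \<in> A"
  by (metis image_iff simple_refl_invol)

lemma card_swap: "(\<And>x. x \<in> X \<longleftrightarrow> simple_refl k x \<in> Y) \<Longrightarrow> card X = card Y"
proof -
  assume a: "\<And>x. x \<in> X \<longleftrightarrow> simple_refl k x \<in> Y"
  have "X = simple_refl k ` Y" using a mem_swap by blast
  then show ?thesis by (simp add: card_image inj_on_def)
qed

lemma grass_in: "finite A \<Longrightarrow> 0 \<notin> A \<Longrightarrow> i \<in> A \<Longrightarrow> 1 \<le> grass A i \<and> grass A i \<le> card A"
proof -
  assume a: "finite A" "0 \<notin> A" "i \<in> A"
  then have "A \<inter> {..i} \<noteq> {}" by auto
  then have "0 < card (A \<inter> {..i})" using a by (simp add: card_gt_0_iff)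
  moreover have "card (A \<inter> {..i}) \<le> card A" using a by (intro card_mono) auto
  moreover have "i \<noteq> 0" using a by metis
  ultimately show ?thesis using a by (simp add: grass_def)
qed

lemma grass_out: "i \<notin> A \<Longrightarrow> 1 \<le> i \<Longrightarrow> card A < grass A i"
proof -
  assume a: "i \<notin> A" "1 \<le> i"
  then have "{1..i} - A \<noteq> {}" by auto
  then have "0 < card ({1..i} - A)" by (simp add: card_gt_0_iff)
  then show ?thesis using a by (simp add: grass_def)
qed

lemma grass_mono_in:
  assumes "finite A" "0 \<notin> A" "i \<in> A" "j \<in> A" "i < j"
  shows "grass A i < grass A j"
proof -
  have "j \<in> A \<inter> {..j}" "j \<notin> A \<inter> {..i}" "A \<inter> {..i} \<subseteq> A \<inter> {..j}" using assms by auto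
  then have "A \<inter> {..i} \<subset> A \<inter> {..j}" by blast
  then have "card (A \<inter> {..i}) < card (A \<inter> {..j})" using assms(1) by (intro psubset_card_mono) auto
  moreover have "i \<noteq> 0" "j \<noteq> 0" using assms by metis+
  ultimately show ?thesis using assms by (simp add: grass_def)
qed

lemma grass_mono_out:
  assumes "i \<notin> A" "j \<notin> A" "1 \<le> i" "i < j"
  shows "grass A i < grass A j"
proof -
  have "j \<in> {1..j} - A" "j \<notin> {1..i} - A" "{1..i} - A \<subseteq> {1..j} - A" using assms by auto
  then have "{1..i} - A \<subset> {1..j} - A" by blast
  then have "card ({1..i} - A) < card ({1..j} - A)" by (intro psubset_card_mono) auto
  then show ?thesis using assms by (simp add: grass_def)
qed

lemma grass_Sn:
  assumes A: "A \<subseteq> {1..n}"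
  shows "grass A \<in> Sn n"
proof -
  have fin: "finite A" and z: "0 \<notin> A" using A finite_subset by auto
  have out: "grass A i = i" if "i \<notin> {1..n}" for i
  proof (cases "i = 0")
    case False
    then have i: "n < i" using that by auto
    then have "card ({1..i} - A) = i - card A"
      using A fin by (subst card_Diff_subset) auto
    moreover have "card A \<le> i" using card_mono[OF _ A] i by auto
    ultimately show ?thesis using i A False by (auto simp: grass_def)
  qed (simp add: grass_def)
  have inj: "inj_on (grass A) {1..n}"
  proof (rule linorder_inj_onI)
    fix i j assume ij: "i < j" "i \<in> {1..n}" "j \<in> {1..n}"
    show "grass A i \<noteq> grass A j"
    proof (cases "i \<in> A"; cases "j \<in> A")
      assume "i \<in> A" "j \<in> A"
      then show ?thesis using grass_mono_in[OF fin z] ij by fastforce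
    next
      assume "i \<in> A" "j \<notin> A"
      then show ?thesis using grass_in[OF fin z, of i] grass_out[of j A] ij by auto
    next
      assume "i \<notin> A" "j \<in> A"
      then show ?thesis using grass_in[OF fin z, of j] grass_out[of i A] ij by auto
    next
      assume "i \<notin> A" "j \<notin> A"
      then show ?thesis using grass_mono_out[of i A j] ij by auto
    qed
  qed auto
  have "grass A i \<in> {1..n}" if i: "i \<in> {1..n}" for i
  proof (cases "i \<in> A")
    case True
    then show ?thesis using grass_in[OF fin z True] card_mono[OF _ A] by auto
  next
    case False
    have "card ({1..i} - A) \<le> card ({1..n} - A)" using i by (intro card_mono) auto
    also have "\<dots> = n - card A" using A fin by (subst card_Diff_subset) auto
    finally have "grass A i \<le> n" using False i card_mono[OF _ A] by (simp add: grass_def)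
    then show ?thesis using grass_out[OF False] i by auto
  qed
  then have "grass A ` {1..n} = {1..n}"
    using inj by (intro endo_inj_surj) auto
  then have "bij_betw (grass A) {1..n} {1..n}" using inj by (simp add: bij_betw_def)
  then show ?thesis unfolding Sn_def using out by (auto intro: bij_imp_permutes)
qed

lemma grass_swap:
  assumes "1 \<le> k" "k \<notin> A" "Suc k \<in> A"
  shows "grass (simple_refl k ` A) = grass A \<circ> simple_refl k"
proof
  fix i
  let ?s = "simple_refl k"
  have c: "card (?s ` A) = card A" by (rule card_swap) (simp add: mem_swap)
  consider "i = 0" | "i = k" | "i = Suc k" | "i \<noteq> 0" "i \<noteq> k" "i \<noteq> Suc k" by blast
  then show "grass (?s ` A) i = (grass A \<circ> ?s) i"
  proof cases
    case 1
    then show ?thesis using assms by (simp add: grass_def)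
  next
    case 2
    have "card (?s ` A \<inter> {..k}) = card (A \<inter> {..Suc k})"
      by (rule card_swap[of _ k]) (use assms in \<open>auto simp: mem_swap simple_refl_def' split: if_splits\<close>)
    then show ?thesis using assms 2 by (simp add: grass_def mem_swap)
  next
    case 3
    have "card ({1..Suc k} - ?s ` A) = card ({1..k} - A)"
      by (rule card_swap[of _ k]) (use assms in \<open>auto simp: mem_swap simple_refl_def' split: if_splits\<close>)
    then show ?thesis using assms 3 c by (simp add: grass_def mem_swap)
  next
    case 4
    have "card (?s ` A \<inter> {..i}) = card (A \<inter> {..i})" "card ({1..i} - ?s ` A) = card ({1..i} - A)"
      by (rule card_swap[of _ k], use assms 4 in \<open>auto simp: mem_swap simple_refl_def' split: if_splits\<close>)+
    then show ?thesis using 4 c by (simp add: grass_def mem_swap)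
  qed
qed

lemma grass_asc:
  assumes "finite A" "0 \<notin> A" "1 \<le> k"
  shows "grass A (Suc k) < grass A k \<longleftrightarrow> k \<notin> A \<and> Suc k \<in> A"
  using grass_mono_in[OF assms(1,2), of k "Suc k"] grass_mono_out[of k A "Suc k"]
    grass_in[OF assms(1,2), of k] grass_in[OF assms(1,2), of "Suc k"] grass_out[of k A] grass_out[of "Suc k" A] assms(3)
  by (cases "k \<in> A"; cases "Suc k \<in> A") auto

lemma inverse_grassmannian_grass:
  assumes v: "v \<in> Sn n" and g: "inverse_grassmannian p v"
  shows "v = grass (v -` {1..p})"
proof
  fix i
  let ?A = "v -` {1..p}"
  have vS: "v \<in> S_infty" using v Sn_Sinf by blast
  note iv = Sinf_inv_simps[OF vS]
  have inj: "inj (inv v)" using Sinf_inj[OF Sinf_inv[OF vS]] .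
  have A: "?A = inv v ` {1..p}" using iv(1,2) by (auto simp: image_iff) (metis iv(1) atLeastAtMost_iff)
  have cA: "card ?A = p" unfolding A using inj by (simp add: card_image inj_on_subset)
  have sm: "strict_mono_on {1..p} (inv v)" "strict_mono_on {p<..} (inv v)"
    using g by (auto simp: inverse_grassmannian_def)
  have le1: "inv v a \<le> inv v b \<longleftrightarrow> a \<le> b" if "a \<in> {1..p}" "b \<in> {1..p}" for a b
    using strict_mono_onD[OF sm(1), of a b] strict_mono_onD[OF sm(1), of b a] that
    by (metis linorder_not_less order_le_less)
  have le2: "inv v a \<le> inv v b \<longleftrightarrow> a \<le> b" if "a \<in> {p<..}" "b \<in> {p<..}" for a b
    using strict_mono_onD[OF sm(2), of a b] strict_mono_onD[OF sm(2), of b a] that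
    by (metis linorder_not_less order_le_less)
  show "v i = grass ?A i"
  proof (cases "i = 0")
    case True
    then show ?thesis using Sinf_0[OF vS] by (simp add: grass_def)
  next
    case False
    then have vi: "1 \<le> v i" using Sinf_pos[OF vS, of i] by simp
    show ?thesis
    proof (cases "v i \<le> p")
      case True
      have "?A \<inter> {..i} = inv v ` {1..v i}"
      proof (intro equalityI subsetI)
        fix x assume "x \<in> ?A \<inter> {..i}"
        then have x: "v x \<in> {1..p}" "inv v (v x) \<le> inv v (v i)" by (auto simp: iv)
        then have "v x \<le> v i" using le1[of "v x" "v i"] vi True by auto
        then show "x \<in> inv v ` {1..v i}" using x iv(1) by (intro image_eqI[of _ _ "v x"]) auto
      next
        fix x assume "x \<in> inv v ` {1..v i}"
        then obtain l where l: "x = inv v l" "l \<in> {1..v i}" by blast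
        then have "inv v l \<le> inv v (v i)" using le1[of l "v i"] vi True by auto
        then show "x \<in> ?A \<inter> {..i}" using l True by (auto simp: iv)
      qed
      then have "card (?A \<inter> {..i}) = v i" using inj by (simp add: card_image inj_on_subset)
      then show ?thesis using False vi True by (simp add: grass_def)
    next
      case big: False
      have "{1..i} - ?A = inv v ` {p<..v i}"
      proof (intro equalityI subsetI)
        fix x assume x: "x \<in> {1..i} - ?A"
        then have "1 \<le> v x" using Sinf_pos[OF vS, of x] by auto
        then have vx: "p < v x" using x by auto
        have "inv v (v x) \<le> inv v (v i)" using x by (auto simp: iv)
        then have "v x \<le> v i" using le2[of "v x" "v i"] vx big by auto
        then show "x \<in> inv v ` {p<..v i}" using vx iv(1) by (intro image_eqI[of _ _ "v x"]) auto
      next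
        fix x assume "x \<in> inv v ` {p<..v i}"
        then obtain l where l: "x = inv v l" "l \<in> {p<..v i}" by blast
        then have "inv v l \<le> inv v (v i)" using le2[of l "v i"] big by auto
        moreover have "1 \<le> inv v l" using Sinf_pos[OF Sinf_inv[OF vS], of l] l by auto
        ultimately show "x \<in> {1..i} - ?A" using l by (auto simp: iv)
      qed
      then have "card ({1..i} - ?A) = v i - p" using inj by (simp add: card_image inj_on_subset)
      then show ?thesis using False big cA by (simp add: grass_def)
    qed
  qed
qed


section \<open>The family of polynomials attached to preclans\<close>

definition grass_schubert :: "nat set \<Rightarrow> int mpoly mpoly" where
  "grass_schubert A = double_schubert (grass A)"

lemma dd_grass_schubert:
  assumes "A \<subseteq> {1..n}" "1 \<le> k"
  shows "divided_difference k (grass_schubert A) = (if k \<notin> A \<and> Suc k \<in> A then grass_schubert (simple_refl k ` A) else 0)"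
proof -
  have fin: "finite A" "0 \<notin> A" using assms finite_subset by auto
  show ?thesis
    unfolding grass_schubert_def dd_double_schubert[OF Sn_Sinf[OF grass_Sn[OF assms(1)]] assms(2)] grass_asc[OF fin assms(2)]
    using grass_swap[OF assms(2)] by simp
qed

lemma swap_insert: "k \<notin> K \<Longrightarrow> Suc k \<notin> K \<Longrightarrow> simple_refl k ` insert (Suc k) K = insert k K"
proof -
  assume a: "k \<notin> K" "Suc k \<notin> K"
  have "simple_refl k ` K = K"
  proof -
    have "x \<in> simple_refl k ` K \<longleftrightarrow> x \<in> K" for x using a by (auto simp: mem_swap simple_refl_def' split: if_splits)
    then show ?thesis by blast
  qed
  then show ?thesis by simp
qed

lemma dd_grass_schubert_left:
  assumes "A \<subseteq> {1..n}" "B \<subseteq> {1..n}" "1 \<le> k" "k \<notin> A" "Suc k \<in> A" "\<not> (k \<notin> B \<and> Suc k \<in> B)"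
  shows "divided_difference k (grass_schubert A * grass_schubert B) = grass_schubert (simple_refl k ` A) * grass_schubert B"
  using dd_grass_schubert[OF assms(1,3)] dd_grass_schubert[OF assms(2,3)] assms by (simp add: dd_mult)

lemma dd_grass_schubert_right:
  assumes "A \<subseteq> {1..n}" "B \<subseteq> {1..n}" "1 \<le> k" "k \<notin> B" "Suc k \<in> B" "\<not> (k \<notin> A \<and> Suc k \<in> A)"
  shows "divided_difference k (grass_schubert A * grass_schubert B) = grass_schubert A * grass_schubert (simple_refl k ` B)"
  using dd_grass_schubert_left[OF assms(2,1,3-6)] by (simp add: mult.commute)

text \<open>For the two signs, the positions at which the two Grassmannian permutations of the preclan take their
  small values; a left end counts for both signs.\<close>

definition marked :: "nat \<Rightarrow> node \<Rightarrow> (nat \<Rightarrow> node) \<Rightarrow> nat set" where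
  "marked n s \<gamma> = {i \<in> {1..n}. \<gamma> i = s \<or> (\<exists>j>i. \<gamma> i = Mate j)}"

lemma marked_sub: "marked n s \<gamma> \<subseteq> {1..n}"
  by (auto simp: marked_def)

definition marked_prod :: "nat \<Rightarrow> (nat \<Rightarrow> node) \<Rightarrow> int mpoly mpoly" where
  "marked_prod n \<gamma> = grass_schubert (marked n Plus \<gamma>) * grass_schubert (marked n Minus \<gamma>)"

lemma mini_no_mate: "mini n \<gamma> \<Longrightarrow> \<gamma> i \<noteq> Mate j"
proof
  assume m: "mini n \<gamma>" and ij: "\<gamma> i = Mate j"
  then have v: "valid n \<gamma>" by (simp add: mini_def)
  have ji: "\<gamma> j = Mate i" using valid_mate[OF v ij] .
  have "i \<noteq> j" using valid_mate_ne[OF v, of i] ij by auto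
  then show False using arc_desc[OF v ij] arc_desc[OF v ji] m unfolding mini_def by (metis linorder_neqE_nat)
qed

lemma mini_marked: "mini n \<gamma> \<Longrightarrow> marked n s \<gamma> = {i \<in> {1..n}. \<gamma> i = s}"
  using mini_no_mate[of n \<gamma>] by (auto simp: marked_def)

lemma dd_marked_prod:
  assumes k: "1 \<le> k" and s: "{s, t} = {Plus, Minus}"
    and J: "k \<notin> marked n s \<gamma>" "Suc k \<in> marked n s \<gamma>" "\<not> (k \<notin> marked n t \<gamma> \<and> Suc k \<in> marked n t \<gamma>)"
    and J': "marked n s \<gamma>' = simple_refl k ` marked n s \<gamma>" "marked n t \<gamma>' = marked n t \<gamma>"
  shows "divided_difference k (marked_prod n \<gamma>) = marked_prod n \<gamma>'"
proof -
  have "s = Plus \<and> t = Minus \<or> s = Minus \<and> t = Plus" using s by (auto simp: doubleton_eq_iff)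
  then show ?thesis
    using dd_grass_schubert_left[OF marked_sub marked_sub k J] dd_grass_schubert_right[OF marked_sub marked_sub k J] J' by (auto simp: marked_prod_def)
qed

text \<open>From either order of two neighbouring opposite signs, the divided difference leads to the product
  in which both sets contain the left one of the two places; this gives the relations between minimal
  preclans.\<close>

interpretation clan_poly: dd_family divided_difference "marked_prod n" n for n
proof
  fix k :: nat and f :: "int mpoly mpoly"
  show "divided_difference k (0 :: int mpoly mpoly) = 0" by simp
  show "divided_difference k (divided_difference k f) = 0" by (rule dd_dd)
  show "divided_difference k (divided_difference l f) = divided_difference l (divided_difference k f)"
    if "Suc k < l" for l using that by (rule dd_comm)
  show "divided_difference k (divided_difference (Suc k) (divided_difference k f))
    = divided_difference (Suc k) (divided_difference k (divided_difference (Suc k) f))" by (rule dd_braid)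
next
  fix \<gamma> k assume m: "mini n \<gamma>" and k: "1 \<le> k" "k < n" "\<gamma> k = \<gamma> (Suc k)"
  have "k \<in> marked n s \<gamma> \<longleftrightarrow> Suc k \<in> marked n s \<gamma>" for s using k by (auto simp: mini_marked[OF m])
  then show "divided_difference k (marked_prod n \<gamma>) = 0"
    using dd_grass_schubert[OF marked_sub k(1)] by (simp add: marked_prod_def dd_mult)
next
  fix \<gamma> :: "nat \<Rightarrow> node" and k s t
  let ?a = "\<gamma>(k := s, Suc k := t)" and ?b = "\<gamma>(k := t, Suc k := s)"
  assume m: "mini n ?a" "mini n ?b" and k: "1 \<le> k" "k < n" and st: "is_sign s" "is_sign t" "s \<noteq> t"
  define c where "c = (\<lambda>s. {i \<in> {1..n}. i \<noteq> k \<and> i \<noteq> Suc k \<and> \<gamma> i = s})"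
  have c: "k \<notin> c x" "Suc k \<notin> c x" "c x \<subseteq> {1..n}" for x by (auto simp: c_def)
  have J: "marked n s ?a = insert k (c s)" "marked n t ?a = insert (Suc k) (c t)"
    "marked n s ?b = insert (Suc k) (c s)" "marked n t ?b = insert k (c t)"
    using st k by (auto simp: mini_marked[OF m(1)] mini_marked[OF m(2)] c_def split: if_splits)
  have r: "insert k (c x) \<subseteq> {1..n}" "insert (Suc k) (c x) \<subseteq> {1..n}" for x using k c(3) by auto
  have "divided_difference k (grass_schubert (insert k (c x)) * grass_schubert (insert (Suc k) (c y))) = grass_schubert (insert k (c x)) * grass_schubert (insert k (c y))"
    "divided_difference k (grass_schubert (insert (Suc k) (c x)) * grass_schubert (insert k (c y))) = grass_schubert (insert k (c x)) * grass_schubert (insert k (c y))" for x y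
    using dd_grass_schubert_right[OF r(1)[of x] r(2)[of y] k(1)] dd_grass_schubert_left[OF r(2)[of x] r(1)[of y] k(1)] c swap_insert by auto
  then show "divided_difference k (marked_prod n ?a) = divided_difference k (marked_prod n ?b)"
    using J st by (auto simp: marked_prod_def is_sign_def)
next
  fix \<gamma> :: "nat \<Rightarrow> node" and k s t
  let ?j = "Suc k" and ?l = "Suc (Suc k)"
  let ?a = "\<gamma>(k := s, ?j := s, ?l := t)" and ?b = "\<gamma>(k := t, ?j := s, ?l := s)"
  assume m: "mini n ?a" "mini n ?b" and k: "1 \<le> k" "Suc k < n" and st: "is_sign s" "is_sign t" "s \<noteq> t"
  define c where "c = (\<lambda>s. {i \<in> {1..n}. i \<noteq> k \<and> i \<noteq> ?j \<and> i \<noteq> ?l \<and> \<gamma> i = s})"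
  have c: "k \<notin> c x" "?j \<notin> c x" "?l \<notin> c x" "c x \<subseteq> {1..n}" for x by (auto simp: c_def)
  have J: "marked n s ?a = insert k (insert ?j (c s))" "marked n t ?a = insert ?l (c t)"
    "marked n s ?b = insert ?l (insert ?j (c s))" "marked n t ?b = insert k (c t)"
    using st k by (auto simp: mini_marked[OF m(1)] mini_marked[OF m(2)] c_def split: if_splits)
  have r: "insert k (c x) \<subseteq> {1..n}" "insert ?j (c x) \<subseteq> {1..n}" "insert ?l (c x) \<subseteq> {1..n}"
    "insert k (insert ?j (c x)) \<subseteq> {1..n}" "insert ?l (insert ?j (c x)) \<subseteq> {1..n}" "insert ?l (insert k (c x)) \<subseteq> {1..n}" for x
    using k c(4) by auto
  have sw: "simple_refl ?j ` insert ?l (c x) = insert ?j (c x)" "simple_refl k ` insert ?j (c x) = insert k (c x)"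
    "simple_refl k ` insert ?l (insert ?j (c x)) = insert ?l (insert k (c x))"
    "simple_refl ?j ` insert ?l (insert k (c x)) = insert k (insert ?j (c x))" for x
    using swap_insert[of ?j "c x"] swap_insert[of k "c x"] swap_insert[of k "insert ?l (c x)"] swap_insert[of ?j "insert k (c x)"] c[of x]
    by (auto simp: insert_commute)
  have l: "divided_difference ?j (grass_schubert (insert k (insert ?j (c s))) * grass_schubert (insert ?l (c t))) = grass_schubert (insert k (insert ?j (c s))) * grass_schubert (insert ?j (c t))"
    "divided_difference k (grass_schubert (insert k (insert ?j (c s))) * grass_schubert (insert ?j (c t))) = grass_schubert (insert k (insert ?j (c s))) * grass_schubert (insert k (c t))" for s t
    using dd_grass_schubert_right[OF r(4)[of s] r(3)[of t], of ?j] dd_grass_schubert_right[OF r(4)[of s] r(2)[of t], of k] c k sw by auto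
  have q: "divided_difference k (grass_schubert (insert ?l (insert ?j (c s))) * grass_schubert (insert k (c t))) = grass_schubert (insert ?l (insert k (c s))) * grass_schubert (insert k (c t))"
    "divided_difference ?j (grass_schubert (insert ?l (insert k (c s))) * grass_schubert (insert k (c t))) = grass_schubert (insert k (insert ?j (c s))) * grass_schubert (insert k (c t))" for s t
    using dd_grass_schubert_left[OF r(5)[of s] r(1)[of t], of k] dd_grass_schubert_left[OF r(6)[of s] r(1)[of t], of ?j] c k sw by auto
  have pj: "marked_prod n g = grass_schubert (marked n s g) * grass_schubert (marked n t g)" for g
    using st by (auto simp: marked_prod_def is_sign_def mult.commute)
  show "divided_difference k (divided_difference ?j (marked_prod n ?a)) = divided_difference ?j (divided_difference k (marked_prod n ?b))"
    unfolding pj J l q ..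
qed


section \<open>Noncrossing preclans\<close>

text \<open>Arcs may neither cross each other nor pass over blanks; the preclans of pairs have this form, as their
  arcs come from first returns of a path.\<close>

definition noncrossing :: "nat \<Rightarrow> (nat \<Rightarrow> node) \<Rightarrow> bool" where
  "noncrossing n \<gamma> \<longleftrightarrow> valid n \<gamma> \<and>
     (\<forall>a b c d. \<gamma> a = Mate b \<longrightarrow> \<gamma> c = Mate d \<longrightarrow> \<not> (a < c \<and> c < b \<and> b < d)) \<and>
     (\<forall>a b c. \<gamma> a = Mate b \<longrightarrow> a < c \<longrightarrow> c < b \<longrightarrow> \<gamma> c \<noteq> Blank)"

lemma clan_poly_dn: "valid n \<gamma> \<Longrightarrow> dn n k \<gamma> \<delta> \<Longrightarrow> clan_poly.P n \<gamma> = divided_difference k (clan_poly.P n \<delta>)"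
  using clan_poly.all_good[of n \<gamma>] unfolding clan_poly.good_def by blast

lemma noncrossing_valid: "noncrossing n \<gamma> \<Longrightarrow> valid n \<gamma>"
  by (simp add: noncrossing_def)

lemma noncrossing_cross: "noncrossing n \<gamma> \<Longrightarrow> \<gamma> a = Mate b \<Longrightarrow> \<gamma> c = Mate d \<Longrightarrow> a < c \<Longrightarrow> c < b \<Longrightarrow> b < d \<Longrightarrow> False"
  unfolding noncrossing_def by blast

lemma noncrossing_blank: "noncrossing n \<gamma> \<Longrightarrow> \<gamma> a = Mate b \<Longrightarrow> a < c \<Longrightarrow> c < b \<Longrightarrow> \<gamma> c = Blank \<Longrightarrow> False"
  unfolding noncrossing_def by blast

lemma sconj_Mate: "sconj k \<gamma> i = Mate j \<longleftrightarrow> \<gamma> (simple_refl k i) = Mate (simple_refl k j)"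
  by (cases "\<gamma> (simple_refl k i)") (auto simp: sconj_def)

lemma noncrossing_sconj:
  assumes nc: "noncrossing n \<gamma>" and v: "valid n (sconj k \<gamma>)" and s: "is_sign (sconj k \<gamma> k)"
    and nb: "sconj k \<gamma> (Suc k) \<noteq> Blank \<or> (\<forall>i j. \<gamma> i \<noteq> Mate j)"
  shows "noncrossing n (sconj k \<gamma>)"
proof -
  let ?\<delta> = "sconj k \<gamma>" and ?s = "simple_refl k"
  have nk: "x \<noteq> k \<and> y \<noteq> k" if "?\<delta> x = Mate y" for x y
    using that s valid_mate[OF v that] by auto
  have lt: "?s x < ?s y" if "x < y" "x \<noteq> k \<or> y \<noteq> Suc k" for x y
    using that by (auto simp: simple_refl_def')
  show ?thesis
    unfolding noncrossing_def
  proof (intro conjI allI impI notI)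
    show "valid n ?\<delta>" by (rule v)
  next
    fix a b c d assume m: "?\<delta> a = Mate b" "?\<delta> c = Mate d" and o: "a < c \<and> c < b \<and> b < d"
    show False
      using noncrossing_cross[OF nc m[unfolded sconj_Mate]] lt[of a c] lt[of c b] lt[of b d] o nk[OF m(1)] nk[OF m(2)]
      by auto
  next
    fix a b c assume m: "?\<delta> a = Mate b" and o: "a < c" "c < b" and bl: "?\<delta> c = Blank"
    have "c \<noteq> k" using bl s by auto
    then show False
      using noncrossing_blank[OF nc m[unfolded sconj_Mate], of "?s c"] lt[of a c] lt[of c b] o nk[OF m] bl
      unfolding sconj_Blank by auto
  qed
qed

lemma marked_iff: "i \<in> marked n s \<gamma> \<longleftrightarrow> 1 \<le> i \<and> i \<le> n \<and> (\<gamma> i = s \<or> (\<exists>j>i. \<gamma> i = Mate j))"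
  by (auto simp: marked_def)

lemma sign_cases: "is_sign c \<Longrightarrow> \<exists>t. is_sign t \<and> t \<noteq> c \<and> {t, c} = {Plus, Minus}"
  by (auto simp: is_sign_def)

text \<open>By induction on the length: shrinking an innermost arc by moving its left end to the right, or
  undoing an arc of length one, is a divided difference of one of the two factors only.\<close>

lemma noncrossing_clan_poly: "noncrossing n \<gamma> \<Longrightarrow> clan_poly.P n \<gamma> = marked_prod n \<gamma>"
proof (induction "plen n \<gamma>" arbitrary: \<gamma> rule: less_induct)
  case less
  note nc = less.prems and v = noncrossing_valid[OF less.prems]
  have step: "clan_poly.P n \<gamma> = marked_prod n \<gamma>"
    if d: "dn n k \<gamma> \<delta>" and n\<delta>: "valid n \<delta> \<Longrightarrow> noncrossing n \<delta>" and s: "{s, t} = {Plus, Minus}"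
      and J: "k \<notin> marked n s \<delta>" "Suc k \<in> marked n s \<delta>" "\<not> (k \<notin> marked n t \<delta> \<and> Suc k \<in> marked n t \<delta>)"
      and J': "\<And>x. x \<in> marked n s \<gamma> \<longleftrightarrow> simple_refl k x \<in> marked n s \<delta>" "\<And>x. x \<in> marked n t \<gamma> \<longleftrightarrow> x \<in> marked n t \<delta>"
    for k \<delta> s t
  proof -
    note p = dn_props[OF v d]
    have "clan_poly.P n \<delta> = marked_prod n \<delta>" using less.hyps[OF dn_plen[OF v d] n\<delta>[OF p(1)]] .
    moreover have "divided_difference k (marked_prod n \<delta>) = marked_prod n \<gamma>"
      by (rule dd_marked_prod[OF p(2) s J]) (use J' mem_swap in blast)+
    ultimately show ?thesis using clan_poly_dn[OF v d] by simp
  qed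
  show ?case
  proof (cases "\<exists>a b. \<gamma> a = Mate b \<and> a < b")
    case True
    then obtain a b where ab: "\<gamma> a = Mate b" "a < b"
      and min: "\<And>c d. \<gamma> c = Mate d \<Longrightarrow> c < d \<Longrightarrow> b - a \<le> d - c"
      using ex_has_least_nat[of "\<lambda>x. \<gamma> (fst x) = Mate (snd x) \<and> fst x < snd x" _ "\<lambda>x. snd x - fst x"]
      by (metis fst_conv snd_conv)
    have ba: "\<gamma> b = Mate a" using valid_mate[OF v ab(1)] .
    have r: "1 \<le> a" "b \<le> n" using valid_mate_range[OF v ab(1)] by auto
    have sg: "is_sign (\<gamma> c)" if c: "a < c" "c < b" for c
    proof (cases "\<gamma> c")
      case (Mate d)
      have dc: "\<gamma> d = Mate c" using valid_mate[OF v Mate] .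
      have "d \<noteq> a" "d \<noteq> b" using dc ab ba c by auto
      then consider "d < a" | "b < d" | "a < d" "d < b" by linarith
      then show ?thesis
      proof cases
        case 1
        then show ?thesis using noncrossing_cross[OF nc dc ab(1)] c by simp
      next
        case 2
        then show ?thesis using noncrossing_cross[OF nc ab(1) Mate] c by simp
      next
        case 3
        have "c \<noteq> d" using valid_mate_ne[OF v, of c] Mate by auto
        then show ?thesis using min[OF Mate] min[OF dc] c 3 by linarith
      qed
    qed (use noncrossing_blank[OF nc ab(1) c] in auto)
    show ?thesis
    proof (cases "b = Suc a")
      case True
      let ?\<delta> = "\<gamma>(a := Minus, Suc a := Plus)"
      have "desc n \<gamma> a" using ab ba r True by (simp add: desc_def)
      then have d: "dn n a \<gamma> ?\<delta>" using dn_link[of n \<gamma> a Minus Plus] ab True by simp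
      have sub: "\<gamma> x = Mate y" if "?\<delta> x = Mate y" for x y using that by (auto split: if_splits)
      have "noncrossing n ?\<delta>" if "valid n ?\<delta>"
        unfolding noncrossing_def
      proof (intro conjI allI impI notI that)
        fix a' b' c' d' assume "?\<delta> a' = Mate b'" "?\<delta> c' = Mate d'" "a' < c' \<and> c' < b' \<and> b' < d'"
        then show False using noncrossing_cross[OF nc sub sub] by blast
      next
        fix a' b' c' assume "?\<delta> a' = Mate b'" "a' < c'" "c' < b'" "?\<delta> c' = Blank"
        then show False using noncrossing_blank[OF nc sub, of a' b' c'] by (auto split: if_splits)
      qed
      then show ?thesis
        by (rule step[OF d, of Plus Minus]) (use ab ba r True in \<open>auto simp: marked_iff simple_refl_def'\<close>)
    next
      case False
      then have b: "Suc a < b" using ab by simp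
      have s: "is_sign (\<gamma> (Suc a))" by (rule sg) (use b in auto)
      let ?\<delta> = "sconj a \<gamma>"
      have "desc n \<gamma> a" using ab s r b by (simp add: desc_def nkey_sign)
      then have d: "dn n a \<gamma> ?\<delta>" using dn_sconj[of n \<gamma> a] ab b by simp
      have at: "?\<delta> a = \<gamma> (Suc a)" "?\<delta> (Suc a) = Mate b" using s ab b by (auto simp: sconj_at)
      have oth: "?\<delta> i = (if i = b then Mate (Suc a) else \<gamma> i)" if "i \<noteq> a" "i \<noteq> Suc a" for i
      proof (cases "i = b")
        case True
        then show ?thesis using that ba by (simp add: sconj_at)
      next
        case False
        have "\<gamma> i \<noteq> Mate a" using valid_mate[OF v, of i a] ab False by auto
        moreover have "\<gamma> i \<noteq> Mate (Suc a)" using valid_mate[OF v, of i "Suc a"] s by auto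
        ultimately show ?thesis using that False by (simp add: sconj_other)
      qed
      obtain t where t: "is_sign t" "t \<noteq> \<gamma> (Suc a)" "{t, \<gamma> (Suc a)} = {Plus, Minus}" using sign_cases[OF s] by blast
      have J: "x \<in> marked n z ?\<delta> \<longleftrightarrow> (if x = a then \<gamma> (Suc a) = z else if x = Suc a then True else x \<in> marked n z \<gamma>)"
        if "is_sign z" for x z
        using at oth[of x] ab ba b r s that by (auto simp: marked_iff)
      have J2: "a \<in> marked n z \<gamma>" "Suc a \<in> marked n z \<gamma> \<longleftrightarrow> \<gamma> (Suc a) = z" for z
        using ab r b s by (auto simp: marked_iff)
      show ?thesis
      proof (rule step[OF d _ t(3)])
        show "noncrossing n ?\<delta>" if "valid n ?\<delta>"
          by (rule noncrossing_sconj[OF nc that]) (use at s in auto)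
      qed (use t s J2 in \<open>auto simp: J simple_refl_def'\<close>)
    qed
  next
    case False
    then have no: "\<gamma> i \<noteq> Mate j" for i j
      using valid_mate[OF v, of i j] valid_mate_ne[OF v, of i] by (metis linorder_neqE_nat)
    show ?thesis
    proof (cases "\<exists>k. desc n \<gamma> k")
      case False
      then have "mini n \<gamma>" using v by (simp add: mini_def)
      then show ?thesis by (rule clan_poly.P_mini)
    next
      case True
      then obtain k where k: "desc n \<gamma> k" by blast
      have s: "is_sign (\<gamma> k)" "\<gamma> (Suc k) = Blank"
        using k no[of k] no[of "Suc k"] by (cases "\<gamma> k"; cases "\<gamma> (Suc k)"; simp add: desc_def)+
      have r: "1 \<le> k" "k < n" using k by (auto simp: desc_def)
      let ?\<delta> = "sconj k \<gamma>"
      have d: "dn n k \<gamma> ?\<delta>" using dn_sconj[OF k no] .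
      have \<delta>: "?\<delta> x = \<gamma> (simple_refl k x)" for x
        using no by (cases "\<gamma> (simple_refl k x)") (auto simp: sconj_def)
      have no': "?\<delta> i \<noteq> Mate j" for i j using no by (simp add: \<delta>)
      obtain t where t: "is_sign t" "t \<noteq> \<gamma> k" "{t, \<gamma> k} = {Plus, Minus}" using sign_cases[OF s(1)] by blast
      have J: "x \<in> marked n z \<gamma> \<longleftrightarrow> 1 \<le> x \<and> x \<le> n \<and> \<gamma> x = z"
        "x \<in> marked n z ?\<delta> \<longleftrightarrow> 1 \<le> x \<and> x \<le> n \<and> \<gamma> (simple_refl k x) = z" for x z
        using no no' by (auto simp: marked_iff \<delta>)
      show ?thesis
      proof (rule step[OF d])
        show "noncrossing n ?\<delta>" if "valid n ?\<delta>" using that no' by (simp add: noncrossing_def)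
        show "{\<gamma> k, t} = {Plus, Minus}" using t(3) by (simp add: insert_commute)
        show "x \<in> marked n (\<gamma> k) \<gamma> \<longleftrightarrow> simple_refl k x \<in> marked n (\<gamma> k) ?\<delta>" for x
          using r simple_refl_range[OF r, of x] by (auto simp: J)
        show "x \<in> marked n t \<gamma> \<longleftrightarrow> x \<in> marked n t ?\<delta>" for x
          using r t(2,1) s by (auto simp: J simple_refl_def')
      qed (use r s t in \<open>auto simp: J\<close>)
    qed
  qed
qed

section \<open>The preclan of a pair\<close>

context
  fixes p q m n :: nat and v u :: "nat \<Rightarrow> nat"
  assumes def: "pair_preclan_defined p q n v u" and n: "n = p + m + q"
begin

text \<open>The path with the up and down steps of the pair, in terms of which a return is an equality of heights.\<close>

definition height :: "nat \<Rightarrow> int" where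
  "height i = int (card (up_steps p q v u \<inter> {1..i})) - int (card (down_steps p q v u \<inter> {1..i}))"

lemma vimage_sub: "v -` {1..p} \<subseteq> {1..n}" "u -` {1..q} \<subseteq> {1..n}"
  using def n permutes_not_in[of v "{1..n}"] permutes_not_in[of u "{1..n}"]
  by (fastforce simp: pair_preclan_defined_def Sn_def)+

lemma down_range: "i \<in> down_steps p q v u \<Longrightarrow> 1 \<le> i \<and> i \<le> n"
  using vimage_sub by (auto simp: down_steps_def)

lemma up_not_down: "i \<in> up_steps p q v u \<Longrightarrow> i \<notin> down_steps p q v u"
  by (auto simp: up_steps_def down_steps_def)

lemma height_Suc: "height (Suc k) = height k +
    (if Suc k \<in> up_steps p q v u then 1 else 0) - (if Suc k \<in> down_steps p q v u then 1 else 0)"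
  by (simp add: height_def atLeastAtMostSuc_conv Int_insert_right)

lemma height_down: "a \<in> down_steps p q v u \<Longrightarrow> height a = height (a - 1) - 1"
  using height_Suc[of "a - 1"] down_range[of a] up_not_down[of a] by auto

lemma returns_height: "returns_at p q v u i j \<longleftrightarrow>
    i \<in> down_steps p q v u \<and> i < j \<and> j \<in> up_steps p q v u \<and> height j = height (i - 1)"
proof -
  have "height j - height (i - 1) =
      int (card (up_steps p q v u \<inter> {i..j})) - int (card (down_steps p q v u \<inter> {i..j}))"
    if "1 \<le> i" "i < j"
  proof -
    have "{1..j} = {1..i - 1} \<union> {i..j}" using that by auto
    then have "card (X \<inter> {1..j}) = card (X \<inter> {1..i - 1}) + card (X \<inter> {i..j})" for X
      using that by (subst card_Un_disjoint[symmetric]) (auto simp: Int_Un_distrib)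
    then show ?thesis by (simp add: height_def)
  qed
  then show ?thesis using down_range[of i] by (auto simp: returns_at_def)
qed

text \<open>Before its first return the path stays below the height at which the step starts.\<close>

lemma height_inside:
  assumes "step_match p q v u a b" "a \<le> l" "l < b"
  shows "height l < height (a - 1)"
proof -
  have a: "a \<in> down_steps p q v u" using assms(1) by (auto simp: step_match_def returns_height)
  have "a + d < b \<longrightarrow> height (a + d) < height (a - 1)" for d
  proof (induction d)
    case 0
    then show ?case using height_down[OF a] by simp
  next
    case (Suc d)
    show ?case
    proof
      assume lt: "a + Suc d < b"
      then have "height (a + d) < height (a - 1)" using Suc by simp
      moreover have "\<not> returns_at p q v u a (a + Suc d)" using assms(1) lt unfolding step_match_def by fastforce
      ultimately show "height (a + Suc d) < height (a - 1)"
        using height_Suc[of "a + d"] a unfolding returns_height by (auto split: if_splits)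
    qed
  qed
  from this[of "l - a"] show ?thesis using assms by simp
qed

abbreviation (input) pair_clan where "pair_clan \<equiv> pair_preclan p q n v u"

lemma pair_valid: "valid n pair_clan"
  using preclan_pair_preclan[OF def n] n unfolding preclan_def valid_def Let_def by blast

lemma pair_match: "step_match p q v u i j \<Longrightarrow> pair_clan i = Mate j"
proof -
  assume s: "step_match p q v u i j"
  then have i: "i \<in> down_steps p q v u" by (auto simp: step_match_def returns_at_def)
  have "(THE j. step_match p q v u i j) = j"
    using s by (intro the_equality) (auto simp: step_match_def intro: order_antisym)
  then show ?thesis
    using i down_range[OF i] by (auto simp: pair_preclan_def plus_steps_def minus_steps_def down_steps_def)
qed

lemma pair_arc: "pair_clan i = Mate j \<Longrightarrow> i < j \<Longrightarrow> step_match p q v u i j"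
proof -
  assume ij: "pair_clan i = Mate j" "i < j"
  show ?thesis
  proof (cases "i \<in> down_steps p q v u")
    case True
    then obtain j' where "step_match p q v u i j'" using def by (auto simp: pair_preclan_defined_def)
    then show ?thesis using pair_match ij by fastforce
  next
    case False
    then obtain l where l: "step_match p q v u l i"
      using ij by (auto simp: pair_preclan_def split: if_splits)
    then have "pair_clan i = Mate l" using valid_mate[OF pair_valid pair_match] by simp
    then show ?thesis using l ij by (auto simp: step_match_def returns_at_def)
  qed
qed

lemma down_arc: "i \<in> down_steps p q v u \<Longrightarrow> \<exists>j>i. pair_clan i = Mate j"
  using def pair_match by (fastforce simp: pair_preclan_defined_def step_match_def returns_at_def)

lemma pair_left: "(\<exists>j>i. pair_clan i = Mate j) \<longleftrightarrow> i \<in> down_steps p q v u"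
  using down_arc pair_arc by (fastforce simp: step_match_def returns_at_def)

lemma pair_marked: "marked n Plus pair_clan = v -` {1..p}" "marked n Minus pair_clan = u -` {1..q}"
proof -
  have a: "pair_clan i = Plus \<longleftrightarrow> i \<in> plus_steps p q v u" "pair_clan i = Minus \<longleftrightarrow> i \<in> minus_steps p q v u" if "i \<in> {1..n}" for i
    using that by (auto simp: pair_preclan_def plus_steps_def minus_steps_def)
  show "marked n Plus pair_clan = v -` {1..p}" "marked n Minus pair_clan = u -` {1..q}"
    using a vimage_sub unfolding marked_def pair_left by (auto simp: plus_steps_def minus_steps_def down_steps_def)
qed

text \<open>The heights at the ends of two crossing arcs would form a cyclic chain of inequalities. An up step
  below an arc is matched with the last down step before it that starts at the height reached.\<close>

lemma pair_noncrossing: "noncrossing n pair_clan"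
  unfolding noncrossing_def
proof (intro conjI allI impI notI)
  show "valid n pair_clan" by (rule pair_valid)
next
  fix a b c d assume m: "pair_clan a = Mate b" "pair_clan c = Mate d" and o: "a < c \<and> c < b \<and> b < d"
  have s: "step_match p q v u a b" "step_match p q v u c d" using pair_arc m o by auto
  have "height (c - 1) < height (a - 1)" using height_inside[OF s(1), of "c - 1"] o by auto
  moreover have "height b < height (c - 1)" using height_inside[OF s(2), of b] o by auto
  moreover have "height b = height (a - 1)" using s(1) by (auto simp: step_match_def returns_height)
  ultimately show False by simp
next
  fix a b c assume m: "pair_clan a = Mate b" and o: "a < c" "c < b" and bl: "pair_clan c = Blank"
  have s: "step_match p q v u a b" using pair_arc m o by auto
  have c: "1 \<le> c" "c \<le> n" using valid_mate_range[OF pair_valid m] o by auto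
  have nc: "c \<notin> plus_steps p q v u" "c \<notin> minus_steps p q v u" "c \<notin> down_steps p q v u"
    "\<And>l. \<not> step_match p q v u l c"
    using bl c by (auto simp: pair_preclan_def split: if_splits)
  then have cu: "c \<in> up_steps p q v u" using c by (auto simp: plus_steps_def minus_steps_def down_steps_def up_steps_def)
  have hc: "height (c - 1) = height c - 1" using height_Suc[of "c - 1"] c cu nc(3) by auto
  let ?Q = "\<lambda>l. a \<le> l \<and> l \<le> c \<and> height c \<le> height (l - 1)"
  (* The last step up to c that does not start below the height reached at c. It is a down step,
     and c is its first return. *)
  define l where "l = (GREATEST l. ?Q l)"
  have "?Q a" using height_inside[OF s, of c] o by auto
  then have l: "?Q l" "\<And>i. ?Q i \<Longrightarrow> i \<le> l"
    unfolding l_def by (rule GreatestI_nat[of ?Q a c], simp) (rule Greatest_le_nat[of ?Q _ c], auto)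
  have "l \<noteq> c" using l(1) hc by auto
  then have lc: "l < c" using l(1) by simp
  have below: "height j < height c" if "l \<le> j" "j < c" for j
    using l(2)[of "Suc j"] l(1) that by (cases "height c \<le> height j") auto
  have l1: "1 \<le> l" using l(1) valid_mate_range[OF pair_valid m] by auto
  have "height l < height c" using below lc by simp
  then have ld: "l \<in> down_steps p q v u" "height (l - 1) = height c"
    using height_Suc[of "l - 1"] l(1) l1 by (auto split: if_splits)
  have "returns_at p q v u l c" using ld lc cu by (simp add: returns_height)
  moreover have "c \<le> j" if "returns_at p q v u l j" for j
    using that below[of j] ld by (auto simp: returns_height not_less[symmetric])
  ultimately show False using nc(4)[of l] by (simp add: step_match_def)
qed

lemma pair_card: "card (marked n Plus pair_clan) = p" "card (marked n Minus pair_clan) = q"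
proof -
  have "bij v" "bij u" using def by (auto simp: pair_preclan_defined_def Sn_def permutes_bij)
  then show "card (marked n Plus pair_clan) = p" "card (marked n Minus pair_clan) = q"
    unfolding pair_marked by (simp_all add: card_vimage_inj bij_is_inj bij_is_surj)
qed

end


section \<open>Vanishing of localizations\<close>

text \<open>The localization is zero unless every initial interval contains at most as many elements of the
  preimage of \<open>{1..p}\<close> under \<open>\<sigma>\<close> as elements of \<open>A\<close>. This is a part of the Bruhat order.\<close>

definition vanishing :: "nat \<Rightarrow> nat set \<Rightarrow> int mpoly mpoly \<Rightarrow> bool" where
  "vanishing p A f \<longleftrightarrow> (\<forall>\<sigma>\<in>S_infty. \<forall>i. card (A \<inter> {1..i}) < rk \<sigma> i p \<longrightarrow> loc \<sigma> f = 0)"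

definition demazure :: "nat \<Rightarrow> nat set \<Rightarrow> nat set" where
  "demazure k A = (if k \<notin> A \<and> Suc k \<in> A then simple_refl k ` A else A)"

lemma vanishingD: "vanishing p A f \<Longrightarrow> \<sigma> \<in> S_infty \<Longrightarrow> card (A \<inter> {1..i}) < rk \<sigma> i p \<Longrightarrow> loc \<sigma> f = 0"
  unfolding vanishing_def by blast

lemma card_prefix_Suc: "card (A \<inter> {1..Suc i}) = card (A \<inter> {1..i}) + (if Suc i \<in> A then 1 else 0)"
  by (simp add: atLeastAtMostSuc_conv Int_insert_right)

lemma card_prefix_swap: "i \<noteq> k \<Longrightarrow> 1 \<le> k \<Longrightarrow> card (simple_refl k ` A \<inter> {1..i}) = card (A \<inter> {1..i})"
  by (rule card_swap[of _ k]) (auto simp: mem_swap simple_refl_def' split: if_splits)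

text \<open>Both terms of the divided difference vanish: if an inequality is violated at the interval \<open>{1..k}\<close>,
  which is the only one that \<open>s\<^sub>k\<close> affects, then it is already violated at a neighbouring interval.\<close>

lemma vanishing_dd:
  assumes f: "vanishing p A f" and k: "1 \<le> k"
  shows "vanishing p (demazure k A) (divided_difference k f)"
  unfolding vanishing_def
proof (intro ballI allI impI)
  fix \<sigma> i assume \<sigma>: "\<sigma> \<in> S_infty" and lt: "card (demazure k A \<inter> {1..i}) < rk \<sigma> i p"
  obtain k' where k': "k = Suc k'" using k by (cases k) auto
  have pre: "card (demazure k A \<inter> {1..j}) = card (A \<inter> {1..j})" if "j \<noteq> k" for j
    using card_prefix_swap[OF that k] by (simp add: demazure_def)
  have mem: "k \<in> demazure k A \<longleftrightarrow> k \<in> A \<or> Suc k \<in> A"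
    by (auto simp: demazure_def mem_swap)
  have atk: "card (demazure k A \<inter> {1..k}) = card (A \<inter> {1..k'}) + (if k \<in> A \<or> Suc k \<in> A then 1 else 0)"
    using card_prefix_Suc[of "demazure k A" k'] pre[of k'] mem k' by simp
  have "card (A \<inter> {1..i}) \<le> card (demazure k A \<inter> {1..i})"
    using pre[of i] atk card_prefix_Suc[of A k'] k' by (cases "i = k") auto
  then have 1: "loc \<sigma> f = 0" using vanishingD[OF f \<sigma> order.strict_trans1[OF _ lt]] by blast
  have s: "\<sigma> \<circ> simple_refl k \<in> S_infty" using Sinf_comp[OF \<sigma> Sinf_simple[OF k]] .
  have "\<exists>j. card (A \<inter> {1..j}) < rk (\<sigma> \<circ> simple_refl k) j p"
  proof (cases "i = k")
    case False
    then have "card (A \<inter> {1..i}) < rk (\<sigma> \<circ> simple_refl k) i p"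
      using lt pre[OF False] rk_swap[OF False k, of \<sigma> p] by simp
    then show ?thesis by blast
  next
    case True
    show ?thesis
    proof (cases "k \<in> A \<or> Suc k \<in> A")
      case True
      then have "card (A \<inter> {1..k'}) < rk \<sigma> k' p"
        using lt \<open>i = k\<close> atk rk_Suc[of \<sigma> k' p] k' by (auto split: if_splits)
      then have "card (A \<inter> {1..k'}) < rk (\<sigma> \<circ> simple_refl k) k' p" using rk_swap[of k' k \<sigma> p] k' by simp
      then show ?thesis by blast
    next
      case False
      then have "card (A \<inter> {1..Suc k}) < rk \<sigma> (Suc k) p"
        using lt \<open>i = k\<close> atk rk_Suc[of \<sigma> k p] card_prefix_Suc[of A k] card_prefix_Suc[of A k'] k' by auto
      then have "card (A \<inter> {1..Suc k}) < rk (\<sigma> \<circ> simple_refl k) (Suc k) p"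
        using rk_swap[of "Suc k" k \<sigma> p] k by simp
      then show ?thesis by blast
    qed
  qed
  then have "loc (\<sigma> \<circ> simple_refl k) f = 0" using vanishingD[OF f s] by blast
  then have "(t_var (\<sigma> k) - t_var (\<sigma> (Suc k))) * loc \<sigma> (divided_difference k f) = 0"
    unfolding loc_dd using 1 by simp
  then show "loc \<sigma> (divided_difference k f) = 0" using Sinf_eq_iff[OF \<sigma>] by simp
qed

lemma rk_grass:
  assumes "A \<subseteq> {1..n}"
  shows "rk (grass A) i (card A) = card (A \<inter> {1..i})"
proof -
  have A: "finite A" "0 \<notin> A" using assms finite_subset by auto
  have "grass A a \<le> card A \<longleftrightarrow> a \<in> A" if "1 \<le> a" for a
    using grass_in[OF A, of a] grass_out[of a A] that by (cases "a \<in> A") auto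
  then have "{a \<in> {1..i}. grass A a \<le> card A} = A \<inter> {1..i}" by auto
  then show ?thesis by (simp add: rk_def)
qed

lemma vanishing_grass_schubert:
  assumes "A \<subseteq> {1..n}"
  shows "vanishing (card A) A (grass_schubert A)"
  unfolding vanishing_def grass_schubert_def
proof (intro ballI allI impI)
  fix \<sigma> i assume \<sigma>: "\<sigma> \<in> S_infty" and lt: "card (A \<inter> {1..i}) < rk \<sigma> i (card A)"
  have S: "schubert_rel (max n i) (grass A) (double_schubert (grass A))"
    using double_schubert_rel[OF grass_Sn[OF assms]] schubert_mono by simp
  show "loc \<sigma> (double_schubert (grass A)) = 0"
    by (rule schubert_vanish[OF S \<sigma>, of i "card A"]) (use lt rk_grass[OF assms] in simp_all)
qed

lemma vanishing_mult: "vanishing p A f \<Longrightarrow> vanishing p A (f * g)" "vanishing p A f \<Longrightarrow> vanishing p A (g * f)"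
  by (auto simp: vanishing_def loc.hom_mult)

lemma marked_sconj:
  assumes k: "1 \<le> k" "k < n" and s: "is_sign s" and nm: "\<gamma> k \<noteq> Mate (Suc k)" "\<gamma> (Suc k) \<noteq> Mate k"
  shows "marked n s (sconj k \<gamma>) = simple_refl k ` marked n s \<gamma>"
proof -
  have sg: "sconj k \<gamma> x = s \<longleftrightarrow> \<gamma> (simple_refl k x) = s" for x
    using s by (cases "\<gamma> (simple_refl k x)") (auto simp: sconj_def)
  have "(\<exists>j>x. sconj k \<gamma> x = Mate j) \<longleftrightarrow> (\<exists>j>simple_refl k x. \<gamma> (simple_refl k x) = Mate j)" for x
  proof -
    have "x < simple_refl k j \<longleftrightarrow> simple_refl k x < j" if "\<gamma> (simple_refl k x) = Mate j" for j
      using simple_refl_less_iff[of "simple_refl k x" k j] that nm by (metis simple_refl_invol)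
    then show ?thesis unfolding sconj_Mate by (metis simple_refl_invol)
  qed
  then have "x \<in> marked n s (sconj k \<gamma>) \<longleftrightarrow> simple_refl k x \<in> marked n s \<gamma>" for x
    using simple_refl_range[OF k, of x] by (auto simp: marked_iff sg)
  then show ?thesis using mem_swap by blast
qed

text \<open>On the level of the sets of left ends and nodes of a given sign, the action is the action of
  Demazure operators on subsets.\<close>

lemma marked_simple_act:
  assumes v: "valid n \<gamma>" and k: "1 \<le> k" "k < n" and s: "is_sign s" and ne: "simple_act k \<gamma> \<noteq> \<gamma>"
  shows "marked n s (simple_act k \<gamma>) = demazure k (marked n s \<gamma>)"
proof -
  have asc: "key \<gamma> k < key \<gamma> (Suc k)" using ne unfolding simple_act_eq[OF v k(1)] by auto
  have nm: "\<gamma> k \<noteq> Mate (Suc k)" "\<gamma> (Suc k) \<noteq> Mate k"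
    using asc valid_mate[OF v, of k "Suc k"] valid_mate[OF v, of "Suc k" k] by auto
  show ?thesis
  proof (cases "is_sign (\<gamma> k) \<and> is_sign (\<gamma> (Suc k))")
    case True
    then have act: "simple_act k \<gamma> = \<gamma>(k := Mate (Suc k), Suc k := Mate k)" and d: "\<gamma> k \<noteq> \<gamma> (Suc k)"
      using ne unfolding simple_act_eq[OF v k(1)] by (auto split: if_splits)
    have "x \<in> marked n s (simple_act k \<gamma>) \<longleftrightarrow> x \<in> demazure k (marked n s \<gamma>)" for x
      using True d k s unfolding act by (auto simp: marked_iff demazure_def mem_swap simple_refl_def' is_sign_def split: if_splits)
    then show ?thesis by blast
  next
    case False
    then have act: "simple_act k \<gamma> = sconj k \<gamma>" using asc unfolding simple_act_eq[OF v k(1)] by auto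
    let ?J = "marked n s \<gamma>"
    have "Suc k \<in> ?J" if "k \<in> ?J"
    proof (cases "\<gamma> k")
      case (Mate j)
      then have "Suc k < j" using that s nm by (auto simp: marked_iff)
      then show ?thesis using asc Mate k by (cases "\<gamma> (Suc k)") (auto simp: marked_iff)
    next
      case Blank
      then show ?thesis using that s by (auto simp: marked_iff)
    qed (use that s asc False k nm valid_mate_ne[OF v, of "Suc k"] in \<open>cases "\<gamma> (Suc k)"; force simp: marked_iff\<close>)+
    then have "simple_refl k x \<in> ?J \<longleftrightarrow> x \<in> demazure k ?J" for x
      by (cases "k \<in> ?J"; cases "Suc k \<in> ?J") (simp_all add: demazure_def mem_swap simple_refl_def')
    then have "simple_refl k ` ?J = demazure k ?J" using mem_swap by blast
    then show ?thesis unfolding act marked_sconj[OF k s nm] .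
  qed
qed

lemma card_demazure: "card (demazure k A) = card A"
  by (auto simp: demazure_def card_image inj_on_def)

lemma card_marked_simple_act:
  "valid n \<gamma> \<Longrightarrow> 1 \<le> k \<Longrightarrow> k < n \<Longrightarrow> is_sign s \<Longrightarrow> card (marked n s (simple_act k \<gamma>)) = card (marked n s \<gamma>)"
  using marked_simple_act[of n \<gamma> k s] card_demazure by (cases "simple_act k \<gamma> = \<gamma>") auto

lemma marked_dn:
  assumes "valid n \<gamma>" "dn n k \<gamma> \<delta>" "is_sign s"
  shows "marked n s \<gamma> = demazure k (marked n s \<delta>)"
proof -
  note d = dn_props[OF assms(1,2)]
  show ?thesis using marked_simple_act[OF d(1-3) assms(3)] d(4,5) by simp
qed

lemma clan_poly_induct [consumes 1, case_names mini dn]: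
  assumes "valid n \<gamma>"
    and "\<And>\<gamma>. mini n \<gamma> \<Longrightarrow> X \<gamma> (marked_prod n \<gamma>)"
    and "\<And>\<gamma> k \<delta>. valid n \<gamma> \<Longrightarrow> dn n k \<gamma> \<delta> \<Longrightarrow> valid n \<delta> \<Longrightarrow> 1 \<le> k \<Longrightarrow> k < n \<Longrightarrow> X \<delta> (clan_poly.P n \<delta>)
      \<Longrightarrow> X \<gamma> (divided_difference k (clan_poly.P n \<delta>))"
  shows "X \<gamma> (clan_poly.P n \<gamma>)"
  using assms(1)
proof (induction "plen n \<gamma>" arbitrary: \<gamma> rule: less_induct)
  case less
  show ?case
  proof (cases "\<exists>k. desc n \<gamma> k")
    case False
    then have m: "mini n \<gamma>" using less.prems by (simp add: mini_def)
    then show ?thesis using assms(2)[OF m] clan_poly.P_mini[OF m] by simp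
  next
    case True
    then obtain k \<delta> where d: "dn n k \<gamma> \<delta>" using clan_poly.dn_down by blast
    note p = dn_props[OF less.prems d]
    have "X \<delta> (clan_poly.P n \<delta>)" using less.hyps[OF dn_plen[OF less.prems d] p(1)] .
    then show ?thesis using assms(3)[OF less.prems d p(1-3)] clan_poly_dn[OF less.prems d] by simp
  qed
qed

lemma vanishing_clan_poly:
  assumes "valid n \<gamma>" "is_sign s"
  shows "vanishing (card (marked n s \<gamma>)) (marked n s \<gamma>) (clan_poly.P n \<gamma>)"
  using assms(1)
proof (induction rule: clan_poly_induct)
  case (mini \<gamma>)
  show ?case
    using vanishing_grass_schubert[OF marked_sub, of n s \<gamma>] vanishing_mult assms(2) by (auto simp: marked_prod_def is_sign_def)
next
  case (dn \<gamma> k \<delta>)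
  then show ?case
    using vanishing_dd marked_dn[OF dn(1,2) assms(2)] by (simp add: card_demazure)
qed

text \<open>A set of \<open>p\<close> positions different from \<open>{1..p}\<close> has fewer than \<open>p\<close> elements in this interval.\<close>

lemma loc_id_clan_poly_eq_0:
  assumes v: "valid n \<gamma>" and s: "is_sign s" and J: "marked n s \<gamma> \<noteq> {1..card (marked n s \<gamma>)}"
  shows "loc id (clan_poly.P n \<gamma>) = 0"
proof -
  let ?A = "marked n s \<gamma>"
  let ?p = "card ?A"
  have "\<not> {1..?p} \<subseteq> ?A"
    using J card_subset_eq[OF finite_subset[OF marked_sub finite_atLeastAtMost], of "{1..?p}" n s \<gamma>] by auto
  then have "?A \<inter> {1..?p} \<subset> {1..?p}" by blast
  then have "card (?A \<inter> {1..?p}) < ?p" using psubset_card_mono[of "{1..?p}" "?A \<inter> {1..?p}"] by simp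
  moreover have "{a \<in> {1..?p}. id a \<le> ?p} = {1..?p}" by auto
  then have "rk id ?p ?p = ?p" by (simp add: rk_def)
  ultimately show ?thesis using vanishingD[OF vanishing_clan_poly[OF v s] Sinf_id, of ?p] by simp
qed

section \<open>Symmetry in the equivariant parameters\<close>

text \<open>The inverse of a Grassmannian permutation ascends at every \<open>k\<close> except the number of elements of \<open>A\<close>.\<close>

lemma tswap_grass_schubert:
  assumes A: "A \<subseteq> {1..n}" and k: "1 \<le> k" "k < n" "k \<noteq> card A"
  shows "tswap k (grass_schubert A) = grass_schubert A"
proof -
  have fin: "finite A" "0 \<notin> A" using A finite_subset by auto
  let ?w = "grass A"
  have w: "?w \<in> S_infty" using Sn_Sinf[OF grass_Sn[OF A]] .
  note iv = Sinf_inv_simps[OF w]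
  have "\<not> inv ?w (Suc k) < inv ?w k"
  proof
    let ?i = "inv ?w k" and ?j = "inv ?w (Suc k)"
    assume lt: "?j < ?i"
    have pos: "1 \<le> ?i" "1 \<le> ?j" using Sinf_pos[OF Sinf_inv[OF w]] k by auto
    have g: "?w ?i = k" "?w ?j = Suc k" by (simp_all add: iv)
    have "?i \<in> A \<longleftrightarrow> ?j \<in> A"
      using grass_in[OF fin, of ?i] grass_in[OF fin, of ?j] grass_out[of ?i A] grass_out[of ?j A] pos g k(3) by fastforce
    then show False
      using grass_mono_in[OF fin, of ?j ?i] grass_mono_out[of ?j A ?i] lt pos g by fastforce
  qed
  then show ?thesis using double_schubert_left[OF grass_Sn[OF A] k(1,2)] by (simp add: grass_schubert_def)
qed

lemma tswap_clan_poly: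
  assumes "valid n \<gamma>" and k: "1 \<le> k" "k < n" "k \<noteq> card (marked n Plus \<gamma>)" "k \<noteq> card (marked n Minus \<gamma>)"
  shows "tswap k (clan_poly.P n \<gamma>) = clan_poly.P n \<gamma>"
  using assms(1) k(3,4)
proof (induction rule: clan_poly_induct)
  case (mini \<gamma>)
  then show ?case using tswap_grass_schubert[OF marked_sub k(1,2)] by (simp add: marked_prod_def ts.hom_mult)
next
  case (dn \<gamma> l \<delta>)
  then have "tswap k (clan_poly.P n \<delta>) = clan_poly.P n \<delta>"
    using marked_dn[OF dn(1,2)] by (simp add: card_demazure)
  then show ?case by (simp add: tswap_dd)
qed

section \<open>Localization at Grassmannian permutations\<close>

text \<open>If a vanishing condition leaves only one of the two terms of a divided difference, the
  localization is multiplied by a linear form.\<close>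

lemma loc_vanishing_step:
  assumes f: "vanishing p A f" and k: "1 \<le> k" "k \<notin> A" "Suc k \<in> A"
    and \<sigma>: "\<sigma> \<in> S_infty" "\<And>i. 1 \<le> i \<Longrightarrow> \<sigma> i \<le> p \<longleftrightarrow> i \<in> A"
  shows "loc \<sigma> f = (t_var (\<sigma> k) - t_var (\<sigma> (Suc k))) * loc (\<sigma> \<circ> simple_refl k) (divided_difference k f)"
proof -
  let ?\<tau> = "\<sigma> \<circ> simple_refl k"
  have \<tau>: "?\<tau> \<in> S_infty" using Sinf_comp[OF \<sigma>(1) Sinf_simple[OF k(1)]] .
  have "{a \<in> {1..k}. ?\<tau> a \<le> p} = insert k (A \<inter> {1..k})"
    using k \<sigma>(2) by (auto simp: simple_refl_def')
  then have "card (A \<inter> {1..k}) < rk ?\<tau> k p" using k by (simp add: rk_def)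
  then have z: "loc ?\<tau> f = 0" using vanishingD[OF f \<tau>] by blast
  have "?\<tau> \<circ> simple_refl k = \<sigma>" by auto
  then have "(t_var (\<sigma> (Suc k)) - t_var (\<sigma> k)) * loc ?\<tau> (divided_difference k f) = - loc \<sigma> f"
    using loc_dd[of ?\<tau> k f] z by simp
  then show ?thesis by (simp add: algebra_simps)
qed

text \<open>The product of the linear forms of the inversions of \<open>grass A\<close>, taken at \<open>\<sigma>\<close>.\<close>

definition root_prod :: "(nat \<Rightarrow> nat) \<Rightarrow> nat set \<Rightarrow> int mpoly" where
  "root_prod \<sigma> A = (\<Prod>(l, b) \<in> {(l, b). 1 \<le> l \<and> l < b \<and> l \<notin> A \<and> b \<in> A}. t_var (\<sigma> l) - t_var (\<sigma> b))"

lemma finite_roots: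
  fixes A :: "nat set"
  shows "finite A \<Longrightarrow> finite {(l, b). 1 \<le> l \<and> l < b \<and> l \<notin> A \<and> b \<in> A}"
proof -
  assume fin: "finite A"
  have "l \<le> Max A" if "l < b" "b \<in> A" for l b using Max_ge[OF fin that(2)] that(1) by simp
  then have "{(l, b). 1 \<le> l \<and> l < b \<and> l \<notin> A \<and> b \<in> A} \<subseteq> {..Max A} \<times> A" by blast
  then show ?thesis using finite_subset fin by blast
qed

lemma root_prod_ne_0: "finite A \<Longrightarrow> \<sigma> \<in> S_infty \<Longrightarrow> root_prod \<sigma> A \<noteq> 0"
  unfolding root_prod_def using finite_roots[of A] by (auto simp: Sinf_eq_iff)

lemma root_prod_step:
  assumes A: "finite A" and k: "1 \<le> k" "k \<notin> A" "Suc k \<in> A"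
  shows "root_prod \<sigma> A = (t_var (\<sigma> k) - t_var (\<sigma> (Suc k))) * root_prod (\<sigma> \<circ> simple_refl k) (simple_refl k ` A)"
proof -
  let ?s = "simple_refl k"
  let ?R = "\<lambda>A. {(l, b). 1 \<le> l \<and> l < b \<and> l \<notin> A \<and> b \<in> (A :: nat set)}"
  have lt: "?s l < ?s b \<longleftrightarrow> l < b" if "(l, b) \<noteq> (k, Suc k)" "(l, b) \<noteq> (Suc k, k)" for l b
    using simple_refl_less_iff[of l k b] that by auto
  have R: "?R A = insert (k, Suc k) (map_prod ?s ?s ` ?R (?s ` A))"
  proof (rule set_eqI, clarify)
    fix l b
    have "(l, b) = map_prod ?s ?s x \<longleftrightarrow> x = (?s l, ?s b)" for x
      by (cases x) (metis map_prod_simp prod.inject simple_refl_invol)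
    then have "(l, b) \<in> map_prod ?s ?s ` ?R (?s ` A) \<longleftrightarrow> (?s l, ?s b) \<in> ?R (?s ` A)"
      unfolding image_iff by simp
    also have "\<dots> \<longleftrightarrow> 1 \<le> l \<and> ?s l < ?s b \<and> l \<notin> A \<and> b \<in> A"
      using k by (auto simp: mem_swap simple_refl_def' split: if_splits)
    finally have "(l, b) \<in> map_prod ?s ?s ` ?R (?s ` A) \<longleftrightarrow> 1 \<le> l \<and> ?s l < ?s b \<and> l \<notin> A \<and> b \<in> A" .
    moreover have "(l, b) \<in> ?R A \<longleftrightarrow> (l, b) = (k, Suc k) \<or> 1 \<le> l \<and> ?s l < ?s b \<and> l \<notin> A \<and> b \<in> A"
      by (cases "(l, b) = (k, Suc k)"; cases "(l, b) = (Suc k, k)") (use lt[of l b] k in auto)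
    ultimately show "(l, b) \<in> ?R A \<longleftrightarrow> (l, b) \<in> insert (k, Suc k) (map_prod ?s ?s ` ?R (?s ` A))"
      unfolding insert_iff by blast
  qed
  have nin: "(k, Suc k) \<notin> map_prod ?s ?s ` ?R (?s ` A)"
  proof
    assume "(k, Suc k) \<in> map_prod ?s ?s ` ?R (?s ` A)"
    then obtain x y where "x < y" "k = ?s x" "Suc k = ?s y" by auto
    then show False by (metis Suc_n_not_le_n less_imp_le simple_refl_invol simple_refl_simps(1,2))
  qed
  have fin: "finite (?R (?s ` A))" using finite_roots[of "?s ` A"] A by simp
  have "(\<Prod>(l, b)\<in>map_prod ?s ?s ` ?R (?s ` A). t_var (\<sigma> l) - t_var (\<sigma> b)) = root_prod (\<sigma> \<circ> ?s) (?s ` A)"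
    unfolding root_prod_def by (subst prod.reindex) (auto intro!: inj_onI prod.cong)
  then show ?thesis
    unfolding root_prod_def[of \<sigma> A] R prod.insert[OF finite_imageI[OF fin] nin] by simp
qed

lemma initial_segment:
  assumes "A \<subseteq> {1..n}" "\<And>k. 1 \<le> k \<Longrightarrow> Suc k \<in> A \<Longrightarrow> k \<in> A"
  shows "A = {1..card A}"
proof -
  have fin: "finite A" using assms(1) finite_subset by auto
  have down: "1 \<le> j \<Longrightarrow> j + d \<in> A \<Longrightarrow> j \<in> A" for j d
  proof (induction d)
    case (Suc d)
    then show ?case using assms(2)[of "j + d"] by simp
  qed simp
  show ?thesis
  proof (cases "A = {}")
    case True
    then show ?thesis by simp
  next
    case ne: False
    have e: "A = {1..Max A}"
    proof (intro equalityI subsetI)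
      fix x assume "x \<in> {1..Max A}"
      then show "x \<in> A" using down[of x "Max A - x"] Max_in[OF fin ne] by auto
    next
      fix x assume "x \<in> A"
      then show "x \<in> {1..Max A}" using assms(1) Max_ge[OF fin] by auto
    qed
    have c: "card A = Max A" using arg_cong[OF e, of card] unfolding card_atLeastAtMost by simp
    show ?thesis unfolding c by (rule e)
  qed
qed

text \<open>The measure for moving the elements of a set to the left.\<close>

lemma sum_swap:
  fixes A :: "nat set"
  assumes "finite A" "k \<notin> A" "Suc k \<in> A"
  shows "\<Sum>(simple_refl k ` A) < \<Sum>A"
proof -
  have "simple_refl k ` A = insert k (A - {Suc k})"
    using swap_insert[of k "A - {Suc k}"] assms by (simp add: insert_absorb)
  then show ?thesis using assms sum.remove[of A "Suc k" "\<lambda>x. x"] by simp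
qed

lemma swap_range: "A \<subseteq> {1..n} \<Longrightarrow> 1 \<le> k \<Longrightarrow> Suc k \<in> A \<Longrightarrow> simple_refl k ` A \<subseteq> {1..n}"
  by (auto simp: simple_refl_def')

lemma grass_id:
  assumes "A \<subseteq> {1..n}" "\<not> (\<exists>k. 1 \<le> k \<and> k \<notin> A \<and> Suc k \<in> A)"
  shows "grass A = id"
proof -
  have fin: "finite A" "0 \<notin> A" using assms finite_subset by auto
  have w: "grass A \<in> S_infty" using Sn_Sinf[OF grass_Sn[OF assms(1)]] .
  show ?thesis
    using Sinf_no_desc_id[OF w] grass_asc[OF fin] assms(2) Sinf_eq_iff[OF w]
    by (metis linorder_neqE_nat n_not_Suc_n)
qed

lemma root_prod_segment:
  assumes "A \<subseteq> {1..n}" "\<not> (\<exists>k. 1 \<le> k \<and> k \<notin> A \<and> Suc k \<in> A)"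
  shows "root_prod \<sigma> A = 1"
proof -
  have seg: "A = {1..card A}" by (rule initial_segment[OF assms(1)]) (use assms(2) in blast)
  have iff: "x \<in> A \<longleftrightarrow> 1 \<le> x \<and> x \<le> card A" for x
    using arg_cong[OF seg, of "\<lambda>S. x \<in> S"] unfolding atLeastAtMost_iff .
  have "False" if "1 \<le> l" "l < b" "l \<notin> A" "b \<in> A" for l b
    using that iff[of l] iff[of b] by simp
  then have e: "{(l, b). 1 \<le> l \<and> l < b \<and> l \<notin> A \<and> b \<in> A} = {}" by blast
  show ?thesis unfolding root_prod_def e by simp
qed

lemma loc_grass_schubert:
  assumes "A \<subseteq> {1..n}" "\<sigma> \<in> S_infty" "\<And>i. 1 \<le> i \<Longrightarrow> \<sigma> i \<le> card A \<longleftrightarrow> i \<in> A"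
  shows "loc \<sigma> (grass_schubert A) = root_prod \<sigma> A"
  using assms
proof (induction "\<Sum>A" arbitrary: A \<sigma> rule: less_induct)
  case less
  note A = less.prems(1) and \<sigma> = less.prems(2,3)
  have fin: "finite A" using A finite_subset by auto
  show ?case
  proof (cases "\<exists>k. 1 \<le> k \<and> k \<notin> A \<and> Suc k \<in> A")
    case True
    then obtain k where k: "1 \<le> k" "k \<notin> A" "Suc k \<in> A" by blast
    let ?s = "simple_refl k"
    have c: "card (?s ` A) = card A" by (simp add: card_image inj_on_def)
    have "loc (\<sigma> \<circ> ?s) (grass_schubert (?s ` A)) = root_prod (\<sigma> \<circ> ?s) (?s ` A)"
    proof (rule less.hyps)
      show "\<Sum>(?s ` A) < \<Sum>A" by (rule sum_swap[OF fin k(2,3)])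
      show "?s ` A \<subseteq> {1..n}" by (rule swap_range[OF A k(1,3)])
      show "\<sigma> \<circ> ?s \<in> S_infty" using Sinf_comp[OF \<sigma>(1) Sinf_simple[OF k(1)]] .
      show "(\<sigma> \<circ> ?s) i \<le> card (?s ` A) \<longleftrightarrow> i \<in> ?s ` A" if "1 \<le> i" for i
      proof -
        have "1 \<le> ?s i" using that k by (auto simp: simple_refl_def')
        then show ?thesis using \<sigma>(2)[of "?s i"] by (simp add: c mem_swap)
      qed
    qed
    moreover have "divided_difference k (grass_schubert A) = grass_schubert (?s ` A)" using dd_grass_schubert[OF A k(1)] k by simp
    ultimately show ?thesis
      using loc_vanishing_step[OF vanishing_grass_schubert[OF A] k \<sigma>] root_prod_step[OF fin k] by simp
  next
    case False
    then show ?thesis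
      using root_prod_segment[OF A False] grass_id[OF A False] by (simp add: grass_schubert_def double_schubert_id loc.hom_one)
  qed
qed

definition pconj :: "(nat \<Rightarrow> nat) \<Rightarrow> (nat \<Rightarrow> node) \<Rightarrow> nat \<Rightarrow> node" where
  "pconj \<sigma> \<gamma> i = map_mate \<sigma> (\<gamma> (inv \<sigma> i))"

text \<open>Without minus signs there is a move at every place outside \<open>A\<close> that is followed by one in
  \<open>A\<close>. It is a relabelling, and only one term of the divided difference survives localization. So
  moving all nodes of the set \<open>A\<close> of left ends and plus signs to the front divides the localization
  by the same factor as for the polynomial of \<open>A\<close>.\<close>

lemma loc_clan_poly_grass:
  assumes "valid n \<gamma>" "\<And>i. \<gamma> i \<noteq> Minus"
  defines "A \<equiv> marked n Plus \<gamma>"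
  shows "loc (grass A) (clan_poly.P n \<gamma>) = root_prod (grass A) A * loc id (clan_poly.P n (pconj (grass A) \<gamma>))"
  using assms(1,2) unfolding A_def
proof (induction "\<Sum>(marked n Plus \<gamma>)" arbitrary: \<gamma> rule: less_induct)
  case less
  note v = less.prems(1) and nm = less.prems(2)
  let ?A = "marked n Plus \<gamma>"
  have A: "?A \<subseteq> {1..n}" by (rule marked_sub)
  have fin: "finite ?A" "0 \<notin> ?A" using A finite_subset by auto
  show ?case
  proof (cases "\<exists>k. 1 \<le> k \<and> k \<notin> ?A \<and> Suc k \<in> ?A")
    case True
    then obtain k where k: "1 \<le> k" "k \<notin> ?A" "Suc k \<in> ?A" by blast
    have kn: "k < n" using k(3) A by auto
    let ?s = "simple_refl k" and ?\<delta> = "sconj k \<gamma>"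
    have ck: "\<gamma> k = Blank \<or> (\<exists>j<k. \<gamma> k = Mate j)"
      using k(1,2) kn nm[of k] valid_mate_ne[OF v, of k] by (cases "\<gamma> k") (auto simp: marked_iff not_less order_le_less)
    have cs: "\<gamma> (Suc k) = Plus \<or> (\<exists>j>Suc k. \<gamma> (Suc k) = Mate j)"
      using k(3) by (auto simp: marked_iff)
    have asc: "key \<gamma> k < key \<gamma> (Suc k)" "\<not> is_sign (\<gamma> k)" using ck cs by auto
    then have act: "simple_act k \<gamma> = ?\<delta>" using simple_act_eq[OF v k(1)] by simp
    have nmk: "\<gamma> k \<noteq> Mate (Suc k)" "\<gamma> (Suc k) \<noteq> Mate k" using ck cs by auto
    have at: "?\<delta> k = \<gamma> (Suc k)" using sconj_exchange[OF v nmk] by simp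
    have ne: "?\<delta> \<noteq> \<gamma>"
    proof
      assume "?\<delta> = \<gamma>"
      then have "\<gamma> k = \<gamma> (Suc k)" using at by simp
      then show False using ck cs by auto
    qed
    have v\<delta>: "valid n ?\<delta>" by (rule valid_sconj[OF v k(1) kn])
    have J: "marked n Plus ?\<delta> = ?s ` ?A" by (rule marked_sconj[OF k(1) kn _ nmk]) simp
    have g: "grass (?s ` ?A) = grass ?A \<circ> ?s" by (rule grass_swap[OF k])
    have w: "grass ?A \<in> S_infty" using Sn_Sinf[OF grass_Sn[OF A]] .
    have IH: "loc (grass (?s ` ?A)) (clan_poly.P n ?\<delta>)
        = root_prod (grass (?s ` ?A)) (?s ` ?A) * loc id (clan_poly.P n (pconj (grass (?s ` ?A)) ?\<delta>))"
    proof -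
      have nm\<delta>: "?\<delta> i \<noteq> Minus" for i
        using nm[of "?s i"] by (cases "\<gamma> (?s i)") (auto simp: sconj_def)
      show ?thesis
        by (rule less.hyps[OF _ v\<delta> nm\<delta>, unfolded J]) (rule sum_swap[OF fin(1) k(2,3)])
    qed
    have P: "divided_difference k (clan_poly.P n \<gamma>) = clan_poly.P n ?\<delta>"
      using clan_poly.P_simple_act[OF v k(1) kn] act ne by simp
    have pc: "pconj (grass (?s ` ?A)) ?\<delta> = pconj (grass ?A) \<gamma>"
    proof
      fix i
      show "pconj (grass (?s ` ?A)) ?\<delta> i = pconj (grass ?A) \<gamma> i"
        unfolding g pconj_def inv_comp_simple[OF w] by (cases "\<gamma> (inv (grass ?A) i)") (auto simp: sconj_def)
    qed
    have gA: "grass ?A i \<le> card ?A \<longleftrightarrow> i \<in> ?A" if "1 \<le> i" for i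
      using grass_in[OF fin, of i] grass_out[of i ?A] that by (cases "i \<in> ?A") auto
    have "loc (grass ?A) (clan_poly.P n \<gamma>) =
        (t_var (grass ?A k) - t_var (grass ?A (Suc k))) * loc (grass ?A \<circ> ?s) (clan_poly.P n ?\<delta>)"
      using loc_vanishing_step[OF vanishing_clan_poly[OF v, of Plus] k w gA] P by simp
    also have "loc (grass ?A \<circ> ?s) (clan_poly.P n ?\<delta>) =
        root_prod (grass ?A \<circ> ?s) (?s ` ?A) * loc id (clan_poly.P n (pconj (grass ?A) \<gamma>))"
      using IH unfolding pc unfolding g .
    finally show ?thesis unfolding root_prod_step[OF fin(1) k] by (simp add: mult.assoc)
  next
    case False
    have r: "root_prod \<sigma> ?A = 1" for \<sigma> by (rule root_prod_segment[OF A False])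
    have g: "grass ?A = id" by (rule grass_id[OF A False])
    have "pconj id \<gamma> = \<gamma>"
    proof
      fix i show "pconj id \<gamma> i = \<gamma> i" by (cases "\<gamma> i") (auto simp: pconj_def)
    qed
    then show ?thesis by (simp add: g r)
  qed
qed


section \<open>Localization for permutational preclans\<close>

lemma pconj_inverse:
  assumes "\<sigma> \<in> S_infty"
  shows "pconj \<sigma> (pconj (inv \<sigma>) \<gamma>) = \<gamma>"
proof
  fix i
  show "pconj \<sigma> (pconj (inv \<sigma>) \<gamma>) i = \<gamma> i"
    by (cases "\<gamma> i") (simp_all add: pconj_def Sinf_inv_simps[OF assms])
qed

lemma pconj_Mate: "\<sigma> \<in> S_infty \<Longrightarrow> pconj (inv \<sigma>) \<gamma> x = Mate y \<longleftrightarrow> \<gamma> (\<sigma> x) = Mate (\<sigma> y)"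
  by (cases "\<gamma> (\<sigma> x)") (auto simp: pconj_def Sinf_inv_simps)

lemma pconj_other:
  "\<sigma> \<in> S_infty \<Longrightarrow> c \<in> {Plus, Minus, Blank} \<Longrightarrow> pconj (inv \<sigma>) \<gamma> x = c \<longleftrightarrow> \<gamma> (\<sigma> x) = c"
  by (cases "\<gamma> (\<sigma> x)") (auto simp: pconj_def Sinf_inv_simps)

context
  fixes p m q n :: nat
  assumes qp: "q \<le> p" and n: "n = p + m + q"
begin

text \<open>Permutational preclans in terms of the marked positions (\<open>permutational_iff\<close>), the form in which the
  vanishing criterion yields them.\<close>

definition perm_preclan :: "(nat \<Rightarrow> node) \<Rightarrow> bool" where
  "perm_preclan \<gamma> \<longleftrightarrow> valid n \<gamma> \<and> marked n Plus \<gamma> = {1..p} \<and> marked n Minus \<gamma> = {1..q}"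

lemma perm_preclan_marked:
  assumes "perm_preclan \<gamma>"
  shows "i \<in> marked n Plus \<gamma> \<longleftrightarrow> 1 \<le> i \<and> i \<le> p" "i \<in> marked n Minus \<gamma> \<longleftrightarrow> 1 \<le> i \<and> i \<le> q"
  using assms by (auto simp: perm_preclan_def)

lemma perm_preclan_valid: "perm_preclan \<gamma> \<Longrightarrow> valid n \<gamma>"
  by (simp add: perm_preclan_def)

lemma left_node:
  assumes g: "perm_preclan \<gamma>" and i: "1 \<le> i" "i \<le> q"
  obtains j where "\<gamma> i = Mate j" "p < j" "j \<le> n"
proof -
  note v = perm_preclan_valid[OF g] and J = perm_preclan_marked[OF g]
  have "i \<in> marked n Plus \<gamma>" "i \<in> marked n Minus \<gamma>" unfolding J using i qp by auto
  then obtain j where j: "\<gamma> i = Mate j" "i < j" by (auto simp: marked_iff)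
  have ji: "\<gamma> j = Mate i" using valid_mate[OF v j(1)] .
  have r: "1 \<le> j" "j \<le> n" using valid_mate_range[OF v j(1)] by auto
  have "j \<notin> marked n Plus \<gamma>" using ji j(2) by (auto simp: marked_iff)
  then have "p < j" unfolding J using r by auto
  then show ?thesis using that j r by blast
qed

lemma plus_node: "perm_preclan \<gamma> \<Longrightarrow> q < i \<Longrightarrow> i \<le> p \<Longrightarrow> \<gamma> i = Plus"
  using perm_preclan_marked[of \<gamma> i] unfolding marked_iff by auto

lemma right_node:
  assumes g: "perm_preclan \<gamma>" and i: "p < i"
  shows "\<gamma> i = Blank \<or> (\<exists>a. 1 \<le> a \<and> a \<le> q \<and> \<gamma> i = Mate a)"
proof (cases "\<gamma> i")
  case (Mate a)
  note v = perm_preclan_valid[OF g] and J = perm_preclan_marked[OF g]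
  have ai: "\<gamma> a = Mate i" using valid_mate[OF v Mate] .
  have r: "1 \<le> a" "1 \<le> i" "i \<le> n" "a \<le> n" using valid_mate_range[OF v Mate] by auto
  have "i \<notin> marked n Plus \<gamma>" unfolding J using i by auto
  then have "a < i" using Mate r valid_mate_ne[OF v, of i] by (auto simp: marked_iff not_less order_le_less)
  then have "a \<in> marked n Minus \<gamma>" using ai r by (auto simp: marked_iff)
  then show ?thesis unfolding J using Mate by auto
next
  case Plus
  then show ?thesis using perm_preclan_marked(1)[OF g, of i] i valid_out[OF perm_preclan_valid[OF g], of i]
    by (cases "i \<in> {1..n}") (auto simp: marked_iff)
next
  case Minus
  then show ?thesis using perm_preclan_marked(2)[OF g, of i] i qp valid_out[OF perm_preclan_valid[OF g], of i]
    by (cases "i \<in> {1..n}") (auto simp: marked_iff)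
qed simp

lemma blank_range: "perm_preclan \<gamma> \<Longrightarrow> b \<in> blanks n \<gamma> \<Longrightarrow> p < b \<and> b \<le> n \<and> \<gamma> b = Blank"
  using plus_node[of \<gamma> b] left_node[of \<gamma> b] by (cases "b \<le> q"; cases "b \<le> p") (auto simp: blanks_def)

lemma card_blanks:
  assumes g: "perm_preclan \<gamma>"
  shows "card (blanks n \<gamma>) = m"
proof -
  note v = perm_preclan_valid[OF g]
  define R where "R = {j. p < j \<and> \<gamma> j \<noteq> Blank}"
  have "bij_betw (pos \<gamma>) {1..q} R"
  proof (rule bij_betwI[where g = "pos \<gamma>"])
    show "pos \<gamma> \<in> {1..q} \<rightarrow> R"
    proof
      fix i assume "i \<in> {1..q}"
      then obtain j where j: "\<gamma> i = Mate j" "p < j" using left_node[OF g, of i] by auto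
      then show "pos \<gamma> i \<in> R" using valid_mate[OF v j(1)] by (simp add: R_def pos_def)
    qed
    show "pos \<gamma> \<in> R \<rightarrow> {1..q}"
    proof
      fix j assume "j \<in> R"
      then obtain a where "1 \<le> a" "a \<le> q" "\<gamma> j = Mate a" using right_node[OF g, of j] by (auto simp: R_def)
      then show "pos \<gamma> j \<in> {1..q}" by (simp add: pos_def)
    qed
    show "pos \<gamma> (pos \<gamma> i) = i" for i
      using valid_mate[OF v, of i] by (cases "\<gamma> i") (auto simp: pos_def)
    then show "pos \<gamma> (pos \<gamma> i) = i" for i .
  qed
  then have "card R = q" using bij_betw_same_card by fastforce
  moreover have R: "R \<subseteq> {p<..n}" using valid_out[OF v] by (auto simp: R_def) (meson atLeastAtMost_iff not_le_imp_less)
  moreover have "blanks n \<gamma> = {p<..n} - R"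
    using blank_range[OF g] by (auto simp: R_def blanks_def)
  ultimately show ?thesis using n finite_subset[OF R] by (simp add: card_Diff_subset)
qed

abbreviation (input) eta where "eta \<equiv> eta_perm p m q"

lemma eta_left: "1 \<le> a \<Longrightarrow> a \<le> q \<Longrightarrow> \<gamma> a = Mate j \<Longrightarrow> eta \<gamma> (q + 1 - a) = j - p"
  by (auto simp: eta_perm_def)

lemma finite_blanks: "finite (blanks n \<gamma>)"
  by (simp add: blanks_def)

lemma blank_rank:
  assumes g: "perm_preclan \<gamma>" and b: "b \<in> blanks n \<gamma>"
  shows "1 \<le> card (blanks n \<gamma> \<inter> {..b})" "card (blanks n \<gamma> \<inter> {..b}) \<le> m"
proof -
  have "card (blanks n \<gamma> \<inter> {..b}) \<in> {1..card (blanks n \<gamma>)}"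
    using rank_bij(1)[OF finite_blanks] b unfolding bij_betw_def by blast
  then show "1 \<le> card (blanks n \<gamma> \<inter> {..b})" "card (blanks n \<gamma> \<inter> {..b}) \<le> m"
    by (auto simp: card_blanks[OF g])
qed

lemma eta_blank:
  assumes g: "perm_preclan \<gamma>" and b: "b \<in> blanks n \<gamma>"
  shows "eta \<gamma> (q + card (blanks n \<gamma> \<inter> {..b})) = b - p"
proof -
  define r where "r = card (blanks n \<gamma> \<inter> {..b})"
  have "1 \<le> r" "r \<le> m" "nth_smallest (blanks n \<gamma>) r = b"
    using blank_rank[OF assms] rank_bij(2)[OF finite_blanks b] by (simp_all only: r_def)
  then have "eta \<gamma> (q + r) = b - p" unfolding n eta_perm_def by auto
  then show ?thesis by (simp only: r_def)
qed

text \<open>Read backwards, \<open>\<eta>\<close> is given by the contents of the nodes after the first \<open>p\<close>.\<close>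

lemma eta_node:
  assumes g: "perm_preclan \<gamma>" and c: "1 \<le> c" "c \<le> q + m"
  obtains (arc) a where "\<gamma> (p + c) = Mate a" "1 \<le> a" "a \<le> q" "eta \<gamma> (q + 1 - a) = c"
  | (blank) r where "\<gamma> (p + c) = Blank" "1 \<le> r" "r \<le> m" "eta \<gamma> (q + r) = c"
proof -
  note v = perm_preclan_valid[OF g]
  consider "\<gamma> (p + c) = Blank" | a where "1 \<le> a" "a \<le> q" "\<gamma> (p + c) = Mate a"
    using right_node[OF g, of "p + c"] c by auto
  then show ?thesis
  proof cases
    case 1
    then have b: "p + c \<in> blanks n \<gamma>" using c n by (simp add: blanks_def)
    show ?thesis using blank[OF 1 blank_rank[OF g b]] eta_blank[OF g b] by simp
  next
    case 2
    then show ?thesis using arc[OF 2(3,1,2)] eta_left[where \<gamma> = \<gamma>, OF 2(1,2) valid_mate[OF v 2(3)]] by simp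
  qed
qed

text \<open>All values are attained, so \<open>\<eta>\<close> is a permutation by counting.\<close>

lemma eta_Sn:
  assumes g: "perm_preclan \<gamma>"
  shows "eta \<gamma> \<in> Sn (q + m)"
proof -
  let ?S = "{1..q + m}"
  have "c \<in> eta \<gamma> ` ?S" if "c \<in> ?S" for c
  proof -
    have c: "1 \<le> c" "c \<le> q + m" using that by auto
    from g c show ?thesis
    proof (cases rule: eta_node)
      case (arc a)
      then show ?thesis by (intro image_eqI[of _ _ "q + 1 - a"]) auto
    next
      case (blank r)
      then show ?thesis by (intro image_eqI[of _ _ "q + r"]) auto
    qed
  qed
  then have sub: "?S \<subseteq> eta \<gamma> ` ?S" by blast
  have le: "card (eta \<gamma> ` ?S) \<le> card ?S" by (rule card_image_le) simp
  have im: "eta \<gamma> ` ?S = ?S" using card_seteq[OF _ sub le] by simp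
  have "inj_on (eta \<gamma>) ?S" by (rule eq_card_imp_inj_on) (simp, simp only: im)
  then have "bij_betw (eta \<gamma>) ?S ?S" using im by (simp add: bij_betw_def)
  then have "eta \<gamma> permutes ?S" by (rule bij_imp_permutes) (auto simp: eta_perm_def)
  then show ?thesis by (simp add: Sn_def)
qed

text \<open>The inverse of \<open>\<eta>\<close> reads the contents of the nodes after the first \<open>p\<close>: arcs come before blanks
  and arcs with larger left ends before those with smaller ones. So undoing a descent there removes a
  left factor that makes \<open>\<eta>\<close> longer.\<close>

lemma eta_desc:
  assumes g: "perm_preclan \<gamma>" and k: "desc n \<gamma> k" "p < k"
  defines "\<delta> \<equiv> sconj k \<gamma>"
  shows "perm_preclan \<delta>" "dn n k \<gamma> \<delta>" "eta \<gamma> = simple_refl (k - p) \<circ> eta \<delta>"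
    "inv (eta \<delta>) (Suc (k - p)) < inv (eta \<delta>) (k - p)"
proof -
  note v = perm_preclan_valid[OF g]
  have kd: "1 \<le> k" "k < n" "\<gamma> k \<noteq> Blank" "key \<gamma> (Suc k) < key \<gamma> k" using k(1) by (auto simp: desc_def)
  obtain a where a: "1 \<le> a" "a \<le> q" "\<gamma> k = Mate a" using right_node[OF g k(2)] kd(3) by auto
  have nk: "\<gamma> k \<noteq> Mate (Suc k)" "\<gamma> (Suc k) \<noteq> Mate k"
    using a k(2) qp valid_mate[OF v, of "Suc k" k] by auto
  show d: "dn n k \<gamma> \<delta>" unfolding \<delta>_def by (rule dn_sconj[OF k(1) nk(1)])
  note p = dn_props[OF v d]
  have "marked n s \<delta> = simple_refl k ` marked n s \<gamma>" if "is_sign s" for s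
    unfolding \<delta>_def by (rule marked_sconj[OF kd(1,2) that nk])
  moreover have "simple_refl k ` {1..r} = {1..r}" if "r < k" for r
    using that by (auto simp: mem_swap simple_refl_def')
  ultimately show pd: "perm_preclan \<delta>"
    using g p(1) k(2) qp by (simp add: perm_preclan_def)
  let ?s = "simple_refl k"
  have at: "\<delta> k = \<gamma> (Suc k)" "\<delta> (Suc k) = Mate a"
    using sconj_exchange[OF v nk] a(3) by (auto simp: \<delta>_def)
  have conj: "?s j - p = simple_refl (k - p) (j - p)" if "p < j" for j
    using that k(2) by (auto simp: simple_refl_def')
  have nb: "Suc k \<notin> blanks n \<delta>" using at(2) by (simp add: blanks_def)
  have B: "x \<in> blanks n \<gamma> \<longleftrightarrow> ?s x \<in> blanks n \<delta>" for x
    using simple_refl_range[OF kd(1,2), of x] by (auto simp: blanks_def \<delta>_def sconj_Blank)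
  show "eta \<gamma> = simple_refl (k - p) \<circ> eta \<delta>"
  proof
    fix i
    consider "1 \<le> i" "i \<le> q" | "q < i" "i \<le> q + m" | "i \<notin> {1..q + m}" by fastforce
    then show "eta \<gamma> i = (simple_refl (k - p) \<circ> eta \<delta>) i"
    proof cases
      case 1
      define c where "c = q + 1 - i"
      have c: "1 \<le> c" "c \<le> q" "i = q + 1 - c" using 1 by (auto simp: c_def)
      obtain j where j: "\<delta> c = Mate j" "p < j" using left_node[OF pd c(1,2)] by blast
      have "\<gamma> c = Mate (?s j)"
        using j(1) c k(2) qp unfolding \<delta>_def sconj_Mate by simp
      then show ?thesis using eta_left[OF c(1,2)] j conj[OF j(2)] c(3) by simp
    next
      case 2
      define r where "r = i - q"
      have r: "1 \<le> r" "r \<le> card (blanks n \<delta>)" "i = q + r" using 2 card_blanks[OF pd] by (auto simp: r_def)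
      define b where "b = nth_smallest (blanks n \<delta>) r"
      have b: "b \<in> blanks n \<delta>" "card (blanks n \<delta> \<inter> {..b}) = r"
        using nth_smallest_rank[OF finite_blanks r(1,2)] by (auto simp: b_def)
      have sb: "?s b \<in> blanks n \<gamma>" using b(1) by (simp add: B)
      have "card (blanks n \<gamma> \<inter> {..?s b}) = card (blanks n \<delta> \<inter> {..b})"
      proof (rule card_swap)
        fix x
        have "x \<le> ?s b \<longleftrightarrow> ?s x \<le> b" if "?s x \<in> blanks n \<delta>"
          using that b(1) nb by (auto simp: simple_refl_def' split: if_splits)
        then show "x \<in> blanks n \<gamma> \<inter> {..?s b} \<longleftrightarrow> ?s x \<in> blanks n \<delta> \<inter> {..b}"
          by (auto simp: B)
      qed
      then have "eta \<gamma> (q + r) = ?s b - p" using eta_blank[OF g sb] b(2) by simp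
      moreover have "eta \<delta> (q + r) = b - p" using eta_blank[OF pd b(1)] b(2) by simp
      moreover have "p < b" using blank_range[OF pd b(1)] by simp
      ultimately show ?thesis using conj r(3) by simp
    next
      case 3
      then have "eta \<gamma> i = i" "eta \<delta> i = i" by (auto simp: eta_perm_def)
      moreover have "i \<noteq> k - p" "i \<noteq> Suc (k - p)" using 3 k(2) kd(2) n by auto
      ultimately show ?thesis by simp
    qed
  qed
  have w: "eta \<delta> \<in> S_infty" using Sn_Sinf[OF eta_Sn[OF pd]] .
  have inv: "inv (eta \<delta>) c = i" if "eta \<delta> i = c" for i c
    using that Sinf_inv_simps(1)[OF w] by auto
  have "eta \<delta> (q + 1 - a) = Suc (k - p)"
    using eta_left[where \<gamma> = \<delta>, OF a(1,2) valid_mate[OF p(1) at(2)]] k(2) by simp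
  then have i1: "inv (eta \<delta>) (Suc (k - p)) = q + 1 - a" by (rule inv)
  have c: "1 \<le> k - p" "k - p \<le> q + m" "p + (k - p) = k" using k(2) kd(2) n by auto
  from pd c(1,2) show "inv (eta \<delta>) (Suc (k - p)) < inv (eta \<delta>) (k - p)"
  proof (cases rule: eta_node)
    case (arc a')
    then have "\<gamma> (Suc k) = Mate a'" using c(3) at by simp
    then have "a' < a" using kd(4) a(3) by simp
    then show ?thesis using inv[OF arc(4)] i1 arc a by simp
  next
    case (blank r)
    then show ?thesis using inv[OF blank(4)] i1 a by simp
  qed
qed

text \<open>Without descents after the first \<open>p\<close> nodes the blanks precede the right ends there, and the partners of
  the right ends increase.\<close>

lemma base_nodes:
  assumes g: "perm_preclan \<gamma>" and no: "\<And>k. p < k \<Longrightarrow> \<not> desc n \<gamma> k"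
  shows "1 \<le> i \<Longrightarrow> i \<le> q \<Longrightarrow> \<gamma> i = Mate (p + m + i) \<and> \<gamma> (p + m + i) = Mate i"
    "p < i \<Longrightarrow> i \<le> p + m \<Longrightarrow> \<gamma> i = Blank"
proof -
  note v = perm_preclan_valid[OF g]
  define U where "U = {i \<in> {p<..n}. \<gamma> i \<noteq> Blank}"
  have U: "U \<subseteq> {p<..n}" "finite U" by (auto simp: U_def)
  have "U = {p<..n} - blanks n \<gamma>" by (auto simp: U_def blanks_def)
  moreover have "blanks n \<gamma> \<subseteq> {p<..n}" using blank_range[OF g] by auto
  ultimately have cU: "card U = q"
    using card_blanks[OF g] finite_blanks[of \<gamma>] n by (simp add: card_Diff_subset)
  have key: "key \<gamma> i < key \<gamma> (Suc i) \<and> Suc i \<in> U" if i: "i \<in> U" "i < n" for i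
  proof -
    have "p < i" "\<gamma> i \<noteq> Blank" using i by (auto simp: U_def)
    then obtain a where a: "\<gamma> i = Mate a" using right_node[OF g] by blast
    have le: "key \<gamma> i \<le> key \<gamma> (Suc i)"
      using no[of i] i by (auto simp: desc_def U_def)
    then have "\<gamma> (Suc i) \<noteq> Blank" using a by auto
    then obtain a' where a': "\<gamma> (Suc i) = Mate a'" using right_node[OF g, of "Suc i"] \<open>p < i\<close> by auto
    have "a \<noteq> a'" using valid_mate[OF v a] valid_mate[OF v a'] by auto
    then show ?thesis using le a a' i \<open>p < i\<close> by (auto simp: U_def)
  qed
  have up: "i + d \<in> U" if "i \<in> U" "i + d \<le> n" for i d
    using that
  proof (induction d)
    case (Suc d)
    then show ?case using key[of "i + d"] by simp
  qed simp
  have "U \<subseteq> {p + m<..n}"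
  proof
    fix i assume i: "i \<in> U"
    have "{i..n} \<subseteq> U" using up[OF i, of "_ - i"] by (metis atLeastAtMost_iff le_add_diff_inverse subsetI)
    then have "card {i..n} \<le> q" using card_mono[OF U(2)] cU by metis
    then show "i \<in> {p + m<..n}" using i U n by auto
  qed
  then have Ueq: "U = {p + m<..n}" by (rule card_subset_eq[rotated]) (use cU n in simp_all)
  show bl: "\<gamma> i = Blank" if "p < i" "i \<le> p + m" for i
  proof -
    have "i \<notin> U" using Ueq that by simp
    then show ?thesis using that n by (simp add: U_def)
  qed
  have in_U: "p + m + i \<in> U" if "1 \<le> i" "i \<le> q" for i using that Ueq n by auto
  have kr: "1 \<le> key \<gamma> (p + m + i) \<and> key \<gamma> (p + m + i) \<le> int q" if "1 \<le> i" "i \<le> q" for i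
    using in_U[OF that] right_node[OF g, of "p + m + i"] by (auto simp: U_def)
  have mono: "key \<gamma> (p + m + i) + int d \<le> key \<gamma> (p + m + (i + d))" if "1 \<le> i" "i + d \<le> q" for i d
    using that
  proof (induction d)
    case (Suc d)
    then show ?case using key[OF in_U[of "i + d"]] n by simp
  qed simp
  show "\<gamma> i = Mate (p + m + i) \<and> \<gamma> (p + m + i) = Mate i" if i: "1 \<le> i" "i \<le> q" for i
  proof -
    have "int i \<le> key \<gamma> (p + m + i)" using mono[of 1 "i - 1"] kr[of 1] i by simp
    moreover have "key \<gamma> (p + m + i) \<le> int i" using mono[of i "q - i"] kr[of q] i by simp
    moreover obtain a where "\<gamma> (p + m + i) = Mate a"
      using in_U[OF i] right_node[OF g, of "p + m + i"] by (auto simp: U_def)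
    ultimately have "\<gamma> (p + m + i) = Mate i" by simp
    then show ?thesis using valid_mate[OF v, of "p + m + i" i] by simp
  qed
qed

text \<open>The places at which the nodes of the preclan with arcs from \<open>i\<close> to \<open>p + m + i\<close> are put to make it
  noncrossing: first the blanks, then \<open>q\<close> short arcs, then the plus signs.\<close>

definition unshuffle :: "nat \<Rightarrow> nat" where
  "unshuffle i = (if 1 \<le> i \<and> i \<le> q then m + 2 * i - 1 else if q < i \<and> i \<le> p then m + q + i
     else if p < i \<and> i \<le> p + m then i - p else if p + m < i \<and> i \<le> p + m + q then m + 2 * (i - p - m) else i)"

lemma unshuffle_cases:
  obtains "1 \<le> i" "i \<le> q" "unshuffle i = m + 2 * i - 1"
  | "q < i" "i \<le> p" "unshuffle i = m + q + i"
  | "p < i" "i \<le> p + m" "unshuffle i = i - p"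
  | "p + m < i" "i \<le> n" "unshuffle i = m + 2 * (i - p - m)"
  | "i = 0 \<or> n < i" "unshuffle i = i"
proof -
  consider "1 \<le> i" "i \<le> q" | "q < i" "i \<le> p" | "p < i" "i \<le> p + m" | "p + m < i" "i \<le> n" | "i = 0 \<or> n < i"
    by linarith
  then show ?thesis
    by cases (use that qp n in \<open>auto simp: unshuffle_def\<close>)
qed

lemma unshuffle_arc:
  "1 \<le> a \<Longrightarrow> a \<le> q \<Longrightarrow> unshuffle a = m + 2 * a - 1 \<and> unshuffle (p + m + a) = m + 2 * a"
  using qp by (simp add: unshuffle_def)

lemma unshuffle_inj:
  assumes eq: "unshuffle i = unshuffle j"
  shows "i = j"
proof -
  have odd: "m + 2 * a - 1 \<noteq> m + 2 * x" if "1 \<le> a" for a x using that by presburger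
  show ?thesis
    by (cases i rule: unshuffle_cases; cases j rule: unshuffle_cases;
        (use eq qp n in linarith | use eq odd[of i "j - p - m"] odd[of j "i - p - m"] in simp))
qed

lemma unshuffle_range: "1 \<le> i \<Longrightarrow> i \<le> n \<Longrightarrow> 1 \<le> unshuffle i \<and> unshuffle i \<le> n"
  by (cases i rule: unshuffle_cases) (use qp n in auto)

lemma unshuffle_Sn: "unshuffle \<in> Sn n"
proof -
  have inj: "inj_on unshuffle {1..n}" by (rule inj_onI) (rule unshuffle_inj)
  have "unshuffle ` {1..n} = {1..n}"
    by (rule endo_inj_surj[OF _ _ inj]) (use unshuffle_range in auto)
  then have "bij_betw unshuffle {1..n} {1..n}" using inj by (simp add: bij_betw_def)
  then have "unshuffle permutes {1..n}" by (rule bij_imp_permutes) (auto simp: unshuffle_def n)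
  then show ?thesis by (simp add: Sn_def)
qed

abbreviation (input) shuffle where "shuffle \<equiv> inv unshuffle"

lemma shuffle_facts:
  "unshuffle \<in> S_infty" "shuffle \<in> S_infty" "inv shuffle = unshuffle"
  "unshuffle (shuffle i) = i" "shuffle (unshuffle i) = i" "shuffle \<in> Sn n"
proof -
  show S: "unshuffle \<in> S_infty" using Sn_Sinf[OF unshuffle_Sn] .
  show "shuffle \<in> S_infty" "shuffle \<in> Sn n" by (rule Sinf_inv[OF S], rule Sn_inv[OF unshuffle_Sn])
  show "inv shuffle = unshuffle" "unshuffle (shuffle i) = i" "shuffle (unshuffle i) = i"
    by (simp_all only: Sinf_inv_simps[OF S])
qed

lemma shuffle_permutes: "shuffle permutes {1..n}"
  using shuffle_facts(6) unfolding Sn_def by (rule CollectD)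

lemma unshuffle_mono:
  assumes "1 \<le> r \<and> s \<le> p \<or> p < r" "r < s"
  shows "unshuffle r < unshuffle s"
  by (cases r rule: unshuffle_cases; cases s rule: unshuffle_cases; use assms qp n in linarith)

lemma shuffle_grass: "shuffle = grass (shuffle -` {1..p})"
proof (rule inverse_grassmannian_grass)
  show "shuffle \<in> Sn n" by (rule shuffle_facts)
  show "inverse_grassmannian p shuffle"
    unfolding inverse_grassmannian_def shuffle_facts
    by (intro conjI strict_mono_onI unshuffle_mono) auto
qed

lemma vimage_shuffle:
  assumes "r \<le> n"
  shows "shuffle -` {1..r} \<subseteq> {1..n}" "card (shuffle -` {1..r}) = r"
proof -
  show "shuffle -` {1..r} \<subseteq> {1..n}"
  proof (rule subsetI, rule ccontr)
    fix x assume x: "x \<in> shuffle -` {1..r}" "x \<notin> {1..n}"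
    have "shuffle x = x" by (rule permutes_not_in[OF shuffle_permutes x(2)])
    then show False using x assms by simp
  qed
  show "card (shuffle -` {1..r}) = r"
  proof -
    have "card (shuffle -` {1..r}) = card {1..r}"
      by (rule card_vimage_inj[OF Sinf_inj[OF shuffle_facts(2)]])
        (simp only: bij_is_surj[OF Sinf_bij[OF shuffle_facts(2)]] subset_UNIV)
    then show ?thesis by simp
  qed
qed

text \<open>The preclan with arcs joining \<open>i\<close> to \<open>p + m + i\<close> is the rearrangement of a
  noncrossing one, with all arcs of length one.\<close>

lemma loc_base:
  assumes g: "perm_preclan \<gamma>" and no: "\<And>k. p < k \<Longrightarrow> \<not> desc n \<gamma> k"
  shows "loc id (clan_poly.P n \<gamma>) = root_prod shuffle (shuffle -` {1..q})"
proof -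
  note v = perm_preclan_valid[OF g] and b = base_nodes[OF g no] and S = shuffle_facts(2)
  let ?\<gamma> = "pconj (inv shuffle) \<gamma>"
  have nodes: "\<gamma> c = Mate d \<longleftrightarrow> 1 \<le> c \<and> c \<le> q \<and> d = p + m + c \<or> 1 \<le> d \<and> d \<le> q \<and> c = p + m + d" for c d
  proof
    assume cd: "\<gamma> c = Mate d"
    then have r: "1 \<le> c" "c \<le> n" using valid_mate_range[OF v cd] by auto
    consider "c \<le> q" | "q < c" "c \<le> p" | "p < c" "c \<le> p + m" | "p + m < c" by linarith
    then show "1 \<le> c \<and> c \<le> q \<and> d = p + m + c \<or> 1 \<le> d \<and> d \<le> q \<and> c = p + m + d"
    proof cases
      case 4
      define i where "i = c - p - m"
      have "1 \<le> i" "i \<le> q" "c = p + m + i" using 4 r n by (auto simp: i_def)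
      then show ?thesis using b(1)[of i] cd by simp
    next
      case 1
      then show ?thesis using b(1)[of c] r cd by simp
    next
      case 2
      then show ?thesis using plus_node[OF g, of c] cd by simp
    next
      case 3
      then show ?thesis using b(2)[of c] cd by simp
    qed
  next
    assume "1 \<le> c \<and> c \<le> q \<and> d = p + m + c \<or> 1 \<le> d \<and> d \<le> q \<and> c = p + m + d"
    then show "\<gamma> c = Mate d" using b(1)[of c] b(1)[of d] by blast
  qed
  have sign: "\<gamma> c = Plus \<longleftrightarrow> q < c \<and> c \<le> p" "\<gamma> c \<noteq> Minus" for c
  proof -
    have c: "c = 0 \<or> n < c \<Longrightarrow> \<gamma> c = Blank" using valid_out[OF v, of c] by auto
    consider "1 \<le> c" "c \<le> q" | "q < c" "c \<le> p" | "p < c" | "c = 0" by linarith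
    then have "(\<gamma> c = Plus \<longleftrightarrow> q < c \<and> c \<le> p) \<and> \<gamma> c \<noteq> Minus"
      using b(1)[of c] plus_node[OF g, of c] right_node[OF g, of c] c qp by cases auto
    then show "\<gamma> c = Plus \<longleftrightarrow> q < c \<and> c \<le> p" "\<gamma> c \<noteq> Minus" by simp_all
  qed
  have mate: "?\<gamma> x = Mate y \<longleftrightarrow> \<gamma> (shuffle x) = Mate (shuffle y)" for x y
    by (rule pconj_Mate[OF S])
  have val: "valid n ?\<gamma>"
  proof (rule validI)
    fix i assume "i \<notin> {1..n}"
    then have "shuffle i \<notin> {1..n}" unfolding permutes_in_image[OF shuffle_permutes] .
    then show "?\<gamma> i = Blank" using valid_out[OF v, of "shuffle i"] pconj_other[OF S, of Blank \<gamma> i] by simp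
  next
    fix i j assume "?\<gamma> i = Mate j"
    then show "j \<noteq> i \<and> ?\<gamma> j = Mate i" unfolding mate
      using valid_mate[OF v, of "shuffle i" "shuffle j"] valid_mate_ne[OF v, of "shuffle i"] by auto
  qed
  have arc: "y = Suc x \<and> 1 \<le> shuffle x \<and> shuffle x \<le> q" if m: "?\<gamma> x = Mate y" "x < y" for x y
  proof -
    define c d where "c = shuffle x" and "d = shuffle y"
    have xy: "x = unshuffle c" "y = unshuffle d" by (simp_all add: c_def d_def shuffle_facts)
    have cd: "1 \<le> c \<and> c \<le> q \<and> d = p + m + c \<or> 1 \<le> d \<and> d \<le> q \<and> c = p + m + d"
      using m(1) unfolding mate nodes c_def d_def .
    then have "1 \<le> c \<and> c \<le> q \<and> y = Suc x"
    proof (elim disjE conjE)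
      assume "1 \<le> c" "c \<le> q" "d = p + m + c"
      then show ?thesis using unshuffle_arc[of c] unfolding xy by simp
    next
      assume "1 \<le> d" "d \<le> q" "c = p + m + d"
      then show ?thesis using unshuffle_arc[of d] m(2) unfolding xy by simp
    qed
    then show ?thesis by (simp add: c_def)
  qed
  have nc: "noncrossing n ?\<gamma>"
    unfolding noncrossing_def
  proof (intro conjI allI impI notI val)
    fix a b c d assume m: "?\<gamma> a = Mate b" and o: "a < c \<and> c < b \<and> b < d"
    have "a < b" using o by simp
    then show False using arc[OF m] o by auto
  next
    fix a b c assume m: "?\<gamma> a = Mate b" and o: "a < c" "c < b"
    have "a < b" using o by simp
    then show False using arc[OF m] o by auto
  qed
  have left: "(\<exists>y>x. ?\<gamma> x = Mate y) \<longleftrightarrow> 1 \<le> shuffle x \<and> shuffle x \<le> q" for x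
  proof
    assume c: "1 \<le> shuffle x \<and> shuffle x \<le> q"
    let ?y = "unshuffle (p + m + shuffle x)"
    have "?\<gamma> x = Mate ?y" unfolding mate nodes using c by (simp add: shuffle_facts)
    moreover have "unshuffle (shuffle x) < ?y" using unshuffle_arc[of "shuffle x"] c by linarith
    then have "x < ?y" unfolding shuffle_facts .
    ultimately show "\<exists>y>x. ?\<gamma> x = Mate y" by blast
  qed (use arc in blast)
  have J: "marked n Plus ?\<gamma> = shuffle -` {1..p}" "marked n Minus ?\<gamma> = shuffle -` {1..q}"
  proof -
    have "?\<gamma> x = Plus \<longleftrightarrow> q < shuffle x \<and> shuffle x \<le> p" "?\<gamma> x \<noteq> Minus" for x
      using pconj_other[OF S, of Plus \<gamma> x] pconj_other[OF S, of Minus \<gamma> x] sign by auto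
    then show "marked n Plus ?\<gamma> = shuffle -` {1..p}" "marked n Minus ?\<gamma> = shuffle -` {1..q}"
      using vimage_shuffle(1)[of p] vimage_shuffle(1)[of q] n qp
      unfolding marked_def left by auto
  qed
  let ?A = "shuffle -` {1..p}" and ?B = "shuffle -` {1..q}"
  have pos: "1 \<le> shuffle i" if "1 \<le> i" for i using Sinf_pos[OF S that] .
  have "root_prod shuffle ?A * loc id (clan_poly.P n \<gamma>) = loc shuffle (clan_poly.P n ?\<gamma>)"
    using loc_clan_poly_grass[OF val] sign(2) pconj_other[OF S, of Minus \<gamma>]
    unfolding J shuffle_grass[symmetric] pconj_inverse[OF S] by simp
  also have "\<dots> = loc shuffle (grass_schubert ?A) * loc shuffle (grass_schubert ?B)"
    unfolding noncrossing_clan_poly[OF nc] marked_prod_def J by (simp add: loc.hom_mult)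
  also have "loc shuffle (grass_schubert ?A) = root_prod shuffle ?A"
    by (rule loc_grass_schubert[OF vimage_shuffle(1) S]) (use vimage_shuffle(2)[of p] n pos in auto)
  also have "loc shuffle (grass_schubert ?B) = root_prod shuffle ?B"
    by (rule loc_grass_schubert[OF vimage_shuffle(1) S]) (use vimage_shuffle(2)[of q] n pos in auto)
  finally have eq: "root_prod shuffle ?A * loc id (clan_poly.P n \<gamma>) = root_prod shuffle ?A * root_prod shuffle ?B" .
  have ne: "root_prod shuffle ?A \<noteq> 0"
    by (rule root_prod_ne_0[OF finite_subset[OF vimage_shuffle(1)] S]) (use n in auto)
  show ?thesis using eq unfolding mult_left_cancel[OF ne] .
qed

abbreviation (input) target :: "(nat \<times> nat) set" where
  "target \<equiv> {(c, a). 1 \<le> a \<and> a \<le> q \<and> p < c \<and> c < p + m + a}"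

text \<open>A blank stands to the left of all left ends, and the right end of the arc of \<open>i\<close> to the left of the left
  ends after \<open>i\<close>; the plus signs follow all of them.\<close>

lemma root_prod_shuffle:
  "root_prod shuffle (shuffle -` {1..q}) = (\<Prod>(c, a)\<in>target. t_var c - t_var a)"
  unfolding root_prod_def
proof (rule prod.reindex_bij_witness[where i = "map_prod unshuffle unshuffle" and j = "map_prod shuffle shuffle"])
  fix x assume "x \<in> {(l, b). 1 \<le> l \<and> l < b \<and> l \<notin> shuffle -` {1..q} \<and> b \<in> shuffle -` {1..q}}"
  then obtain l b where x: "x = (l, b)" "1 \<le> l" "l < b" "\<not> (1 \<le> shuffle l \<and> shuffle l \<le> q)" "1 \<le> shuffle b" "shuffle b \<le> q"
    unfolding vimage_def mem_Collect_eq by auto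
  define c a where "c = shuffle l" and "a = shuffle b"
  have lb: "l = unshuffle c" "b = unshuffle a" by (simp_all add: c_def a_def shuffle_facts)
  have c: "1 \<le> c" using Sinf_pos[OF shuffle_facts(2) x(2)] by (simp add: c_def)
  then have qc: "q < c" using x(4) by (simp add: c_def)
  have a: "1 \<le> a" "a \<le> q" using x by (auto simp: a_def)
  have ua: "unshuffle a = m + 2 * a - 1" using a by (simp add: unshuffle_def)
  have "p < c \<and> c < p + m + a"
    by (cases c rule: unshuffle_cases) (use x(3)[unfolded lb ua] qc a n qp in linarith)+
  then show "map_prod shuffle shuffle x \<in> target" using a x(1) by (simp add: c_def a_def)
next
  fix x assume "x \<in> target"
  then obtain c a where x: "x = (c, a)" "1 \<le> a" "a \<le> q" "p < c" "c < p + m + a" by auto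
  have "1 \<le> unshuffle c \<and> unshuffle c < unshuffle a"
    by (cases c rule: unshuffle_cases) (use x(2-) unshuffle_arc[OF x(2,3)] n qp in linarith)+
  then show "map_prod unshuffle unshuffle x \<in> {(l, b). 1 \<le> l \<and> l < b \<and> l \<notin> shuffle -` {1..q} \<and> b \<in> shuffle -` {1..q}}"
    using x qp by (simp add: shuffle_facts)
qed (auto simp: shuffle_facts)

definition spec :: "int mpoly mpoly \<Rightarrow> int mpoly" where
  "spec = schubert_subst (\<lambda>i. if i \<in> {1..q} then - t_var (q + 1 - i) else 0) (\<lambda>j. - t_var (p + j))"

lemma spec_hom: "comm_ring_hom' spec"
  unfolding spec_def schubert_subst_def[abs_def]
  by (rule comm_ring_hom'.mpoly_subst_hom[OF comm_ring_hom'.mpoly_subst_hom[OF Const_hom]])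

lemma spec_Var: "spec (Var i) = (if i \<in> {1..q} then - t_var (q + 1 - i) else 0)"
  unfolding spec_def schubert_subst_def
  by (rule comm_ring_hom'.mpoly_subst_Var[OF comm_ring_hom'.mpoly_subst_hom[OF Const_hom]])

lemma spec_Const: "spec (Const c) = mpoly_subst Const (\<lambda>j. - t_var (p + j)) c"
  unfolding spec_def schubert_subst_def
  by (rule comm_ring_hom'.mpoly_subst_Const[OF comm_ring_hom'.mpoly_subst_hom[OF Const_hom]])

lemma spec_t: "spec (Const (t_var j)) = - t_var (p + j)"
  unfolding spec_Const by (rule comm_ring_hom'.mpoly_subst_Var[OF Const_hom])

text \<open>For the preclan with arcs from \<open>i\<close> to \<open>p + m + i\<close> the permutation \<open>\<eta>\<close> is dominant.\<close>

lemma spec_base: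
  assumes g: "perm_preclan \<gamma>" and no: "\<And>k. p < k \<Longrightarrow> \<not> desc n \<gamma> k"
  shows "spec (double_schubert (eta \<gamma>)) = (\<Prod>(c, a)\<in>target. t_var c - t_var a)"
proof -
  note b = base_nodes[OF g no]
  have bl: "blanks n \<gamma> = {p<..p + m}"
  proof (rule set_eqI)
    fix x
    have nb: "\<gamma> x \<noteq> Blank" if "p + m < x" "x \<le> n" using b(1)[of "x - p - m"] that n by auto
    show "x \<in> blanks n \<gamma> \<longleftrightarrow> x \<in> {p<..p + m}"
    proof
      assume "x \<in> blanks n \<gamma>"
      then have "p < x" "x \<le> n" "\<gamma> x = Blank" using blank_range[OF g, of x] by auto
      then show "x \<in> {p<..p + m}" using nb by (cases "p + m < x") auto
    next
      assume "x \<in> {p<..p + m}"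
      then show "x \<in> blanks n \<gamma>" using b(2)[of x] n by (simp add: blanks_def)
    qed
  qed
  have "eta \<gamma> i = stair_perm q m 0 i" for i
  proof -
    consider "1 \<le> i" "i \<le> q" | "q < i" "i \<le> q + m" | "i \<notin> {1..q + m}" by fastforce
    then show ?thesis
    proof cases
      case 1
      define a where "a = q + 1 - i"
      have a: "1 \<le> a" "a \<le> q" "i = q + 1 - a" using 1 by (auto simp: a_def)
      then show ?thesis using eta_left[of a \<gamma> "p + m + a"] b(1)[of a] 1 by (simp add: stair_perm_def)
    next
      case 2
      let ?b = "p + (i - q)"
      have "?b \<in> blanks n \<gamma>" using 2 unfolding bl greaterThanAtMost_iff by linarith
      moreover have "blanks n \<gamma> \<inter> {..?b} = {p<..?b}" using 2 by (auto simp: bl)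
      ultimately have "eta \<gamma> (q + (i - q)) = i - q" using eta_blank[OF g, of ?b] by simp
      then show ?thesis using 2 by (simp add: stair_perm_def)
    next
      case 3
      then show ?thesis by (auto simp: eta_perm_def stair_perm_def)
    qed
  qed
  then have e: "eta \<gamma> = stair_perm q m 0" by (rule ext)
  have "spec (double_schubert (eta \<gamma>)) =
      (\<Prod>(i, j)\<in>{(i, j). 1 \<le> i \<and> i \<le> q \<and> 1 \<le> j \<and> i + j \<le> q + m}. t_var (p + j) - t_var (q + 1 - i))"
    unfolding e double_schubert_dominant box_prod_def comm_ring_hom'.hom_prod[OF spec_hom]
    by (rule prod.cong) (auto simp: comm_ring_hom'.hom_diff[OF spec_hom] spec_Var spec_t)
  also have "\<dots> = (\<Prod>(c, a)\<in>target. t_var c - t_var a)"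
    by (rule prod.reindex_bij_witness[where i = "\<lambda>(c, a). (q + 1 - a, c - p)" and j = "\<lambda>(i, j). (p + j, q + 1 - i)"]) auto
  finally show ?thesis .
qed

text \<open>The substitution sends the variables \<open>x\<close> to parameters among the first \<open>p\<close>, and shifts the parameters
  by \<open>p\<close>.\<close>

lemma spec_tswap: "1 \<le> l \<Longrightarrow> spec (tswap l f) = swap_vars (p + l) (spec f)"
proof (rule hom_eqI[OF hom_comp[OF spec_hom tswap_hom] hom_comp[OF swap_vars_hom spec_hom]])
  fix c assume l: "1 \<le> l"
  show "spec (tswap l (Const c)) = swap_vars (p + l) (spec (Const c))"
    unfolding tswap_Const spec_Const
  proof (rule hom_eqI[OF hom_comp[OF comm_ring_hom'.mpoly_subst_hom[OF Const_hom] swap_vars_hom]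
        hom_comp[OF swap_vars_hom comm_ring_hom'.mpoly_subst_hom[OF Const_hom]]])
    fix j
    have "simple_refl (p + l) (p + j) = p + simple_refl l j" by (auto simp: simple_refl_def')
    then show "mpoly_subst Const (\<lambda>j. - t_var (p + j)) (swap_vars l (Var j))
      = swap_vars (p + l) (mpoly_subst Const (\<lambda>j. - t_var (p + j)) (Var j))"
      by (simp add: comm_ring_hom'.mpoly_subst_Var[OF Const_hom] comm_ring_hom'.hom_simps[OF swap_vars_hom])
  qed (simp add: comm_ring_hom'.mpoly_subst_Const[OF Const_hom])
next
  fix i assume l: "1 \<le> l"
  show "spec (tswap l (Var i)) = swap_vars (p + l) (spec (Var i))"
    using l qp by (auto simp: spec_Var comm_ring_hom'.hom_simps[OF swap_vars_hom] simple_refl_def')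
qed

text \<open>Symmetry in the parameters turns the divided difference at \<open>k > p\<close> into one in the parameters, which
  on the other side is the left divided difference of the double Schubert polynomial. So both sides
  satisfy the same recursion along descents after the first \<open>p\<close> nodes.\<close>

lemma loc_perm_preclan: "perm_preclan \<gamma> \<Longrightarrow> loc id (clan_poly.P n \<gamma>) = spec (double_schubert (eta \<gamma>))"
proof (induction "plen n \<gamma>" arbitrary: \<gamma> rule: less_induct)
  case less
  note g = less.prems and v = perm_preclan_valid[OF less.prems]
  show ?case
  proof (cases "\<exists>k>p. desc n \<gamma> k")
    case False
    then show ?thesis using loc_base[OF g] spec_base[OF g] root_prod_shuffle by simp
  next
    case True
    then obtain k where k: "desc n \<gamma> k" "p < k" by blast
    let ?\<delta> = "sconj k \<gamma>" and ?l = "k - p"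
    note d = eta_desc[OF g k]
    note pr = dn_props[OF v d(2)]
    have c: "card (marked n Plus ?\<delta>) = p" "card (marked n Minus ?\<delta>) = q"
      using d(1) by (simp_all add: perm_preclan_def)
    have IH: "loc id (clan_poly.P n ?\<delta>) = spec (double_schubert (eta ?\<delta>))"
      by (rule less.hyps[OF dn_plen[OF v d(2)] d(1)])
    have ts: "tswap k (clan_poly.P n ?\<delta>) = clan_poly.P n ?\<delta>"
      by (rule tswap_clan_poly[OF pr(1-3)]) (use c k qp in auto)
    have "swap_vars k (loc id (clan_poly.P n ?\<delta>)) = loc (simple_refl k) (clan_poly.P n ?\<delta>)"
      unfolding swap_loc ts by simp
    then have 1: "(t_var k - t_var (Suc k)) * loc id (clan_poly.P n \<gamma>) = loc id (clan_poly.P n ?\<delta>) - swap_vars k (loc id (clan_poly.P n ?\<delta>))"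
      using loc_dd[of id k "clan_poly.P n ?\<delta>"] clan_poly_dn[OF v d(2)] by simp
    let ?w = "eta ?\<delta>"
    have l: "1 \<le> ?l" "?l < q + m" "p + ?l = k" using k pr(3) n by auto
    have "double_schubert ?w - tswap ?l (double_schubert ?w)
        = Const (t_var (Suc ?l) - t_var ?l) * double_schubert (eta \<gamma>)"
      using double_schubert_left[OF eta_Sn[OF d(1)] l(1,2)] d(3,4) by simp
    then have "spec (double_schubert ?w - tswap ?l (double_schubert ?w))
        = spec (Const (t_var (Suc ?l) - t_var ?l) * double_schubert (eta \<gamma>))" by simp
    then have "spec (double_schubert ?w) - swap_vars k (spec (double_schubert ?w))
        = (t_var k - t_var (Suc k)) * spec (double_schubert (eta \<gamma>))"
      using l spec_tswap[OF l(1), of "double_schubert ?w"]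
      by (simp add: comm_ring_hom'.hom_simps[OF spec_hom] comm_ring_hom'.hom_simps[OF Const_hom] spec_t)
    then have "(t_var k - t_var (Suc k)) * loc id (clan_poly.P n \<gamma>) = (t_var k - t_var (Suc k)) * spec (double_schubert (eta \<gamma>))"
      unfolding 1 IH .
    then show ?thesis by simp
  qed
qed

text \<open>The numbers of marked positions leave no room for further left ends or signs.\<close>

lemma permutational_iff:
  assumes v: "valid n \<gamma>" and c: "card (marked n Plus \<gamma>) = p" "card (marked n Minus \<gamma>) = q"
  shows "permutational p q \<gamma> \<longleftrightarrow> perm_preclan \<gamma>"
proof
  assume pm: "permutational p q \<gamma>"
  have "{1..p} \<subseteq> marked n Plus \<gamma>" "{1..q} \<subseteq> marked n Minus \<gamma>"
  proof -
    show "{1..q} \<subseteq> marked n Minus \<gamma>" using pm qp n by (auto simp: permutational_def marked_iff)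
    show "{1..p} \<subseteq> marked n Plus \<gamma>"
    proof
      fix i assume "i \<in> {1..p}"
      then show "i \<in> marked n Plus \<gamma>" using pm n by (cases "i \<le> q") (auto simp: permutational_def marked_iff)
    qed
  qed
  then have "{1..p} = marked n Plus \<gamma>" "{1..q} = marked n Minus \<gamma>"
    using c card_subset_eq[OF finite_subset[OF marked_sub finite_atLeastAtMost]] by (metis card_atLeastAtMost diff_Suc_1)+
  then show "perm_preclan \<gamma>" using v by (simp add: perm_preclan_def)
next
  assume g: "perm_preclan \<gamma>"
  have "\<exists>j>i. \<gamma> i = Mate j" if "i \<in> {1..q}" for i
  proof -
    have "1 \<le> i" "i \<le> q" using that by auto
    then obtain j where "\<gamma> i = Mate j" "p < j" using left_node[OF g] by blast
    then show ?thesis using \<open>i \<le> q\<close> qp by auto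
  qed
  then show "permutational p q \<gamma>" using plus_node[OF g] by (auto simp: permutational_def)
qed

end

lemma card_marked_foldr:
  "valid n \<gamma> \<Longrightarrow> set ks \<subseteq> {1..<n} \<Longrightarrow> is_sign s \<Longrightarrow>
    valid n (foldr simple_act ks \<gamma>) \<and> card (marked n s (foldr simple_act ks \<gamma>)) = card (marked n s \<gamma>)"
  by (induction ks) (auto simp: valid_simple_act card_marked_simple_act)

theorem mainTheorem1:
  fixes p q m n :: nat and v u w :: "nat \<Rightarrow> nat" and \<gamma>\<^sub>0 \<gamma> :: "nat \<Rightarrow> node"
  assumes "q \<le> p"
    and "v \<in> S_infty" and "inverse_grassmannian p v"
    and "u \<in> S_infty" and "inverse_grassmannian q u"
    and "w \<in> S_infty"
    and "n = p + m + q"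
    and "v \<in> Sn n" and "u \<in> Sn n" and "w \<in> Sn n"
    and "pair_preclan_defined p q n v u"
    and "\<gamma>\<^sub>0 = pair_preclan p q n v u"
    and "\<gamma> = perm_act n w \<gamma>\<^sub>0"
  shows "structure_const v u w =
    (if permutational p q \<gamma> \<and> preclan_length n \<gamma> = int (perm_length w) + preclan_length n \<gamma>\<^sub>0
     then schubert_subst
            (\<lambda>i. if i \<in> {1..q} then - t_var (q + 1 - i) else 0)
            (\<lambda>j. - t_var (p + j))
            (double_schubert (eta_perm p m q \<gamma>))
     else 0)"
proof -
  note def = assms(11) and n = assms(7)
  define ks where "ks = (SOME ks. reduced_word n w ks)"
  have "\<exists>ks. reduced_word n w ks"
    using ex_word[OF assms(10)] perm_length_eq[OF assms(6)] by (auto simp: reduced_word_def)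
  then have "reduced_word n w ks" unfolding ks_def by (rule someI_ex)
  then have ks: "set ks \<subseteq> {1..<n}" "word_perm ks = w" "length ks = perm_length w"
    by (auto simp: reduced_word_def)
  have \<gamma>: "\<gamma> = foldr simple_act ks \<gamma>\<^sub>0" using assms(13) by (simp add: perm_act_def ks_def)
  have v0: "valid n \<gamma>\<^sub>0" unfolding assms(12) by (rule pair_valid[OF def n])
  have red: "redw ks" using ks perm_length_eq[OF assms(6)] by (auto simp: redw_def)
  have P0: "double_schubert v * double_schubert u = clan_poly.P n \<gamma>\<^sub>0"
    unfolding assms(12) noncrossing_clan_poly[OF pair_noncrossing[OF def n]] marked_prod_def pair_marked[OF def n] grass_schubert_def
    using inverse_grassmannian_grass[OF assms(8,3)] inverse_grassmannian_grass[OF assms(9,5)] by simp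
  have c: "valid n \<gamma>" "card (marked n Plus \<gamma>) = p" "card (marked n Minus \<gamma>) = q"
    using card_marked_foldr[OF v0 ks(1), of Plus] card_marked_foldr[OF v0 ks(1), of Minus] pair_card[OF def n]
    unfolding \<gamma> assms(12) by auto
  have "structure_const v u w = loc id (dds ks (clan_poly.P n \<gamma>\<^sub>0))"
    by (simp only: structure_const_eq[OF assms(2,4,6)] P0 ddw_word[OF red, unfolded ks(2)])
  also have "\<dots> = (if preclan_length n \<gamma> = preclan_length n \<gamma>\<^sub>0 + int (perm_length w) then loc id (clan_poly.P n \<gamma>) else 0)"
    using clan_poly.foldr_simple_act[OF v0 ks(1)] unfolding \<gamma>[symmetric] ks(3) by (simp add: loc.hom_zero)
  also have "loc id (clan_poly.P n \<gamma>) = (if permutational p q \<gamma> then schubert_subst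
            (\<lambda>i. if i \<in> {1..q} then - t_var (q + 1 - i) else 0)
            (\<lambda>j. - t_var (p + j)) (double_schubert (eta_perm p m q \<gamma>)) else 0)"
  proof (cases "perm_preclan p q n \<gamma>")
    case True
    then show ?thesis
      using loc_perm_preclan[OF assms(1) n True] permutational_iff[OF assms(1) n c]
      by (simp only: spec_def[OF assms(1) n] if_True)
  next
    case False
    then have "marked n Plus \<gamma> \<noteq> {1..card (marked n Plus \<gamma>)} \<or> marked n Minus \<gamma> \<noteq> {1..card (marked n Minus \<gamma>)}"
      using c by (auto simp: perm_preclan_def[OF assms(1) n])
    then have "loc id (clan_poly.P n \<gamma>) = 0"
      using loc_id_clan_poly_eq_0[OF c(1), of Plus] loc_id_clan_poly_eq_0[OF c(1), of Minus] by auto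
    then show ?thesis using False permutational_iff[OF assms(1) n c] by simp
  qed
  finally show ?thesis by (simp add: add.commute)
qed


end
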